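(* Let $b\in\mathbb R^d$. Assume $c\in C(\mathbb R^d\times\mathbb R^d)$ satisfies $-D_1\le c(x,y)\le D_2(1+|x|^p+|y|^p)$ for some $p\in[0,2)$ and $D_1,D_2>0$; $\mu,\nu\in\mathcal P_2^b(\mathbb R^d)$ (not necessarily in convex order); $\mu_n,\nu_n\in\mathcal P_2^b(\mathbb R^d)$ with $Z_2(\mu_n,\mu)\to0$, $Z_2(\nu_n,\nu)\to0$; and $\varepsilon_n>0$, $\varepsilon_n\to0$, with $\lim_{n}\frac{Z_2(\mu,\mu_n)+Z_2(\nu,\nu_n)}{\varepsilon_n}=0$. Define on $\mathcal M(\mathbb R^d\times\mathbb R^d;\mathbb R\times\mathbb R^d)$ $$F_n(\gamma,q)=\int\!\!\int\Big(c(x,y)+\frac1{2\varepsilon_n}\Big(\Big|\tfrac{dq}{d\gamma}(x,y)\Big|^2-\mathcal C(\mu_n,\nu_n)\Big)\Big)\gamma(dxdy)+\chi_{\Gamma Q(\mu_n,\nu_n)}(\gamma,q),$$ $$F(\gamma,q)=\int\!\!\int c(x,y)\,\gamma(dxdy)+\chi_{\overline{\Gamma Q}(\mu,\nu)}(\gamma,q).$$ Then $F_n$ $\Gamma$-converges to $F$ on $\mathcal M(\mathbb R^d\times\mathbb R^d;\mathbb R\times\mathbb R^d)$ equipped with the topology of weak convergence.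
   Context: $\mathcal P_2^b(\mathbb R^d)$: probability measures with finite second moment and barycentre $b$; $m_2(\rho)=\int|z|^2\rho(dz)$. $\chi_A$ is $0$ on $A$ and $+\infty$ outside. For $\alpha,\beta\in\mathcal P_2^b$ with supports $X,Y$: $\Gamma(\alpha,\beta)$ is the set of probabilities on $X\times Y$ with marginals $\alpha,\beta$; $Q(\alpha,\beta)$ is the set of finite $\mathbb R^d$-valued Borel measures $q$ on $X\times Y$ with $\int\langle\Phi(x),q(dxdy)\rangle=\int\langle\Phi(x),x\rangle\alpha(dx)$ and $\int\langle\Psi(y),q(dxdy)\rangle=\int\langle\Psi(y),y\rangle\beta(dy)$ for all bounded Borel $\Phi,\Psi$; $\Gamma Q(\alpha,\beta)=\{(\gamma,q)\in\Gamma\times Q:q\ll\gamma\}$; $\overline{\Gamma Q}(\alpha,\beta)$ is the set of minimizers of $\int\!\!\int|\frac{dq}{d\gamma}|^2d\gamma$ over $\Gamma Q(\alpha,\beta)$. Convex order $\rho\succeq_c\alpha$: $\int\varphi d\alpha\le\int\varphi d\rho$ for all convex $\varphi$. $\mathcal C(\alpha,\beta)=\min\{m_2(\rho):\rho\in\mathcal P_2,\rho\succeq_c\alpha,\rho\succeq_c\beta\}$. $Z_2(\alpha,\beta)=\max\{\int u\,d(\alpha-\beta):u\in C^{1,1}(\mathbb R^d),\ \mathrm{lip}(\nabla u)\le1\}$. Weak convergence: against bounded continuous test functions. *)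

theory Defs
  imports "HOL-Probability.Probability"
begin

definition m2 :: "'a::euclidean_space measure \<Rightarrow> real" where
  "m2 \<rho> = (\<integral>z. (norm z)\<^sup>2 \<partial>\<rho>)"

definition P2 :: "'a::euclidean_space measure set" where
  "P2 = {\<rho>. prob_space \<rho> \<and> sets \<rho> = sets borel \<and> integrable \<rho> (\<lambda>z. (norm z)\<^sup>2)}"

definition P2b :: "'a::euclidean_space \<Rightarrow> 'a measure set" where
  "P2b b = {\<rho>. \<rho> \<in> P2 \<and> (\<integral>z. z \<partial>\<rho>) = b}"

definition ext_integral :: "'b measure \<Rightarrow> ('b \<Rightarrow> real) \<Rightarrow> ereal" where
  "ext_integral M f = enn2ereal (\<integral>\<^sup>+ x. ennreal (f x) \<partial>M) - enn2ereal (\<integral>\<^sup>+ x. ennreal (- f x) \<partial>M)"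

definition convex_dominates :: "'a::euclidean_space measure \<Rightarrow> 'a measure \<Rightarrow> bool" where
  "convex_dominates \<rho> \<alpha> \<longleftrightarrow>
     (\<forall>\<phi>::'a \<Rightarrow> real. convex_on UNIV \<phi> \<longrightarrow> ext_integral \<alpha> \<phi> \<le> ext_integral \<rho> \<phi>)"

definition Ccost :: "'a::euclidean_space measure \<Rightarrow> 'a measure \<Rightarrow> real" where
  "Ccost \<alpha> \<beta> = Inf {m2 \<rho> | \<rho>. \<rho> \<in> P2 \<and> convex_dominates \<rho> \<alpha> \<and> convex_dominates \<rho> \<beta>}"

definition C11_1 :: "('a::euclidean_space \<Rightarrow> real) \<Rightarrow> bool" where
  "C11_1 u \<longleftrightarrow> (\<exists>G::'a \<Rightarrow> 'a. (\<forall>x. (u has_derivative (\<lambda>h. G x \<bullet> h)) (at x))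
                     \<and> (\<forall>x y. dist (G x) (G y) \<le> dist x y))"

definition Z2 :: "'a::euclidean_space measure \<Rightarrow> 'a measure \<Rightarrow> real" where
  "Z2 \<alpha> \<beta> = Sup {(\<integral>z. u z \<partial>\<alpha>) - (\<integral>z. u z \<partial>\<beta>) | u. C11_1 u}"

definition supp :: "'a::metric_space measure \<Rightarrow> 'a set" where
  "supp \<mu> = {x. \<forall>e>0. emeasure \<mu> (ball x e) > 0}"

text \<open>Such a measure is represented as a pair (m, H) of a finite Borel measure m and an
  m-integrable density H; it denotes the vector measure A \<mapsto> \<integral>_A H dm.
  Every finite vector measure has such a representation (e.g. m = total variation).
  The first component is the scalar part gamma, the second the R^d-valued part q.\<close>
type_synonym 'a vmeas = "('a \<times> 'a) measure \<times> ('a \<times> 'a \<Rightarrow> real \<times> 'a)"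

definition VM :: "'a::euclidean_space vmeas set" where
  "VM = {(m, H). finite_measure m \<and> sets m = sets borel \<and> integrable m H}"

definition vm_set :: "'a::euclidean_space vmeas \<Rightarrow> ('a \<times> 'a) set \<Rightarrow> real \<times> 'a" where
  "vm_set P A = (\<integral>z. indicator A z *\<^sub>R snd P z \<partial>fst P)"

definition gam_set where "gam_set P A = fst (vm_set P A)"
definition q_set where "q_set P A = snd (vm_set P A)"

text \<open>The scalar part as an Isabelle measure (meaningful when it is nonnegative).\<close>
definition gam :: "'a::euclidean_space vmeas \<Rightarrow> ('a \<times> 'a) measure" where
  "gam P = density (fst P) (\<lambda>z. ennreal (fst (snd P z)))"

definition vm_weak_conv :: "(nat \<Rightarrow> 'a::euclidean_space vmeas) \<Rightarrow> 'a vmeas \<Rightarrow> bool" where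
  "vm_weak_conv Ps P \<longleftrightarrow>
     (\<forall>f :: 'a \<times> 'a \<Rightarrow> real \<times> 'a. continuous_on UNIV f \<longrightarrow> bounded (range f) \<longrightarrow>
        (\<lambda>n. \<integral>z. f z \<bullet> snd (Ps n) z \<partial>fst (Ps n)) \<longlonglongrightarrow> (\<integral>z. f z \<bullet> snd P z \<partial>fst P))"

definition GammaSet :: "'a::euclidean_space measure \<Rightarrow> 'a measure \<Rightarrow> 'a vmeas set" where
  "GammaSet \<alpha> \<beta> = {P \<in> VM.
      (AE z in fst P. fst (snd P z) \<ge> 0) \<and> gam_set P UNIV = 1 \<and>
      (AE z in fst P. z \<notin> supp \<alpha> \<times> supp \<beta> \<longrightarrow> fst (snd P z) = 0) \<and>
      (\<forall>A \<in> sets borel. gam_set P (A \<times> UNIV) = measure \<alpha> A) \<and>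
      (\<forall>B \<in> sets borel. gam_set P (UNIV \<times> B) = measure \<beta> B)}"

definition QSet :: "'a::euclidean_space measure \<Rightarrow> 'a measure \<Rightarrow> 'a vmeas set" where
  "QSet \<alpha> \<beta> = {P \<in> VM.
      (AE z in fst P. z \<notin> supp \<alpha> \<times> supp \<beta> \<longrightarrow> snd (snd P z) = 0) \<and>
      (\<forall>\<Phi>::'a \<Rightarrow> 'a. \<Phi> \<in> borel_measurable borel \<longrightarrow> bounded (range \<Phi>) \<longrightarrow>
          (\<integral>z. \<Phi> (fst z) \<bullet> snd (snd P z) \<partial>fst P) = (\<integral>x. \<Phi> x \<bullet> x \<partial>\<alpha>)) \<and>
      (\<forall>\<Psi>::'a \<Rightarrow> 'a. \<Psi> \<in> borel_measurable borel \<longrightarrow> bounded (range \<Psi>) \<longrightarrow>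
          (\<integral>z. \<Psi> (snd z) \<bullet> snd (snd P z) \<partial>fst P) = (\<integral>y. \<Psi> y \<bullet> y \<partial>\<beta>))}"

definition abs_cont :: "'a::euclidean_space vmeas \<Rightarrow> bool" where
  "abs_cont P \<longleftrightarrow> (\<forall>A \<in> sets borel. gam_set P A = 0 \<longrightarrow> q_set P A = 0)"

definition rn :: "'a::euclidean_space vmeas \<Rightarrow> 'a \<times> 'a \<Rightarrow> 'a" where
  "rn P = (SOME k. k \<in> borel_measurable borel \<and> integrable (gam P) k \<and>
             (\<forall>A \<in> sets borel. q_set P A = (\<integral>z. indicator A z *\<^sub>R k z \<partial>gam P)))"

definition GammaQ :: "'a::euclidean_space measure \<Rightarrow> 'a measure \<Rightarrow> 'a vmeas set" where
  "GammaQ \<alpha> \<beta> = {P. P \<in> GammaSet \<alpha> \<beta> \<and> P \<in> QSet \<alpha> \<beta> \<and> abs_cont P}"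

definition energy :: "'a::euclidean_space vmeas \<Rightarrow> ennreal" where
  "energy P = (\<integral>\<^sup>+ z. ennreal ((norm (rn P z))\<^sup>2) \<partial>gam P)"

definition GammaQbar :: "'a::euclidean_space measure \<Rightarrow> 'a measure \<Rightarrow> 'a vmeas set" where
  "GammaQbar \<alpha> \<beta> = {P \<in> GammaQ \<alpha> \<beta>. \<forall>P' \<in> GammaQ \<alpha> \<beta>. energy P \<le> energy P'}"

definition chi :: "'b set \<Rightarrow> 'b \<Rightarrow> ereal" where
  "chi A x = (if x \<in> A then 0 else \<infinity>)"

definition Gamma_converges ::
  "'b set \<Rightarrow> ((nat \<Rightarrow> 'b) \<Rightarrow> 'b \<Rightarrow> bool) \<Rightarrow> (nat \<Rightarrow> 'b \<Rightarrow> ereal) \<Rightarrow> ('b \<Rightarrow> ereal) \<Rightarrow> bool" where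
  "Gamma_converges S conv Fs F \<longleftrightarrow>
     (\<forall>x \<in> S. \<forall>xs. (\<forall>n. xs n \<in> S) \<longrightarrow> conv xs x \<longrightarrow> F x \<le> liminf (\<lambda>n. Fs n (xs n))) \<and>
     (\<forall>x \<in> S. \<exists>xs. (\<forall>n. xs n \<in> S) \<and> conv xs x \<and> limsup (\<lambda>n. Fs n (xs n)) \<le> F x)"

end

theory Submission
  imports Defs
begin

text \<open>Dualising the discrete, entropically regularised problem gives, for measures with the same
  barycentre and every \<open>\<delta> > 0\<close>, a coupling of \<open>X\<close>, \<open>Y\<close> and a third variable \<open>K\<close> with
  \<open>E[K|X] = X\<close>, \<open>E[K|Y] = Y\<close> and \<open>E|K|^2 \<le> (m2 \<alpha> + m2 \<beta>) / 2 + Z2 \<alpha> \<beta> + \<delta>\<close>; this is sharp, since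
  the right-hand side without \<open>\<delta>\<close> is a lower bound for \<open>Ccost\<close> and for the energy. For
  \<open>\<alpha> = \<mu>\<close>, \<open>\<beta> = \<mu>s n\<close> it yields \<open>E|K - X|^2 \<le> 2 Z2 \<mu> (\<mu>s n) + \<delta>\<close>. Gluing such couplings for the two
  marginals onto an admissible pair of \<open>(\<mu>, \<nu>)\<close> gives an admissible pair of \<open>(\<mu>s n, \<nu>s n)\<close> whose energy
  grows by at most a multiple of \<open>Z2 \<mu> (\<mu>s n) + Z2 \<nu> (\<nu>s n)\<close>, which is negligible against \<open>\<epsilon> n\<close>. This
  provides recovery sequences, and also shows that limits of sequences with bounded \<open>F n\<close> are minimisers
  of the energy, because the energy is a supremum of weakly continuous functionals.\<close>

subsection \<open>The distance \<open>Z2\<close>\<close>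

text \<open>The penalty is divided by \<open>2 * \<epsilon> n\<close>, so passing from \<mu>, \<nu>
  to the perturbed marginals may raise the energy only linearly in \<open>Z2\<close>. A perturbation
  whose mean square is of order \<open>Z2\<close> would normally enter through a cross term, that
  is, through the square root of \<open>Z2\<close>. The cross terms vanish here because each
  increment K - X has mean zero given everything built before it, so the energies add as in
  Pythagoras' theorem. This is why closeness of marginals is expressed through a third variable K
  and not through a transport plan alone. The lower bound has to be equally sharp: when the gradient
  of u is 1-Lipschitz, both |z|^2/2 + u and |z|^2/2 - u are convex, and testing the convex order
  with them bounds the cost from below by the value that the discrete duality attains up to
  \<delta>. Couplings are kept as bounded densities with respect to product measures, so conditional
  expectations are integrals over fibres and gluing is Fubini's theorem.\<close>

lemma C11_descent:
  fixes u :: "'a::euclidean_space \<Rightarrow> real"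
  assumes der: "\<And>x. (u has_derivative (\<lambda>h. G x \<bullet> h)) (at x)"
    and lip: "\<And>x y. dist (G x) (G y) \<le> dist x y"
  shows "u y - u x - G x \<bullet> (y - x) \<le> (norm (y - x))\<^sup>2 / 2"
proof -
  define d where "d = y - x"
  \<comment> \<open>Up to the constant \<open>u x\<close>, \<open>h\<close> is the Taylor remainder
    along the segment minus the claimed bound. The claim is \<open>h 1 \<le> h 0\<close>, and the
    Lipschitz bound on \<open>G\<close> makes the derivative nonpositive.\<close>
  define h where "h t = u (x + t *\<^sub>R d) - t * (G x \<bullet> d) - t\<^sup>2 * ((norm d)\<^sup>2 / 2)" for t :: real
  have dh: "(h has_real_derivative (G (x + t *\<^sub>R d) \<bullet> d - G x \<bullet> d - t * (norm d)\<^sup>2)) (at t)" for t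
  proof -
    have "((\<lambda>t. u (x + t *\<^sub>R d)) has_derivative (\<lambda>s. G (x + t *\<^sub>R d) \<bullet> (s *\<^sub>R d))) (at t)"
      by (rule has_derivative_compose[of "\<lambda>t. x + t *\<^sub>R d" _ _ _ u, OF _ der])
        (auto intro!: derivative_eq_intros)
    then have "((\<lambda>t. u (x + t *\<^sub>R d)) has_real_derivative (G (x + t *\<^sub>R d) \<bullet> d)) (at t)"
      by (rule has_derivative_imp_has_field_derivative) simp
    then show ?thesis
      unfolding h_def by (auto intro!: derivative_eq_intros)
  qed
  have "h 1 \<le> h 0"
  proof (rule DERIV_nonpos_imp_nonincreasing[of 0 1 h])
    fix t :: real assume t: "0 \<le> t" "t \<le> 1"
    have "(G (x + t *\<^sub>R d) - G x) \<bullet> d \<le> norm (G (x + t *\<^sub>R d) - G x) * norm d"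
      by (rule norm_cauchy_schwarz)
    also have "\<dots> \<le> (t * norm d) * norm d"
      using lip[of "x + t *\<^sub>R d" x] t by (intro mult_right_mono) (auto simp: dist_norm)
    finally show "\<exists>y. (h has_real_derivative y) (at t) \<and> y \<le> 0"
      using dh[of t] by (intro exI conjI) (auto simp: inner_diff_left power2_eq_square mult.assoc)
  qed simp
  then show ?thesis by (simp add: h_def d_def)
qed

lemma C11_1_uminus: "C11_1 u \<Longrightarrow> C11_1 (\<lambda>x. - u x)"
  unfolding C11_1_def
proof (elim exE conjE)
  fix G assume G: "\<forall>x. (u has_derivative (\<bullet>) (G x)) (at x)" "\<forall>x y. dist (G x) (G y) \<le> dist x y"
  show "\<exists>G. (\<forall>x. ((\<lambda>x. - u x) has_derivative (\<bullet>) (G x)) (at x)) \<and> (\<forall>x y. dist (G x) (G y) \<le> dist x y)"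
  proof (intro exI[of _ "\<lambda>x. - G x"] conjI allI)
    show "((\<lambda>x. - u x) has_derivative (\<bullet>) (- G x)) (at x)" for x
      by (rule has_derivative_eq_rhs[OF has_derivative_minus[OF G(1)[rule_format, of x]]])
        (simp add: fun_eq_iff)
    show "dist (- G x) (- G y) \<le> dist x y" for x y
      using G(2)[rule_format, of x y] by (simp add: dist_minus)
  qed
qed

text \<open>The class \<open>C11_1\<close> enters the estimates below through this bound: its lower
  side makes |z|^2/2 + u convex, and both sides together give quadratic growth. The lower side is
  the descent bound for -u.\<close>

lemma C11_1_taylor:
  fixes u :: "'a::euclidean_space \<Rightarrow> real"
  assumes "C11_1 u"
  obtains G where "\<And>x y. \<bar>u y - u x - G x \<bullet> (y - x)\<bar> \<le> (norm (y - x))\<^sup>2 / 2"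
proof -
  obtain G where G: "\<And>x. (u has_derivative (\<lambda>h. G x \<bullet> h)) (at x)"
      "\<And>x y. dist (G x) (G y) \<le> dist x y"
    using assms unfolding C11_1_def by auto
  have 1: "u y - u x - G x \<bullet> (y - x) \<le> (norm (y - x))\<^sup>2 / 2" for x y
    using C11_descent[of u G, OF G] .
  have 2: "((\<lambda>x. - u x) has_derivative (\<lambda>h. (- G x) \<bullet> h)) (at x)" for x
    using has_derivative_minus[OF G(1)[of x]] by (simp add: inner_minus_left)
  have 3: "dist (- G x) (- G y) \<le> dist x y" for x y
    using G(2)[of x y] by (simp add: dist_minus)
  have 4: "- u y - - u x - (- G x) \<bullet> (y - x) \<le> (norm (y - x))\<^sup>2 / 2" for x y
    using C11_descent[of "\<lambda>x. - u x" "\<lambda>x. - G x", OF 2 3] .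
  show thesis
  proof (rule that)
    show "\<bar>u y - u x - G x \<bullet> (y - x)\<bar> \<le> (norm (y - x))\<^sup>2 / 2" for x y
      using 1[of y x] 4[of y x] by (intro abs_leI) simp_all
  qed
qed

lemma C11_1_measurable: "C11_1 u \<Longrightarrow> u \<in> borel_measurable borel"
  unfolding C11_1_def
  by (auto intro!: borel_measurable_continuous_onI continuous_at_imp_continuous_on
      dest: has_derivative_continuous)

lemma norm_le_quadratic: "norm z \<le> 1 + (norm z)\<^sup>2"
proof -
  have "2 * norm z \<le> 1 + (norm z)\<^sup>2" using sum_squares_bound[of "norm z" 1] by simp
  then show ?thesis using norm_ge_zero[of z] by linarith
qed

lemma C11_1_growth:
  assumes "C11_1 u"
  obtains C where "\<And>z. \<bar>u z\<bar> \<le> C * (1 + (norm z)\<^sup>2)"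
proof -
  obtain G where G: "\<And>x y. \<bar>u y - u x - G x \<bullet> (y - x)\<bar> \<le> (norm (y - x))\<^sup>2 / 2"
    using C11_1_taylor[OF assms] by blast
  show thesis
  proof (rule that)
    fix z
    have "\<bar>u z\<bar> \<le> \<bar>u 0\<bar> + \<bar>G 0 \<bullet> z\<bar> + (norm z)\<^sup>2 / 2" using G[of z 0] unfolding diff_zero by arith
    also have "\<bar>G 0 \<bullet> z\<bar> \<le> norm (G 0) * norm z" by (rule Cauchy_Schwarz_ineq2)
    also have "\<dots> \<le> norm (G 0) * (1 + (norm z)\<^sup>2)"
      by (intro mult_left_mono norm_le_quadratic) auto
    also have "\<bar>u 0\<bar> \<le> \<bar>u 0\<bar> * (1 + (norm z)\<^sup>2)" by (simp add: mult_le_cancel_left1)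
    also have "(norm z)\<^sup>2 / 2 \<le> 1 * (1 + (norm z)\<^sup>2)" by simp
    finally show "\<bar>u z\<bar> \<le> (\<bar>u 0\<bar> + norm (G 0) + 1) * (1 + (norm z)\<^sup>2)"
      by (simp add: algebra_simps)
  qed
qed

lemma P2_D:
  assumes "\<rho> \<in> P2"
  shows "prob_space \<rho>" "sets \<rho> = sets borel" "space \<rho> = UNIV" "integrable \<rho> (\<lambda>z. (norm z)\<^sup>2)"
  using assms sets_eq_imp_space_eq[of \<rho> borel] by (auto simp: P2_def)

lemma P2b_P2: "\<rho> \<in> P2b b \<Longrightarrow> \<rho> \<in> P2"
  by (simp add: P2b_def)

lemma P2_integrable:
  fixes f :: "'a::euclidean_space \<Rightarrow> 'b::{banach, second_countable_topology}"
  assumes \<rho>: "\<rho> \<in> P2" and f: "f \<in> borel_measurable borel"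
    and bd: "\<And>z. norm (f z) \<le> C * (1 + (norm z)\<^sup>2)"
  shows "integrable \<rho> f"
proof -
  interpret prob_space \<rho> using P2_D[OF \<rho>] by simp
  have "integrable \<rho> (\<lambda>z. C * (1 + (norm z)\<^sup>2))"
    using P2_D(4)[OF \<rho>] by (intro integrable_mult_right integrable_add) auto
  then show ?thesis
    by (rule Bochner_Integration.integrable_bound)
      (use f in \<open>auto intro!: AE_I2 order_trans[OF bd] simp: measurable_cong_sets[OF P2_D(2)[OF \<rho>] refl]\<close>)
qed

lemma P2_integrable_id: "\<rho> \<in> P2 \<Longrightarrow> integrable \<rho> (\<lambda>z. z)"
  by (rule P2_integrable[where C=1]) (auto simp: norm_le_quadratic)

lemma C11_1_integrable:
  assumes "C11_1 u" "\<rho> \<in> P2"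
  shows "integrable \<rho> u"
proof -
  obtain C where "\<And>z. \<bar>u z\<bar> \<le> C * (1 + (norm z)\<^sup>2)" using C11_1_growth[OF assms(1)] by blast
  then show ?thesis
    using assms by (intro P2_integrable[where C=C]) (auto intro: C11_1_measurable)
qed

lemma C11_1_half_norm_sq: "C11_1 (\<lambda>z::'a::euclidean_space. (norm z)\<^sup>2 / 2)"
  unfolding C11_1_def
proof (intro exI[of _ "\<lambda>x. x"] conjI allI)
  show "((\<lambda>z. (norm z)\<^sup>2 / 2) has_derivative (\<bullet>) x) (at x)" for x :: 'a
    unfolding power2_norm_eq_inner
    by (auto intro!: derivative_eq_intros simp: fun_eq_iff inner_commute)
qed simp

lemma C11_1_0: "C11_1 (\<lambda>z::'a::euclidean_space. 0)"
  unfolding C11_1_def by (intro exI[of _ "\<lambda>x. 0"]) (simp add: inner_zero_left[abs_def])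

text \<open>Affine functions are test functions, so without a common barycentre the set could be
  unbounded and the real \<open>Sup\<close> would carry no information. Expanding u at b, the affine
  part has the same integral under both measures, and the remainder is at most half of each second
  central moment.\<close>

lemma Z2_bdd_above:
  fixes \<alpha> \<beta> :: "'a::euclidean_space measure"
  assumes \<alpha>: "\<alpha> \<in> P2b b" and \<beta>: "\<beta> \<in> P2b b"
  shows "bdd_above {(\<integral>z. u z \<partial>\<alpha>) - (\<integral>z. u z \<partial>\<beta>) | u. C11_1 u}"
proof -
  note P = P2_D[OF P2b_P2[OF \<alpha>]] P2_D[OF P2b_P2[OF \<beta>]]
  have int: "integrable \<rho> (\<lambda>z. (norm (z - b))\<^sup>2)" if "\<rho> \<in> P2" for \<rho> :: "'a measure"
  proof (rule P2_integrable[OF that, where C="2 + 2 * (norm b)\<^sup>2"])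
    fix z
    have "(norm (z - b))\<^sup>2 \<le> (norm z + norm b)\<^sup>2"
      by (intro power_mono norm_triangle_ineq4) auto
    also have "\<dots> \<le> 2 * (norm z)\<^sup>2 + 2 * (norm b)\<^sup>2"
      using sum_squares_bound[of "norm z" "norm b"] by (simp add: power2_sum)
    also have "\<dots> \<le> (2 + 2 * (norm b)\<^sup>2) * (1 + (norm z)\<^sup>2)"
      by (simp add: algebra_simps)
    finally show "norm ((norm (z - b))\<^sup>2) \<le> (2 + 2 * (norm b)\<^sup>2) * (1 + (norm z)\<^sup>2)" by simp
  qed simp
  have mean: "(\<integral>z. u0 + g \<bullet> (z - b) + r * ((norm (z - b))\<^sup>2 / 2) \<partial>\<rho>) = u0 + r * ((\<integral>z. (norm (z - b))\<^sup>2 \<partial>\<rho>) / 2)"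
    and imean: "integrable \<rho> (\<lambda>z. u0 + g \<bullet> (z - b) + r * ((norm (z - b))\<^sup>2 / 2))"
    if \<rho>: "\<rho> \<in> P2b b" for \<rho> :: "'a measure" and u0 r g
  proof -
    interpret prob_space \<rho> using P2_D[OF P2b_P2[OF \<rho>]] by simp
    have i1: "integrable \<rho> (\<lambda>z. g \<bullet> (z - b))"
      using P2_integrable_id[OF P2b_P2[OF \<rho>]] by auto
    have "(\<integral>z. g \<bullet> (z - b) \<partial>\<rho>) = g \<bullet> (\<integral>z. (z - b) \<partial>\<rho>)"
      using P2_integrable_id[OF P2b_P2[OF \<rho>]] by (intro integral_inner_right) auto
    also have "\<dots> = 0" using P2_integrable_id[OF P2b_P2[OF \<rho>]] \<rho> by (simp add: P2b_def prob_space)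
    finally have z: "(\<integral>z. g \<bullet> (z - b) \<partial>\<rho>) = 0" .
    show "integrable \<rho> (\<lambda>z. u0 + g \<bullet> (z - b) + r * ((norm (z - b))\<^sup>2 / 2))"
      using i1 int[OF P2b_P2[OF \<rho>]] by (intro Bochner_Integration.integrable_add integrable_mult_right) simp_all
    show "(\<integral>z. u0 + g \<bullet> (z - b) + r * ((norm (z - b))\<^sup>2 / 2) \<partial>\<rho>) = u0 + r * ((\<integral>z. (norm (z - b))\<^sup>2 \<partial>\<rho>) / 2)"
      using i1 int[OF P2b_P2[OF \<rho>]] z by (simp add: prob_space Bochner_Integration.integral_add)
  qed
  show ?thesis
  proof (rule bdd_aboveI[where M="(\<integral>z. (norm (z - b))\<^sup>2 \<partial>\<alpha>) / 2 + (\<integral>z. (norm (z - b))\<^sup>2 \<partial>\<beta>) / 2"], clarify)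
    fix u :: "'a \<Rightarrow> real" assume u: "C11_1 u"
    obtain G where G: "\<And>x y. \<bar>u y - u x - G x \<bullet> (y - x)\<bar> \<le> (norm (y - x))\<^sup>2 / 2"
      using C11_1_taylor[OF u] by blast
    have tay: "u z \<le> u b + G b \<bullet> (z - b) + 1 * ((norm (z - b))\<^sup>2 / 2)"
        "u b + G b \<bullet> (z - b) + (-1) * ((norm (z - b))\<^sup>2 / 2) \<le> u z" for z
      using abs_le_D1[OF G[of z b]] abs_le_D2[OF G[of z b]] by linarith+
    have 1: "(\<integral>z. u z \<partial>\<alpha>) \<le> (\<integral>z. u b + G b \<bullet> (z - b) + 1 * ((norm (z - b))\<^sup>2 / 2) \<partial>\<alpha>)"
      using imean[OF \<alpha>, of "u b" "G b" 1] C11_1_integrable[OF u P2b_P2[OF \<alpha>]]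
      by (intro integral_mono) (use tay in simp_all)
    have 2: "(\<integral>z. u b + G b \<bullet> (z - b) + (-1) * ((norm (z - b))\<^sup>2 / 2) \<partial>\<beta>) \<le> (\<integral>z. u z \<partial>\<beta>)"
      using imean[OF \<beta>, of "u b" "G b" "-1"] C11_1_integrable[OF u P2b_P2[OF \<beta>]]
      by (intro integral_mono) (use tay in simp_all)
    show "(\<integral>z. u z \<partial>\<alpha>) - (\<integral>z. u z \<partial>\<beta>) \<le> (\<integral>z. (norm (z - b))\<^sup>2 \<partial>\<alpha>) / 2 + (\<integral>z. (norm (z - b))\<^sup>2 \<partial>\<beta>) / 2"
      using 1 2 mean[OF \<alpha>, of "u b" "G b" 1] mean[OF \<beta>, of "u b" "G b" "-1"] by simp
  qed
qed

lemma Z2_upper: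
  assumes "\<alpha> \<in> P2b b" "\<beta> \<in> P2b b" "C11_1 u"
  shows "(\<integral>z. u z \<partial>\<alpha>) - (\<integral>z. u z \<partial>\<beta>) \<le> Z2 \<alpha> \<beta>"
  unfolding Z2_def by (rule cSup_upper[OF _ Z2_bdd_above[OF assms(1,2)]]) (use assms(3) in blast)

lemma Z2_least:
  assumes "\<And>u. C11_1 u \<Longrightarrow> (\<integral>z. u z \<partial>\<alpha>) - (\<integral>z. u z \<partial>\<beta>) \<le> B"
  shows "Z2 \<alpha> \<beta> \<le> B"
  unfolding Z2_def
proof (rule cSup_least)
  show "{(\<integral>z. u z \<partial>\<alpha>) - (\<integral>z. u z \<partial>\<beta>) | u. C11_1 u} \<noteq> {}" using C11_1_0 by blast
qed (use assms in blast)

lemma Z2_commute: "Z2 \<alpha> \<beta> = Z2 \<beta> \<alpha>"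
proof -
  have "{(\<integral>z. u z \<partial>\<alpha>) - (\<integral>z. u z \<partial>\<beta>) | u. C11_1 u} \<subseteq> {(\<integral>z. u z \<partial>\<beta>) - (\<integral>z. u z \<partial>\<alpha>) | u. C11_1 u}" for \<alpha> \<beta> :: "'a measure"
  proof clarify
    fix u :: "'a \<Rightarrow> real" assume "C11_1 u"
    then show "\<exists>ua. (\<integral>z. u z \<partial>\<alpha>) - (\<integral>z. u z \<partial>\<beta>) = (\<integral>z. ua z \<partial>\<beta>) - (\<integral>z. ua z \<partial>\<alpha>) \<and> C11_1 ua"
      by (intro exI[of _ "\<lambda>x. - u x"]) (simp add: C11_1_uminus)
  qed
  then show ?thesis unfolding Z2_def by (intro arg_cong[of _ _ Sup] subset_antisym)
qed

lemma Z2_nonneg: "\<alpha> \<in> P2b b \<Longrightarrow> \<beta> \<in> P2b b \<Longrightarrow> 0 \<le> Z2 \<alpha> \<beta>"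
  using Z2_upper[of \<alpha> b \<beta> "\<lambda>_. 0"] C11_1_0 by simp

lemma Z2_triangle:
  assumes "\<alpha> \<in> P2b b" "\<beta> \<in> P2b b" "\<rho> \<in> P2b b"
  shows "Z2 \<alpha> \<beta> \<le> Z2 \<alpha> \<rho> + Z2 \<rho> \<beta>"
proof (rule Z2_least)
  fix u :: "'a \<Rightarrow> real" assume "C11_1 u"
  then show "(\<integral>z. u z \<partial>\<alpha>) - (\<integral>z. u z \<partial>\<beta>) \<le> Z2 \<alpha> \<rho> + Z2 \<rho> \<beta>"
    using Z2_upper[OF assms(1,3)] Z2_upper[OF assms(3,2)] by (smt (verit))
qed

text \<open>|z|^2/2 is itself a test function, whence the factor 2.\<close>

lemma m2_diff_le_Z2:
  assumes "\<alpha> \<in> P2b b" "\<beta> \<in> P2b b"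
  shows "m2 \<alpha> - m2 \<beta> \<le> 2 * Z2 \<alpha> \<beta>"
  using Z2_upper[OF assms C11_1_half_norm_sq] by (simp add: m2_def)

subsection \<open>Discrete duality\<close>

text \<open>The potential is the Moreau envelope of the convex function with epigraph \<open>S\<close>, up to
  \<open>|z|^2 / 2\<close>; firm nonexpansiveness of the proximal map gives the sharp Lipschitz constant.\<close>
lemma moreau_potential:
  fixes S :: "('a::euclidean_space \<times> real) set"
  assumes S: "compact S" "convex S" "S \<noteq> {}"
  obtains u where "C11_1 u"
    "\<And>z w t. (w, t) \<in> S \<Longrightarrow> u z + (norm z)\<^sup>2 / 2 \<le> (norm (z - w))\<^sup>2 + t"
    "\<And>z. \<exists>w t. (w, t) \<in> S \<and> u z + (norm z)\<^sup>2 / 2 = (norm (z - w))\<^sup>2 + t"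
proof -
  have "\<exists>p\<in>S. \<forall>q\<in>S. (norm (z - fst p))\<^sup>2 + snd p \<le> (norm (z - fst q))\<^sup>2 + snd q" for z
    by (rule continuous_attains_inf) (use S in \<open>auto intro!: continuous_intros\<close>)
  then obtain p where p: "\<And>z. p z \<in> S"
      "\<And>z q. q \<in> S \<Longrightarrow> (norm (z - fst (p z)))\<^sup>2 + snd (p z) \<le> (norm (z - fst q))\<^sup>2 + snd q"
    by metis
  define w where "w z = fst (p z)" for z
  define A where "A z = (norm (z - w z))\<^sup>2 + snd (p z)" for z
  \<comment> \<open>Optimality of \<open>p z\<close> against the points
    \<open>(1 - s) *\<^sub>R p z + s *\<^sub>R q\<close> of the convex set, divided by s, in the
    limit of small s.\<close>
  have vi: "0 \<le> 2 * ((w z - z) \<bullet> (fst q - w z)) + snd q - snd (p z)" if q: "q \<in> S" for z q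
  proof -
    have "0 \<le> (2 * ((w z - z) \<bullet> (fst q - w z)) + snd q - snd (p z)) + s * (norm (fst q - w z))\<^sup>2"
      if s: "0 < s" "s < 1" for s
    proof -
      have m: "(1 - s) *\<^sub>R p z + s *\<^sub>R q \<in> S"
        using S(2) p(1)[of z] q s unfolding convex_alt by auto
      have fe: "z - fst ((1 - s) *\<^sub>R p z + s *\<^sub>R q) = (z - w z) - s *\<^sub>R (fst q - w z)"
        by (simp add: w_def algebra_simps)
      then have "(norm (z - w z))\<^sup>2 + snd (p z) \<le> (norm ((z - w z) - s *\<^sub>R (fst q - w z)))\<^sup>2 + ((1 - s) * snd (p z) + s * snd q)"
        using p(2)[OF m, of z] unfolding fe by (simp add: w_def)
      then have "0 \<le> s * ((2 * ((w z - z) \<bullet> (fst q - w z)) + snd q - snd (p z)) + s * (norm (fst q - w z))\<^sup>2)"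
        unfolding power2_norm_eq_inner
        by (simp add: algebra_simps power2_eq_square inner_commute)
      then show ?thesis using s by (simp add: zero_le_mult_iff)
    qed
    note * = this
    define L where "L = 2 * ((w z - z) \<bullet> (fst q - w z)) + snd q - snd (p z)"
    have "((\<lambda>s. L + s * (norm (fst q - w z))\<^sup>2) \<longlongrightarrow> L + 0 * (norm (fst q - w z))\<^sup>2) (at_right 0)"
      by (intro tendsto_intros)
    moreover have "eventually (\<lambda>s::real. 0 \<le> L + s * (norm (fst q - w z))\<^sup>2) (at_right 0)"
      using eventually_at_right_less[of 0] eventually_at_rightI[of 0 1 "\<lambda>s. s < 1"]
      unfolding L_def by (auto intro!: eventually_at_rightI[of 0 1] *)
    ultimately have "0 \<le> L + 0 * (norm (fst q - w z))\<^sup>2"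
      by (intro tendsto_lowerbound) auto
    then show ?thesis by (simp add: L_def)
  qed
  \<comment> \<open>Adding the variational inequalities at z and z', each tested with the minimiser
    of the other, cancels the second components and leaves firm nonexpansiveness of the proximal map
    w.\<close>
  have firm: "(norm (w z - w z'))\<^sup>2 \<le> (z - z') \<bullet> (w z - w z')" for z z'
    using vi[of "p z'" z] vi[of "p z" z'] p(1)
    by (simp add: power2_norm_eq_inner w_def[symmetric] inner_diff_left inner_diff_right inner_commute)
  have up: "A z' \<le> A z + 2 * ((z - w z) \<bullet> (z' - z)) + (norm (z' - z))\<^sup>2" for z z'
  proof -
    have "A z' \<le> (norm (z' - w z))\<^sup>2 + snd (p z)"
      using p(2)[OF p(1), of z' z] by (simp add: A_def w_def)
    then show ?thesis
      by (simp add: A_def power2_norm_eq_inner inner_diff_left inner_diff_right inner_commute)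
  qed
  \<comment> \<open>This is \<open>up\<close> with z and z' exchanged. Moving the gradient from z'
    to z loses nothing, because w is nonexpansive.\<close>
  have lo: "A z + 2 * ((z - w z) \<bullet> (z' - z)) - (norm (z' - z))\<^sup>2 \<le> A z'" for z z'
  proof -
    have "(norm ((z' - w z') - (z - w z)))\<^sup>2 = (norm (z' - z))\<^sup>2 - 2 * ((z' - z) \<bullet> (w z' - w z)) + (norm (w z' - w z))\<^sup>2"
      by (simp add: power2_norm_eq_inner inner_diff_left inner_diff_right inner_commute)
    have "(z' - z) \<bullet> (w z' - w z) \<le> (norm (z' - z))\<^sup>2"
    proof -
      have "(norm (w z' - w z))\<^sup>2 \<le> norm (z' - z) * norm (w z' - w z)"
        using firm[of z' z] norm_cauchy_schwarz[of "z' - z" "w z' - w z"] by linarith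
      then have n: "norm (w z' - w z) \<le> norm (z' - z)"
        by (cases "norm (w z' - w z) = 0") (auto simp: power2_eq_square)
      have "(z' - z) \<bullet> (w z' - w z) \<le> norm (z' - z) * norm (w z' - w z)"
        by (rule norm_cauchy_schwarz)
      also have "\<dots> \<le> norm (z' - z) * norm (z' - z)"
        using n by (intro mult_left_mono) auto
      finally show ?thesis by (simp add: power2_eq_square)
    qed
    moreover have "A z \<le> A z' + 2 * ((z' - w z') \<bullet> (z - z')) + (norm (z - z'))\<^sup>2"
      by (rule up)
    ultimately show ?thesis
      by (simp add: power2_norm_eq_inner inner_diff_left inner_diff_right inner_commute)
  qed
  define u where "u z = A z - (norm z)\<^sup>2 / 2" for z
  have derA: "(A has_derivative (\<lambda>h. 2 * ((z - w z) \<bullet> h))) (at z)" for z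
    unfolding has_derivative_at2
  proof (intro conjI)
    show "bounded_linear (\<lambda>h. 2 * ((z - w z) \<bullet> h))"
      by (intro bounded_linear_intros)
    show "((\<lambda>y. (1 / norm (y - z)) *\<^sub>R (A y - (A z + 2 * ((z - w z) \<bullet> (y - z))))) \<longlongrightarrow> 0) (at z)"
    proof (rule Lim_null_comparison)
      show "\<forall>\<^sub>F y in at z. norm ((1 / norm (y - z)) *\<^sub>R (A y - (A z + 2 * ((z - w z) \<bullet> (y - z))))) \<le> norm (y - z)"
      proof (rule always_eventually, rule allI)
        fix y
        have "\<bar>A y - (A z + 2 * ((z - w z) \<bullet> (y - z)))\<bar> \<le> (norm (y - z))\<^sup>2"
          using up[of y z] lo[of z y] by (simp add: abs_le_iff)
        then show "norm ((1 / norm (y - z)) *\<^sub>R (A y - (A z + 2 * ((z - w z) \<bullet> (y - z))))) \<le> norm (y - z)"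
          by (cases "y = z") (auto simp: field_simps power2_eq_square)
      qed
      show "((\<lambda>y. norm (y - z)) \<longlongrightarrow> 0) (at z)"
        by (auto intro!: tendsto_eq_intros)
    qed
  qed
  have "C11_1 u"
    unfolding C11_1_def
  \<comment> \<open>The envelope \<open>A\<close> has gradient 2 (z - w z). Subtracting z leaves
    minus the reflection 2 w - id, which is nonexpansive because w is firmly nonexpansive; this is
    where the Lipschitz constant becomes exactly 1.\<close>
  proof (intro exI[of _ "\<lambda>z. z - 2 *\<^sub>R w z"] conjI allI)
    fix z
    have "((\<lambda>z::'a. (norm z)\<^sup>2 / 2) has_derivative (\<bullet>) z) (at z)"
      unfolding power2_norm_eq_inner
      by (auto intro!: derivative_eq_intros simp: fun_eq_iff inner_commute)
    from has_derivative_diff[OF derA[of z] this]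
    show "(u has_derivative (\<bullet>) (z - 2 *\<^sub>R w z)) (at z)"
      unfolding u_def[abs_def]
      by (rule has_derivative_eq_rhs) (simp add: fun_eq_iff inner_diff_left algebra_simps)
  next
    fix z z'
    have "(norm ((z - 2 *\<^sub>R w z) - (z' - 2 *\<^sub>R w z')))\<^sup>2
        = (norm (z - z'))\<^sup>2 - 4 * ((z - z') \<bullet> (w z - w z')) + 4 * (norm (w z - w z'))\<^sup>2"
      by (simp add: power2_norm_eq_inner inner_diff_left inner_diff_right inner_commute)
    also have "\<dots> \<le> (norm (z - z'))\<^sup>2" using firm[of z z'] by simp
    finally show "dist (z - 2 *\<^sub>R w z) (z' - 2 *\<^sub>R w z') \<le> dist z z'"
      by (simp add: dist_norm power2_le_iff_abs_le)
  qed
  moreover have "u z + (norm z)\<^sup>2 / 2 \<le> (norm (z - w'))\<^sup>2 + t" if "(w', t) \<in> S" for z w' t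
    using p(2)[OF that, of z] by (simp add: u_def A_def w_def)
  moreover have "\<exists>w' t. (w', t) \<in> S \<and> u z + (norm z)\<^sup>2 / 2 = (norm (z - w'))\<^sup>2 + t" for z
    using p(1)[of z] by (intro exI[of _ "w z"] exI[of _ "snd (p z)"]) (simp add: u_def A_def w_def)
  ultimately show thesis by (rule that)
qed

text \<open>Condenses a dual feasible family into a single test function for \<open>Z2\<close>:
  integrating the two conclusions bounds the dual value by the second moments and the difference of
  the integrals of u.\<close>

lemma dual_feasible_potential:
  fixes \<Phi> :: "'i \<Rightarrow> 'a::euclidean_space" and \<Psi> :: "'j \<Rightarrow> 'a"
  assumes J: "finite J" "J \<noteq> {}"
    and feas: "\<And>i j. i \<in> I \<Longrightarrow> j \<in> J \<Longrightarrow> \<phi> i + \<psi> j + (norm (\<Phi> i + \<Psi> j))\<^sup>2 \<le> 0"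
  obtains u where "C11_1 u"
    "\<And>i z. i \<in> I \<Longrightarrow> \<phi> i + 2 * (\<Phi> i \<bullet> z) \<le> (norm z)\<^sup>2 / 2 + u z"
    "\<And>j z. j \<in> J \<Longrightarrow> \<psi> j + 2 * (\<Psi> j \<bullet> z) \<le> (norm z)\<^sup>2 / 2 - u z"
proof -
  \<comment> \<open>The heights are chosen so that |z - w|^2 + t at the vertex of j equals |z|^2 - 2
    \<Psi> j . z - \<psi> j; the inequality for \<psi> is then the bound of the envelope by that
    vertex.\<close>
  define V where "V = (\<lambda>j. (\<Psi> j, - (norm (\<Psi> j))\<^sup>2 - \<psi> j)) ` J"
  have V: "finite V" "V \<noteq> {}" using J by (auto simp: V_def)
  obtain u where u: "C11_1 u"
    "\<And>z w t. (w, t) \<in> convex hull V \<Longrightarrow> u z + (norm z)\<^sup>2 / 2 \<le> (norm (z - w))\<^sup>2 + t"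
    "\<And>z. \<exists>w t. (w, t) \<in> convex hull V \<and> u z + (norm z)\<^sup>2 / 2 = (norm (z - w))\<^sup>2 + t"
    using V by (elim moreau_potential[rotated 3]) (auto simp: finite_imp_compact_convex_hull convex_convex_hull)
  have 1: "\<phi> i + 2 * (\<Phi> i \<bullet> z) \<le> (norm z)\<^sup>2 / 2 + u z" if i: "i \<in> I" for i z
  proof -
    \<comment> \<open>For fixed i, feasibility is one linear inequality satisfied by all vertices,
      hence by their hull and by the minimiser that realises the envelope at z. Completing the
      square in z - w - \<Phi> i then gives the inequality for \<phi>.\<close>
    let ?T = "{q. (2 *\<^sub>R \<Phi> i, -1) \<bullet> q \<le> - \<phi> i - (norm (\<Phi> i))\<^sup>2}"
    have "V \<subseteq> ?T"
    proof
      fix q assume "q \<in> V"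
      then obtain j where j: "j \<in> J" "q = (\<Psi> j, - (norm (\<Psi> j))\<^sup>2 - \<psi> j)" by (auto simp: V_def)
      show "q \<in> ?T"
        using feas[OF i j(1)] unfolding j(2)
        by (simp add: power2_norm_eq_inner inner_add_left inner_add_right inner_commute)
    qed
    then have "convex hull V \<subseteq> ?T" by (intro hull_minimal convex_halfspace_le)
    moreover obtain w t where wt: "(w, t) \<in> convex hull V" "u z + (norm z)\<^sup>2 / 2 = (norm (z - w))\<^sup>2 + t"
      using u(3) by blast
    ultimately have "2 * (\<Phi> i \<bullet> w) - t \<le> - \<phi> i - (norm (\<Phi> i))\<^sup>2" by auto
    moreover have "0 \<le> (norm (z - w - \<Phi> i))\<^sup>2" by simp
    ultimately show ?thesis
      using wt(2) by (simp add: power2_norm_eq_inner inner_diff_left inner_diff_right inner_commute)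
  qed
  have 2: "\<psi> j + 2 * (\<Psi> j \<bullet> z) \<le> (norm z)\<^sup>2 / 2 - u z" if j: "j \<in> J" for j z
  proof -
    have "(\<Psi> j, - (norm (\<Psi> j))\<^sup>2 - \<psi> j) \<in> convex hull V"
      using j by (intro hull_inc) (auto simp: V_def)
    from u(2)[OF this, of z] show ?thesis
      by (simp add: power2_norm_eq_inner inner_diff_left inner_diff_right inner_commute)
  qed
  show thesis by (rule that[OF u(1) 1 2])
qed

text \<open>Dual of minimising the sum of \<gamma> |k|^2 over plans \<gamma> with marginals
  \<alpha>, \<beta> and vectors k whose conditional means are a and b. The first components of x, y
  are multipliers of the mass constraints, the second components those of the mean constraints, with
  minimiser k = \<Phi> + \<Psi>. The hard constraint \<phi> + \<psi> + |\<Phi> + \<Psi>|^2 \<le> 0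
  is replaced by an exponential penalty.\<close>

definition entropic_dual ::
  "'i set \<Rightarrow> 'j set \<Rightarrow> ('i \<Rightarrow> real) \<Rightarrow> ('j \<Rightarrow> real) \<Rightarrow> ('i \<Rightarrow> 'a::euclidean_space) \<Rightarrow> ('j \<Rightarrow> 'a) \<Rightarrow> real
    \<Rightarrow> ('i \<Rightarrow> real \<times> 'a) \<Rightarrow> ('j \<Rightarrow> real \<times> 'a) \<Rightarrow> real" where
  "entropic_dual I J \<alpha> \<beta> a b \<tau> x y =
     (\<Sum>i\<in>I. \<alpha> i * (fst (x i) + 2 * (snd (x i) \<bullet> a i))) + (\<Sum>j\<in>J. \<beta> j * (fst (y j) + 2 * (snd (y j) \<bullet> b j)))
     - \<tau> * (\<Sum>i\<in>I. \<Sum>j\<in>J. exp ((fst (x i) + fst (y j) + (norm (snd (x i) + snd (y j)))\<^sup>2) / \<tau>))"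

text \<open>Makes the penalised dual coercive in both directions of s: for positive s the
  exponential dominates a quadratic, for negative s the linear term is already -p|s|.\<close>

lemma exp_coercive:
  fixes p s \<tau> :: real
  assumes "p \<ge> 0" "\<tau> > 0"
  shows "p * s - \<tau> * exp (s / \<tau>) \<le> 2 * \<tau> * p\<^sup>2 - p * \<bar>s\<bar>"
proof (cases "s \<ge> 0")
  case True
  define y where "y = s / \<tau>"
  have s: "s = \<tau> * y" and y: "y \<ge> 0" using assms True by (auto simp: y_def)
  have "0 \<le> (y - 2 * p)\<^sup>2" by simp
  then have "2 * y * p \<le> y\<^sup>2 / 2 + 2 * p\<^sup>2" by (simp add: power2_eq_square algebra_simps)
  also have "y\<^sup>2 / 2 \<le> exp y" using exp_lower_Taylor_quadratic[OF y] y by linarith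
  finally have "\<tau> * (2 * y * p) \<le> \<tau> * (exp y + 2 * p\<^sup>2)" using assms by (intro mult_left_mono) auto
  then show ?thesis using True assms by (simp add: s abs_mult y algebra_simps)
next
  case False
  have "0 \<le> \<tau> * exp (s / \<tau>)" "0 \<le> \<tau> * p\<^sup>2" using assms by auto
  then show ?thesis using False by simp
qed

text \<open>The first-order conditions for a maximiser of the entropically regularised dual make the
  exponential weights an exactly feasible primal competitor, while weights of at most 1 are exact
  dual feasibility; the duality gap is the entropy.\<close>
lemma entropic_duality:
  fixes a :: "'i \<Rightarrow> 'a::euclidean_space" and b :: "'j \<Rightarrow> 'a" and \<tau> :: real
  assumes fin: "finite I" "finite J" and ne: "I \<noteq> {}" "J \<noteq> {}"
    and \<alpha>: "\<And>i. i \<in> I \<Longrightarrow> \<alpha> i > 0" "(\<Sum>i\<in>I. \<alpha> i) = 1"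
    and \<beta>: "\<And>j. j \<in> J \<Longrightarrow> \<beta> j > 0" "(\<Sum>j\<in>J. \<beta> j) = 1"
    and bary: "(\<Sum>i\<in>I. \<alpha> i *\<^sub>R a i) = (\<Sum>j\<in>J. \<beta> j *\<^sub>R b j)"
    and \<tau>: "\<tau> > 0"
  obtains \<phi> \<Phi> \<psi> \<Psi> \<gamma> where
    "\<And>i j. i \<in> I \<Longrightarrow> j \<in> J \<Longrightarrow> \<phi> i + \<psi> j + (norm (\<Phi> i + \<Psi> j))\<^sup>2 \<le> (0::real)"
    "\<And>i j. i \<in> I \<Longrightarrow> j \<in> J \<Longrightarrow> 0 \<le> \<gamma> i j"
    "\<And>i. i \<in> I \<Longrightarrow> (\<Sum>j\<in>J. \<gamma> i j) = \<alpha> i"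
    "\<And>j. j \<in> J \<Longrightarrow> (\<Sum>i\<in>I. \<gamma> i j) = \<beta> j"
    "\<And>i. i \<in> I \<Longrightarrow> (\<Sum>j\<in>J. \<gamma> i j *\<^sub>R (\<Phi> i + \<Psi> j)) = \<alpha> i *\<^sub>R a i"
    "\<And>j. j \<in> J \<Longrightarrow> (\<Sum>i\<in>I. \<gamma> i j *\<^sub>R (\<Phi> i + \<Psi> j)) = \<beta> j *\<^sub>R b j"
    "(\<Sum>i\<in>I. \<alpha> i * (\<Phi> i \<bullet> a i)) + (\<Sum>j\<in>J. \<beta> j * (\<Psi> j \<bullet> b j))
      \<le> (\<Sum>i\<in>I. \<alpha> i * (\<phi> i + 2 * (\<Phi> i \<bullet> a i))) + (\<Sum>j\<in>J. \<beta> j * (\<psi> j + 2 * (\<Psi> j \<bullet> b j)))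
         + \<tau> * (card I * card J)"
proof -
  define c where "c = (\<Sum>i\<in>I. \<alpha> i *\<^sub>R a i)"
  define G where "G = entropic_dual I J \<alpha> \<beta> a b \<tau>"
  \<comment> \<open>\<open>a i + b j - c\<close> has \<beta>-mean \<open>a i\<close> and
    \<alpha>-mean \<open>b j\<close>, because c is the common barycentre. Hence the linear part is
    also a sum over pairs, and the functional depends on x and y only through the sums
    \<open>x i + y j\<close>.\<close>
  define T where "T i j w k = \<alpha> i * \<beta> j * (w + 2 * ((a i + b j - c) \<bullet> k)) - \<tau> * exp ((w + (norm k)\<^sup>2) / \<tau>)" for i j w k
  \<comment> \<open>The two constants come from 2 m.k \<le> |k|^2/2 + 2|m|^2 with m = a i + b j - c,
    and from \<open>exp_coercive\<close> with p = \<alpha> i \<beta> j.\<close>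
  define U where "U i j = \<alpha> i * \<beta> j * (2 * (norm (a i + b j - c))\<^sup>2) + 2 * \<tau> * (\<alpha> i * \<beta> j)\<^sup>2" for i j
  have c1: "(\<Sum>j\<in>J. \<beta> j *\<^sub>R (a i + b j - c)) = a i" for i
  proof -
    have "(\<Sum>j\<in>J. \<beta> j *\<^sub>R (a i + b j - c)) = (\<Sum>j\<in>J. \<beta> j) *\<^sub>R (a i - c) + (\<Sum>j\<in>J. \<beta> j *\<^sub>R b j)"
      by (simp add: scaleR_sum_left sum.distrib[symmetric] algebra_simps)
    then show ?thesis using \<beta>(2) bary by (simp add: c_def)
  qed
  have c2: "(\<Sum>i\<in>I. \<alpha> i *\<^sub>R (a i + b j - c)) = b j" for j
  proof -
    have "(\<Sum>i\<in>I. \<alpha> i *\<^sub>R (a i + b j - c)) = (\<Sum>i\<in>I. \<alpha> i) *\<^sub>R (b j - c) + (\<Sum>i\<in>I. \<alpha> i *\<^sub>R a i)"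
      by (simp add: scaleR_sum_left sum.distrib[symmetric] algebra_simps)
    then show ?thesis using \<alpha>(2) by (simp add: c_def)
  qed
  have GT: "G x y = (\<Sum>i\<in>I. \<Sum>j\<in>J. T i j (fst (x i) + fst (y j)) (snd (x i) + snd (y j)))" for x y
  proof -
    have 1: "(\<Sum>i\<in>I. \<Sum>j\<in>J. \<alpha> i * \<beta> j * (fst (x i) + 2 * ((a i + b j - c) \<bullet> snd (x i))))
        = (\<Sum>i\<in>I. \<alpha> i * (fst (x i) + 2 * (snd (x i) \<bullet> a i)))"
    proof (rule sum.cong[OF refl])
      fix i
      have "(\<Sum>j\<in>J. \<alpha> i * \<beta> j * (fst (x i) + 2 * ((a i + b j - c) \<bullet> snd (x i))))
         = \<alpha> i * ((\<Sum>j\<in>J. \<beta> j) * fst (x i) + 2 * ((\<Sum>j\<in>J. \<beta> j *\<^sub>R (a i + b j - c)) \<bullet> snd (x i)))"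
        unfolding inner_sum_left sum_distrib_left sum_distrib_right sum.distrib[symmetric]
        by (intro sum.cong refl) (simp add: algebra_simps)
      then show "(\<Sum>j\<in>J. \<alpha> i * \<beta> j * (fst (x i) + 2 * ((a i + b j - c) \<bullet> snd (x i)))) = \<alpha> i * (fst (x i) + 2 * (snd (x i) \<bullet> a i))"
        unfolding c1 \<beta>(2) by (simp add: inner_commute)
    qed
    have "(\<Sum>i\<in>I. \<Sum>j\<in>J. \<alpha> i * \<beta> j * (fst (y j) + 2 * ((a i + b j - c) \<bullet> snd (y j))))
        = (\<Sum>j\<in>J. \<Sum>i\<in>I. \<alpha> i * \<beta> j * (fst (y j) + 2 * ((a i + b j - c) \<bullet> snd (y j))))"
      by (rule sum.swap)
    also have "\<dots> = (\<Sum>j\<in>J. \<beta> j * (fst (y j) + 2 * (snd (y j) \<bullet> b j)))"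
    proof (rule sum.cong[OF refl])
      fix j
      have "(\<Sum>i\<in>I. \<alpha> i * \<beta> j * (fst (y j) + 2 * ((a i + b j - c) \<bullet> snd (y j))))
         = \<beta> j * ((\<Sum>i\<in>I. \<alpha> i) * fst (y j) + 2 * ((\<Sum>i\<in>I. \<alpha> i *\<^sub>R (a i + b j - c)) \<bullet> snd (y j)))"
        unfolding inner_sum_left sum_distrib_left sum_distrib_right sum.distrib[symmetric]
        by (intro sum.cong refl) (simp add: algebra_simps)
      then show "(\<Sum>i\<in>I. \<alpha> i * \<beta> j * (fst (y j) + 2 * ((a i + b j - c) \<bullet> snd (y j)))) = \<beta> j * (fst (y j) + 2 * (snd (y j) \<bullet> b j))"
        unfolding c2 \<alpha>(2) by (simp add: inner_commute)
    qed
    finally have 2: "(\<Sum>i\<in>I. \<Sum>j\<in>J. \<alpha> i * \<beta> j * (fst (y j) + 2 * ((a i + b j - c) \<bullet> snd (y j)))) = \<dots>" .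
    show ?thesis
      unfolding G_def entropic_dual_def 1[symmetric] 2[symmetric] T_def sum_distrib_left
        sum.distrib[symmetric] sum_subtractf[symmetric]
      by (intro sum.cong refl) (simp add: algebra_simps)
  qed
  have TU: "T i j w k \<le> U i j - \<alpha> i * \<beta> j * (\<bar>w + (norm k)\<^sup>2\<bar> + (norm k)\<^sup>2 / 2)" if "i \<in> I" "j \<in> J" for i j w k
  proof -
    define p where "p = \<alpha> i * \<beta> j"
    define m where "m = a i + b j - c"
    have p: "p \<ge> 0" using \<alpha>(1)[OF that(1)] \<beta>(1)[OF that(2)] by (simp add: p_def)
    have "0 \<le> (norm (k - 2 *\<^sub>R m))\<^sup>2" by simp
    then have "2 * (m \<bullet> k) \<le> (norm k)\<^sup>2 / 2 + 2 * (norm m)\<^sup>2"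
      by (simp add: power2_norm_eq_inner inner_diff_left inner_diff_right inner_commute)
    then have "p * (2 * (m \<bullet> k)) \<le> p * ((norm k)\<^sup>2 / 2 + 2 * (norm m)\<^sup>2)" using p by (rule mult_left_mono)
    moreover have "p * (w + (norm k)\<^sup>2) - \<tau> * exp ((w + (norm k)\<^sup>2) / \<tau>) \<le> 2 * \<tau> * p\<^sup>2 - p * \<bar>w + (norm k)\<^sup>2\<bar>"
      using exp_coercive[OF p \<tau>] .
    ultimately show ?thesis
      unfolding T_def U_def p_def[symmetric] m_def[symmetric] by (simp add: algebra_simps)
  qed
  \<comment> \<open>On the superlevel set through the origin the deficit U - T of each pair is
    nonnegative, hence at most the total deficit. Dividing by the weight of the pair bounds that
    pair, and the sum over all pairs is one bound for all of them.\<close>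
  define B where "B = (\<Sum>i\<in>I. \<Sum>j\<in>J. \<bar>(\<Sum>i\<in>I. \<Sum>j\<in>J. U i j) - G (\<lambda>_. 0) (\<lambda>_. 0)\<bar> / (\<alpha> i * \<beta> j))"
  have bound: "norm (x i + y j) \<le> 1 + 5 * B"
    if g: "G (\<lambda>_. 0) (\<lambda>_. 0) \<le> G x y" and ij: "i \<in> I" "j \<in> J" for x y i j
  proof -
    let ?w = "fst (x i) + fst (y j)" and ?k = "snd (x i) + snd (y j)"
    let ?s = "\<bar>?w + (norm ?k)\<^sup>2\<bar> + (norm ?k)\<^sup>2 / 2"
    let ?N = "(\<Sum>i\<in>I. \<Sum>j\<in>J. U i j) - G (\<lambda>_. 0) (\<lambda>_. 0)"
    let ?t = "\<lambda>i' j'. U i' j' - T i' j' (fst (x i') + fst (y j')) (snd (x i') + snd (y j'))"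
    have t0: "0 \<le> ?t i' j'" if "i' \<in> I" "j' \<in> J" for i' j'
    proof -
      have "0 \<le> \<alpha> i' * \<beta> j' * (\<bar>fst (x i') + fst (y j') + (norm (snd (x i') + snd (y j')))\<^sup>2\<bar> + (norm (snd (x i') + snd (y j')))\<^sup>2 / 2)"
        using \<alpha>(1)[OF that(1)] \<beta>(1)[OF that(2)] by (intro mult_nonneg_nonneg add_nonneg_nonneg) auto
      then show ?thesis using TU[OF that, of "fst (x i') + fst (y j')" "snd (x i') + snd (y j')"] by linarith
    qed
    have "\<alpha> i * \<beta> j * ?s \<le> ?t i j" using TU[OF ij, of ?w ?k] by linarith
    also have "\<dots> \<le> (\<Sum>j'\<in>J. ?t i j')" using fin ij t0 by (intro member_le_sum) auto
    also have "\<dots> \<le> (\<Sum>i'\<in>I. \<Sum>j'\<in>J. ?t i' j')"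
      using fin ij t0 by (intro member_le_sum[of i I "\<lambda>i'. \<Sum>j'\<in>J. ?t i' j'"] sum_nonneg) auto
    also have "\<dots> = (\<Sum>i\<in>I. \<Sum>j\<in>J. U i j) - G x y" by (simp add: GT sum_subtractf)
    also have "\<dots> \<le> \<bar>?N\<bar>" using g by linarith
    finally have "?s \<le> \<bar>?N\<bar> / (\<alpha> i * \<beta> j)"
      using \<alpha>(1)[OF ij(1)] \<beta>(1)[OF ij(2)] by (simp add: pos_le_divide_eq mult.commute)
    also have "\<dots> \<le> (\<Sum>j\<in>J. \<bar>?N\<bar> / (\<alpha> i * \<beta> j))"
      using fin ij \<alpha>(1) \<beta>(1) by (intro member_le_sum[of j J "\<lambda>j. \<bar>?N\<bar> / (\<alpha> i * \<beta> j)"]) (auto intro!: divide_nonneg_pos)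
    also have "\<dots> \<le> B"
      unfolding B_def using fin ij \<alpha>(1) \<beta>(1)
      by (intro member_le_sum[of i I "\<lambda>i. \<Sum>j\<in>J. \<bar>?N\<bar> / (\<alpha> i * \<beta> j)"]) (auto intro!: divide_nonneg_pos sum_nonneg)
    finally have s: "?s \<le> B" .
    \<comment> \<open>B controls both |w + |k|^2| and |k|^2/2, so |w| \<le> 3 B and |k| \<le> 1 + 2
      B, which add up to 1 + 5 B.\<close>
    have k: "norm ?k \<le> 1 + (norm ?k)\<^sup>2" by (rule norm_le_quadratic)
    have "norm (x i + y j) \<le> \<bar>?w\<bar> + norm ?k"
      using norm_Pair_le[of ?w ?k] by (simp add: prod_eq_iff plus_prod_def)
    moreover have "0 \<le> (norm ?k)\<^sup>2" by simp
    ultimately show ?thesis using s k by linarith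
  qed
  obtain i0 j0 where i0: "i0 \<in> I" and j0: "j0 \<in> J" using ne by auto
  \<comment> \<open>Twice the bound on pair sums, because \<open>y''\<close> below is a difference
    of two such sums.\<close>
  define R where "R = 2 * (1 + 5 * B)"
  have "G (\<lambda>_. 0) (\<lambda>_. 0) \<le> G (\<lambda>_. 0) (\<lambda>_. 0)" by simp
  from bound[OF this i0 j0] have R0: "R \<ge> 0" by (simp add: R_def)
  \<comment> \<open>Coordinates outside I are pinned to 0, so the box in the space of all functions
    on the index type is a product of compact sets.\<close>
  define KI where "KI = Pi\<^sub>E (UNIV :: 'i set) (\<lambda>i. if i \<in> I then cball (0 :: real \<times> 'a) R else {0})"
  define KJ where "KJ = Pi\<^sub>E (UNIV :: 'j set) (\<lambda>j. if j \<in> J then cball (0 :: real \<times> 'a) R else {0})"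
  have "compactin euclidean KI" unfolding KI_def euclidean_product_topology[symmetric] compactin_PiE by auto
  then have KI: "compact KI" by simp
  have "compactin euclidean KJ" unfolding KJ_def euclidean_product_topology[symmetric] compactin_PiE by auto
  then have KJ: "compact KJ" by simp
  have zero: "(\<lambda>_. 0) \<in> KI" "(\<lambda>_. 0) \<in> KJ" using R0 by (auto simp: KI_def KJ_def)
  have ci: "continuous_on S (\<lambda>q :: ('i \<Rightarrow> real \<times> 'a) \<times> ('j \<Rightarrow> real \<times> 'a). fst q i)" for S i
    by (rule continuous_on_product_then_coordinatewise[OF continuous_on_fst[OF continuous_on_id]])
  have cj: "continuous_on S (\<lambda>q :: ('i \<Rightarrow> real \<times> 'a) \<times> ('j \<Rightarrow> real \<times> 'a). snd q j)" for S j
    by (rule continuous_on_product_then_coordinatewise[OF continuous_on_snd[OF continuous_on_id]])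
  have "\<exists>q\<in>KI \<times> KJ. \<forall>q'\<in>KI \<times> KJ. G (fst q') (snd q') \<le> G (fst q) (snd q)"
  proof (rule continuous_attains_sup)
    show "compact (KI \<times> KJ)" by (intro compact_Times KI KJ)
    show "KI \<times> KJ \<noteq> {}" using zero by auto
    show "continuous_on (KI \<times> KJ) (\<lambda>q. G (fst q) (snd q))"
      unfolding G_def entropic_dual_def using \<tau> by (auto intro!: continuous_intros ci cj)
  qed
  then obtain x y where xy: "x \<in> KI" "y \<in> KJ"
      and mx0: "\<And>x' y'. x' \<in> KI \<Longrightarrow> y' \<in> KJ \<Longrightarrow> G x' y' \<le> G x y" by fastforce
  have mx: "G x' y' \<le> G x y" for x' y'
  proof (cases "G (\<lambda>_. 0) (\<lambda>_. 0) \<le> G x' y'")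
    case False
    then show ?thesis using mx0[OF zero] by simp
  next
    case True
    \<comment> \<open>Adding a vector to all of x and subtracting it from all of y changes no pair
      sum, so a superlevel set is not bounded. Shifting by \<open>y' j0\<close> uses this freedom to
      move any competitor into the compact box.\<close>
    define x'' where "x'' i = (if i \<in> I then x' i + y' j0 else 0)" for i
    define y'' where "y'' j = (if j \<in> J then y' j - y' j0 else 0)" for j
    have n1: "norm (x'' i) \<le> 1 + 5 * B" if "i \<in> I" for i
      using bound[OF True that j0] that by (simp add: x''_def)
    have n2: "norm (y'' j) \<le> R" if j: "j \<in> J" for j
    proof -
      have "y'' j = (x' i0 + y' j) - (x' i0 + y' j0)" using j by (simp add: y''_def)
      then show ?thesis
        using norm_triangle_ineq4[of "x' i0 + y' j" "x' i0 + y' j0"] bound[OF True i0 j] bound[OF True i0 j0]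
        by (simp add: R_def)
    qed
    have "x'' \<in> KI" using n1 R0 by (fastforce simp: KI_def R_def x''_def)
    moreover have "y'' \<in> KJ" using n2 by (auto simp: KJ_def y''_def)
    moreover have "G x'' y'' = G x' y'"
      unfolding GT by (intro sum.cong refl) (auto simp: x''_def y''_def)
    ultimately show ?thesis using mx0 by metis
  qed
  define \<phi> \<Phi> \<psi> \<Psi> where "\<phi> i = fst (x i)" and "\<Phi> i = snd (x i)" and "\<psi> j = fst (y j)" and "\<Psi> j = snd (y j)" for i j
  define \<gamma> where "\<gamma> i j = exp ((\<phi> i + \<psi> j + (norm (\<Phi> i + \<Psi> j))\<^sup>2) / \<tau>)" for i j
  \<comment> \<open>First-order condition in an arbitrary direction. The marginal and mean
    identities below are this equation for directions supported at a single index; the direction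
    (\<Phi>, \<Psi>) gives the energy.\<close>
  have var: "(\<Sum>i\<in>I. \<alpha> i * (\<phi>' i + 2 * (\<Phi>' i \<bullet> a i))) + (\<Sum>j\<in>J. \<beta> j * (\<psi>' j + 2 * (\<Psi>' j \<bullet> b j)))
     = (\<Sum>i\<in>I. \<Sum>j\<in>J. \<gamma> i j * (\<phi>' i + \<psi>' j + 2 * ((\<Phi> i + \<Psi> j) \<bullet> (\<Phi>' i + \<Psi>' j))))" for \<phi>' \<Phi>' \<psi>' \<Psi>'
  proof -
    define L0 where "L0 = (\<Sum>i\<in>I. \<alpha> i * (\<phi> i + 2 * (\<Phi> i \<bullet> a i))) + (\<Sum>j\<in>J. \<beta> j * (\<psi> j + 2 * (\<Psi> j \<bullet> b j)))"
    define L1 where "L1 = (\<Sum>i\<in>I. \<alpha> i * (\<phi>' i + 2 * (\<Phi>' i \<bullet> a i))) + (\<Sum>j\<in>J. \<beta> j * (\<psi>' j + 2 * (\<Psi>' j \<bullet> b j)))"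
    define e0 where "e0 i j = \<phi> i + \<psi> j + (norm (\<Phi> i + \<Psi> j))\<^sup>2" for i j
    define e1 where "e1 i j = \<phi>' i + \<psi>' j + 2 * ((\<Phi> i + \<Psi> j) \<bullet> (\<Phi>' i + \<Psi>' j))" for i j
    define e2 where "e2 i j = (norm (\<Phi>' i + \<Psi>' j))\<^sup>2" for i j
    define h where "h t = G (\<lambda>i. x i + t *\<^sub>R (\<phi>' i, \<Phi>' i)) (\<lambda>j. y j + t *\<^sub>R (\<psi>' j, \<Psi>' j))" for t
    have h: "h t = L0 + t * L1 - \<tau> * (\<Sum>i\<in>I. \<Sum>j\<in>J. exp ((e0 i j + t * e1 i j + t\<^sup>2 * e2 i j) / \<tau>))" for t
    proof -
      have "fst (x i) + t * \<phi>' i + (fst (y j) + t * \<psi>' j) + (norm (snd (x i) + t *\<^sub>R \<Phi>' i + (snd (y j) + t *\<^sub>R \<Psi>' j)))\<^sup>2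
          = e0 i j + t * e1 i j + t\<^sup>2 * e2 i j" for i j
        unfolding e0_def e1_def e2_def \<phi>_def \<Phi>_def \<psi>_def \<Psi>_def power2_norm_eq_inner
        by (simp add: inner_add_left inner_add_right inner_commute algebra_simps power2_eq_square)
      moreover have "(\<Sum>i\<in>I. \<alpha> i * (fst (x i) + t * \<phi>' i + 2 * ((snd (x i) + t *\<^sub>R \<Phi>' i) \<bullet> a i)))
          = (\<Sum>i\<in>I. \<alpha> i * (\<phi> i + 2 * (\<Phi> i \<bullet> a i))) + t * (\<Sum>i\<in>I. \<alpha> i * (\<phi>' i + 2 * (\<Phi>' i \<bullet> a i)))"
        unfolding sum_distrib_left sum.distrib[symmetric] \<phi>_def \<Phi>_def
        by (intro sum.cong refl) (simp add: inner_add_left algebra_simps)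
      moreover have "(\<Sum>j\<in>J. \<beta> j * (fst (y j) + t * \<psi>' j + 2 * ((snd (y j) + t *\<^sub>R \<Psi>' j) \<bullet> b j)))
          = (\<Sum>j\<in>J. \<beta> j * (\<psi> j + 2 * (\<Psi> j \<bullet> b j))) + t * (\<Sum>j\<in>J. \<beta> j * (\<psi>' j + 2 * (\<Psi>' j \<bullet> b j)))"
        unfolding sum_distrib_left sum.distrib[symmetric] \<psi>_def \<Psi>_def
        by (intro sum.cong refl) (simp add: inner_add_left algebra_simps)
      ultimately show ?thesis
        unfolding h_def G_def entropic_dual_def L0_def L1_def by (simp add: distrib_left)
    qed
    have "(h has_real_derivative L1 - \<tau> * (\<Sum>i\<in>I. \<Sum>j\<in>J. exp (e0 i j / \<tau>) * (e1 i j / \<tau>))) (at 0)"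
      unfolding h[abs_def] using \<tau> by (auto intro!: derivative_eq_intros sum.cong)
    moreover have "h t \<le> h 0" for t
      unfolding h_def using mx by (simp add: zero_prod_def[symmetric])
    ultimately have "L1 - \<tau> * (\<Sum>i\<in>I. \<Sum>j\<in>J. exp (e0 i j / \<tau>) * (e1 i j / \<tau>)) = 0"
      by (intro DERIV_local_max[of h _ 0 1]) auto
    moreover have "\<tau> * (\<Sum>i\<in>I. \<Sum>j\<in>J. exp (e0 i j / \<tau>) * (e1 i j / \<tau>)) = (\<Sum>i\<in>I. \<Sum>j\<in>J. \<gamma> i j * e1 i j)"
      unfolding sum_distrib_left \<gamma>_def e0_def using \<tau> by (intro sum.cong refl) simp
    ultimately show ?thesis unfolding L1_def e1_def by simp
  qed
  show thesis
  proof (rule that[of \<phi> \<psi> \<Phi> \<Psi> \<gamma>])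
    show \<gamma>0: "0 \<le> \<gamma> i j" for i j by (simp add: \<gamma>_def)
    show r\<alpha>: "(\<Sum>j\<in>J. \<gamma> i j) = \<alpha> i" if i: "i \<in> I" for i
    proof -
      have "\<alpha> i = (\<Sum>i'\<in>I. \<alpha> i' * ((if i' = i then 1 else 0) + 2 * (0 \<bullet> a i'))) + (\<Sum>j\<in>J. \<beta> j * (0 + 2 * (0 \<bullet> b j)))"
        using i fin by (simp add: if_distrib[of "\<lambda>v. _ * v"] sum.delta cong: if_cong)
      also have "\<dots> = (\<Sum>i'\<in>I. \<Sum>j\<in>J. \<gamma> i' j * ((if i' = i then 1 else 0) + 0 + 2 * ((\<Phi> i' + \<Psi> j) \<bullet> (0 + 0))))"
        by (rule var)
      also have "\<dots> = (\<Sum>i'\<in>I. if i' = i then (\<Sum>j\<in>J. \<gamma> i' j) else 0)"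
        by (intro sum.cong refl) auto
      finally show ?thesis using i fin by (simp add: sum.delta)
    qed
    show "(\<Sum>i\<in>I. \<gamma> i j) = \<beta> j" if j: "j \<in> J" for j
    proof -
      have "\<beta> j = (\<Sum>i\<in>I. \<alpha> i * (0 + 2 * (0 \<bullet> a i))) + (\<Sum>j'\<in>J. \<beta> j' * ((if j' = j then 1 else 0) + 2 * (0 \<bullet> b j')))"
        using j fin by (simp add: if_distrib[of "\<lambda>v. _ * v"] sum.delta cong: if_cong)
      also have "\<dots> = (\<Sum>i\<in>I. \<Sum>j'\<in>J. \<gamma> i j' * (0 + (if j' = j then 1 else 0) + 2 * ((\<Phi> i + \<Psi> j') \<bullet> (0 + 0))))"
        by (rule var)
      also have "\<dots> = (\<Sum>i\<in>I. \<Sum>j'\<in>J. if j' = j then \<gamma> i j' else 0)"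
        by (intro sum.cong refl) auto
      finally show ?thesis using j fin by (simp add: sum.delta)
    qed
    show "(\<Sum>j\<in>J. \<gamma> i j *\<^sub>R (\<Phi> i + \<Psi> j)) = \<alpha> i *\<^sub>R a i" if i: "i \<in> I" for i
    proof (rule vector_eq_ldot[THEN iffD1], rule allI)
      fix v
      have "2 * (\<alpha> i * (v \<bullet> a i)) = (\<Sum>i'\<in>I. \<alpha> i' * (0 + 2 * ((if i' = i then v else 0) \<bullet> a i'))) + (\<Sum>j\<in>J. \<beta> j * (0 + 2 * (0 \<bullet> b j)))"
        using i fin by (simp add: if_distrib[of "\<lambda>v. v \<bullet> _"] if_distrib[of "\<lambda>v. _ * v"] sum.delta cong: if_cong)
      also have "\<dots> = (\<Sum>i'\<in>I. \<Sum>j\<in>J. \<gamma> i' j * (0 + 0 + 2 * ((\<Phi> i' + \<Psi> j) \<bullet> ((if i' = i then v else 0) + 0))))"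
        by (rule var)
      also have "\<dots> = (\<Sum>i'\<in>I. if i' = i then (\<Sum>j\<in>J. \<gamma> i j * (2 * ((\<Phi> i + \<Psi> j) \<bullet> v))) else 0)"
        by (intro sum.cong refl) auto
      also have "\<dots> = 2 * (v \<bullet> (\<Sum>j\<in>J. \<gamma> i j *\<^sub>R (\<Phi> i + \<Psi> j)))"
        using i fin by (simp add: sum.delta inner_sum_right sum_distrib_left inner_commute algebra_simps)
      finally show "v \<bullet> (\<Sum>j\<in>J. \<gamma> i j *\<^sub>R (\<Phi> i + \<Psi> j)) = v \<bullet> (\<alpha> i *\<^sub>R a i)" by simp
    qed
    show "(\<Sum>i\<in>I. \<gamma> i j *\<^sub>R (\<Phi> i + \<Psi> j)) = \<beta> j *\<^sub>R b j" if j: "j \<in> J" for j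
    proof (rule vector_eq_ldot[THEN iffD1], rule allI)
      fix v
      have "2 * (\<beta> j * (v \<bullet> b j)) = (\<Sum>i\<in>I. \<alpha> i * (0 + 2 * (0 \<bullet> a i))) + (\<Sum>j'\<in>J. \<beta> j' * (0 + 2 * ((if j' = j then v else 0) \<bullet> b j')))"
        using j fin by (simp add: if_distrib[of "\<lambda>v. v \<bullet> _"] if_distrib[of "\<lambda>v. _ * v"] sum.delta cong: if_cong)
      also have "\<dots> = (\<Sum>i\<in>I. \<Sum>j'\<in>J. \<gamma> i j' * (0 + 0 + 2 * ((\<Phi> i + \<Psi> j') \<bullet> (0 + (if j' = j then v else 0)))))"
        by (rule var)
      also have "\<dots> = (\<Sum>i\<in>I. \<Sum>j'\<in>J. if j' = j then \<gamma> i j * (2 * ((\<Phi> i + \<Psi> j) \<bullet> v)) else 0)"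
        by (intro sum.cong refl) auto
      also have "\<dots> = 2 * (v \<bullet> (\<Sum>i\<in>I. \<gamma> i j *\<^sub>R (\<Phi> i + \<Psi> j)))"
        using j fin by (simp add: sum.delta inner_sum_right sum_distrib_left inner_commute algebra_simps)
      finally show "v \<bullet> (\<Sum>i\<in>I. \<gamma> i j *\<^sub>R (\<Phi> i + \<Psi> j)) = v \<bullet> (\<beta> j *\<^sub>R b j)" by simp
    qed
    show "\<phi> i + \<psi> j + (norm (\<Phi> i + \<Psi> j))\<^sup>2 \<le> 0" if ij: "i \<in> I" "j \<in> J" for i j
    proof -
      have "\<gamma> i j \<le> (\<Sum>j\<in>J. \<gamma> i j)" using fin ij \<gamma>0 by (intro member_le_sum) auto
      also have "\<dots> = \<alpha> i" using r\<alpha> ij by simp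
      also have "\<dots> \<le> (\<Sum>i\<in>I. \<alpha> i)" using fin ij \<alpha>(1) by (intro member_le_sum) (auto intro: less_imp_le)
      finally have "\<gamma> i j \<le> 1" using \<alpha>(2) by simp
      then show ?thesis using \<tau> by (simp add: \<gamma>_def divide_le_0_iff)
    qed
    define E where "E = (\<Sum>i\<in>I. \<Sum>j\<in>J. \<gamma> i j * (norm (\<Phi> i + \<Psi> j))\<^sup>2)"
    have e1: "(\<Sum>i\<in>I. \<alpha> i * (\<Phi> i \<bullet> a i)) + (\<Sum>j\<in>J. \<beta> j * (\<Psi> j \<bullet> b j)) = E"
      using var[of "\<lambda>_. 0" \<Phi> "\<lambda>_. 0" \<Psi>]
      by (simp add: E_def power2_norm_eq_inner sum_distrib_left[symmetric] mult.left_commute[of _ 2])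
    \<comment> \<open>The dual value minus the energy \<open>E\<close> equals the sum of \<tau>
      \<gamma> log \<gamma> over all pairs, and t log t \<ge> -1 for t > 0.\<close>
    have "- (\<tau> * (card I * card J)) = (\<Sum>i\<in>I. \<Sum>j\<in>J. \<tau> * (- 1))" by simp
    also have "\<dots> \<le> (\<Sum>i\<in>I. \<Sum>j\<in>J. \<gamma> i j * (\<phi> i + \<psi> j + (norm (\<Phi> i + \<Psi> j))\<^sup>2))"
    proof (intro sum_mono)
      fix i j
      define s where "s = (\<phi> i + \<psi> j + (norm (\<Phi> i + \<Psi> j))\<^sup>2) / \<tau>"
      have "1 + - s \<le> exp (- s)" by (rule exp_ge_add_one_self)
      then have "exp s * (1 + - s) \<le> exp s * exp (- s)" by (intro mult_left_mono) auto
      then have "exp s \<le> 1 + exp s * s" by (simp add: exp_minus algebra_simps)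
      then have "- 1 \<le> exp s * s" using exp_gt_zero[of s] by linarith
      then have "\<tau> * (- 1) \<le> \<tau> * (exp s * s)" using \<tau> by (intro mult_left_mono) auto
      then show "\<tau> * (- 1) \<le> \<gamma> i j * (\<phi> i + \<psi> j + (norm (\<Phi> i + \<Psi> j))\<^sup>2)"
        using \<tau> by (simp add: \<gamma>_def s_def)
    qed
    also have "\<dots> = (\<Sum>i\<in>I. \<Sum>j\<in>J. \<gamma> i j * (\<phi> i + \<psi> j)) + E"
      unfolding E_def sum.distrib[symmetric] by (intro sum.cong refl) (simp add: algebra_simps)
    also have "(\<Sum>i\<in>I. \<Sum>j\<in>J. \<gamma> i j * (\<phi> i + \<psi> j)) = (\<Sum>i\<in>I. \<alpha> i * \<phi> i) + (\<Sum>j\<in>J. \<beta> j * \<psi> j)"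
      using var[of \<phi> "\<lambda>_. 0" \<psi> "\<lambda>_. 0"] by simp
    finally show "(\<Sum>i\<in>I. \<alpha> i * (\<Phi> i \<bullet> a i)) + (\<Sum>j\<in>J. \<beta> j * (\<Psi> j \<bullet> b j))
      \<le> (\<Sum>i\<in>I. \<alpha> i * (\<phi> i + 2 * (\<Phi> i \<bullet> a i))) + (\<Sum>j\<in>J. \<beta> j * (\<psi> j + 2 * (\<Psi> j \<bullet> b j)))
         + \<tau> * (card I * card J)"
      using e1 by (simp add: distrib_left sum.distrib mult.left_commute[of _ 2] sum_distrib_left[symmetric])
  qed
qed

subsection \<open>Continuous test functions\<close>

lemma closed_indicator_approx:
  fixes K :: "'b::metric_space set"
  assumes "closed K" "K \<noteq> {}"
  shows "(\<lambda>j. max 0 (1 - real j * infdist x K)) \<longlonglongrightarrow> indicator K x"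
proof (cases "x \<in> K")
  case True
  then show ?thesis by simp
next
  case False
  then have d: "infdist x K > 0" using assms by (simp add: infdist_pos_not_in_closed)
  have "\<forall>\<^sub>F j in sequentially. 1 / infdist x K \<le> real j"
    using filterlim_real_sequentially unfolding filterlim_at_top by blast
  then have "\<forall>\<^sub>F j in sequentially. max 0 (1 - real j * infdist x K) = 0"
    by eventually_elim (use d in \<open>simp add: pos_divide_le_eq\<close>)
  then show ?thesis using False by (simp add: tendsto_eventually)
qed

lemma closed_indicator_approx_continuous:
  "continuous_on UNIV (\<lambda>x. max 0 (1 - real j * infdist x K))"
  by (intro continuous_intros)

text \<open>Indicators of closed sets are limits of the bounded functions max 0 (1 - j dist), and
  the closed sets generate the Borel sets and are stable under intersection.\<close>

lemma finite_measure_eqI_continuous: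
  fixes M N :: "'b::euclidean_space measure"
  assumes M: "finite_measure M" "sets M = sets borel" and N: "finite_measure N" "sets N = sets borel"
    and eq: "\<And>f. continuous_on UNIV f \<Longrightarrow> bounded (range f) \<Longrightarrow> (\<integral>x. f x \<partial>M) = (\<integral>x. (f x :: real) \<partial>N)"
  shows "M = N"
proof -
  interpret M: finite_measure M by fact
  interpret N: finite_measure N by fact
  have closed_eq: "emeasure M K = emeasure N K" if K: "closed K" for K
  proof (cases "K = {}")
    case False
    let ?h = "\<lambda>j x. max 0 (1 - real j * infdist x K)"
    have lim: "(\<lambda>j. \<integral>x. ?h j x \<partial>L) \<longlonglongrightarrow> measure L K"
      if L: "finite_measure L" "sets L = sets borel" for L :: "'b measure"
    proof -
      interpret L: finite_measure L by fact
      have "(\<lambda>j. \<integral>x. ?h j x \<partial>L) \<longlonglongrightarrow> (\<integral>x. indicator K x \<partial>L)"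
      proof (rule integral_dominated_convergence[where w="\<lambda>_. 1"])
        show "AE x in L. norm (?h j x) \<le> 1" for j by (auto simp: infdist_nonneg)
        show "(\<lambda>x. ?h j x) \<in> borel_measurable L" for j
          using borel_measurable_continuous_onI[OF closed_indicator_approx_continuous[of j K]]
            measurable_cong_sets[OF L(2) refl] by blast
        show "(\<lambda>x. indicat_real K x) \<in> borel_measurable L"
          using K L by (intro borel_measurable_indicator) simp
        show "AE x in L. (\<lambda>j. ?h j x) \<longlonglongrightarrow> indicator K x"
          by (intro AE_I2 closed_indicator_approx K False)
      qed simp
      then show ?thesis using L K sets_eq_imp_space_eq[OF L(2)] by simp
    qed
    have "(\<integral>x. ?h j x \<partial>M) = (\<integral>x. ?h j x \<partial>N)" for j
    proof (rule eq)
      show "bounded (range (?h j))"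
        by (rule boundedI[of _ 1]) (auto simp: infdist_nonneg)
    qed (rule closed_indicator_approx_continuous)
    then have "measure M K = measure N K"
      using lim[OF M] lim[OF N] LIMSEQ_unique by fastforce
    then show ?thesis by (simp add: M.emeasure_eq_measure N.emeasure_eq_measure)
  qed simp
  show ?thesis
  proof (rule measure_eqI_generator_eq[where \<Omega>=UNIV and E="Collect closed" and A="\<lambda>_. UNIV"])
    show "Int_stable (Collect closed)" by (auto intro!: Int_stableI)
    show "sets M = sigma_sets UNIV (Collect closed)" "sets N = sigma_sets UNIV (Collect closed)"
      using M(2) N(2) by (simp_all add: borel_eq_closed)
  qed (use closed_eq in \<open>auto simp: M.emeasure_eq_measure\<close>)
qed

text \<open>Induction over integrable functions. For an indicator, inner regularity supplies a
  compact subset of almost full measure, and the distance to that subset supplies the continuous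
  functions.\<close>

lemma continuous_dense_L1:
  fixes f :: "'b::euclidean_space \<Rightarrow> 'c::euclidean_space"
  assumes M: "finite_measure M" "sets M = sets borel" and f: "integrable M f" and e: "e > 0"
  shows "\<exists>g. continuous_on UNIV g \<and> integrable M g \<and> (\<integral>x. norm (f x - g x) \<partial>M) < e"
  using f e
proof (induction arbitrary: e rule: integrable_induct)
  case (base A c)
  interpret finite_measure M by fact
  have A: "A \<in> sets borel" using base M by simp
  \<comment> \<open>The error in measure and the error of the continuous approximation are each at
    most d and are both scaled by |c|, so 2 d |c| < e is needed; the added 1 covers c = 0.\<close>
  define d where "d = e / (2 * (norm c + 1))"
  have d: "d > 0" using base by (simp add: d_def add_nonneg_pos)
  have dc: "d * norm c < e / 2"
  proof -
    have "d * norm c < d * (norm c + 1)" using d by simp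
    also have "\<dots> = e / 2" by (simp add: d_def field_simps add_nonneg_eq_0_iff)
    finally show ?thesis .
  qed
  obtain K where K: "K \<subseteq> A" "compact K" "measure M A - measure M K < d"
  proof (cases "measure M A < d")
    case True
    then show ?thesis by (intro that[of "{}"]) auto
  next
    case False
    have "emeasure M A = (SUP K \<in> {K. K \<subseteq> A \<and> compact K}. emeasure M K)"
      by (rule inner_regular[OF M(2) _ A]) simp
    moreover have "ennreal (measure M A - d) < emeasure M A"
      unfolding emeasure_eq_measure using d False by (intro ennreal_lessI) auto
    ultimately obtain K where K: "K \<subseteq> A" "compact K" "ennreal (measure M A - d) < emeasure M K"
      by (auto simp: less_SUP_iff)
    then have "measure M A - d < measure M K" using False by (simp add: emeasure_eq_measure ennreal_less_iff)
    then show ?thesis using K by (intro that[of K]) auto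
  qed
  have Ks: "K \<in> sets M" using K(2) M by (simp add: borel_compact)
  show ?case
  proof (cases "K = {}")
    case True
    have "(\<integral>x. norm (indicator A x *\<^sub>R c - 0) \<partial>M) = measure M A * norm c"
      using base by simp
    also have "\<dots> \<le> d * norm c" using True K(3) by (intro mult_right_mono) auto
    also have "\<dots> < e" using dc base by simp
    finally show ?thesis by (intro exI[of _ "\<lambda>_. 0"]) auto
  next
    case False
    let ?h = "\<lambda>j x. max 0 (1 - real j * infdist x K)"
    have hm: "?h j \<in> borel_measurable M" for j
      using borel_measurable_continuous_onI[OF closed_indicator_approx_continuous[of j K]]
        measurable_cong_sets[OF M(2) refl] by blast
    have h1: "norm (?h j x) \<le> 1" for j x by (auto simp: infdist_nonneg)
    have "(\<lambda>j. \<integral>x. norm (indicator K x - ?h j x) \<partial>M) \<longlonglongrightarrow> (\<integral>x. 0 \<partial>M)"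
    proof (rule integral_dominated_convergence[where w="\<lambda>_. 2"])
      show "AE x in M. (\<lambda>j. norm (indicator K x - ?h j x)) \<longlonglongrightarrow> 0"
        using tendsto_diff[OF tendsto_const closed_indicator_approx[OF compact_imp_closed[OF K(2)] False]]
        by (intro AE_I2 tendsto_norm_zero) (metis diff_self)
      show "AE x in M. norm (norm (indicator K x - ?h j x)) \<le> 2" for j
      proof (rule AE_I2)
        fix x show "norm (norm (indicator K x - ?h j x)) \<le> 2"
          using h1[of j x] norm_triangle_ineq4[of "indicator K x" "?h j x"]
          by (auto simp: indicator_def split: if_splits)
      qed
    qed (use Ks hm in auto)
    then have "\<forall>\<^sub>F j in sequentially. (\<integral>x. norm (indicator K x - ?h j x) \<partial>M) < d"
      using order_tendstoD(2)[of _ _ _ d] d by simp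
    then obtain j where j: "(\<integral>x. norm (indicator K x - ?h j x) \<partial>M) < d"
      by (auto simp: eventually_sequentially)
    have ih: "integrable M (?h j)"
      by (rule integrable_const_bound[where B=1]) (use h1 hm in auto)
    have iI: "integrable M (indicat_real S)" if "S \<in> sets M" for S
      by (rule integrable_const_bound[where B=1]) (use that in \<open>auto simp: indicator_def\<close>)
    have i1: "integrable M (\<lambda>x. norm (indicator K x - ?h j x))"
      by (intro integrable_norm Bochner_Integration.integrable_diff ih iI Ks)
    have i2: "integrable M (\<lambda>x. norm (indicator A x - indicator K x :: real))"
      by (intro integrable_norm Bochner_Integration.integrable_diff iI Ks base)
    have "(\<integral>x. norm (indicator A x *\<^sub>R c - ?h j x *\<^sub>R c) \<partial>M)
        \<le> (\<integral>x. (norm (indicator A x - indicator K x :: real) + norm (indicator K x - ?h j x)) * norm c \<partial>M)"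
    proof (rule integral_mono)
      show "integrable M (\<lambda>x. norm (indicator A x *\<^sub>R c - ?h j x *\<^sub>R c))"
        by (intro integrable_norm Bochner_Integration.integrable_diff integrable_scaleR_left iI base ih)
      show "integrable M (\<lambda>x. (norm (indicator A x - indicator K x :: real) + norm (indicator K x - ?h j x)) * norm c)"
        using i1 i2 by (intro integrable_mult_left Bochner_Integration.integrable_add)
      fix x
      have "norm (indicator A x *\<^sub>R c - ?h j x *\<^sub>R c) = norm (indicator A x - ?h j x) * norm c"
        by (simp add: scaleR_diff_left[symmetric])
      also have "\<dots> \<le> (norm (indicator A x - indicator K x :: real) + norm (indicator K x - ?h j x)) * norm c"
        by (intro mult_right_mono) (auto simp: abs_le_iff)
      finally show "norm (indicator A x *\<^sub>R c - ?h j x *\<^sub>R c) \<le> (norm (indicator A x - indicator K x :: real) + norm (indicator K x - ?h j x)) * norm c" .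
    qed
    also have "\<dots> = ((\<integral>x. norm (indicator A x - indicator K x :: real) \<partial>M) + (\<integral>x. norm (indicator K x - ?h j x) \<partial>M)) * norm c"
      using i1 i2 by simp
    also have "(\<lambda>x. norm (indicator A x - indicator K x :: real)) = indicator (A - K)"
      using K(1) by (auto simp: fun_eq_iff indicator_def)
    also have "(\<integral>x. indicator (A - K) x \<partial>M) = measure M A - measure M K"
      using base Ks K(1) sets.sets_into_space[OF base(1)] finite_measure_Diff[OF base(1) Ks K(1)]
      by (simp add: Int_absorb2 Diff_subset subset_trans Int_commute)
    also have "((measure M A - measure M K) + (\<integral>x. norm (indicator K x - ?h j x) \<partial>M)) * norm c \<le> (d + d) * norm c"
      using K(3) j by (intro mult_right_mono) auto
    also have "\<dots> < e" using dc by (simp add: distrib_right)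
    finally have "(\<integral>x. norm (indicator A x *\<^sub>R c - ?h j x *\<^sub>R c) \<partial>M) < e" .
    moreover have "continuous_on UNIV (\<lambda>x. ?h j x *\<^sub>R c)"
      by (intro continuous_intros)
    ultimately show ?thesis using ih by (intro exI[of _ "\<lambda>x. ?h j x *\<^sub>R c"]) auto
  qed
next
  case (add f1 f2)
  from add.IH(1)[of "e/2"] add.IH(2)[of "e/2"] add.prems
  obtain g1 g2 where g: "continuous_on UNIV g1" "integrable M g1" "(\<integral>x. norm (f1 x - g1 x) \<partial>M) < e / 2"
      "continuous_on UNIV g2" "integrable M g2" "(\<integral>x. norm (f2 x - g2 x) \<partial>M) < e / 2"
    by auto
  have "(\<integral>x. norm (f1 x + f2 x - (g1 x + g2 x)) \<partial>M) \<le> (\<integral>x. norm (f1 x - g1 x) + norm (f2 x - g2 x) \<partial>M)"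
    using add g by (intro integral_mono) (auto intro: norm_diff_triangle_ineq)
  also have "\<dots> < e" using add g by simp
  finally show ?case using g by (intro exI[of _ "\<lambda>x. g1 x + g2 x"]) (auto intro!: continuous_intros)
next
  case (lim f s)
  have "(\<lambda>i. \<integral>x. norm (f x - s i x) \<partial>M) \<longlonglongrightarrow> (\<integral>x. 0 \<partial>M)"
  proof (rule integral_dominated_convergence[where w="\<lambda>x. 3 * norm (f x)"])
    show "AE x in M. (\<lambda>i. norm (f x - s i x)) \<longlonglongrightarrow> 0"
      using tendsto_diff[OF tendsto_const lim.hyps(2)]
      by (intro AE_I2 tendsto_norm_zero) (metis diff_self)
    show "AE x in M. norm (norm (f x - s i x)) \<le> 3 * norm (f x)" for i
    proof (rule AE_I2)
      fix x assume "x \<in> space M"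
      then show "norm (norm (f x - s i x)) \<le> 3 * norm (f x)"
        using norm_triangle_ineq4[of "f x" "s i x"] lim.hyps(3)[of x i] by simp
    qed
  qed (use lim.hyps in auto)
  then have "\<forall>\<^sub>F i in sequentially. (\<integral>x. norm (f x - s i x) \<partial>M) < e / 2"
    by (rule order_tendstoD(2)) (use lim.prems in simp)
  then obtain i where i: "(\<integral>x. norm (f x - s i x) \<partial>M) < e / 2"
    by (auto simp: eventually_sequentially)
  have "\<exists>g. continuous_on UNIV g \<and> integrable M g \<and> (\<integral>x. norm (s i x - g x) \<partial>M) < e / 2"
    by (rule lim.IH) (use lim.prems in simp)
  then obtain g where g: "continuous_on UNIV g" "integrable M g" "(\<integral>x. norm (s i x - g x) \<partial>M) < e / 2"
    by blast
  have i1: "integrable M (\<lambda>x. norm (f x - s i x))" and i2: "integrable M (\<lambda>x. norm (s i x - g x))"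
    and i3: "integrable M (\<lambda>x. norm (f x - g x))"
    by (intro integrable_norm Bochner_Integration.integrable_diff lim.hyps g)+
  have "(\<integral>x. norm (f x - g x) \<partial>M) \<le> (\<integral>x. norm (f x - s i x) + norm (s i x - g x) \<partial>M)"
  proof (rule integral_mono)
    show "norm (f x - g x) \<le> norm (f x - s i x) + norm (s i x - g x)" for x
      using norm_triangle_ineq[of "f x - s i x" "s i x - g x"] by simp
  qed (intro i1 i2 i3 Bochner_Integration.integrable_add)+
  also have "\<dots> = (\<integral>x. norm (f x - s i x) \<partial>M) + (\<integral>x. norm (s i x - g x) \<partial>M)"
    by (rule Bochner_Integration.integral_add[OF i1 i2])
  also have "\<dots> < e" using g(3) i by linarith
  finally show ?case using g by blast
qed

text \<open>Bridge from continuous test functions, which weak convergence provides, to the bounded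
  Borel ones in the constraints. A subsequence of an L1 approximation converges a.e.; projecting
  onto the ball of radius C restores the bound and leaves the limit unchanged.\<close>

lemma bounded_borel_continuous_approx:
  fixes f :: "'b::euclidean_space \<Rightarrow> 'c::euclidean_space"
  assumes M: "finite_measure M" "sets M = sets borel" and f: "f \<in> borel_measurable borel"
    and C: "\<And>x. norm (f x) \<le> C"
  obtains g where "\<And>n::nat. continuous_on UNIV (g n)" "\<And>n x. norm (g n x) \<le> C"
    "AE x in M. (\<lambda>n. g n x) \<longlonglongrightarrow> f x"
proof -
  interpret finite_measure M by fact
  have fM: "f \<in> borel_measurable M" using f measurable_cong_sets[OF M(2) refl] by blast
  have fi: "integrable M f" by (rule integrable_const_bound[where B=C]) (use C fM in auto)
  have "\<exists>g. continuous_on UNIV g \<and> integrable M g \<and> (\<integral>x. norm (f x - g x) \<partial>M) < 1 / Suc n" for n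
    by (rule continuous_dense_L1[OF M fi]) simp
  then obtain g where g: "\<And>n. continuous_on UNIV (g n)" "\<And>n. integrable M (g n)"
      "\<And>n. (\<integral>x. norm (f x - g n x) \<partial>M) < 1 / Suc n" by metis
  have "(\<lambda>n. \<integral>x. norm (f x - g n x) \<partial>M) \<longlonglongrightarrow> 0"
  proof (rule real_tendsto_sandwich[OF _ _ tendsto_const LIMSEQ_inverse_real_of_nat])
    show "\<forall>\<^sub>F n in sequentially. (\<integral>x. norm (f x - g n x) \<partial>M) \<le> inverse (real (Suc n))"
      using g(3) by (intro always_eventually allI) (simp add: inverse_eq_divide less_imp_le)
  qed simp
  then obtain r :: "nat \<Rightarrow> nat" where r: "strict_mono r" "AE x in M. (\<lambda>n. f x - g (r n) x) \<longlonglongrightarrow> 0"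
    using tendsto_L1_AE_subseq[of M "\<lambda>n x. f x - g n x"] fi g(2) by auto
  have C0: "C \<ge> 0" using C norm_ge_zero order_trans by blast
  let ?p = "closest_point (cball (0::'c) C)"
  have pc: "continuous_on UNIV ?p" using C0 by (intro continuous_on_closest_point) auto
  have pf: "?p (f x) = f x" for x using C by (intro closest_point_self) simp
  show thesis
  proof (rule that[of "\<lambda>n x. ?p (g (r n) x)"])
    show "continuous_on UNIV (\<lambda>x. ?p (g (r n) x))" for n
      using continuous_on_compose2[OF pc g(1)] by simp
    show "norm (?p (g (r n) x)) \<le> C" for n x
      using closest_point_in_set[of "cball (0::'c) C" "g (r n) x"] C0 by simp
    show "AE x in M. (\<lambda>n. ?p (g (r n) x)) \<longlonglongrightarrow> f x"
      using r(2)
    proof eventually_elim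
      case (elim x)
      have "(\<lambda>n. f x - (f x - g (r n) x)) \<longlonglongrightarrow> f x - 0" by (intro tendsto_diff elim tendsto_const)
      then have "(\<lambda>n. g (r n) x) \<longlonglongrightarrow> f x" by simp
      moreover have "isCont ?p (f x)" using pc by (simp add: continuous_on_eq_continuous_at)
      ultimately have "(\<lambda>n. ?p (g (r n) x)) \<longlonglongrightarrow> ?p (f x)" by (rule isCont_tendsto_compose[rotated])
      then show ?case by (simp add: pf)
    qed
  qed
qed

text \<open>The complement of the support is covered by null balls, and by the Lindelof property
  countably many of them suffice.\<close>

lemma AE_supp:
  fixes \<alpha> :: "'a::euclidean_space measure"
  assumes "sets \<alpha> = sets borel"
  shows "AE x in \<alpha>. x \<in> supp \<alpha>"
proof -
  let ?B = "{ball x e | x e. e > 0 \<and> emeasure \<alpha> (ball x e) = 0}"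
  obtain \<F> where F: "\<F> \<subseteq> ?B" "countable \<F>" "\<Union>\<F> = \<Union>?B"
    using Lindelof[of ?B] by auto
  have "(\<Union>S\<in>\<F>. S) \<in> null_sets \<alpha>"
  proof (rule null_sets_UN')
    fix S assume "S \<in> \<F>"
    then show "S \<in> null_sets \<alpha>" using F(1) assms by (auto intro!: null_setsI)
  qed fact
  moreover have "{x \<in> space \<alpha>. x \<notin> supp \<alpha>} \<subseteq> (\<Union>S\<in>\<F>. S)"
  proof
    fix x assume "x \<in> {x \<in> space \<alpha>. x \<notin> supp \<alpha>}"
    then obtain e where "e > 0" "emeasure \<alpha> (ball x e) = 0" by (auto simp: supp_def not_less)
    then have "x \<in> \<Union>?B" using centre_in_ball by blast
    then show "x \<in> (\<Union>S\<in>\<F>. S)" using F(3) by auto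
  qed
  ultimately show ?thesis by (rule AE_I')
qed

subsection \<open>Vector measures and their densities\<close>

lemma borel_measurable_sets_borel:
  "sets M = sets borel \<Longrightarrow> f \<in> borel_measurable borel \<Longrightarrow> f \<in> borel_measurable M"
  using measurable_cong_sets[of M borel borel borel] by simp

lemma VM_D:
  assumes "P \<in> VM"
  shows "finite_measure (fst P)" "sets (fst P) = sets borel" "integrable (fst P) (snd P)"
    "snd P \<in> borel_measurable borel" "(\<lambda>z. fst (snd P z)) \<in> borel_measurable borel"
    "(\<lambda>z. snd (snd P z)) \<in> borel_measurable borel"
    "integrable (fst P) (\<lambda>z. fst (snd P z))" "integrable (fst P) (\<lambda>z. snd (snd P z))"
proof -
  show 1: "finite_measure (fst P)" "sets (fst P) = sets borel" "integrable (fst P) (snd P)"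
    using assms by (auto simp: VM_def split: prod.splits)
  then show m: "snd P \<in> borel_measurable borel"
    using measurable_cong_sets[OF 1(2), of borel borel] by auto
  show "(\<lambda>z. fst (snd P z)) \<in> borel_measurable borel" "(\<lambda>z. snd (snd P z)) \<in> borel_measurable borel"
    using measurable_compose[OF m borel_measurable_continuous_onI[OF continuous_on_fst[OF continuous_on_id]]]
      measurable_compose[OF m borel_measurable_continuous_onI[OF continuous_on_snd[OF continuous_on_id]]]
    by auto
  show "integrable (fst P) (\<lambda>z. fst (snd P z))" "integrable (fst P) (\<lambda>z. snd (snd P z))"
    using integrable_bounded_linear[OF bounded_linear_fst 1(3)] integrable_bounded_linear[OF bounded_linear_snd 1(3)]
    by auto
qed

text \<open>Explicit version of dq/d\<gamma>: the quotient of the two densities. \<open>rn\<close>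
  is a choice among versions and determined only up to null sets, so all computations are done with
  \<open>vdens\<close>.\<close>

definition vdens :: "'a::euclidean_space vmeas \<Rightarrow> 'a \<times> 'a \<Rightarrow> 'a" where
  "vdens P z = (if fst (snd P z) > 0 then (1 / fst (snd P z)) *\<^sub>R snd (snd P z) else 0)"

lemma vdens_borel: "P \<in> VM \<Longrightarrow> vdens P \<in> borel_measurable borel"
  unfolding vdens_def[abs_def] using VM_D(5,6)[of P] by measurable

lemma sets_gam: "P \<in> VM \<Longrightarrow> sets (gam P) = sets borel"
  by (simp add: gam_def VM_D(2))

lemma vm_set_integrable:
  assumes "P \<in> VM" "A \<in> sets borel"
  shows "integrable (fst P) (\<lambda>z. indicator A z *\<^sub>R snd P z)"
  using assms by (intro integrable_mult_indicator) (auto simp: VM_D)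

lemma gam_set_eq:
  "P \<in> VM \<Longrightarrow> A \<in> sets borel \<Longrightarrow> gam_set P A = (\<integral>z. indicator A z * fst (snd P z) \<partial>fst P)"
  unfolding gam_set_def vm_set_def
  by (subst integral_bounded_linear[OF bounded_linear_fst vm_set_integrable, symmetric]) auto

lemma q_set_eq:
  "P \<in> VM \<Longrightarrow> A \<in> sets borel \<Longrightarrow> q_set P A = (\<integral>z. indicator A z *\<^sub>R snd (snd P z) \<partial>fst P)"
  unfolding q_set_def vm_set_def
  by (subst integral_bounded_linear[OF bounded_linear_snd vm_set_integrable, symmetric]) auto

text \<open>\<open>gam\<close> cuts negative densities off at 0; nonnegativity is what makes it
  agree with the scalar part of the vector measure.\<close>

locale nonneg_vmeas =
  fixes P :: "'a::euclidean_space vmeas"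
  assumes VM: "P \<in> VM" and nonneg: "AE z in fst P. 0 \<le> fst (snd P z)"
begin

lemma borelM: "f \<in> borel_measurable borel \<Longrightarrow> f \<in> borel_measurable (fst P)"
  by (rule borel_measurable_sets_borel[OF VM_D(2)[OF VM]])

lemma borelG: "f \<in> borel_measurable borel \<Longrightarrow> f \<in> borel_measurable (gam P)"
  by (rule borel_measurable_sets_borel[OF sets_gam[OF VM]])

lemma integral_gam:
  fixes f :: "'a \<times> 'a \<Rightarrow> 'c::{banach, second_countable_topology}"
  assumes "f \<in> borel_measurable borel"
  shows "(\<integral>z. f z \<partial>gam P) = (\<integral>z. fst (snd P z) *\<^sub>R f z \<partial>fst P)"
  unfolding gam_def
  by (rule integral_density[OF borelM[OF assms] borelM[OF VM_D(5)[OF VM]] nonneg])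

lemma integrable_gam_iff:
  fixes f :: "'a \<times> 'a \<Rightarrow> 'c::{banach, second_countable_topology}"
  assumes "f \<in> borel_measurable borel"
  shows "integrable (gam P) f \<longleftrightarrow> integrable (fst P) (\<lambda>z. fst (snd P z) *\<^sub>R f z)"
  unfolding gam_def
  by (rule integrable_density[OF borelM[OF assms] borelM[OF VM_D(5)[OF VM]] nonneg])

lemma AE_gam: "(AE z in gam P. Q z) \<longleftrightarrow> (AE z in fst P. 0 < fst (snd P z) \<longrightarrow> Q z)"
  unfolding gam_def using borelM[OF VM_D(5)[OF VM]] by (subst AE_density) auto

lemma emeasure_gam:
  assumes A: "A \<in> sets borel"
  shows "emeasure (gam P) A = ennreal (gam_set P A)"
proof -
  have "emeasure (gam P) A = (\<integral>\<^sup>+z. ennreal (fst (snd P z)) * indicator A z \<partial>fst P)"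
    unfolding gam_def using A VM_D(2)[OF VM] borelM[OF VM_D(5)[OF VM]] by (intro emeasure_density) auto
  also have "\<dots> = (\<integral>\<^sup>+z. ennreal (indicator A z * fst (snd P z)) \<partial>fst P)"
    by (intro nn_integral_cong) (auto simp: indicator_def)
  also have "\<dots> = ennreal (\<integral>z. indicator A z * fst (snd P z) \<partial>fst P)"
  proof (rule nn_integral_eq_integral)
    show "integrable (fst P) (\<lambda>z. indicator A z * fst (snd P z))"
      using integrable_mult_indicator[OF _ VM_D(7)[OF VM], of A] A VM_D(2)[OF VM] by simp
    show "AE z in fst P. 0 \<le> indicator A z * fst (snd P z)"
      using nonneg by eventually_elim auto
  qed
  finally show ?thesis using gam_set_eq[OF VM A] by simp
qed

lemma gam_set_nonneg:
  assumes A: "A \<in> sets borel"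
  shows "0 \<le> gam_set P A"
  unfolding gam_set_eq[OF VM A] by (rule integral_nonneg_AE) (use nonneg in eventually_elim, auto)

lemma measure_gam: "A \<in> sets borel \<Longrightarrow> measure (gam P) A = gam_set P A"
  by (simp add: measure_def emeasure_gam gam_set_nonneg)

lemma finite_gam: "finite_measure (gam P)"
proof
  have "space (gam P) = UNIV" using sets_eq_imp_space_eq[OF sets_gam[OF VM]] by simp
  then show "emeasure (gam P) (space (gam P)) \<noteq> \<infinity>" by (simp add: emeasure_gam)
qed

lemma AE_vdens:
  assumes ac: "AE z in fst P. fst (snd P z) = 0 \<longrightarrow> snd (snd P z) = 0"
  shows "AE z in fst P. fst (snd P z) *\<^sub>R vdens P z = snd (snd P z)"
  using nonneg ac by eventually_elim (auto simp: vdens_def)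

lemma integrable_vdens:
  assumes ac: "AE z in fst P. fst (snd P z) = 0 \<longrightarrow> snd (snd P z) = 0"
  shows "integrable (gam P) (vdens P)"
  unfolding integrable_gam_iff[OF vdens_borel[OF VM]]
  using AE_vdens[OF ac] VM_D(8)[OF VM]
  by (subst integrable_cong_AE[of _ _ "\<lambda>z. snd (snd P z)"])
    (auto intro!: borelM borel_measurable_scaleR VM_D vdens_borel VM)

lemma integral_inner_vdens:
  assumes ac: "AE z in fst P. fst (snd P z) = 0 \<longrightarrow> snd (snd P z) = 0"
    and f: "f \<in> borel_measurable borel"
  shows "(\<integral>z. f z \<bullet> vdens P z \<partial>gam P) = (\<integral>z. f z \<bullet> snd (snd P z) \<partial>fst P)"
proof -
  have "(\<integral>z. f z \<bullet> vdens P z \<partial>gam P) = (\<integral>z. fst (snd P z) *\<^sub>R (f z \<bullet> vdens P z) \<partial>fst P)"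
    using f vdens_borel[OF VM] by (intro integral_gam) auto
  also have "\<dots> = (\<integral>z. f z \<bullet> snd (snd P z) \<partial>fst P)"
  proof (rule integral_cong_AE)
    show "AE z in fst P. fst (snd P z) *\<^sub>R (f z \<bullet> vdens P z) = f z \<bullet> snd (snd P z)"
      using AE_vdens[OF ac] by eventually_elim (simp add: inner_scaleR_right[symmetric])
  qed (intro borelM borel_measurable_scaleR borel_measurable_inner f vdens_borel VM_D(5,6) VM)+
  finally show ?thesis .
qed

lemma q_set_vdens:
  assumes ac: "AE z in fst P. fst (snd P z) = 0 \<longrightarrow> snd (snd P z) = 0" and A: "A \<in> sets borel"
  shows "q_set P A = (\<integral>z. indicator A z *\<^sub>R vdens P z \<partial>gam P)"
proof -
  have "(\<integral>z. indicator A z *\<^sub>R vdens P z \<partial>gam P) = (\<integral>z. fst (snd P z) *\<^sub>R (indicator A z *\<^sub>R vdens P z) \<partial>fst P)"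
    using A vdens_borel[OF VM] by (intro integral_gam) auto
  also have "\<dots> = (\<integral>z. indicator A z *\<^sub>R snd (snd P z) \<partial>fst P)"
  proof (rule integral_cong_AE)
    show "AE z in fst P. fst (snd P z) *\<^sub>R (indicator A z *\<^sub>R vdens P z) = indicator A z *\<^sub>R snd (snd P z)"
      using AE_vdens[OF ac] by eventually_elim (simp add: indicator_def)
  qed (intro borelM borel_measurable_scaleR borel_measurable_indicator A vdens_borel VM_D(5,6) VM)+
  finally show ?thesis using q_set_eq[OF VM A] by simp
qed

text \<open>On every subset of the zero set S of the scalar density \<gamma> vanishes, so absolute
  continuity forces the density of q restricted to S to have zero integral over every set, hence to
  be 0 a.e.\<close>

lemma abs_cont_iff:
  "abs_cont P \<longleftrightarrow> (AE z in fst P. fst (snd P z) = 0 \<longrightarrow> snd (snd P z) = 0)"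
proof
  assume ac: "abs_cont P"
  define S where "S = {z. fst (snd P z) = 0}"
  have S: "S \<in> sets borel" unfolding S_def
    using measurable_sets_borel[OF VM_D(5)[OF VM], of "{0}"] by (simp add: vimage_def)
  have i: "integrable (fst P) (\<lambda>z. indicator S z *\<^sub>R snd (snd P z))"
    using S VM_D(2,8)[OF VM] by (intro integrable_mult_indicator) auto
  have "AE z in fst P. indicator S z *\<^sub>R snd (snd P z) = (0::'a)"
  proof (rule sigma_finite_measure.density_unique_banach[OF finite_measure.axioms(1)[OF VM_D(1)[OF VM]] i])
    fix A assume "A \<in> sets (fst P)"
    then have A: "A \<in> sets borel" using VM_D(2)[OF VM] by simp
    have "(\<lambda>z. indicator (A \<inter> S) z * fst (snd P z)) = (\<lambda>z. 0)"
      by (auto simp: S_def indicator_def)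
    then have "gam_set P (A \<inter> S) = 0"
      using A S by (subst gam_set_eq[OF VM]) auto
    then have "q_set P (A \<inter> S) = 0" using ac A S by (auto simp: abs_cont_def)
    then show "(LINT z:A|fst P. indicator S z *\<^sub>R snd (snd P z)) = (LINT z:A|fst P. (0::'a))"
      using A S q_set_eq[OF VM, of "A \<inter> S"]
      by (simp add: set_lebesgue_integral_def indicator_inter_arith)
  qed simp
  then show "AE z in fst P. fst (snd P z) = 0 \<longrightarrow> snd (snd P z) = 0"
    by eventually_elim (auto simp: S_def indicator_def split: if_splits)
next
  assume ac: "AE z in fst P. fst (snd P z) = 0 \<longrightarrow> snd (snd P z) = 0"
  show "abs_cont P" unfolding abs_cont_def
  proof (intro ballI impI)
    fix A assume A: "A \<in> sets (borel :: ('a \<times> 'a) measure)" and 0: "gam_set P A = 0"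
    have "emeasure (gam P) A = 0" using emeasure_gam[OF A] 0 by simp
    then have "AE z in gam P. z \<notin> A" using A sets_gam[OF VM] by (intro AE_not_in) auto
    then have "(\<integral>z. indicator A z *\<^sub>R vdens P z \<partial>gam P) = (\<integral>z. 0 \<partial>gam P)"
      using A vdens_borel[OF VM]
      by (intro integral_cong_AE) (auto intro!: borelG borel_measurable_scaleR elim!: eventually_mono)
    then show "q_set P A = 0" using q_set_vdens[OF ac A] by simp
  qed
qed

text \<open>\<open>vdens\<close> witnesses that the choice defining \<open>rn\<close> succeeds, and
  two densities of the same vector measure agree a.e.\<close>

lemma rn_vdens:
  assumes ac: "AE z in fst P. fst (snd P z) = 0 \<longrightarrow> snd (snd P z) = 0"
  shows "rn P \<in> borel_measurable borel" "AE z in gam P. rn P z = vdens P z"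
proof -
  let ?Q = "\<lambda>k. k \<in> borel_measurable borel \<and> integrable (gam P) k \<and>
             (\<forall>A \<in> sets borel. q_set P A = (\<integral>z. indicator A z *\<^sub>R k z \<partial>gam P))"
  have v: "?Q (vdens P)"
    using vdens_borel[OF VM] integrable_vdens[OF ac] q_set_vdens[OF ac] by blast
  have r: "?Q (rn P)" unfolding rn_def by (rule someI[of ?Q, OF v])
  then show "rn P \<in> borel_measurable borel" by blast
  interpret G: finite_measure "gam P" by (rule finite_gam)
  show "AE z in gam P. rn P z = vdens P z"
  proof (rule G.density_unique_banach)
    show "integrable (gam P) (rn P)" "integrable (gam P) (vdens P)" using r v by auto
    fix A assume "A \<in> sets (gam P)"
    then have "A \<in> sets borel" using sets_gam[OF VM] by simp
    then show "set_lebesgue_integral (gam P) A (rn P) = set_lebesgue_integral (gam P) A (vdens P)"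
      using r v by (auto simp: set_lebesgue_integral_def)
  qed
qed

lemma energy_vdens:
  assumes ac: "AE z in fst P. fst (snd P z) = 0 \<longrightarrow> snd (snd P z) = 0"
  shows "energy P = (\<integral>\<^sup>+z. ennreal ((norm (vdens P z))\<^sup>2) \<partial>gam P)"
  unfolding energy_def
  by (rule nn_integral_cong_AE) (use rn_vdens(2)[OF ac] in eventually_elim, simp)

end

text \<open>The truncation drops large values to 0 instead of capping them at N, so that for g =
  |v|^2 it is again the square of a field, namely of v cut off where it is large.\<close>

lemma nn_integral_le_truncated:
  fixes g :: "'b \<Rightarrow> real"
  assumes g[measurable]: "g \<in> borel_measurable M"
    and le: "\<And>N::nat. (\<integral>\<^sup>+z. ennreal (if g z \<le> real N then g z else 0) \<partial>M) \<le> L"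
  shows "(\<integral>\<^sup>+z. ennreal (g z) \<partial>M) \<le> L"
proof -
  let ?u = "\<lambda>N z. ennreal (if g z \<le> real N then g z else 0)"
  have "(\<integral>\<^sup>+z. ennreal (g z) \<partial>M) = (\<integral>\<^sup>+z. liminf (\<lambda>N. ?u N z) \<partial>M)"
  proof (rule nn_integral_cong)
    fix z
    obtain N where N: "g z \<le> real N" using real_arch_simple by blast
    have "(\<lambda>N. ?u N z) \<longlonglongrightarrow> ennreal (g z)"
      by (rule tendsto_eventually, rule eventually_sequentiallyI[of N]) (use N in auto)
    then show "ennreal (g z) = liminf (\<lambda>N. ?u N z)" by (simp add: lim_imp_Liminf)
  qed
  also have "\<dots> \<le> liminf (\<lambda>N. \<integral>\<^sup>+z. ?u N z \<partial>M)" by (intro nn_integral_liminf) measurable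
  also have "\<dots> \<le> L" using le by (intro Liminf_le) (auto intro: always_eventually)
  finally show ?thesis .
qed

text \<open>The energy is the supremum of the integrals of f.dq - |f|^2/4 d\<gamma> over bounded f.
  These integrals make sense without q \<lless> \<gamma>, and a finite bound on them enforces it;
  this is how absolute continuity survives weak limits.\<close>

lemma (in nonneg_vmeas) dual_energy_bound:
  assumes dual: "\<And>f. f \<in> borel_measurable borel \<Longrightarrow> bounded (range f) \<Longrightarrow>
      (\<integral>z. f z \<bullet> snd (snd P z) - (norm (f z))\<^sup>2 / 4 * fst (snd P z) \<partial>fst P) \<le> L"
  shows "AE z in fst P. fst (snd P z) = 0 \<longrightarrow> snd (snd P z) = 0"
    and "(\<integral>\<^sup>+z. ennreal ((norm (vdens P z))\<^sup>2) \<partial>gam P) \<le> ennreal L"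
proof -
  let ?h = "\<lambda>z. fst (snd P z)" and ?H = "\<lambda>z. snd (snd P z)"
  define S where "S = {z. ?h z = 0}"
  have S: "S \<in> sets borel" unfolding S_def
    using measurable_sets_borel[OF VM_D(5)[OF VM], of "{0}"] by (simp add: vimage_def)
  have iS: "integrable (fst P) (\<lambda>z. indicator S z * norm (?H z))"
    using integrable_mult_indicator[OF _ integrable_norm[OF VM_D(8)[OF VM]], of S] S VM_D(2)[OF VM] by simp
  have tS: "t * (\<integral>z. indicator S z * norm (?H z) \<partial>fst P) \<le> L" for t :: real
  proof -
    \<comment> \<open>On S the scalar density is 0, so the quadratic term disappears and the test is
      linear in t. A bound uniform in t leaves no mass of q on S.\<close>
    define f where "f z = (t * indicator S z) *\<^sub>R sgn (?H z)" for z
    have "(\<integral>z. f z \<bullet> ?H z - (norm (f z))\<^sup>2 / 4 * ?h z \<partial>fst P) \<le> L"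
    proof (rule dual)
      show "f \<in> borel_measurable borel"
        unfolding f_def[abs_def] sgn_div_norm using S VM_D(6)[OF VM] by measurable
      show "bounded (range f)"
        by (rule boundedI[of _ "\<bar>t\<bar>"]) (auto simp: f_def norm_sgn indicator_def)
    qed
    also have "(\<lambda>z. f z \<bullet> ?H z - (norm (f z))\<^sup>2 / 4 * ?h z) = (\<lambda>z. t * (indicator S z * norm (?H z)))"
    proof
      fix z
      have "sgn (?H z) \<bullet> ?H z = norm (?H z)"
        by (cases "?H z = 0") (simp_all add: sgn_div_norm power2_norm_eq_inner[symmetric] power2_eq_square)
      then show "f z \<bullet> ?H z - (norm (f z))\<^sup>2 / 4 * ?h z = t * (indicator S z * norm (?H z))"
        by (auto simp: f_def S_def indicator_def)
    qed
    finally show ?thesis using iS by simp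
  qed
  have "(\<integral>z. indicator S z * norm (?H z) \<partial>fst P) = 0"
  proof (rule ccontr)
    let ?I = "\<integral>z. indicator S z * norm (?H z) \<partial>fst P"
    assume "?I \<noteq> 0"
    then have "(\<bar>L\<bar> + 1) / ?I * ?I = \<bar>L\<bar> + 1" by simp
    then show False using tS[of "(\<bar>L\<bar> + 1) / ?I"] by linarith
  qed
  then have "AE z in fst P. indicator S z * norm (?H z) = 0"
    using iS by (subst (asm) integral_nonneg_eq_0_iff_AE) auto
  then show ac: "AE z in fst P. ?h z = 0 \<longrightarrow> ?H z = 0"
    by eventually_elim (auto simp: S_def)
  let ?g = "\<lambda>z. (norm (vdens P z))\<^sup>2"
  have gm: "?g \<in> borel_measurable borel" using vdens_borel[OF VM] by measurable
  show "(\<integral>\<^sup>+z. ennreal (?g z) \<partial>gam P) \<le> ennreal L"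
  proof (rule nn_integral_le_truncated[OF borelG[OF gm]])
    fix N :: nat
    \<comment> \<open>f = 2 v is the pointwise maximiser of f.v - |f|^2/4, with value |v|^2; the
      cut-off keeps it bounded.\<close>
    define f where "f z = (if ?g z \<le> N then 2 *\<^sub>R vdens P z else 0)" for z
    let ?t = "\<lambda>z. if ?g z \<le> real N then ?g z else 0"
    have tm: "?t \<in> borel_measurable borel" using gm by measurable
    have ft: "integrable (gam P) ?t"
    proof -
      interpret finite_measure "gam P" by (rule finite_gam)
      show ?thesis by (rule integrable_const_bound[where B="real N"]) (use borelG[OF tm] in auto)
    qed
    have fm: "f \<in> borel_measurable borel"
      unfolding f_def[abs_def] using gm vdens_borel[OF VM] by measurable
    have "bounded (range f)"
    proof (rule boundedI[of _ "2 * sqrt N"], clarify)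
      fix z1 z2
      show "norm (f (z1, z2)) \<le> 2 * sqrt N"
        by (auto simp: f_def intro: real_le_rsqrt)
    qed
    from dual[OF fm this]
    have "(\<integral>z. f z \<bullet> ?H z - (norm (f z))\<^sup>2 / 4 * ?h z \<partial>fst P) \<le> L" .
    also have "(\<integral>z. f z \<bullet> ?H z - (norm (f z))\<^sup>2 / 4 * ?h z \<partial>fst P) = (\<integral>z. ?h z *\<^sub>R ?t z \<partial>fst P)"
    proof (rule integral_cong_AE)
      show "AE z in fst P. f z \<bullet> ?H z - (norm (f z))\<^sup>2 / 4 * ?h z = ?h z *\<^sub>R ?t z"
        using AE_vdens[OF ac]
      proof eventually_elim
        case (elim z)
        show ?case unfolding elim[symmetric] f_def
          by (simp add: power2_norm_eq_inner[symmetric] power_mult_distrib algebra_simps)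
      qed
      note [measurable] = fm tm VM_D(5,6)[OF VM]
      show "(\<lambda>z. f z \<bullet> ?H z - (norm (f z))\<^sup>2 / 4 * ?h z) \<in> borel_measurable (fst P)"
        by (rule borelM) measurable
      show "(\<lambda>z. ?h z *\<^sub>R ?t z) \<in> borel_measurable (fst P)"
        by (rule borelM, rule borel_measurable_scaleR) measurable
    qed
    also have "\<dots> = (\<integral>z. ?t z \<partial>gam P)" by (rule integral_gam[OF tm, symmetric])
    finally have "(\<integral>z. ?t z \<partial>gam P) \<le> L" .
    moreover have "(\<integral>\<^sup>+z. ennreal (?t z) \<partial>gam P) = ennreal (\<integral>z. ?t z \<partial>gam P)"
      using ft by (intro nn_integral_eq_integral) auto
    ultimately show "(\<integral>\<^sup>+z. ennreal (?t z) \<partial>gam P) \<le> ennreal L" by (simp add: ennreal_leI)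
  qed
qed

text \<open>Expresses membership through laws and the density alone. Mass one follows from the
  marginals being probabilities, and the support conditions hold because a measure is carried by its
  support, so almost every z has its coordinates in the two supports.\<close>

lemma GammaQ_iff:
  fixes \<alpha> \<beta> :: "'a::euclidean_space measure"
  assumes \<alpha>: "prob_space \<alpha>" "sets \<alpha> = sets borel" and \<beta>: "prob_space \<beta>" "sets \<beta> = sets borel"
  shows "P \<in> GammaQ \<alpha> \<beta> \<longleftrightarrow> P \<in> VM \<and> (AE z in fst P. 0 \<le> fst (snd P z))
     \<and> (AE z in fst P. fst (snd P z) = 0 \<longrightarrow> snd (snd P z) = 0)
     \<and> distr (gam P) borel fst = \<alpha> \<and> distr (gam P) borel snd = \<beta>
     \<and> (\<forall>\<Phi>\<in>borel_measurable borel. bounded (range \<Phi>) \<longrightarrow> (\<integral>z. \<Phi> (fst z) \<bullet> vdens P z \<partial>gam P) = (\<integral>x. \<Phi> x \<bullet> x \<partial>\<alpha>))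
     \<and> (\<forall>\<Psi>\<in>borel_measurable borel. bounded (range \<Psi>) \<longrightarrow> (\<integral>z. \<Psi> (snd z) \<bullet> vdens P z \<partial>gam P) = (\<integral>y. \<Psi> y \<bullet> y \<partial>\<beta>))"
    (is "_ \<longleftrightarrow> ?R")
proof (cases "P \<in> VM \<and> (AE z in fst P. 0 \<le> fst (snd P z)) \<and> (AE z in fst P. fst (snd P z) = 0 \<longrightarrow> snd (snd P z) = 0)")
  case False
  moreover have "P \<in> VM \<and> (AE z in fst P. 0 \<le> fst (snd P z)) \<and> (AE z in fst P. fst (snd P z) = 0 \<longrightarrow> snd (snd P z) = 0)"
    if "P \<in> GammaQ \<alpha> \<beta>"
  proof -
    have 1: "P \<in> VM" "AE z in fst P. 0 \<le> fst (snd P z)" "abs_cont P"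
      using that by (auto simp: GammaQ_def GammaSet_def)
    then interpret nonneg_vmeas P by unfold_locales
    show ?thesis using 1 abs_cont_iff by blast
  qed
  ultimately show ?thesis by blast
next
  case True
  then have VM: "P \<in> VM" and nn: "AE z in fst P. 0 \<le> fst (snd P z)"
    and ac: "AE z in fst P. fst (snd P z) = 0 \<longrightarrow> snd (snd P z) = 0" by auto
  interpret nonneg_vmeas P using VM nn by unfold_locales
  interpret A: prob_space \<alpha> by fact
  interpret B: prob_space \<beta> by fact
  have spG: "space (gam P) = UNIV" using sets_eq_imp_space_eq[OF sets_gam[OF VM]] by simp
  have fm: "(fst :: 'a \<times> 'a \<Rightarrow> 'a) \<in> borel_measurable (gam P)" "(snd :: 'a \<times> 'a \<Rightarrow> 'a) \<in> borel_measurable (gam P)"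
    by (auto intro!: borelG borel_measurable_continuous_onI continuous_intros)
  have prod_sets: "A \<times> UNIV \<in> sets (borel :: ('a \<times> 'a) measure)" "UNIV \<times> A \<in> sets (borel :: ('a \<times> 'a) measure)"
    if "A \<in> sets borel" for A :: "'a set"
    using that by (auto simp: borel_prod[symmetric])
  have v: "fst -` A = A \<times> UNIV" "snd -` A = UNIV \<times> A" for A :: "'a set" by auto
  have m1: "(\<forall>A \<in> sets borel. gam_set P (A \<times> UNIV) = measure \<alpha> A) \<longleftrightarrow> distr (gam P) borel fst = \<alpha>"
  proof
    assume a: "\<forall>A \<in> sets borel. gam_set P (A \<times> UNIV) = measure \<alpha> A"
    show "distr (gam P) borel fst = \<alpha>"
      by (rule measure_eqI) (use a \<alpha> fm spG in \<open>auto simp: emeasure_distr v emeasure_gam prod_sets A.emeasure_eq_measure\<close>)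
  next
    assume "distr (gam P) borel fst = \<alpha>"
    then show "\<forall>A \<in> sets borel. gam_set P (A \<times> UNIV) = measure \<alpha> A"
      using fm spG by (auto simp: measure_distr v measure_gam[symmetric] prod_sets)
  qed
  have m2: "(\<forall>A \<in> sets borel. gam_set P (UNIV \<times> A) = measure \<beta> A) \<longleftrightarrow> distr (gam P) borel snd = \<beta>"
  proof
    assume a: "\<forall>A \<in> sets borel. gam_set P (UNIV \<times> A) = measure \<beta> A"
    show "distr (gam P) borel snd = \<beta>"
      by (rule measure_eqI) (use a \<beta> fm spG in \<open>auto simp: emeasure_distr v emeasure_gam prod_sets B.emeasure_eq_measure\<close>)
  next
    assume "distr (gam P) borel snd = \<beta>"
    then show "\<forall>A \<in> sets borel. gam_set P (UNIV \<times> A) = measure \<beta> A"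
      using fm spG by (auto simp: measure_distr v measure_gam[symmetric] prod_sets)
  qed
  have q1: "(\<integral>z. \<Phi> (fst z) \<bullet> snd (snd P z) \<partial>fst P) = (\<integral>z. \<Phi> (fst z) \<bullet> vdens P z \<partial>gam P)"
      "(\<integral>z. \<Phi> (snd z) \<bullet> snd (snd P z) \<partial>fst P) = (\<integral>z. \<Phi> (snd z) \<bullet> vdens P z \<partial>gam P)"
    if "\<Phi> \<in> borel_measurable borel" for \<Phi> :: "'a \<Rightarrow> 'a"
  proof -
    have m: "(\<lambda>z. \<Phi> (fst z)) \<in> borel_measurable borel" "(\<lambda>z. \<Phi> (snd z)) \<in> borel_measurable borel"
      by (rule measurable_compose[OF _ that], intro borel_measurable_continuous_onI continuous_intros)+
    show "(\<integral>z. \<Phi> (fst z) \<bullet> snd (snd P z) \<partial>fst P) = (\<integral>z. \<Phi> (fst z) \<bullet> vdens P z \<partial>gam P)"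
      by (rule integral_inner_vdens[OF ac m(1), symmetric])
    show "(\<integral>z. \<Phi> (snd z) \<bullet> snd (snd P z) \<partial>fst P) = (\<integral>z. \<Phi> (snd z) \<bullet> vdens P z \<partial>gam P)"
      by (rule integral_inner_vdens[OF ac m(2), symmetric])
  qed
  show ?thesis
  proof
    assume P: "P \<in> GammaQ \<alpha> \<beta>"
    show ?R using True P m1 m2 q1 by (auto simp: GammaQ_def GammaSet_def QSet_def)
  next
    assume R: ?R
    have u: "gam_set P UNIV = 1"
      using R m1 A.prob_space sets_eq_imp_space_eq[OF \<alpha>(2)] by (metis UNIV_Times_UNIV sets.top space_borel)
    have "AE x in distr (gam P) borel fst. x \<in> supp \<alpha>" "AE x in distr (gam P) borel snd. x \<in> supp \<beta>"
      using R AE_supp[OF \<alpha>(2)] AE_supp[OF \<beta>(2)] by auto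
    then have "AE z in gam P. fst z \<in> supp \<alpha>" "AE z in gam P. snd z \<in> supp \<beta>"
      using AE_distrD[OF fm(1)] AE_distrD[OF fm(2)] by auto
    then have "AE z in fst P. 0 < fst (snd P z) \<longrightarrow> z \<in> supp \<alpha> \<times> supp \<beta>"
      unfolding AE_gam by eventually_elim (auto simp: mem_Times_iff)
    then have s: "AE z in fst P. z \<notin> supp \<alpha> \<times> supp \<beta> \<longrightarrow> fst (snd P z) = 0 \<and> snd (snd P z) = 0"
      using nn ac by eventually_elim auto
    then have "AE z in fst P. z \<notin> supp \<alpha> \<times> supp \<beta> \<longrightarrow> fst (snd P z) = 0"
        "AE z in fst P. z \<notin> supp \<alpha> \<times> supp \<beta> \<longrightarrow> snd (snd P z) = 0"
      by (auto elim: eventually_mono)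
    then show "P \<in> GammaQ \<alpha> \<beta>"
      using R m1 m2 q1 u abs_cont_iff by (auto simp: GammaQ_def GammaSet_def QSet_def)
  qed
qed

text \<open>Converse of \<open>dual_energy_bound\<close>, from |v - f/2|^2 \<ge> 0. When only the
  first two conclusions are wanted, f = 0 is substituted.\<close>

lemma (in nonneg_vmeas) dual_le_energy:
  assumes ac: "AE z in fst P. fst (snd P z) = 0 \<longrightarrow> snd (snd P z) = 0"
    and L: "energy P \<le> ennreal L" "0 \<le> L"
    and f: "f \<in> borel_measurable borel" "bounded (range f)"
  shows "integrable (gam P) (\<lambda>z. (norm (vdens P z))\<^sup>2)"
    and "(\<integral>z. (norm (vdens P z))\<^sup>2 \<partial>gam P) \<le> L"
    and "(\<integral>z. f z \<bullet> snd (snd P z) - (norm (f z))\<^sup>2 / 4 * fst (snd P z) \<partial>fst P) \<le> L"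
proof -
  interpret G: finite_measure "gam P" by (rule finite_gam)
  note [measurable] = f(1) vdens_borel[OF VM] VM_D(5,6)[OF VM]
  have vm: "(\<lambda>z. (norm (vdens P z))\<^sup>2) \<in> borel_measurable borel" by measurable
  have le: "(\<integral>\<^sup>+z. ennreal ((norm (vdens P z))\<^sup>2) \<partial>gam P) \<le> ennreal L"
    using L(1) by (simp add: energy_vdens[OF ac])
  show i: "integrable (gam P) (\<lambda>z. (norm (vdens P z))\<^sup>2)"
    using le borelG[OF vm] by (intro integrableI_bounded) (auto simp: top.not_eq_extremum[symmetric] top_unique)
  have "ennreal (\<integral>z. (norm (vdens P z))\<^sup>2 \<partial>gam P) \<le> ennreal L"
    using le nn_integral_eq_integral[OF i] by simp
  then show vL: "(\<integral>z. (norm (vdens P z))\<^sup>2 \<partial>gam P) \<le> L"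
    using L(2) by (simp add: ennreal_le_iff)
  obtain C where C: "\<And>z. norm (f z) \<le> C" using f(2) by (auto simp: bounded_iff)
  have iv: "integrable (gam P) (\<lambda>z. f z \<bullet> vdens P z)"
  proof (rule Bochner_Integration.integrable_bound)
    show "integrable (gam P) (\<lambda>z. C * norm (vdens P z))"
      using integrable_vdens[OF ac] by auto
    show "(\<lambda>z. f z \<bullet> vdens P z) \<in> borel_measurable (gam P)" by (rule borelG) measurable
    show "AE z in gam P. norm (f z \<bullet> vdens P z) \<le> norm (C * norm (vdens P z))"
    proof (rule AE_I2)
      fix z
      have "norm (f z \<bullet> vdens P z) \<le> norm (f z) * norm (vdens P z)" by (simp add: Cauchy_Schwarz_ineq2)
      also have "\<dots> \<le> C * norm (vdens P z)" using C by (intro mult_right_mono) auto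
      finally show "norm (f z \<bullet> vdens P z) \<le> norm (C * norm (vdens P z))" by simp
    qed
  qed
  have inf: "integrable (gam P) (\<lambda>z. (norm (f z))\<^sup>2 / 4)"
  proof (rule G.integrable_const_bound[where B="C\<^sup>2 / 4"])
    show "(\<lambda>z. (norm (f z))\<^sup>2 / 4) \<in> borel_measurable (gam P)" by (rule borelG) measurable
    show "AE z in gam P. norm ((norm (f z))\<^sup>2 / 4) \<le> C\<^sup>2 / 4"
      using C by (auto intro!: AE_I2 divide_right_mono power_mono)
  qed
  have "(\<integral>z. f z \<bullet> snd (snd P z) - (norm (f z))\<^sup>2 / 4 * fst (snd P z) \<partial>fst P)
      = (\<integral>z. fst (snd P z) *\<^sub>R (f z \<bullet> vdens P z - (norm (f z))\<^sup>2 / 4) \<partial>fst P)"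
  proof (rule integral_cong_AE)
    show "AE z in fst P. f z \<bullet> snd (snd P z) - (norm (f z))\<^sup>2 / 4 * fst (snd P z)
        = fst (snd P z) *\<^sub>R (f z \<bullet> vdens P z - (norm (f z))\<^sup>2 / 4)"
      using AE_vdens[OF ac] by eventually_elim (simp add: right_diff_distrib inner_scaleR_right[symmetric] mult.commute)
    show "(\<lambda>z. f z \<bullet> snd (snd P z) - (norm (f z))\<^sup>2 / 4 * fst (snd P z)) \<in> borel_measurable (fst P)"
      by (rule borelM) measurable
    show "(\<lambda>z. fst (snd P z) *\<^sub>R (f z \<bullet> vdens P z - (norm (f z))\<^sup>2 / 4)) \<in> borel_measurable (fst P)"
      by (rule borelM) measurable
  qed
  also have "\<dots> = (\<integral>z. f z \<bullet> vdens P z - (norm (f z))\<^sup>2 / 4 \<partial>gam P)"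
    by (rule integral_gam[symmetric]) measurable
  also have "\<dots> \<le> (\<integral>z. (norm (vdens P z))\<^sup>2 \<partial>gam P)"
  proof (rule integral_mono)
    show "f z \<bullet> vdens P z - (norm (f z))\<^sup>2 / 4 \<le> (norm (vdens P z))\<^sup>2" for z
    proof -
      have "0 \<le> (norm (vdens P z - (1/2) *\<^sub>R f z))\<^sup>2" by simp
      then show ?thesis by (simp add: power2_norm_eq_inner inner_diff_left inner_diff_right inner_commute)
    qed
  qed (use i iv inf in auto)
  finally show "(\<integral>z. f z \<bullet> snd (snd P z) - (norm (f z))\<^sup>2 / 4 * fst (snd P z) \<partial>fst P) \<le> L"
    using vL by simp
qed

section \<open>Stability of admissible pairs under weak convergence\<close>

lemma vm_weak_convD:
  assumes "vm_weak_conv Ps P" "continuous_on UNIV g" "bounded (range g)" "continuous_on UNIV f" "bounded (range f)"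
  shows "(\<lambda>n. \<integral>z. g z * fst (snd (Ps n) z) + f z \<bullet> snd (snd (Ps n) z) \<partial>fst (Ps n))
     \<longlonglongrightarrow> (\<integral>z. g z * fst (snd P z) + f z \<bullet> snd (snd P z) \<partial>fst P)"
proof -
  have "continuous_on UNIV (\<lambda>z. (g z, f z))" using assms by (intro continuous_intros)
  moreover have "bounded (range (\<lambda>z. (g z, f z)))"
  proof -
    have "range (\<lambda>z. (g z, f z)) \<subseteq> range g \<times> range f" by auto
    then show ?thesis using assms bounded_Times bounded_subset by blast
  qed
  ultimately show ?thesis
    using assms(1)[unfolded vm_weak_conv_def, rule_format, of "\<lambda>z. (g z, f z)"]
    by (simp add: inner_prod_def)
qed

text \<open>\<open>pr\<close> is either coordinate. The constraint is required for bounded Borel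
  fields, while weak limits reach only continuous ones. So the marginal is identified first;
  continuous fields that converge \<alpha>-a.e. then also converge a.e. for \<open>gam P\<close>,
  and dominated convergence carries the constraint over.\<close>

lemma marginal_constraint_limit:
  fixes pr :: "'a::euclidean_space \<times> 'a \<Rightarrow> 'a" and \<alpha> :: "'a measure"
  assumes pr: "continuous_on UNIV pr"
    and Ps: "\<And>n. nonneg_vmeas (Ps n)"
    and acs: "\<And>n. AE z in fst (Ps n). fst (snd (Ps n) z) = 0 \<longrightarrow> snd (snd (Ps n) z) = 0"
    and ms: "\<And>n. distr (gam (Ps n)) borel pr = \<alpha>s n"
    and qs: "\<And>n \<Phi>. \<Phi> \<in> borel_measurable borel \<Longrightarrow> bounded (range \<Phi>) \<Longrightarrow> (\<integral>z. \<Phi> (pr z) \<bullet> vdens (Ps n) z \<partial>gam (Ps n)) = (\<integral>x. \<Phi> x \<bullet> x \<partial>\<alpha>s n)"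
    and P: "nonneg_vmeas P"
    and ac: "AE z in fst P. fst (snd P z) = 0 \<longrightarrow> snd (snd P z) = 0"
    and conv: "vm_weak_conv Ps P"
    and \<alpha>: "\<alpha> \<in> P2"
    and lim1: "\<And>\<phi>::'a \<Rightarrow> real. continuous_on UNIV \<phi> \<Longrightarrow> bounded (range \<phi>) \<Longrightarrow> (\<lambda>n. \<integral>x. \<phi> x \<partial>\<alpha>s n) \<longlonglongrightarrow> (\<integral>x. \<phi> x \<partial>\<alpha>)"
    and lim2: "\<And>\<Phi>::'a \<Rightarrow> 'a. continuous_on UNIV \<Phi> \<Longrightarrow> bounded (range \<Phi>) \<Longrightarrow> (\<lambda>n. \<integral>x. \<Phi> x \<bullet> x \<partial>\<alpha>s n) \<longlonglongrightarrow> (\<integral>x. \<Phi> x \<bullet> x \<partial>\<alpha>)"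
  shows "distr (gam P) borel pr = \<alpha>"
    and "\<And>\<Phi>. \<Phi> \<in> borel_measurable borel \<Longrightarrow> bounded (range \<Phi>) \<Longrightarrow> (\<integral>z. \<Phi> (pr z) \<bullet> vdens P z \<partial>gam P) = (\<integral>x. \<Phi> x \<bullet> x \<partial>\<alpha>)"
proof -
  interpret P: nonneg_vmeas P by fact
  interpret A: prob_space \<alpha> using P2_D[OF \<alpha>] by simp
  have prm: "pr \<in> borel_measurable borel" using pr by (rule borel_measurable_continuous_onI)
  have cpr: "continuous_on UNIV (\<lambda>z. g (pr z))" "bounded (range (\<lambda>z. g (pr z)))"
    if "continuous_on UNIV g" "bounded (range g)" for g :: "'a \<Rightarrow> 'b::euclidean_space"
  proof -
    show "continuous_on UNIV (\<lambda>z. g (pr z))" using continuous_on_compose2[OF that(1) pr] by simp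
    show "bounded (range (\<lambda>z. g (pr z)))" using that(2) by (rule bounded_subset) auto
  qed
  show m: "distr (gam P) borel pr = \<alpha>"
  proof (rule finite_measure_eqI_continuous)
    show "finite_measure (distr (gam P) borel pr)"
      by (rule finite_measure.finite_measure_distr[OF P.finite_gam P.borelG[OF prm]])
    fix \<phi> :: "'a \<Rightarrow> real" assume \<phi>: "continuous_on UNIV \<phi>" "bounded (range \<phi>)"
    have \<phi>m: "\<phi> \<in> borel_measurable borel" using \<phi>(1) by (rule borel_measurable_continuous_onI)
    have eq: "(\<integral>z. \<phi> (pr z) * fst (snd Q z) + (0::'a) \<bullet> snd (snd Q z) \<partial>fst Q) = (\<integral>x. \<phi> x \<partial>distr (gam Q) borel pr)"
      if "nonneg_vmeas Q" for Q
    proof -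
      interpret Q: nonneg_vmeas Q by fact
      show ?thesis
        using Q.integral_gam[OF measurable_compose[OF prm \<phi>m]] integral_distr[OF Q.borelG[OF prm] \<phi>m]
        by (simp add: mult.commute)
    qed
    have "(\<lambda>n. \<integral>x. \<phi> x \<partial>\<alpha>s n) \<longlonglongrightarrow> (\<integral>x. \<phi> x \<partial>distr (gam P) borel pr)"
      using vm_weak_convD[OF conv cpr[OF \<phi>] continuous_on_const, of 0]
      unfolding eq[OF P] eq[OF Ps] ms by simp
    then show "(\<integral>x. \<phi> x \<partial>distr (gam P) borel pr) = (\<integral>x. \<phi> x \<partial>\<alpha>)"
      using lim1[OF \<phi>] LIMSEQ_unique by blast
  qed (use P2_D[OF \<alpha>] A.finite_measure_axioms in auto)
  have qc: "(\<integral>z. \<Phi> (pr z) \<bullet> vdens P z \<partial>gam P) = (\<integral>x. \<Phi> x \<bullet> x \<partial>\<alpha>)"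
    if \<Phi>: "continuous_on UNIV \<Phi>" "bounded (range \<Phi>)" for \<Phi>
  proof -
    have \<Phi>m: "\<Phi> \<in> borel_measurable borel" using \<Phi>(1) by (rule borel_measurable_continuous_onI)
    have "(\<lambda>n. \<integral>z. \<Phi> (pr z) \<bullet> snd (snd (Ps n) z) \<partial>fst (Ps n)) \<longlonglongrightarrow> (\<integral>z. \<Phi> (pr z) \<bullet> snd (snd P z) \<partial>fst P)"
      using vm_weak_convD[OF conv continuous_on_const _ cpr[OF \<Phi>], of 0] by simp
    then have "(\<lambda>n. \<integral>x. \<Phi> x \<bullet> x \<partial>\<alpha>s n) \<longlonglongrightarrow> (\<integral>z. \<Phi> (pr z) \<bullet> vdens P z \<partial>gam P)"
      by (simp add: nonneg_vmeas.integral_inner_vdens[OF Ps acs measurable_compose[OF prm \<Phi>m], symmetric]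
          P.integral_inner_vdens[OF ac measurable_compose[OF prm \<Phi>m], symmetric] qs[OF \<Phi>m \<Phi>(2)])
    then show ?thesis using lim2[OF \<Phi>] LIMSEQ_unique by blast
  qed
  fix \<Phi> :: "'a \<Rightarrow> 'a" assume \<Phi>: "\<Phi> \<in> borel_measurable borel" "bounded (range \<Phi>)"
  obtain C where C: "\<And>x. norm (\<Phi> x) \<le> C" using \<Phi>(2) by (auto simp: bounded_iff)
  obtain g where g: "\<And>n::nat. continuous_on UNIV (g n)" "\<And>n x. norm (g n x) \<le> C"
    "AE x in \<alpha>. (\<lambda>n. g n x) \<longlonglongrightarrow> \<Phi> x"
    using bounded_borel_continuous_approx[OF A.finite_measure_axioms P2_D(2)[OF \<alpha>] \<Phi>(1) C] by blast
  have gb: "bounded (range (g n))" for n using g(2) by (auto simp: bounded_iff)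
  have gm: "g n \<in> borel_measurable borel" for n using g(1) by (rule borel_measurable_continuous_onI)
  have dom: "norm (u \<bullet> v) \<le> C * norm v" if "norm u \<le> C" for u v :: 'a
    using Cauchy_Schwarz_ineq2[of u v] mult_right_mono[OF that norm_ge_zero[of v]] by simp
  have "(\<lambda>n. \<integral>x. g n x \<bullet> x \<partial>\<alpha>) \<longlonglongrightarrow> (\<integral>x. \<Phi> x \<bullet> x \<partial>\<alpha>)"
  proof (rule integral_dominated_convergence[where w="\<lambda>x. C * norm x"])
    show "integrable \<alpha> (\<lambda>x. C * norm x)" using P2_integrable_id[OF \<alpha>] by auto
    show "AE x in \<alpha>. (\<lambda>n. g n x \<bullet> x) \<longlonglongrightarrow> \<Phi> x \<bullet> x"
      using g(3) by eventually_elim (intro tendsto_intros)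
    show "AE x in \<alpha>. norm (g n x \<bullet> x) \<le> C * norm x" for n using dom[OF g(2)] by auto
  qed (use \<Phi> gm P2_D(2)[OF \<alpha>] in \<open>auto intro!: borel_measurable_sets_borel[of \<alpha>]\<close>)
  moreover have "(\<lambda>n. \<integral>z. g n (pr z) \<bullet> vdens P z \<partial>gam P) \<longlonglongrightarrow> (\<integral>z. \<Phi> (pr z) \<bullet> vdens P z \<partial>gam P)"
  proof (rule integral_dominated_convergence[where w="\<lambda>z. C * norm (vdens P z)"])
    show "integrable (gam P) (\<lambda>z. C * norm (vdens P z))" using P.integrable_vdens[OF ac] by auto
    \<comment> \<open>Here the marginal identity \<open>m\<close> is used to transport convergence
      outside an \<alpha>-null set to the plan.\<close>
    have "AE x in distr (gam P) borel pr. (\<lambda>n. g n x) \<longlonglongrightarrow> \<Phi> x" unfolding m by (rule g(3))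
    then have "AE z in gam P. (\<lambda>n. g n (pr z)) \<longlonglongrightarrow> \<Phi> (pr z)"
      by (rule AE_distrD[OF P.borelG[OF prm]])
    then show "AE z in gam P. (\<lambda>n. g n (pr z) \<bullet> vdens P z) \<longlonglongrightarrow> \<Phi> (pr z) \<bullet> vdens P z"
      by eventually_elim (intro tendsto_intros)
    show "AE z in gam P. norm (g n (pr z) \<bullet> vdens P z) \<le> C * norm (vdens P z)" for n using dom[OF g(2)] by auto
  qed (auto intro!: P.borelG borel_measurable_inner vdens_borel P.VM measurable_compose[OF prm] gm \<Phi>)
  ultimately show "(\<integral>z. \<Phi> (pr z) \<bullet> vdens P z \<partial>gam P) = (\<integral>x. \<Phi> x \<bullet> x \<partial>\<alpha>)"
    using LIMSEQ_unique by (simp add: qc[OF g(1) gb])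
qed

lemma GammaQ_nonneg_vmeas: "P \<in> GammaQ \<alpha> \<beta> \<Longrightarrow> nonneg_vmeas P"
  by unfold_locales (auto simp: GammaQ_def GammaSet_def)

text \<open>Admissible pairs are closed only under an energy bound: without it q could lose absolute
  continuity in the limit. The bound passes to the limit as the supremum of continuous functionals
  in \<open>dual_energy_bound\<close>.\<close>

lemma GammaQ_closed:
  fixes \<alpha> \<beta> :: "'a::euclidean_space measure"
  assumes Ps: "\<And>n. Ps n \<in> GammaQ (\<alpha>s n) (\<beta>s n)" and P: "P \<in> VM" and conv: "vm_weak_conv Ps P"
    and \<alpha>s: "\<And>n. \<alpha>s n \<in> P2" and \<beta>s: "\<And>n. \<beta>s n \<in> P2" and \<alpha>: "\<alpha> \<in> P2" and \<beta>: "\<beta> \<in> P2"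
    and lim\<alpha>: "\<And>\<phi>::'a \<Rightarrow> real. continuous_on UNIV \<phi> \<Longrightarrow> bounded (range \<phi>) \<Longrightarrow> (\<lambda>n. \<integral>x. \<phi> x \<partial>\<alpha>s n) \<longlonglongrightarrow> (\<integral>x. \<phi> x \<partial>\<alpha>)"
      "\<And>\<Phi>::'a \<Rightarrow> 'a. continuous_on UNIV \<Phi> \<Longrightarrow> bounded (range \<Phi>) \<Longrightarrow> (\<lambda>n. \<integral>x. \<Phi> x \<bullet> x \<partial>\<alpha>s n) \<longlonglongrightarrow> (\<integral>x. \<Phi> x \<bullet> x \<partial>\<alpha>)"
    and lim\<beta>: "\<And>\<phi>::'a \<Rightarrow> real. continuous_on UNIV \<phi> \<Longrightarrow> bounded (range \<phi>) \<Longrightarrow> (\<lambda>n. \<integral>x. \<phi> x \<partial>\<beta>s n) \<longlonglongrightarrow> (\<integral>x. \<phi> x \<partial>\<beta>)"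
      "\<And>\<Phi>::'a \<Rightarrow> 'a. continuous_on UNIV \<Phi> \<Longrightarrow> bounded (range \<Phi>) \<Longrightarrow> (\<lambda>n. \<integral>x. \<Phi> x \<bullet> x \<partial>\<beta>s n) \<longlonglongrightarrow> (\<integral>x. \<Phi> x \<bullet> x \<partial>\<beta>)"
    and en: "\<And>n. energy (Ps n) \<le> ennreal (L n)" "\<And>n. 0 \<le> L n" and L: "L \<longlonglongrightarrow> L'"
  shows "P \<in> GammaQ \<alpha> \<beta>" "energy P \<le> ennreal L'"
proof -
  have D: "nonneg_vmeas (Ps n)" "AE z in fst (Ps n). fst (snd (Ps n) z) = 0 \<longrightarrow> snd (snd (Ps n) z) = 0"
     "distr (gam (Ps n)) borel fst = \<alpha>s n" "distr (gam (Ps n)) borel snd = \<beta>s n"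
     "\<And>\<Phi>. \<Phi> \<in> borel_measurable borel \<Longrightarrow> bounded (range \<Phi>) \<Longrightarrow> (\<integral>z. \<Phi> (fst z) \<bullet> vdens (Ps n) z \<partial>gam (Ps n)) = (\<integral>x. \<Phi> x \<bullet> x \<partial>\<alpha>s n)"
     "\<And>\<Phi>. \<Phi> \<in> borel_measurable borel \<Longrightarrow> bounded (range \<Phi>) \<Longrightarrow> (\<integral>z. \<Phi> (snd z) \<bullet> vdens (Ps n) z \<partial>gam (Ps n)) = (\<integral>x. \<Phi> x \<bullet> x \<partial>\<beta>s n)" for n
    using Ps[of n] GammaQ_nonneg_vmeas[OF Ps[of n]]
    unfolding GammaQ_iff[OF P2_D(1,2)[OF \<alpha>s[of n]] P2_D(1,2)[OF \<beta>s[of n]]] by blast+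
  note VMs = nonneg_vmeas.VM[OF D(1)]
  note fP = VM_D[OF P]
  have dom: "norm (r * x) \<le> C * norm x" if "norm r \<le> C" for r x C :: real
    using mult_right_mono[OF that norm_ge_zero[of x]] by (simp add: abs_mult)
  have nn: "AE z in fst P. 0 \<le> fst (snd P z)"
  proof -
    \<comment> \<open>Nonnegative continuous approximations of the indicator of S have nonnegative
      integrals along the sequence, hence in the limit. As the density is negative on S, S must be
      null.\<close>
    define S where "S = {z. fst (snd P z) < 0}"
    have S: "S \<in> sets borel" unfolding S_def
      using measurable_sets_borel[OF fP(5), of "{..<0}"] by (simp add: vimage_def)
    obtain g where g: "\<And>n::nat. continuous_on UNIV (g n)" "\<And>n x. norm (g n x) \<le> 1"
      "AE x in fst P. (\<lambda>n. g n x) \<longlonglongrightarrow> indicat_real S x"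
      using bounded_borel_continuous_approx[OF fP(1,2), of "indicat_real S" 1] S by (auto simp: indicator_def)
    have "0 \<le> (\<integral>z. max 0 (g k z) * fst (snd P z) \<partial>fst P)" for k
    proof (rule LIMSEQ_le_const)
      have "bounded (range (\<lambda>z. max 0 (g k z)))"
        by (rule boundedI[of _ 1]) (use g(2)[of k] in \<open>auto simp: abs_le_iff\<close>)
      then show "(\<lambda>n. \<integral>z. max 0 (g k z) * fst (snd (Ps n) z) \<partial>fst (Ps n)) \<longlonglongrightarrow> (\<integral>z. max 0 (g k z) * fst (snd P z) \<partial>fst P)"
        using vm_weak_convD[OF conv _ _ continuous_on_const, of "\<lambda>z. max 0 (g k z)" 0] g(1)
        by (simp add: continuous_on_max)
      have "0 \<le> (\<integral>z. max 0 (g k z) * fst (snd (Ps n) z) \<partial>fst (Ps n))" for n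
        by (rule integral_nonneg_AE) (use nonneg_vmeas.nonneg[OF D(1)[of n]] in \<open>eventually_elim, auto\<close>)
      then show "\<exists>N. \<forall>n\<ge>N. 0 \<le> (\<integral>z. max 0 (g k z) * fst (snd (Ps n) z) \<partial>fst (Ps n))" by blast
    qed
    moreover have "(\<lambda>k. \<integral>z. max 0 (g k z) * fst (snd P z) \<partial>fst P) \<longlonglongrightarrow> (\<integral>z. indicator S z * fst (snd P z) \<partial>fst P)"
    proof (rule integral_dominated_convergence[where w="\<lambda>z. 1 * norm (fst (snd P z))"])
      show "integrable (fst P) (\<lambda>z. 1 * norm (fst (snd P z)))" using fP(7) by simp
      show "AE z in fst P. (\<lambda>k. max 0 (g k z) * fst (snd P z)) \<longlonglongrightarrow> indicator S z * fst (snd P z)"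
        using g(3)
      proof eventually_elim
        case (elim z)
        have "(\<lambda>k. max 0 (g k z)) \<longlonglongrightarrow> max 0 (indicator S z)" by (intro tendsto_intros elim)
        then show ?case by (intro tendsto_intros) (simp add: max_def indicator_def split: if_splits)
      qed
      show "AE z in fst P. norm (max 0 (g k z) * fst (snd P z)) \<le> 1 * norm (fst (snd P z))" for k
        using g(2)[of k] by (intro AE_I2 dom) (auto simp: abs_le_iff)
      show "(\<lambda>z. indicator S z * fst (snd P z)) \<in> borel_measurable (fst P)"
        using S fP(5) by (intro borel_measurable_sets_borel[OF fP(2)]) auto
      show "(\<lambda>z. max 0 (g k z) * fst (snd P z)) \<in> borel_measurable (fst P)" for k
        using borel_measurable_continuous_onI[OF g(1)[of k]] fP(5) by (intro borel_measurable_sets_borel[OF fP(2)]) auto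
    qed
    ultimately have "0 \<le> (\<integral>z. indicator S z * fst (snd P z) \<partial>fst P)"
      by (intro LIMSEQ_le_const) auto
    moreover have iS: "integrable (fst P) (\<lambda>z. - (indicator S z * fst (snd P z)))"
      using integrable_mult_indicator[OF _ fP(7), of S] S fP(2) by auto
    moreover have "0 \<le> (\<integral>z. - (indicator S z * fst (snd P z)) \<partial>fst P)"
      by (rule integral_nonneg_AE) (auto simp: S_def indicator_def)
    ultimately have "(\<integral>z. - (indicator S z * fst (snd P z)) \<partial>fst P) = 0" by simp
    then have "AE z in fst P. - (indicator S z * fst (snd P z)) = 0"
      using iS by (subst (asm) integral_nonneg_eq_0_iff_AE) (auto simp: S_def indicator_def)
    then show ?thesis by eventually_elim (auto simp: S_def indicator_def split: if_splits)
  qed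
  interpret P: nonneg_vmeas P using P nn by unfold_locales
  \<comment> \<open>For continuous f both sides pass to the weak limit; for bounded Borel f an a.e.
    approximation with the same bound and dominated convergence suffice.\<close>
  have dual: "(\<integral>z. f z \<bullet> snd (snd P z) - (norm (f z))\<^sup>2 / 4 * fst (snd P z) \<partial>fst P) \<le> L'"
    if f: "f \<in> borel_measurable borel" "bounded (range f)" for f
  proof -
    obtain C where C: "\<And>x. norm (f x) \<le> C" using f(2) by (auto simp: bounded_iff)
    obtain g where g: "\<And>n::nat. continuous_on UNIV (g n)" "\<And>n x. norm (g n x) \<le> C"
      "AE x in fst P. (\<lambda>n. g n x) \<longlonglongrightarrow> f x"
      using bounded_borel_continuous_approx[OF fP(1,2) f(1) C] by blast
    have gb: "bounded (range (g k))" for k using g(2) by (auto simp: bounded_iff)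
    have gm: "g k \<in> borel_measurable borel" for k using g(1) by (rule borel_measurable_continuous_onI)
    have "(\<integral>z. g k z \<bullet> snd (snd P z) - (norm (g k z))\<^sup>2 / 4 * fst (snd P z) \<partial>fst P) \<le> L'" for k
    proof (rule LIMSEQ_le)
      have "continuous_on UNIV (\<lambda>z. - ((norm (g k z))\<^sup>2 / 4))" using g(1) by (intro continuous_intros) auto
      moreover have "bounded (range (\<lambda>z. - ((norm (g k z))\<^sup>2 / 4)))"
      proof (rule boundedI[of _ "C\<^sup>2 / 4"], clarify)
        fix z1 z2
        show "norm (- ((norm (g k (z1, z2)))\<^sup>2 / 4)) \<le> C\<^sup>2 / 4"
          using power_mono[OF g(2)[of k "(z1, z2)"], of 2] by simp
      qed
      ultimately show "(\<lambda>n. \<integral>z. g k z \<bullet> snd (snd (Ps n) z) - (norm (g k z))\<^sup>2 / 4 * fst (snd (Ps n) z) \<partial>fst (Ps n)) \<longlonglongrightarrow>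
          (\<integral>z. g k z \<bullet> snd (snd P z) - (norm (g k z))\<^sup>2 / 4 * fst (snd P z) \<partial>fst P)"
        using vm_weak_convD[OF conv _ _ g(1)[of k] gb, of "\<lambda>z. - ((norm (g k z))\<^sup>2 / 4)"] by simp
      show "L \<longlonglongrightarrow> L'" by fact
      show "\<exists>N. \<forall>n\<ge>N. (\<integral>z. g k z \<bullet> snd (snd (Ps n) z) - (norm (g k z))\<^sup>2 / 4 * fst (snd (Ps n) z) \<partial>fst (Ps n)) \<le> L n"
        using nonneg_vmeas.dual_le_energy(3)[OF D(1,2) en gm gb] by blast
    qed
    moreover have "(\<lambda>k. \<integral>z. g k z \<bullet> snd (snd P z) - (norm (g k z))\<^sup>2 / 4 * fst (snd P z) \<partial>fst P)
       \<longlonglongrightarrow> (\<integral>z. f z \<bullet> snd (snd P z) - (norm (f z))\<^sup>2 / 4 * fst (snd P z) \<partial>fst P)"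
    proof (rule integral_dominated_convergence[where w="\<lambda>z. C * norm (snd (snd P z)) + C\<^sup>2 / 4 * norm (fst (snd P z))"])
      note [measurable] = f(1) gm fP(5,6)
      show "integrable (fst P) (\<lambda>z. C * norm (snd (snd P z)) + C\<^sup>2 / 4 * norm (fst (snd P z)))"
        using fP(7,8) by auto
      show "AE z in fst P. (\<lambda>k. g k z \<bullet> snd (snd P z) - (norm (g k z))\<^sup>2 / 4 * fst (snd P z)) \<longlonglongrightarrow> f z \<bullet> snd (snd P z) - (norm (f z))\<^sup>2 / 4 * fst (snd P z)"
        using g(3) by eventually_elim (intro tendsto_intros, auto)
      show "AE z in fst P. norm (g k z \<bullet> snd (snd P z) - (norm (g k z))\<^sup>2 / 4 * fst (snd P z)) \<le> C * norm (snd (snd P z)) + C\<^sup>2 / 4 * norm (fst (snd P z))" for k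
      proof (rule AE_I2)
        fix z
        have "norm (g k z \<bullet> snd (snd P z)) \<le> C * norm (snd (snd P z))"
          using Cauchy_Schwarz_ineq2[of "g k z" "snd (snd P z)"] mult_right_mono[OF g(2)[of k z] norm_ge_zero[of "snd (snd P z)"]] by simp
        moreover have "norm ((norm (g k z))\<^sup>2 / 4 * fst (snd P z)) \<le> C\<^sup>2 / 4 * norm (fst (snd P z))"
          using power_mono[OF g(2)[of k z], of 2] by (intro dom) simp
        ultimately show "norm (g k z \<bullet> snd (snd P z) - (norm (g k z))\<^sup>2 / 4 * fst (snd P z)) \<le> C * norm (snd (snd P z)) + C\<^sup>2 / 4 * norm (fst (snd P z))"
          using norm_triangle_ineq4 order_trans add_mono by meson
      qed
      show "(\<lambda>z. f z \<bullet> snd (snd P z) - (norm (f z))\<^sup>2 / 4 * fst (snd P z)) \<in> borel_measurable (fst P)"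
        by (rule P.borelM) measurable
      show "(\<lambda>z. g k z \<bullet> snd (snd P z) - (norm (g k z))\<^sup>2 / 4 * fst (snd P z)) \<in> borel_measurable (fst P)" for k
        by (rule P.borelM) measurable
    qed
    ultimately show ?thesis by (intro LIMSEQ_le_const2) auto
  qed
  note ac = P.dual_energy_bound(1)[OF dual] and E = P.dual_energy_bound(2)[OF dual]
  show "energy P \<le> ennreal L'" using E P.energy_vdens[OF ac] by simp
  note m1 = marginal_constraint_limit[OF continuous_on_fst[OF continuous_on_id] D(1,2,3,5) P.nonneg_vmeas_axioms ac conv \<alpha> lim\<alpha>]
  note m2 = marginal_constraint_limit[OF continuous_on_snd[OF continuous_on_id] D(1,2,4,6) P.nonneg_vmeas_axioms ac conv \<beta> lim\<beta>]
  show "P \<in> GammaQ \<alpha> \<beta>"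
    unfolding GammaQ_iff[OF P2_D(1,2)[OF \<alpha>] P2_D(1,2)[OF \<beta>]]
    using P nn ac m1 m2 by blast
qed

text \<open>h composed with T is the conditional expectation of \<kappa> given T. It is built on the
  target space, by Radon-Nikodym for the images of the positive and negative parts of \<kappa>, so
  that it is a Borel function of the value of T.\<close>

lemma pushforward_density:
  fixes \<kappa> :: "'w \<Rightarrow> real" and T :: "'w \<Rightarrow> 'b::euclidean_space"
  assumes N: "finite_measure N" and T: "T \<in> borel_measurable N" and \<kappa>: "integrable N \<kappa>"
  shows "\<exists>h. h \<in> borel_measurable borel \<and> integrable (distr N borel T) h \<and>
    (\<forall>\<phi>::'b \<Rightarrow> real. \<phi> \<in> borel_measurable borel \<longrightarrow> bounded (range \<phi>) \<longrightarrow>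
       (\<integral>z. \<phi> z * h z \<partial>distr N borel T) = (\<integral>w. \<phi> (T w) * \<kappa> w \<partial>N))"
proof -
  interpret N: finite_measure N by fact
  let ?D = "distr N borel T"
  interpret D: finite_measure ?D by (rule N.finite_measure_distr[OF T])
  have pos: "\<exists>h. h \<in> borel_measurable borel \<and> integrable ?D h \<and>
    (\<forall>\<phi>::'b \<Rightarrow> real. \<phi> \<in> borel_measurable borel \<longrightarrow> bounded (range \<phi>) \<longrightarrow>
       (\<integral>z. \<phi> z * h z \<partial>?D) = (\<integral>w. \<phi> (T w) * \<kappa> w \<partial>N))"
    if \<kappa>: "integrable N \<kappa>" and \<kappa>0: "\<And>w. 0 \<le> \<kappa> w" for \<kappa> :: "'w \<Rightarrow> real"
  proof -
    have \<kappa>m[measurable]: "\<kappa> \<in> borel_measurable N" using \<kappa> by auto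
    let ?M = "density N (\<lambda>w. ennreal (\<kappa> w))"
    let ?E = "distr ?M borel T"
    have TM: "T \<in> borel_measurable ?M" using T by simp
    have ac: "absolutely_continuous ?D ?E"
      unfolding absolutely_continuous_def
    proof
      fix A assume A: "A \<in> null_sets ?D"
      then have Ab: "A \<in> sets borel" by auto
      have "AE w in N. T w \<notin> A"
        using AE_not_in[OF A] T Ab by (subst (asm) AE_distr_iff) auto
      then have "AE w in ?M. T w \<notin> A" by (subst AE_density) (auto elim: eventually_mono)
      then have "AE z in ?E. z \<notin> A" using TM Ab by (subst AE_distr_iff) auto
      then show "A \<in> null_sets ?E" using Ab by (subst AE_iff_null_sets) auto
    qed
    obtain f where f: "f \<in> borel_measurable ?D" "density ?D f = ?E"
      using D.Radon_Nikodym[OF ac] by auto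
    have fm[measurable]: "f \<in> borel_measurable borel" using f(1) by simp
    have fin: "(\<integral>\<^sup>+z. f z \<partial>?D) \<noteq> \<infinity>"
    proof -
      have "(\<integral>\<^sup>+z. f z \<partial>?D) = emeasure (density ?D f) UNIV"
        by (subst emeasure_density) auto
      also have "\<dots> = (\<integral>\<^sup>+w. ennreal (\<kappa> w) \<partial>N)"
        unfolding f(2) using TM by (subst emeasure_distr) (auto simp: emeasure_density intro!: nn_integral_cong)
      also have "\<dots> < \<infinity>"
        using \<kappa> \<kappa>0 by (subst nn_integral_eq_integral) auto
      finally show ?thesis by simp
    qed
    have fAE: "AE z in ?D. f z \<noteq> \<infinity>" using fin by (intro nn_integral_PInf_AE) auto
    define h where "h z = enn2real (f z)" for z
    have hm[measurable]: "h \<in> borel_measurable borel" unfolding h_def[abs_def] by measurable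
    have dh: "density ?D (\<lambda>z. ennreal (h z)) = ?E"
      unfolding f(2)[symmetric]
      by (rule density_cong) (use fAE in \<open>auto simp: h_def less_top elim!: eventually_mono intro!: ennreal_enn2real\<close>)
    have hi: "integrable ?D h"
    proof (rule integrableI_bounded)
      have "(\<integral>\<^sup>+z. ennreal (norm (h z)) \<partial>?D) = (\<integral>\<^sup>+z. f z \<partial>?D)"
        by (rule nn_integral_cong_AE) (use fAE in \<open>auto simp: h_def less_top elim!: eventually_mono intro!: ennreal_enn2real\<close>)
      then show "(\<integral>\<^sup>+z. ennreal (norm (h z)) \<partial>?D) < \<infinity>" using fin by (simp add: top.not_eq_extremum)
    qed simp
    have "(\<integral>z. \<phi> z * h z \<partial>?D) = (\<integral>w. \<phi> (T w) * \<kappa> w \<partial>N)"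
      if \<phi>[measurable]: "\<phi> \<in> borel_measurable borel" for \<phi> :: "'b \<Rightarrow> real"
    proof -
      have "(\<integral>z. \<phi> z * h z \<partial>?D) = (\<integral>z. h z *\<^sub>R \<phi> z \<partial>?D)" by (simp add: mult.commute)
      also have "\<dots> = (\<integral>z. \<phi> z \<partial>density ?D (\<lambda>z. ennreal (h z)))"
        by (rule integral_density[symmetric]) (auto simp: h_def)
      also have "\<dots> = (\<integral>w. \<phi> (T w) \<partial>?M)" unfolding dh by (rule integral_distr[OF TM \<phi>])
      also have "\<dots> = (\<integral>w. \<kappa> w *\<^sub>R \<phi> (T w) \<partial>N)"
        using \<kappa>0 by (intro integral_density measurable_compose[OF T \<phi>] \<kappa>m) auto
      finally show ?thesis by (simp add: mult.commute)
    qed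
    then show ?thesis using hm hi by blast
  qed
  have \<kappa>m[measurable]: "\<kappa> \<in> borel_measurable N" using \<kappa> by auto
  have kp: "integrable N (\<lambda>w. max 0 (\<kappa> w))" and kn: "integrable N (\<lambda>w. max 0 (- \<kappa> w))"
    using \<kappa> by (auto intro!: integrable_max)
  obtain h1 where h1: "h1 \<in> borel_measurable borel" "integrable ?D h1"
      "\<And>\<phi>::'b \<Rightarrow> real. \<phi> \<in> borel_measurable borel \<Longrightarrow> bounded (range \<phi>) \<Longrightarrow>
       (\<integral>z. \<phi> z * h1 z \<partial>?D) = (\<integral>w. \<phi> (T w) * max 0 (\<kappa> w) \<partial>N)"
    using pos[OF kp] by auto
  obtain h2 where h2: "h2 \<in> borel_measurable borel" "integrable ?D h2"
      "\<And>\<phi>::'b \<Rightarrow> real. \<phi> \<in> borel_measurable borel \<Longrightarrow> bounded (range \<phi>) \<Longrightarrow>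
       (\<integral>z. \<phi> z * h2 z \<partial>?D) = (\<integral>w. \<phi> (T w) * max 0 (- \<kappa> w) \<partial>N)"
    using pos[OF kn] by auto
  show ?thesis
  proof (intro exI[of _ "\<lambda>z. h1 z - h2 z"] conjI allI impI)
    fix \<phi> :: "'b \<Rightarrow> real" assume \<phi>: "\<phi> \<in> borel_measurable borel" "bounded (range \<phi>)"
    obtain C where C: "\<And>z. norm (\<phi> z) \<le> C" using \<phi>(2) by (auto simp: bounded_iff)
    have i: "integrable M (\<lambda>w. \<phi> (S w) * k w)"
      if "integrable M k" "(\<lambda>w. \<phi> (S w)) \<in> borel_measurable M" for M :: "'x measure" and S and k :: "'x \<Rightarrow> real"
    proof (rule Bochner_Integration.integrable_bound)
      show "integrable M (\<lambda>w. C * k w)" using that by auto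
      show "AE w in M. norm (\<phi> (S w) * k w) \<le> norm (C * k w)"
      proof (rule AE_I2)
        fix w
        have "norm (\<phi> (S w)) * norm (k w) \<le> \<bar>C\<bar> * norm (k w)"
          using C[of "S w"] by (intro mult_right_mono) auto
        then show "norm (\<phi> (S w) * k w) \<le> norm (C * k w)" by (simp add: abs_mult)
      qed
    qed (use that in auto)
    have "(\<integral>z. \<phi> z * (h1 z - h2 z) \<partial>?D) = (\<integral>z. \<phi> z * h1 z \<partial>?D) - (\<integral>z. \<phi> z * h2 z \<partial>?D)"
      using i[OF h1(2), of "\<lambda>z. z"] i[OF h2(2), of "\<lambda>z. z"] \<phi>(1) by (simp add: right_diff_distrib)
    also have "\<dots> = (\<integral>w. \<phi> (T w) * max 0 (\<kappa> w) \<partial>N) - (\<integral>w. \<phi> (T w) * max 0 (- \<kappa> w) \<partial>N)"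
      using h1(3)[OF \<phi>] h2(3)[OF \<phi>] by simp
    also have "\<dots> = (\<integral>w. \<phi> (T w) * max 0 (\<kappa> w) - \<phi> (T w) * max 0 (- \<kappa> w) \<partial>N)"
      using i[OF kp, of T] i[OF kn, of T] measurable_compose[OF T \<phi>(1)] by simp
    also have "\<dots> = (\<integral>w. \<phi> (T w) * \<kappa> w \<partial>N)"
      by (intro Bochner_Integration.integral_cong) (auto simp: max_def)
    finally show "(\<integral>z. \<phi> z * (h1 z - h2 z) \<partial>?D) = (\<integral>w. \<phi> (T w) * \<kappa> w \<partial>N)" .
  qed (use h1 h2 in auto)
qed

lemma pushforward_vector_density:
  fixes K :: "'w \<Rightarrow> 'a::euclidean_space" and T :: "'w \<Rightarrow> 'b::euclidean_space"
  assumes N: "finite_measure N" and T: "T \<in> borel_measurable N" and K: "integrable N K"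
  obtains h where "h \<in> borel_measurable borel" "integrable (distr N borel T) h"
    "\<And>f::'b \<Rightarrow> 'a. f \<in> borel_measurable borel \<Longrightarrow> bounded (range f) \<Longrightarrow>
       (\<integral>z. f z \<bullet> h z \<partial>distr N borel T) = (\<integral>w. f (T w) \<bullet> K w \<partial>N)"
proof -
  let ?D = "distr N borel T"
  have Ki: "integrable N (\<lambda>w. K w \<bullet> i)" for i using K by auto
  have "\<exists>h. \<forall>i. h i \<in> borel_measurable borel \<and> integrable ?D (h i) \<and>
    (\<forall>\<phi>::'b \<Rightarrow> real. \<phi> \<in> borel_measurable borel \<longrightarrow> bounded (range \<phi>) \<longrightarrow>
       (\<integral>z. \<phi> z * h i z \<partial>?D) = (\<integral>w. \<phi> (T w) * (K w \<bullet> i) \<partial>N))"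
    using pushforward_density[OF N T Ki] by (intro choice allI)
  then obtain h where h: "\<And>i. h i \<in> borel_measurable borel" "\<And>i. integrable ?D (h i)"
    "\<And>i \<phi>. \<phi> \<in> borel_measurable borel \<Longrightarrow> bounded (range \<phi>) \<Longrightarrow>
       (\<integral>z. \<phi> z * h i z \<partial>?D) = (\<integral>w. \<phi> (T w) * (K w \<bullet> i) \<partial>N)"
    by blast
  show thesis
  proof (rule that[of "\<lambda>z. \<Sum>i\<in>Basis. h i z *\<^sub>R i"])
    show "(\<lambda>z. \<Sum>i\<in>Basis. h i z *\<^sub>R i) \<in> borel_measurable borel" using h(1) by measurable
    show "integrable ?D (\<lambda>z. \<Sum>i\<in>Basis. h i z *\<^sub>R i)" using h(2) by auto
    fix f :: "'b \<Rightarrow> 'a" assume f: "f \<in> borel_measurable borel" "bounded (range f)"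
    obtain C where C: "\<And>z. norm (f z) \<le> C" using f(2) by (auto simp: bounded_iff)
    have fi: "(\<lambda>z. f z \<bullet> i) \<in> borel_measurable borel" for i using f(1) by measurable
    have fb: "norm (f z \<bullet> i) \<le> C" if "i \<in> Basis" for z i
      using order_trans[OF Basis_le_norm[OF that] C] by simp
    have fib: "bounded (range (\<lambda>z. f z \<bullet> i))" if "i \<in> Basis" for i
      by (rule boundedI[of _ C]) (use fb[OF that] in auto)
    have i: "integrable M (\<lambda>w. (f (S w) \<bullet> i) * k w)"
      if "integrable M k" "(\<lambda>w. f (S w) \<bullet> i) \<in> borel_measurable M" "i \<in> Basis" for M :: "'x measure" and S and k :: "'x \<Rightarrow> real" and i
    proof (rule Bochner_Integration.integrable_bound)
      show "integrable M (\<lambda>w. C * k w)" using that by auto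
      show "AE w in M. norm ((f (S w) \<bullet> i) * k w) \<le> norm (C * k w)"
      proof (rule AE_I2)
        fix w
        have "norm (f (S w) \<bullet> i) * norm (k w) \<le> \<bar>C\<bar> * norm (k w)"
          using fb[OF that(3), of "S w"] by (intro mult_right_mono) auto
        then show "norm ((f (S w) \<bullet> i) * k w) \<le> norm (C * k w)" by (simp add: abs_mult)
      qed
    qed (use that in auto)
    have "(\<integral>z. f z \<bullet> (\<Sum>i\<in>Basis. h i z *\<^sub>R i) \<partial>?D) = (\<integral>z. (\<Sum>i\<in>Basis. (f z \<bullet> i) * h i z) \<partial>?D)"
      by (simp add: inner_sum_right mult.commute)
    also have "\<dots> = (\<Sum>i\<in>Basis. \<integral>z. (f z \<bullet> i) * h i z \<partial>?D)"
      using i[OF h(2), of "\<lambda>z. z"] fi by (intro Bochner_Integration.integral_sum) auto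
    also have "\<dots> = (\<Sum>i\<in>Basis. \<integral>w. (f (T w) \<bullet> i) * (K w \<bullet> i) \<partial>N)"
      using h(3)[OF fi fib] by (intro sum.cong) auto
    also have "\<dots> = (\<integral>w. (\<Sum>i\<in>Basis. (f (T w) \<bullet> i) * (K w \<bullet> i)) \<partial>N)"
      using i[OF Ki, of T] measurable_compose[OF T fi]
      by (intro Bochner_Integration.integral_sum[symmetric]) auto
    also have "\<dots> = (\<integral>w. f (T w) \<bullet> K w \<partial>N)" by (simp add: euclidean_inner[symmetric])
    finally show "(\<integral>z. f z \<bullet> (\<Sum>i\<in>Basis. h i z *\<^sub>R i) \<partial>?D) = (\<integral>w. f (T w) \<bullet> K w \<partial>N)" .
  qed
qed

subsection \<open>Square-integrable random variables\<close>

definition square_integrable :: "'w measure \<Rightarrow> ('w \<Rightarrow> 'a::euclidean_space) \<Rightarrow> bool" where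
  "square_integrable M f \<longleftrightarrow> f \<in> borel_measurable M \<and> integrable M (\<lambda>w. (norm (f w))\<^sup>2)"

lemma square_integrableD:
  assumes "square_integrable M f"
  shows "f \<in> borel_measurable M" "integrable M (\<lambda>w. (norm (f w))\<^sup>2)"
  using assms by (auto simp: square_integrable_def)

lemma square_integrable_inner:
  assumes "square_integrable M f" "square_integrable M g"
  shows "integrable M (\<lambda>w. f w \<bullet> g w)"
proof (rule Bochner_Integration.integrable_bound)
  show "integrable M (\<lambda>w. (norm (f w))\<^sup>2 + (norm (g w))\<^sup>2)"
    using assms by (auto simp: square_integrable_def)
  show "(\<lambda>w. f w \<bullet> g w) \<in> borel_measurable M"
    using assms by (auto simp: square_integrable_def)
  show "AE w in M. norm (f w \<bullet> g w) \<le> norm ((norm (f w))\<^sup>2 + (norm (g w))\<^sup>2)"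
  proof (rule AE_I2)
    fix w
    have "\<bar>f w \<bullet> g w\<bar> \<le> norm (f w) * norm (g w)" by (rule Cauchy_Schwarz_ineq2)
    also have "\<dots> \<le> 2 * norm (f w) * norm (g w)" by simp
    also have "\<dots> \<le> (norm (f w))\<^sup>2 + (norm (g w))\<^sup>2" by (rule sum_squares_bound)
    finally show "norm (f w \<bullet> g w) \<le> norm ((norm (f w))\<^sup>2 + (norm (g w))\<^sup>2)" by simp
  qed
qed

lemma square_integrable_add:
  assumes "square_integrable M f" "square_integrable M g"
  shows "square_integrable M (\<lambda>w. f w + g w)"
proof -
  have "integrable M (\<lambda>w. (norm (f w))\<^sup>2 + 2 * (f w \<bullet> g w) + (norm (g w))\<^sup>2)"
    using square_integrable_inner[OF assms] square_integrableD(2)[OF assms(1)] square_integrableD(2)[OF assms(2)] by auto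
  also have "(\<lambda>w. (norm (f w))\<^sup>2 + 2 * (f w \<bullet> g w) + (norm (g w))\<^sup>2) = (\<lambda>w. (norm (f w + g w))\<^sup>2)"
    by (simp add: fun_eq_iff power2_norm_eq_inner inner_add_left inner_add_right inner_commute)
  finally show ?thesis using assms by (auto simp: square_integrable_def)
qed

lemma square_integrable_uminus: "square_integrable M f \<Longrightarrow> square_integrable M (\<lambda>w. - f w)"
  by (simp add: square_integrable_def)

lemma square_integrable_diff:
  "square_integrable M f \<Longrightarrow> square_integrable M g \<Longrightarrow> square_integrable M (\<lambda>w. f w - g w)"
  using square_integrable_add[OF _ square_integrable_uminus, of M f g] by simp

lemma (in finite_measure) square_integrable_bounded:
  assumes "f \<in> borel_measurable M" "\<And>w. norm (f w) \<le> C"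
  shows "square_integrable M f"
  unfolding square_integrable_def
proof
  show "integrable M (\<lambda>w. (norm (f w))\<^sup>2)"
    by (rule integrable_const_bound[where B="C\<^sup>2"]) (use assms in \<open>auto intro!: power_mono\<close>)
qed fact

lemma (in finite_measure) square_integrable_integrable:
  assumes "square_integrable M f"
  shows "integrable M f"
proof (rule Bochner_Integration.integrable_bound)
  show "integrable M (\<lambda>w. 1 + (norm (f w))\<^sup>2)" using assms by (auto simp: square_integrable_def)
  show "AE w in M. norm (f w) \<le> norm (1 + (norm (f w))\<^sup>2)"
    using norm_le_quadratic[of "f _"] by (intro AE_I2) (simp add: add_nonneg_nonneg)
qed (use assms in \<open>simp add: square_integrable_def\<close>)

lemma square_integrable_distr:
  assumes "T \<in> measurable M N" "f \<in> borel_measurable N"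
  shows "square_integrable (distr M N T) f \<longleftrightarrow> square_integrable M (\<lambda>w. f (T w))"
  unfolding square_integrable_def using assms measurable_compose[OF assms]
  by (auto simp: integrable_distr_eq)

lemma integral_norm_sq_add:
  assumes "square_integrable M f" "square_integrable M g" "(\<integral>w. f w \<bullet> g w \<partial>M) = 0"
  shows "(\<integral>w. (norm (f w + g w))\<^sup>2 \<partial>M) = (\<integral>w. (norm (f w))\<^sup>2 \<partial>M) + (\<integral>w. (norm (g w))\<^sup>2 \<partial>M)"
proof -
  have "(\<lambda>w. (norm (f w + g w))\<^sup>2) = (\<lambda>w. (norm (f w))\<^sup>2 + 2 * (f w \<bullet> g w) + (norm (g w))\<^sup>2)"
    by (simp add: fun_eq_iff power2_norm_eq_inner inner_add_left inner_add_right inner_commute)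
  then show ?thesis
    using square_integrable_inner[OF assms(1,2)] square_integrableD(2)[OF assms(1)]
      square_integrableD(2)[OF assms(2)] assms(3) by simp
qed

text \<open>The density of the vector part is the conditional expectation of \<open>K\<close> given \<open>T\<close>.\<close>
lemma vmeas_of_random_variables:
  fixes T :: "'w \<Rightarrow> 'a::euclidean_space \<times> 'a" and K :: "'w \<Rightarrow> 'a"
  assumes N: "prob_space N" and T: "T \<in> borel_measurable N" and K: "square_integrable N K"
    and \<alpha>: "prob_space \<alpha>" "sets \<alpha> = sets borel" and \<beta>: "prob_space \<beta>" "sets \<beta> = sets borel"
    and m: "distr N borel (\<lambda>w. fst (T w)) = \<alpha>" "distr N borel (\<lambda>w. snd (T w)) = \<beta>"
    and q\<alpha>: "\<And>\<Phi>. \<Phi> \<in> borel_measurable borel \<Longrightarrow> bounded (range \<Phi>) \<Longrightarrow> (\<integral>w. \<Phi> (fst (T w)) \<bullet> K w \<partial>N) = (\<integral>x. \<Phi> x \<bullet> x \<partial>\<alpha>)"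
    and q\<beta>: "\<And>\<Phi>. \<Phi> \<in> borel_measurable borel \<Longrightarrow> bounded (range \<Phi>) \<Longrightarrow> (\<integral>w. \<Phi> (snd (T w)) \<bullet> K w \<partial>N) = (\<integral>x. \<Phi> x \<bullet> x \<partial>\<beta>)"
  obtains P where "P \<in> GammaQ \<alpha> \<beta>" "gam P = distr N borel T"
    "energy P \<le> ennreal (\<integral>w. (norm (K w))\<^sup>2 \<partial>N)"
    "\<And>f. f \<in> borel_measurable borel \<Longrightarrow> bounded (range f) \<Longrightarrow>
      (\<integral>z. f z \<bullet> snd P z \<partial>fst P) = (\<integral>w. fst (f (T w)) + snd (f (T w)) \<bullet> K w \<partial>N)"
proof -
  interpret N: prob_space N by fact
  let ?D = "distr N borel T"
  interpret D: prob_space ?D by (rule N.prob_space_distr[OF T])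
  have Ki: "integrable N K" using K by (rule N.square_integrable_integrable)
  obtain h where h: "h \<in> borel_measurable borel" "integrable ?D h"
    "\<And>f. f \<in> borel_measurable borel \<Longrightarrow> bounded (range f) \<Longrightarrow> (\<integral>z. f z \<bullet> h z \<partial>?D) = (\<integral>w. f (T w) \<bullet> K w \<partial>N)"
    using pushforward_vector_density[OF N.finite_measure_axioms T Ki] by blast
  \<comment> \<open>With the law of T as base measure and scalar density 1, \<open>gam P\<close> is
    that law and \<open>vdens P\<close> is the push-forward density of K.\<close>
  define P where "P = (?D, \<lambda>z. (1::real, h z))"
  have "integrable ?D (\<lambda>z. (1::real, 0::'a) + (0, h z))"
    by (intro Bochner_Integration.integrable_add D.integrable_const
        integrable_bounded_linear[OF bounded_linear_Pair[OF bounded_linear_zero bounded_linear_ident] h(2)])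
  then have VM: "P \<in> VM"
    using D.finite_measure_axioms by (simp add: P_def VM_def)
  have gP: "gam P = ?D" by (simp add: gam_def P_def density_1)
  have vP: "vdens P = h" by (simp add: vdens_def[abs_def] P_def)
  interpret P: nonneg_vmeas P by unfold_locales (use VM in \<open>auto simp: P_def\<close>)
  have ac: "AE z in fst P. fst (snd P z) = 0 \<longrightarrow> snd (snd P z) = 0" by (simp add: P_def)
  have fsb: "fst \<in> measurable (borel :: ('a \<times> 'a) measure) borel" "snd \<in> measurable (borel :: ('a \<times> 'a) measure) borel"
    by (auto intro!: borel_measurable_continuous_onI continuous_intros)
  have rb: "bounded (range (\<lambda>z. \<Phi> (pr z)))" if "bounded (range \<Phi>)" for \<Phi> :: "'a \<Rightarrow> 'a" and pr :: "'a \<times> 'a \<Rightarrow> 'a"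
    using that by (rule bounded_subset) auto
  show thesis
  proof (rule that[of P])
    show "P \<in> GammaQ \<alpha> \<beta>"
      unfolding GammaQ_iff[OF \<alpha> \<beta>]
    proof (intro conjI ballI impI)
      show "distr (gam P) borel fst = \<alpha>" "distr (gam P) borel snd = \<beta>"
        using m T fsb by (simp_all add: gP distr_distr comp_def)
      fix \<Phi> :: "'a \<Rightarrow> 'a" assume \<Phi>: "\<Phi> \<in> borel_measurable borel" "bounded (range \<Phi>)"
      show "(\<integral>z. \<Phi> (fst z) \<bullet> vdens P z \<partial>gam P) = (\<integral>x. \<Phi> x \<bullet> x \<partial>\<alpha>)"
        unfolding gP vP using h(3)[OF measurable_compose[OF fsb(1) \<Phi>(1)] rb[OF \<Phi>(2)]] q\<alpha>[OF \<Phi>] by simp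
      show "(\<integral>z. \<Phi> (snd z) \<bullet> vdens P z \<partial>gam P) = (\<integral>x. \<Phi> x \<bullet> x \<partial>\<beta>)"
        unfolding gP vP using h(3)[OF measurable_compose[OF fsb(2) \<Phi>(1)] rb[OF \<Phi>(2)]] q\<beta>[OF \<Phi>] by simp
    qed (use VM P.nonneg ac in auto)
    show "gam P = ?D" by fact
    show "energy P \<le> ennreal (\<integral>w. (norm (K w))\<^sup>2 \<partial>N)"
      unfolding P.energy_vdens[OF ac]
    \<comment> \<open>Jensen's inequality for the conditional expectation in dual form: f.h
      integrates to the same value as f(T).K, and f.K - |f|^2/4 \<le> |K|^2 pointwise.\<close>
    proof (rule P.dual_energy_bound(2))
      fix f :: "'a \<times> 'a \<Rightarrow> 'a" assume f: "f \<in> borel_measurable borel" "bounded (range f)"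
      obtain C where C: "\<And>z. norm (f z) \<le> C" using f(2) by (auto simp: bounded_iff)
      have fD: "square_integrable ?D f" by (rule D.square_integrable_bounded[where C=C]) (use f C in auto)
      have fN: "square_integrable N (\<lambda>w. f (T w))"
        by (rule N.square_integrable_bounded[where C=C]) (use measurable_compose[OF T f(1)] C in auto)
      have fh: "integrable ?D (\<lambda>z. f z \<bullet> h z)"
      proof (rule Bochner_Integration.integrable_bound)
        show "integrable ?D (\<lambda>z. C * norm (h z))" using h(2) by auto
        show "AE z in ?D. norm (f z \<bullet> h z) \<le> norm (C * norm (h z))"
        proof (rule AE_I2)
          fix z
          have "\<bar>f z \<bullet> h z\<bar> \<le> norm (f z) * norm (h z)" by (rule Cauchy_Schwarz_ineq2)
          also have "\<dots> \<le> C * norm (h z)" using C by (intro mult_right_mono) auto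
          finally show "norm (f z \<bullet> h z) \<le> norm (C * norm (h z))" by simp
        qed
      qed (use f h in auto)
      have "(\<integral>z. f z \<bullet> snd (snd P z) - (norm (f z))\<^sup>2 / 4 * fst (snd P z) \<partial>fst P) = (\<integral>z. f z \<bullet> h z - (norm (f z))\<^sup>2 / 4 \<partial>?D)"
        by (simp add: P_def)
      also have "\<dots> = (\<integral>z. f z \<bullet> h z \<partial>?D) - (\<integral>z. (norm (f z))\<^sup>2 / 4 \<partial>?D)"
        using fh square_integrableD(2)[OF fD] by simp
      also have "\<dots> = (\<integral>w. f (T w) \<bullet> K w \<partial>N) - (\<integral>w. (norm (f (T w)))\<^sup>2 / 4 \<partial>N)"
        using h(3)[OF f] f(1) T by (simp add: integral_distr)
      also have "\<dots> = (\<integral>w. f (T w) \<bullet> K w - (norm (f (T w)))\<^sup>2 / 4 \<partial>N)"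
        using square_integrable_inner[OF fN K] square_integrableD(2)[OF fN] by simp
      also have "\<dots> \<le> (\<integral>w. (norm (K w))\<^sup>2 \<partial>N)"
      proof (rule integral_mono)
        fix w
        have "0 \<le> (norm (K w - (1/2) *\<^sub>R f (T w)))\<^sup>2" by simp
        then show "f (T w) \<bullet> K w - (norm (f (T w)))\<^sup>2 / 4 \<le> (norm (K w))\<^sup>2"
          by (simp add: power2_norm_eq_inner inner_diff_left inner_diff_right inner_commute)
      qed (use square_integrable_inner[OF fN K] square_integrableD(2)[OF fN] square_integrableD(2)[OF K] in auto)
      finally show "(\<integral>z. f z \<bullet> snd (snd P z) - (norm (f z))\<^sup>2 / 4 * fst (snd P z) \<partial>fst P) \<le> (\<integral>w. (norm (K w))\<^sup>2 \<partial>N)" .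
    qed
    fix f :: "'a \<times> 'a \<Rightarrow> real \<times> 'a" assume f: "f \<in> borel_measurable borel" "bounded (range f)"
    obtain C where C: "\<And>z. norm (f z) \<le> C" using f(2) by (auto simp: bounded_iff)
    have C1: "norm (fst (f z)) \<le> C" "norm (snd (f z)) \<le> C" for z
      using C[of z] norm_fst_le[of "fst (f z)" "snd (f z)"] norm_snd_le[of "snd (f z)" "fst (f z)"]
      by (simp_all add: order_trans)
    have fm: "(\<lambda>z. fst (f z)) \<in> borel_measurable borel" "(\<lambda>z. snd (f z)) \<in> borel_measurable borel"
      by (rule measurable_compose[OF f(1)], intro borel_measurable_continuous_onI continuous_intros)+
    have b2: "bounded (range (\<lambda>z. snd (f z)))" by (rule boundedI[of _ C]) (use C1 in auto)
    have i1: "integrable ?D (\<lambda>z. fst (f z))" by (rule D.integrable_const_bound[where B=C]) (use C1 fm in auto)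
    have i1N: "integrable N (\<lambda>w. fst (f (T w)))"
      by (rule N.integrable_const_bound[where B=C]) (use C1 measurable_compose[OF T fm(1)] in auto)
    have fh: "integrable ?D (\<lambda>z. snd (f z) \<bullet> h z)"
    proof (rule Bochner_Integration.integrable_bound)
      show "integrable ?D (\<lambda>z. C * norm (h z))" using h(2) by auto
      show "AE z in ?D. norm (snd (f z) \<bullet> h z) \<le> norm (C * norm (h z))"
      proof (rule AE_I2)
        fix z
        have "\<bar>snd (f z) \<bullet> h z\<bar> \<le> norm (snd (f z)) * norm (h z)" by (rule Cauchy_Schwarz_ineq2)
        also have "\<dots> \<le> C * norm (h z)" using C1 by (intro mult_right_mono) auto
        finally show "norm (snd (f z) \<bullet> h z) \<le> norm (C * norm (h z))" by simp
      qed
    qed (use fm h in auto)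
    have fN: "square_integrable N (\<lambda>w. snd (f (T w)))"
      by (rule N.square_integrable_bounded[where C=C]) (use measurable_compose[OF T fm(2)] C1 in auto)
    have "(\<integral>z. f z \<bullet> snd P z \<partial>fst P) = (\<integral>z. fst (f z) + snd (f z) \<bullet> h z \<partial>?D)"
      by (simp add: P_def inner_prod_def)
    also have "\<dots> = (\<integral>w. fst (f (T w)) \<partial>N) + (\<integral>w. snd (f (T w)) \<bullet> K w \<partial>N)"
      using i1 fh h(3)[OF fm(2) b2] integral_distr[OF T fm(1)] by simp
    also have "\<dots> = (\<integral>w. fst (f (T w)) + snd (f (T w)) \<bullet> K w \<partial>N)"
      using i1N square_integrable_inner[OF fN K] by simp
    finally show "(\<integral>z. f z \<bullet> snd P z \<partial>fst P) = (\<integral>w. fst (f (T w)) + snd (f (T w)) \<bullet> K w \<partial>N)" .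
  qed
qed

text \<open>The spaces vary with n, so closeness is measured in mean square and not almost surely.
  Since all X n have the same law \<rho>, its tail is uniformly small; on a large ball h is
  uniformly continuous; what remains is dominated by a multiple of |Y - X|^2.\<close>

lemma mean_square_perturbation:
  fixes h :: "'b::euclidean_space \<Rightarrow> 'c::euclidean_space" and X Y :: "nat \<Rightarrow> 'w \<Rightarrow> 'b"
  assumes N: "\<And>n. prob_space (N n)"
    and X: "\<And>n. X n \<in> borel_measurable (N n)" and Y: "\<And>n. Y n \<in> borel_measurable (N n)"
    and law: "\<And>n. distr (N n) borel (X n) = \<rho>" and \<rho>: "\<rho> \<in> P2"
    and dist: "\<And>n. integrable (N n) (\<lambda>w. (norm (Y n w - X n w))\<^sup>2)"
      "(\<lambda>n. \<integral>w. (norm (Y n w - X n w))\<^sup>2 \<partial>(N n)) \<longlonglongrightarrow> 0"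
    and h: "continuous_on UNIV h" "\<And>z. norm (h z) \<le> C * (1 + (norm z)\<^sup>2)"
  shows "\<And>n. integrable (N n) (\<lambda>w. norm (h (Y n w) - h (X n w)))"
    and "(\<lambda>n. \<integral>w. norm (h (Y n w) - h (X n w)) \<partial>(N n)) \<longlonglongrightarrow> 0"
proof -
  have hm[measurable]: "h \<in> borel_measurable borel" using h(1) by (rule borel_measurable_continuous_onI)
  have C0: "C \<ge> 0" using order_trans[OF norm_ge_zero h(2)[of 0]] by simp
  define q where "q z = 1 + (norm z)\<^sup>2" for z :: 'b
  have qm[measurable]: "q \<in> borel_measurable borel" unfolding q_def[abs_def] by measurable
  have q0: "q z \<ge> 0" for z by (simp add: q_def)
  interpret R: prob_space \<rho> using P2_D[OF \<rho>] by simp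
  have q\<rho>: "integrable \<rho> q" unfolding q_def[abs_def] using P2_D(4)[OF \<rho>] by auto
  have iN: "integrable (N n) (\<lambda>w. f (X n w))" "(\<integral>w. f (X n w) \<partial>(N n)) = (\<integral>z. f z \<partial>\<rho>)"
    if "integrable \<rho> f" "f \<in> borel_measurable borel" for f :: "'b \<Rightarrow> real" and n
    using that integrable_distr_eq[OF X[of n] that(2)] integral_distr[OF X[of n] that(2)] law[of n] by auto
  \<comment> \<open>From |z'|^2 \<le> 2|z|^2 + 2|z' - z|^2 one gets q z' \<le> 2 q z + 2|z' - z|^2;
    adding the growth bound at z gives the coefficients 3 C and 2 C.\<close>
  have main: "norm (h z' - h z) \<le> 3 * C * q z + 2 * C * (norm (z' - z))\<^sup>2" for z z'
  proof -
    have "(norm z')\<^sup>2 \<le> (norm z + norm (z' - z))\<^sup>2"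
      using norm_triangle_ineq[of z "z' - z"] by (intro power_mono) auto
    also have "\<dots> \<le> 2 * (norm z)\<^sup>2 + 2 * (norm (z' - z))\<^sup>2"
      using sum_squares_bound[of "norm z" "norm (z' - z)"] by (simp add: power2_sum)
    finally have "q z' \<le> 2 * q z + 2 * (norm (z' - z))\<^sup>2" by (simp add: q_def)
    then have "C * q z' \<le> C * (2 * q z + 2 * (norm (z' - z))\<^sup>2)" using C0 by (rule mult_left_mono)
    moreover have "norm (h z' - h z) \<le> C * q z' + C * q z"
      using norm_triangle_ineq4[of "h z'" "h z"] h(2)[of z] h(2)[of z'] by (simp add: q_def)
    ultimately show ?thesis by (simp add: algebra_simps)
  qed
  show int: "integrable (N n) (\<lambda>w. norm (h (Y n w) - h (X n w)))" for n
  proof (rule Bochner_Integration.integrable_bound)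
    show "integrable (N n) (\<lambda>w. 3 * C * q (X n w) + 2 * C * (norm (Y n w - X n w))\<^sup>2)"
      using iN(1)[OF q\<rho> qm] dist(1) by auto
    show "(\<lambda>w. norm (h (Y n w) - h (X n w))) \<in> borel_measurable (N n)"
      using X[of n] Y[of n] by measurable
    show "AE w in N n. norm (norm (h (Y n w) - h (X n w))) \<le> norm (3 * C * q (X n w) + 2 * C * (norm (Y n w - X n w))\<^sup>2)"
      using main by (intro AE_I2) (simp add: order_trans[OF _ abs_ge_self])
  qed
  show "(\<lambda>n. \<integral>w. norm (h (Y n w) - h (X n w)) \<partial>(N n)) \<longlonglongrightarrow> 0"
  proof (rule order_tendstoI)
    fix a :: real assume "a < 0"
    then have "a < (\<integral>w. norm (h (Y n w) - h (X n w)) \<partial>(N n))" for n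
      by (rule less_le_trans) (simp add: integral_nonneg_AE)
    then show "\<forall>\<^sub>F n in sequentially. a < (\<integral>w. norm (h (Y n w) - h (X n w)) \<partial>(N n))" by simp
  next
    fix e :: real assume e: "0 < e"
    have tm: "(\<lambda>z. if norm z > real R then q z else 0) \<in> borel_measurable borel" for R :: nat by measurable
    have "(\<lambda>R. \<integral>z. (if norm z > real R then q z else 0) \<partial>\<rho>) \<longlonglongrightarrow> (\<integral>z. 0 \<partial>\<rho>)"
    proof (rule integral_dominated_convergence[OF _ _ q\<rho>])
      show "AE z in \<rho>. (\<lambda>R. if norm z > real R then q z else 0) \<longlonglongrightarrow> 0"
      proof (rule AE_I2)
        fix z :: 'b
        obtain R where "norm z \<le> real R" using real_arch_simple by blast
        then show "(\<lambda>R. if norm z > real R then q z else 0) \<longlonglongrightarrow> 0"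
          by (intro tendsto_eventually eventually_sequentiallyI[of R]) auto
      qed
      show "AE z in \<rho>. norm (if norm z > real R then q z else 0) \<le> q z" for R using q0 by auto
    qed (use tm P2_D(2)[OF \<rho>] in \<open>auto intro: borel_measurable_sets_borel\<close>)
    then have "(\<lambda>R. 3 * C * (\<integral>z. (if norm z > real R then q z else 0) \<partial>\<rho>)) \<longlonglongrightarrow> 3 * C * 0"
      by (intro tendsto_mult tendsto_const) simp
    then have "\<forall>\<^sub>F R in sequentially. 3 * C * (\<integral>z. (if norm z > real R then q z else 0) \<partial>\<rho>) < e / 3"
      by (rule order_tendstoD(2)) (use e in simp)
    then obtain R where R: "3 * C * (\<integral>z. (if norm z > real R then q z else 0) \<partial>\<rho>) < e / 3"
      by (auto simp: eventually_sequentially)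
    have "uniformly_continuous_on (cball 0 (real R + 1)) h"
      using h(1) by (intro compact_uniformly_continuous) (auto intro: continuous_on_subset)
    then obtain d where d: "d > 0" "\<And>z z'. z \<in> cball 0 (real R + 1) \<Longrightarrow> z' \<in> cball 0 (real R + 1) \<Longrightarrow> dist z' z < d \<Longrightarrow> dist (h z') (h z) < e / 3"
      using e unfolding uniformly_continuous_on_def by (metis divide_pos_pos zero_less_numeral)
    \<comment> \<open>r \<le> 1 keeps z' inside the ball of radius R + 1 on which uniform continuity
      was taken.\<close>
    define r where "r = min d 1"
    have r: "r > 0" "r \<le> d" "r \<le> 1" using d(1) by (auto simp: r_def)
    \<comment> \<open>If |z| \<le> R but |z' - z| \<ge> r, then q z \<le> 1 + R^2 is at most (1 +
      R^2) |z' - z|^2 / r^2. So the term 3 C q z of \<open>main\<close> is also absorbed into a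
      multiple of |z' - z|^2.\<close>
    define B where "B = 2 * C + 3 * C * (1 + (real R)\<^sup>2) / r\<^sup>2"
    have B0: "B \<ge> 0" using C0 by (simp add: B_def)
    have pw: "norm (h z' - h z) \<le> e / 3 + 3 * C * (if norm z > real R then q z else 0) + B * (norm (z' - z))\<^sup>2" for z z'
    proof (cases "norm z > real R")
      case True
      have "2 * C * (norm (z' - z))\<^sup>2 \<le> B * (norm (z' - z))\<^sup>2"
        using C0 by (intro mult_right_mono) (auto simp: B_def)
      then show ?thesis using main[of z' z] True e by simp
    next
      case False
      show ?thesis
      proof (cases "norm (z' - z) < r")
        case True
        have "norm z' \<le> norm z + norm (z' - z)" using norm_triangle_ineq[of z "z' - z"] by simp
        then have "dist (h z') (h z) < e / 3"
          using True False r by (intro d(2)) (auto simp: dist_norm)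
        then show ?thesis using False B0 by (simp add: dist_norm add_increasing2)
      next
        case F: False
        have "1 * q z \<le> (norm (z' - z))\<^sup>2 / r\<^sup>2 * (1 + (real R)\<^sup>2)"
        proof (rule mult_mono)
          show "1 \<le> (norm (z' - z))\<^sup>2 / r\<^sup>2" using F r by (simp add: power_mono)
          show "q z \<le> 1 + (real R)\<^sup>2" using False by (auto simp: q_def intro!: power_mono)
        qed (auto simp: q0)
        then have "3 * C * (1 * q z) \<le> 3 * C * ((norm (z' - z))\<^sup>2 / r\<^sup>2 * (1 + (real R)\<^sup>2))"
          using C0 by (intro mult_left_mono) auto
        then have "norm (h z' - h z) \<le> B * (norm (z' - z))\<^sup>2"
          using main[of z' z] by (simp add: B_def algebra_simps)
        then show ?thesis using False e by simp
      qed
    qed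
    have bound: "(\<integral>w. norm (h (Y n w) - h (X n w)) \<partial>(N n)) \<le> e / 3 + e / 3 + B * (\<integral>w. (norm (Y n w - X n w))\<^sup>2 \<partial>(N n))" for n
    proof -
      interpret Nn: prob_space "N n" by (rule N)
      let ?t = "\<lambda>z. if norm z > real R then q z else 0"
      have t\<rho>: "integrable \<rho> ?t"
        by (rule Bochner_Integration.integrable_bound[OF q\<rho>])
          (use tm P2_D(2)[OF \<rho>] q0 in \<open>auto intro: borel_measurable_sets_borel\<close>)
      have "(\<integral>w. norm (h (Y n w) - h (X n w)) \<partial>(N n))
        \<le> (\<integral>w. e / 3 + 3 * C * ?t (X n w) + B * (norm (Y n w - X n w))\<^sup>2 \<partial>(N n))"
        using iN(1)[OF t\<rho> tm] dist(1)[of n] pw by (intro integral_mono int) auto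
      also have "\<dots> = e / 3 + 3 * C * (\<integral>w. ?t (X n w) \<partial>(N n)) + B * (\<integral>w. (norm (Y n w - X n w))\<^sup>2 \<partial>(N n))"
        using iN(1)[OF t\<rho> tm, of n] dist(1)[of n] by (simp add: Nn.prob_space)
      also have "(\<integral>w. ?t (X n w) \<partial>(N n)) = (\<integral>z. ?t z \<partial>\<rho>)" by (rule iN(2)[OF t\<rho> tm])
      finally show ?thesis using R by linarith
    qed
    have "(\<lambda>n. B * (\<integral>w. (norm (Y n w - X n w))\<^sup>2 \<partial>(N n))) \<longlonglongrightarrow> B * 0"
      by (intro tendsto_mult tendsto_const dist(2))
    then have "\<forall>\<^sub>F n in sequentially. B * (\<integral>w. (norm (Y n w - X n w))\<^sup>2 \<partial>(N n)) < e / 3"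
      by (rule order_tendstoD(2)) (use e in simp)
    then show "\<forall>\<^sub>F n in sequentially. (\<integral>w. norm (h (Y n w) - h (X n w)) \<partial>(N n)) < e"
    proof eventually_elim
      case (elim n)
      then show ?case using bound[of n] by linarith
    qed
  qed
qed

subsection \<open>Martingale couplings\<close>

text \<open>The conditional expectation of \<open>K\<close> given either marginal variable is that variable, so the law
  of \<open>K\<close> dominates both marginals in convex order.\<close>
locale martingale_coupling =
  fixes \<alpha> \<beta> :: "'a::euclidean_space measure" and g :: "'a \<times> 'a \<Rightarrow> real" and K :: "'a \<times> 'a \<Rightarrow> 'a" and M :: real
  assumes \<alpha>: "\<alpha> \<in> P2" and \<beta>: "\<beta> \<in> P2"
    and g[measurable]: "g \<in> borel_measurable borel" and K[measurable]: "K \<in> borel_measurable borel"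
    and g0: "\<And>z. 0 \<le> g z" and gM: "\<And>z. g z \<le> M"
    and fst_mass: "AE x in \<alpha>. (\<integral>y. g (x, y) \<partial>\<beta>) = 1"
    and fst_mean: "AE x in \<alpha>. (\<integral>y. g (x, y) *\<^sub>R K (x, y) \<partial>\<beta>) = x"
    and snd_mass: "AE y in \<beta>. (\<integral>x. g (x, y) \<partial>\<alpha>) = 1"
    and snd_mean: "AE y in \<beta>. (\<integral>x. g (x, y) *\<^sub>R K (x, y) \<partial>\<alpha>) = y"
    and K_sq: "integrable (\<alpha> \<Otimes>\<^sub>M \<beta>) (\<lambda>z. g z * (norm (K z))\<^sup>2)"
begin

lemma fst_borel: "(fst :: 'a \<times> 'a \<Rightarrow> 'a) \<in> borel_measurable borel"
  and snd_borel: "(snd :: 'a \<times> 'a \<Rightarrow> 'a) \<in> borel_measurable borel"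
  by (intro borel_measurable_continuous_onI continuous_intros)+

definition law :: "('a \<times> 'a) measure" where
  "law = density (\<alpha> \<Otimes>\<^sub>M \<beta>) (\<lambda>z. ennreal (g z))"

text \<open>Gluing onto any space N on which X has law \<alpha>: the new variable is drawn with
  density \<open>g (X, _)\<close> with respect to \<beta>, so given N it depends on N only through
  X.\<close>

definition ext :: "'w measure \<Rightarrow> ('w \<Rightarrow> 'a) \<Rightarrow> ('w \<times> 'a) measure" where
  "ext N X = density (N \<Otimes>\<^sub>M \<beta>) (\<lambda>w. ennreal (g (X (fst w), snd w)))"

lemma prob: "prob_space \<alpha>" "prob_space \<beta>" using P2_D \<alpha> \<beta> by auto

lemma sets_\<alpha>[measurable_cong]: "sets \<alpha> = sets borel" and sets_\<beta>[measurable_cong]: "sets \<beta> = sets borel"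
  using P2_D \<alpha> \<beta> by auto

lemma sets_pair: "sets (\<alpha> \<Otimes>\<^sub>M \<beta>) = sets borel"
  using sets_pair_measure_cong[OF sets_\<alpha> sets_\<beta>] unfolding borel_prod .

lemma sets_borel_pair: "sets ((borel :: 'a measure) \<Otimes>\<^sub>M \<beta>) = sets borel"
  using sets_pair_measure_cong[OF refl sets_\<beta>, of "borel :: 'a measure"] unfolding borel_prod .

lemma sets_law: "sets law = sets borel"
  by (simp add: law_def sets_pair)

lemma measurable_Pair_borel:
  assumes "f \<in> borel_measurable N" "h \<in> borel_measurable N"
  shows "(\<lambda>w. (f w :: 'a, h w :: 'a)) \<in> borel_measurable N"
  using measurable_Pair[OF assms] unfolding borel_prod .

lemma nn_mass: "AE x in \<alpha>. (\<integral>\<^sup>+y. ennreal (g (x, y)) \<partial>\<beta>) = 1"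
  using fst_mass
proof eventually_elim
  case (elim x)
  interpret B: prob_space \<beta> by (rule prob)
  have m: "(\<lambda>y. g (x, y)) \<in> borel_measurable \<beta>"
    by (intro borel_measurable_sets_borel[OF sets_\<beta>] measurable_compose[OF measurable_Pair_borel g]) auto
  have "integrable \<beta> (\<lambda>y. g (x, y))"
    by (rule B.integrable_const_bound[where B=M]) (use m g0 gM in auto)
  then show ?case using elim g0 by (simp add: nn_integral_eq_integral)
qed

lemma integrable_gK: "integrable (\<alpha> \<Otimes>\<^sub>M \<beta>) (\<lambda>z. g z *\<^sub>R K z)"
proof -
  interpret A: prob_space \<alpha> by (rule prob)
  interpret B: prob_space \<beta> by (rule prob)
  interpret AB: pair_prob_space \<alpha> \<beta> ..
  have gm: "g \<in> borel_measurable (\<alpha> \<Otimes>\<^sub>M \<beta>)" and Km: "K \<in> borel_measurable (\<alpha> \<Otimes>\<^sub>M \<beta>)"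
    by (rule borel_measurable_sets_borel[OF sets_pair g] borel_measurable_sets_borel[OF sets_pair K])+
  have gi: "integrable (\<alpha> \<Otimes>\<^sub>M \<beta>) g"
    by (rule AB.integrable_const_bound[where B=M]) (use gm g0 gM in auto)
  show ?thesis
  proof (rule Bochner_Integration.integrable_bound)
    show "integrable (\<alpha> \<Otimes>\<^sub>M \<beta>) (\<lambda>z. g z + g z * (norm (K z))\<^sup>2)" using gi K_sq by auto
    show "AE z in \<alpha> \<Otimes>\<^sub>M \<beta>. norm (g z *\<^sub>R K z) \<le> norm (g z + g z * (norm (K z))\<^sup>2)"
    proof (rule AE_I2)
      fix z
      have "g z * norm (K z) \<le> g z * (1 + (norm (K z))\<^sup>2)"
        using g0 norm_le_quadratic by (intro mult_left_mono)
      then show "norm (g z *\<^sub>R K z) \<le> norm (g z + g z * (norm (K z))\<^sup>2)"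
        using g0[of z] by (simp add: distrib_left)
    qed
  qed (use gm Km in auto)
qed

lemma fiber_integrable:
  "AE x in \<alpha>. integrable \<beta> (\<lambda>y. g (x, y) *\<^sub>R K (x, y))"
proof -
  interpret A: prob_space \<alpha> by (rule prob)
  interpret B: prob_space \<beta> by (rule prob)
  interpret AB: pair_prob_space \<alpha> \<beta> ..
  show ?thesis using AB.AE_integrable_fst'[OF integrable_gK] .
qed

context
  fixes N :: "'w measure" and X :: "'w \<Rightarrow> 'a"
  assumes N: "prob_space N" and X[measurable]: "X \<in> borel_measurable N" and law_X: "distr N borel X = \<alpha>"
begin

lemma T_meas: "(\<lambda>w. (X (fst w), snd w)) \<in> borel_measurable (N \<Otimes>\<^sub>M \<beta>)"
  by (intro measurable_Pair_borel) (use X sets_\<beta> in measurable)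

lemma gT_meas: "(\<lambda>w. g (X (fst w), snd w)) \<in> borel_measurable (N \<Otimes>\<^sub>M \<beta>)"
  by (rule measurable_compose[OF T_meas g])

lemma KT_meas: "(\<lambda>w. K (X (fst w), snd w)) \<in> borel_measurable (N \<Otimes>\<^sub>M \<beta>)"
  by (rule measurable_compose[OF T_meas K])

lemma AE_X: "AE x in \<alpha>. Q x \<Longrightarrow> AE w in N. Q (X w)"
  unfolding law_X[symmetric] by (rule AE_distrD[OF X])

lemma sets_ext: "sets (ext N X) = sets (N \<Otimes>\<^sub>M \<beta>)"
  by (simp add: ext_def)

lemma measurable_ext: "f \<in> measurable (N \<Otimes>\<^sub>M \<beta>) L \<Longrightarrow> f \<in> measurable (ext N X) L"
  by (simp add: measurable_cong_sets[OF sets_ext refl])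

text \<open>The fibres have total mass 1, so adding the new variable does not change the law on
  N.\<close>

lemma distr_ext_fst: "distr (ext N X) N fst = N"
proof (rule measure_eqI)
  interpret N: prob_space N by (rule N)
  interpret B: prob_space \<beta> by (rule prob)
  fix A assume "A \<in> sets (distr (ext N X) N fst)"
  then have A[measurable]: "A \<in> sets N" by simp
  have fm: "fst \<in> measurable (ext N X) N" by (rule measurable_ext) simp
  have "emeasure (distr (ext N X) N fst) A = emeasure (ext N X) (A \<times> space \<beta>)"
    using A sets.sets_into_space[OF A] sets_eq_imp_space_eq[OF sets_ext]
    by (subst emeasure_distr[OF fm A]) (auto simp: space_pair_measure intro!: arg_cong2[where f=emeasure])
  also have "\<dots> = (\<integral>\<^sup>+w. ennreal (g (X (fst w), snd w)) * indicator (A \<times> space \<beta>) w \<partial>(N \<Otimes>\<^sub>M \<beta>))"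
    unfolding ext_def using gT_meas A by (intro emeasure_density) auto
  also have "\<dots> = (\<integral>\<^sup>+w. ennreal (g (X (fst w), snd w)) * indicator A (fst w) \<partial>(N \<Otimes>\<^sub>M \<beta>))"
    by (intro nn_integral_cong) (auto simp: space_pair_measure indicator_def)
  also have "\<dots> = (\<integral>\<^sup>+w. (\<integral>\<^sup>+y. ennreal (g (X w, y)) * indicator A w \<partial>\<beta>) \<partial>N)"
    using B.nn_integral_fst[of "\<lambda>w. ennreal (g (X (fst w), snd w)) * indicator A (fst w)" N] gT_meas A by simp
  also have "\<dots> = (\<integral>\<^sup>+w. indicator A w \<partial>N)"
  proof (rule nn_integral_cong_AE)
    show "AE w in N. (\<integral>\<^sup>+y. ennreal (g (X w, y)) * indicator A w \<partial>\<beta>) = indicator A w"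
      using AE_X[OF nn_mass]
    proof eventually_elim
      case (elim w)
      then show ?case by (cases "w \<in> A") auto
    qed
  qed
  finally show "emeasure (distr (ext N X) N fst) A = emeasure N A" using A by simp
qed simp

lemma prob_ext: "prob_space (ext N X)"
proof -
  interpret N: prob_space N by (rule N)
  have fm: "fst \<in> measurable (ext N X) N" by (rule measurable_ext) simp
  show ?thesis
    by (rule prob_space_distrD[OF fm]) (simp add: distr_ext_fst N)
qed

lemma distr_ext_T: "distr (ext N X) borel (\<lambda>w. (X (fst w), snd w)) = law"
proof (rule measure_eqI)
  interpret N: prob_space N by (rule N)
  interpret B: prob_space \<beta> by (rule prob)
  fix A assume "A \<in> sets (distr (ext N X) borel (\<lambda>w. (X (fst w), snd w)))"
  then have A: "A \<in> sets borel" by simp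
  let ?T = "\<lambda>w. (X (fst w), snd w)"
  let ?f = "\<lambda>z. ennreal (g z) * indicator A z"
  have fm: "?f \<in> borel_measurable borel" using A g by measurable
  have fm2: "?f \<in> borel_measurable (borel \<Otimes>\<^sub>M \<beta>)"
    by (rule borel_measurable_sets_borel[OF sets_borel_pair fm])
  have "emeasure (distr (ext N X) borel ?T) A = emeasure (ext N X) (?T -` A \<inter> space (ext N X))"
    by (rule emeasure_distr[OF measurable_ext[OF T_meas] A])
  also have "\<dots> = (\<integral>\<^sup>+w. ennreal (g (?T w)) * indicator (?T -` A \<inter> space (N \<Otimes>\<^sub>M \<beta>)) w \<partial>(N \<Otimes>\<^sub>M \<beta>))"
    unfolding ext_def using gT_meas measurable_sets[OF T_meas A] by (subst emeasure_density) auto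
  also have "\<dots> = (\<integral>\<^sup>+w. ?f (?T w) \<partial>(N \<Otimes>\<^sub>M \<beta>))"
    by (intro nn_integral_cong) (auto simp: indicator_def)
  also have "\<dots> = (\<integral>\<^sup>+w. (\<integral>\<^sup>+y. ?f (X w, y) \<partial>\<beta>) \<partial>N)"
    using B.nn_integral_fst[of "\<lambda>w. ?f (?T w)" N] measurable_compose[OF T_meas fm] by simp
  also have "\<dots> = (\<integral>\<^sup>+x. (\<integral>\<^sup>+y. ?f (x, y) \<partial>\<beta>) \<partial>\<alpha>)"
    unfolding law_X[symmetric]
    by (rule nn_integral_distr[OF X, symmetric]) (use B.borel_measurable_nn_integral_fst[OF fm2] in simp)
  also have "\<dots> = (\<integral>\<^sup>+z. ?f z \<partial>(\<alpha> \<Otimes>\<^sub>M \<beta>))"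
    using borel_measurable_sets_borel[OF sets_pair fm] by (rule B.nn_integral_fst)
  also have "\<dots> = emeasure law A"
    unfolding law_def using A g sets_pair borel_measurable_sets_borel[OF sets_pair g]
    by (subst emeasure_density) auto
  finally show "emeasure (distr (ext N X) borel ?T) A = emeasure law A" .
qed (simp add: sets_law)

lemma sq_ext_fst: "square_integrable N F \<Longrightarrow> square_integrable (ext N X) (\<lambda>w. F (fst w))"
  using square_integrable_distr[of fst "ext N X" N F] measurable_ext[OF measurable_fst]
  by (simp add: distr_ext_fst square_integrableD)

lemma integral_ext_fst:
  fixes f :: "'w \<Rightarrow> real"
  assumes "f \<in> borel_measurable N"
  shows "(\<integral>w. f (fst w) \<partial>ext N X) = (\<integral>w. f w \<partial>N)"
  using integral_distr[OF measurable_ext[OF measurable_fst] assms] unfolding distr_ext_fst by (rule sym)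

lemma integral_ext_T:
  fixes f :: "'a \<times> 'a \<Rightarrow> real"
  assumes "f \<in> borel_measurable borel"
  shows "(\<integral>w. f (X (fst w), snd w) \<partial>ext N X) = (\<integral>z. f z \<partial>law)"
  using integral_distr[OF measurable_ext[OF T_meas] assms] unfolding distr_ext_T by (rule sym)

lemma sq_law_K: "square_integrable law K"
proof -
  have gm: "g \<in> borel_measurable (\<alpha> \<Otimes>\<^sub>M \<beta>)" and Km: "K \<in> borel_measurable (\<alpha> \<Otimes>\<^sub>M \<beta>)"
    by (rule borel_measurable_sets_borel[OF sets_pair g] borel_measurable_sets_borel[OF sets_pair K])+
  show ?thesis
    unfolding square_integrable_def law_def using gm Km g0 K_sq
    by (subst integrable_density) auto
qed

lemma sq_ext_K: "square_integrable (ext N X) (\<lambda>w. K (X (fst w), snd w))"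
  using square_integrable_distr[OF measurable_ext[OF T_meas], of K] sq_law_K
  by (simp add: distr_ext_T)

lemma sq_X: "square_integrable N X"
proof -
  have "integrable (distr N borel X) (\<lambda>x. (norm x)\<^sup>2)" using P2_D(4)[OF \<alpha>] by (simp add: law_X)
  then show ?thesis by (simp add: square_integrable_def integrable_distr_eq)
qed

lemma sq_ext_D: "square_integrable (ext N X) (\<lambda>w. K (X (fst w), snd w) - X (fst w))"
  by (intro square_integrable_diff sq_ext_K sq_ext_fst sq_X)

text \<open>K - X has mean zero given all of N, not merely given X: on the fibre over w the vector F
  w is constant and K averages to X w. This gives the orthogonality of successive
  increments.\<close>

lemma ext_orth:
  assumes F: "square_integrable N F"
  shows "(\<integral>w. F (fst w) \<bullet> (K (X (fst w), snd w) - X (fst w)) \<partial>ext N X) = 0"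
proof -
  interpret N: prob_space N by (rule N)
  interpret B: prob_space \<beta> by (rule prob)
  interpret NB: pair_prob_space N \<beta> ..
  let ?h = "\<lambda>w. F (fst w) \<bullet> (K (X (fst w), snd w) - X (fst w))"
  have Fm[measurable]: "F \<in> borel_measurable N" using F by (rule square_integrableD)
  have hm: "?h \<in> borel_measurable (N \<Otimes>\<^sub>M \<beta>)" using KT_meas by measurable
  have "integrable (ext N X) ?h" by (rule square_integrable_inner[OF sq_ext_fst[OF F] sq_ext_D])
  then have i: "integrable (N \<Otimes>\<^sub>M \<beta>) (\<lambda>w. g (X (fst w), snd w) *\<^sub>R ?h w)"
    unfolding ext_def using hm gT_meas g0 by (subst (asm) integrable_density) auto
  have "(\<integral>w. ?h w \<partial>ext N X) = (\<integral>w. g (X (fst w), snd w) *\<^sub>R ?h w \<partial>(N \<Otimes>\<^sub>M \<beta>))"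
    unfolding ext_def using hm gT_meas g0 by (subst integral_density) auto
  also have "\<dots> = (\<integral>w. (\<integral>y. g (X w, y) *\<^sub>R (F w \<bullet> (K (X w, y) - X w)) \<partial>\<beta>) \<partial>N)"
    using NB.integral_fst'[OF i] by simp
  also have "\<dots> = (\<integral>w. 0 \<partial>N)"
  proof (rule integral_cong_AE)
    show "(\<lambda>w. \<integral>y. g (X w, y) *\<^sub>R (F w \<bullet> (K (X w, y) - X w)) \<partial>\<beta>) \<in> borel_measurable N"
      using B.borel_measurable_lebesgue_integral[of "\<lambda>w y. g (X w, y) *\<^sub>R (F w \<bullet> (K (X w, y) - X w))" N]
        borel_measurable_scaleR[OF gT_meas hm] by (simp add: case_prod_beta')
    show "AE w in N. (\<integral>y. g (X w, y) *\<^sub>R (F w \<bullet> (K (X w, y) - X w)) \<partial>\<beta>) = 0"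
      using AE_X[OF fiber_integrable] AE_X[OF fst_mass] AE_X[OF fst_mean]
    proof eventually_elim
      case (elim w)
      \<comment> \<open>A function that is not integrable has integral 0 by convention, whereas the
        fibre mass is 1.\<close>
      have gi: "integrable \<beta> (\<lambda>y. g (X w, y))"
        using elim(2) not_integrable_integral_eq by fastforce
      have "(\<integral>y. g (X w, y) *\<^sub>R (F w \<bullet> (K (X w, y) - X w)) \<partial>\<beta>)
         = (\<integral>y. F w \<bullet> (g (X w, y) *\<^sub>R K (X w, y) - g (X w, y) *\<^sub>R X w) \<partial>\<beta>)"
        by (simp add: inner_diff_right algebra_simps)
      also have "\<dots> = F w \<bullet> (\<integral>y. g (X w, y) *\<^sub>R K (X w, y) - g (X w, y) *\<^sub>R X w \<partial>\<beta>)"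
        using elim(1) gi by (intro integral_inner_right) auto
      also have "(\<integral>y. g (X w, y) *\<^sub>R K (X w, y) - g (X w, y) *\<^sub>R X w \<partial>\<beta>) = X w - 1 *\<^sub>R X w"
        using elim gi by simp
      finally show ?case by simp
    qed
  qed simp
  finally show ?thesis by simp
qed

text \<open>Replaces a test field in the new variable by its conditional expectation, which is a
  function of X alone and so can be used in constraints that already hold on N.\<close>

lemma ext_conditional:
  assumes \<Phi>: "\<Phi> \<in> borel_measurable borel" and C: "\<And>y. norm (\<Phi> y) \<le> C" and V: "square_integrable N V"
  shows "(\<integral>w. \<Phi> (snd w) \<bullet> V (fst w) \<partial>ext N X) = (\<integral>w. (\<integral>y. g (X w, y) *\<^sub>R \<Phi> y \<partial>\<beta>) \<bullet> V w \<partial>N)"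
proof -
  interpret N: prob_space N by (rule N)
  interpret B: prob_space \<beta> by (rule prob)
  interpret NB: pair_prob_space N \<beta> ..
  interpret E: prob_space "ext N X" by (rule prob_ext)
  let ?h = "\<lambda>w. \<Phi> (snd w) \<bullet> V (fst w)"
  have Vm[measurable]: "V \<in> borel_measurable N" using V by (rule square_integrableD)
  have \<Phi>m[measurable]: "\<Phi> \<in> borel_measurable \<beta>" by (rule borel_measurable_sets_borel[OF sets_\<beta> \<Phi>])
  have hm: "?h \<in> borel_measurable (N \<Otimes>\<^sub>M \<beta>)" by measurable
  have "square_integrable (ext N X) (\<lambda>w. \<Phi> (snd w))"
    by (rule E.square_integrable_bounded[where C=C]) (use C in \<open>auto intro!: measurable_ext\<close>)
  then have "integrable (ext N X) ?h" by (rule square_integrable_inner[OF _ sq_ext_fst[OF V]])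
  then have i: "integrable (N \<Otimes>\<^sub>M \<beta>) (\<lambda>w. g (X (fst w), snd w) *\<^sub>R ?h w)"
    unfolding ext_def using hm gT_meas g0 by (subst (asm) integrable_density) auto
  have "(\<integral>w. ?h w \<partial>ext N X) = (\<integral>w. g (X (fst w), snd w) *\<^sub>R ?h w \<partial>(N \<Otimes>\<^sub>M \<beta>))"
    unfolding ext_def using hm gT_meas g0 by (subst integral_density) auto
  also have "\<dots> = (\<integral>w. (\<integral>y. g (X w, y) *\<^sub>R (\<Phi> y \<bullet> V w) \<partial>\<beta>) \<partial>N)"
    using NB.integral_fst'[OF i] by simp
  also have "\<dots> = (\<integral>w. (\<integral>y. g (X w, y) *\<^sub>R \<Phi> y \<partial>\<beta>) \<bullet> V w \<partial>N)"
  proof (rule Bochner_Integration.integral_cong[OF refl])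
    fix w
    have gm: "(\<lambda>y. g (X w, y)) \<in> borel_measurable \<beta>"
      by (intro borel_measurable_sets_borel[OF sets_\<beta>] measurable_compose[OF measurable_Pair_borel g]) auto
    have "integrable \<beta> (\<lambda>y. g (X w, y) *\<^sub>R \<Phi> y)"
    proof (rule B.integrable_const_bound[where B="M * C"])
      show "AE y in \<beta>. norm (g (X w, y) *\<^sub>R \<Phi> y) \<le> M * C"
        using g0 mult_mono[OF gM C order_trans[OF g0 gM] norm_ge_zero] by (intro AE_I2) simp
    qed (use gm in measurable)
    then have "(\<integral>y. (g (X w, y) *\<^sub>R \<Phi> y) \<bullet> V w \<partial>\<beta>) = (\<integral>y. g (X w, y) *\<^sub>R \<Phi> y \<partial>\<beta>) \<bullet> V w"
      by (intro integral_inner_left) auto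
    then show "(\<integral>y. g (X w, y) *\<^sub>R (\<Phi> y \<bullet> V w) \<partial>\<beta>) = (\<integral>y. g (X w, y) *\<^sub>R \<Phi> y \<partial>\<beta>) \<bullet> V w" by simp
  qed
  finally show ?thesis .
qed

end

text \<open>The conditional expectation of a bounded Borel field is again an admissible test field;
  the bound M on the density serves here.\<close>

lemma conditional_bounded:
  fixes \<Phi> :: "'a \<Rightarrow> 'a"
  assumes \<Phi>: "\<Phi> \<in> borel_measurable borel" and C: "\<And>y. norm (\<Phi> y) \<le> C"
  shows "(\<lambda>x. \<integral>y. g (x, y) *\<^sub>R \<Phi> y \<partial>\<beta>) \<in> borel_measurable borel"
    and "norm (\<integral>y. g (x, y) *\<^sub>R \<Phi> y \<partial>\<beta>) \<le> M * C"
proof -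
  interpret B: prob_space \<beta> by (rule prob)
  have "(\<lambda>z. g z *\<^sub>R \<Phi> (snd z)) \<in> borel_measurable (borel :: ('a \<times> 'a) measure)"
    by (intro borel_measurable_scaleR g measurable_compose[OF snd_borel \<Phi>])
  then have "(\<lambda>z. g z *\<^sub>R \<Phi> (snd z)) \<in> borel_measurable (borel \<Otimes>\<^sub>M \<beta>)"
    by (rule borel_measurable_sets_borel[OF sets_borel_pair])
  then show "(\<lambda>x. \<integral>y. g (x, y) *\<^sub>R \<Phi> y \<partial>\<beta>) \<in> borel_measurable borel"
    using B.borel_measurable_lebesgue_integral[of "\<lambda>x y. g (x, y) *\<^sub>R \<Phi> y" borel] by (simp add: case_prod_beta')
  have b: "norm (g (x, y) *\<^sub>R \<Phi> y) \<le> M * C" for y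
    using g0[of "(x, y)"] mult_mono[OF gM[of "(x, y)"] C[of y] order_trans[OF g0 gM] norm_ge_zero] by simp
  have "norm (\<integral>y. g (x, y) *\<^sub>R \<Phi> y \<partial>\<beta>) \<le> (\<integral>y. norm (g (x, y) *\<^sub>R \<Phi> y) \<partial>\<beta>)" by (rule integral_norm_bound)
  also have "\<dots> \<le> (\<integral>y. M * C \<partial>\<beta>)"
    by (intro integral_mono' B.integrable_const b) (use order_trans[OF norm_ge_zero b] in auto)
  finally show "norm (\<integral>y. g (x, y) *\<^sub>R \<Phi> y \<partial>\<beta>) \<le> M * C" by (simp add: B.prob_space)
qed

lemma distr_id: "distr \<alpha> borel (\<lambda>x. x) = \<alpha>"
  using distr_id2[of borel \<alpha>] sets_\<alpha> by simp

lemma id_meas: "(\<lambda>x. x) \<in> borel_measurable \<alpha>"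
  by (rule borel_measurable_sets_borel[OF sets_\<alpha>]) simp

text \<open>The coupling itself is the extension of \<alpha> by the identity, so the statements
  about \<open>ext\<close> specialise to it.\<close>

lemma ext_id: "ext \<alpha> (\<lambda>x. x) = law"
  by (simp add: ext_def law_def)

lemmas law_facts = prob_ext[OF prob(1) id_meas distr_id, unfolded ext_id]
  distr_ext_fst[OF prob(1) id_meas distr_id, unfolded ext_id]
  sq_ext_fst[OF prob(1) id_meas distr_id, unfolded ext_id]
  sq_ext_K[OF prob(1) id_meas distr_id, unfolded ext_id prod.collapse]
  sq_ext_D[OF prob(1) id_meas distr_id, unfolded ext_id prod.collapse]
  ext_orth[OF prob(1) id_meas distr_id, unfolded ext_id prod.collapse]

lemma prob_law: "prob_space law" by (rule law_facts)

lemma distr_law_fst: "distr law borel fst = \<alpha>"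
  using law_facts(2) sets_\<alpha> distr_cong[of law law \<alpha> borel fst fst] by simp

lemma sq_\<alpha>: "square_integrable \<alpha> (\<lambda>x. x)"
  using id_meas P2_D(4)[OF \<alpha>] by (simp add: square_integrable_def)

definition cost :: real where
  "cost = (\<integral>z. (norm (K z))\<^sup>2 \<partial>law)"

text \<open>Pythagoras: K - X is orthogonal to X, so E|K|^2 = E|X|^2 + E|K - X|^2.\<close>

lemma integral_fst_dist: "(\<integral>z. (norm (K z - fst z))\<^sup>2 \<partial>law) = cost - m2 \<alpha>"
proof -
  have f: "fst \<in> borel_measurable law"
    by (rule borel_measurable_sets_borel[OF sets_law fst_borel])
  have "cost = (\<integral>z. (norm (fst z + (K z - fst z)))\<^sup>2 \<partial>law)" by (simp add: cost_def)
  also have "\<dots> = (\<integral>z. (norm (fst z))\<^sup>2 \<partial>law) + (\<integral>z. (norm (K z - fst z))\<^sup>2 \<partial>law)"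
    by (intro integral_norm_sq_add law_facts(3)[OF sq_\<alpha>] law_facts(5) law_facts(6)[OF sq_\<alpha>])
  also have "(\<integral>z. (norm (fst z))\<^sup>2 \<partial>law) = m2 \<alpha>"
    using integral_distr[OF f, of "\<lambda>x. (norm x)\<^sup>2"] by (simp add: m2_def distr_law_fst)
  finally show ?thesis by simp
qed

lemma law_constraint_fst:
  assumes \<Phi>: "\<Phi> \<in> borel_measurable borel" "bounded (range \<Phi>)"
  shows "(\<integral>z. \<Phi> (fst z) \<bullet> K z \<partial>law) = (\<integral>x. \<Phi> x \<bullet> x \<partial>\<alpha>)"
proof -
  interpret A: prob_space \<alpha> by (rule prob)
  obtain C where C: "\<And>y. norm (\<Phi> y) \<le> C" using \<Phi>(2) by (auto simp: bounded_iff)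
  have f: "fst \<in> borel_measurable law"
    by (rule borel_measurable_sets_borel[OF sets_law]) (intro borel_measurable_continuous_onI continuous_intros)
  have sq: "square_integrable \<alpha> \<Phi>"
    by (rule A.square_integrable_bounded[where C=C]) (use C borel_measurable_sets_borel[OF sets_\<alpha> \<Phi>(1)] in auto)
  have "(\<integral>z. \<Phi> (fst z) \<bullet> K z \<partial>law) = (\<integral>z. \<Phi> (fst z) \<bullet> fst z + \<Phi> (fst z) \<bullet> (K z - fst z) \<partial>law)"
    by (simp add: inner_diff_right)
  also have "\<dots> = (\<integral>z. \<Phi> (fst z) \<bullet> fst z \<partial>law) + 0"
    using square_integrable_inner[OF law_facts(3)[OF sq] law_facts(3)[OF sq_\<alpha>]]
      square_integrable_inner[OF law_facts(3)[OF sq] law_facts(5)] law_facts(6)[OF sq] by simp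
  also have "\<dots> = (\<integral>x. \<Phi> x \<bullet> x \<partial>\<alpha>)"
    using integral_distr[OF f, of "\<lambda>x. \<Phi> x \<bullet> x"] \<Phi>(1) by (simp add: distr_law_fst)
  finally show ?thesis .
qed

text \<open>The locale is symmetric in its marginals; the facts about the second coordinate are
  those about the first, read in the swapped coupling.\<close>

lemma swap_coupling: "martingale_coupling \<beta> \<alpha> (\<lambda>z. g (snd z, fst z)) (\<lambda>z. K (snd z, fst z)) M"
proof -
  interpret A: prob_space \<alpha> by (rule prob)
  interpret B: prob_space \<beta> by (rule prob)
  interpret AB: pair_prob_space \<alpha> \<beta> ..
  have sm: "(\<lambda>z. (snd z, fst z)) \<in> borel_measurable (borel :: ('a \<times> 'a) measure)"
    by (intro borel_measurable_continuous_onI continuous_intros)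
  show ?thesis
  proof
    show "integrable (\<beta> \<Otimes>\<^sub>M \<alpha>) (\<lambda>z. g (snd z, fst z) * (norm (K (snd z, fst z)))\<^sup>2)"
      using AB.integrable_product_swap[OF K_sq] by (simp add: case_prod_beta')
  qed (use \<alpha> \<beta> g0 gM fst_mass fst_mean snd_mass snd_mean measurable_compose[OF sm g] measurable_compose[OF sm K] in auto)
qed

lemma law_swap: "martingale_coupling.law \<beta> \<alpha> (\<lambda>z. g (snd z, fst z)) = distr law borel (\<lambda>z. (snd z, fst z))"
proof -
  interpret S: martingale_coupling \<beta> \<alpha> "\<lambda>z. g (snd z, fst z)" "\<lambda>z. K (snd z, fst z)" M by (rule swap_coupling)
  interpret A: prob_space \<alpha> by (rule prob)
  interpret B: prob_space \<beta> by (rule prob)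
  interpret BA: pair_prob_space \<beta> \<alpha> ..
  have sw: "(\<lambda>z. (snd z, fst z)) \<in> measurable (\<alpha> \<Otimes>\<^sub>M \<beta>) (\<beta> \<Otimes>\<^sub>M \<alpha>)" by measurable
  have gm: "(\<lambda>z. ennreal (g (snd z, fst z))) \<in> borel_measurable (\<beta> \<Otimes>\<^sub>M \<alpha>)"
    using borel_measurable_sets_borel[OF S.sets_pair S.g] by measurable
  have "\<beta> \<Otimes>\<^sub>M \<alpha> = distr (\<alpha> \<Otimes>\<^sub>M \<beta>) (\<beta> \<Otimes>\<^sub>M \<alpha>) (\<lambda>z. (snd z, fst z))"
    using BA.distr_pair_swap by (simp add: case_prod_beta')
  then have "S.law = density (distr (\<alpha> \<Otimes>\<^sub>M \<beta>) (\<beta> \<Otimes>\<^sub>M \<alpha>) (\<lambda>z. (snd z, fst z))) (\<lambda>z. ennreal (g (snd z, fst z)))"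
    by (simp add: S.law_def)
  also have "\<dots> = distr law (\<beta> \<Otimes>\<^sub>M \<alpha>) (\<lambda>z. (snd z, fst z))"
    by (subst density_distr[OF gm sw]) (simp add: law_def)
  also have "\<dots> = distr law borel (\<lambda>z. (snd z, fst z))"
    by (rule distr_cong) (simp_all add: S.sets_pair)
  finally show ?thesis .
qed

lemma integral_law_swap:
  fixes f :: "'a \<times> 'a \<Rightarrow> real"
  assumes "f \<in> borel_measurable borel"
  shows "(\<integral>z. f z \<partial>law) = (\<integral>z. f (snd z, fst z) \<partial>martingale_coupling.law \<beta> \<alpha> (\<lambda>z. g (snd z, fst z)))"
proof -
  have sm: "(\<lambda>z. (snd z, fst z)) \<in> borel_measurable (borel :: ('a \<times> 'a) measure)"
    by (intro borel_measurable_continuous_onI continuous_intros)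
  show ?thesis
    unfolding law_swap
    using borel_measurable_sets_borel[OF sets_law sm] measurable_compose[OF sm assms] by (subst integral_distr) auto
qed

lemma cost_swap: "martingale_coupling.cost \<beta> \<alpha> (\<lambda>z. g (snd z, fst z)) (\<lambda>z. K (snd z, fst z)) = cost"
proof -
  interpret S: martingale_coupling \<beta> \<alpha> "\<lambda>z. g (snd z, fst z)" "\<lambda>z. K (snd z, fst z)" M by (rule swap_coupling)
  show ?thesis unfolding cost_def S.cost_def by (rule integral_law_swap[symmetric]) measurable
qed

lemma distr_law_snd: "distr law borel snd = \<beta>"
proof -
  interpret S: martingale_coupling \<beta> \<alpha> "\<lambda>z. g (snd z, fst z)" "\<lambda>z. K (snd z, fst z)" M by (rule swap_coupling)
  have sm: "(\<lambda>z. (snd z, fst z)) \<in> borel_measurable (borel :: ('a \<times> 'a) measure)"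
    "fst \<in> borel_measurable (borel :: ('a \<times> 'a) measure)"
    by (intro borel_measurable_continuous_onI continuous_intros)+
  have "\<beta> = distr (distr law borel (\<lambda>z. (snd z, fst z))) borel fst"
    using S.distr_law_fst law_swap by simp
  also have "\<dots> = distr law borel snd"
    using borel_measurable_sets_borel[OF sets_law sm(1)] sm(2) by (subst distr_distr) (auto simp: comp_def)
  finally show ?thesis by simp
qed

lemma integral_snd_dist: "(\<integral>z. (norm (K z - snd z))\<^sup>2 \<partial>law) = cost - m2 \<beta>"
proof -
  interpret S: martingale_coupling \<beta> \<alpha> "\<lambda>z. g (snd z, fst z)" "\<lambda>z. K (snd z, fst z)" M by (rule swap_coupling)
  have "(\<lambda>z. (norm (K z - snd z))\<^sup>2) \<in> borel_measurable borel"
    using borel_measurable_diff[OF K snd_borel] by measurable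
  then show ?thesis using integral_law_swap S.integral_fst_dist cost_swap by simp
qed

lemma law_constraint_snd:
  assumes \<Phi>: "\<Phi> \<in> borel_measurable borel" "bounded (range \<Phi>)"
  shows "(\<integral>z. \<Phi> (snd z) \<bullet> K z \<partial>law) = (\<integral>x. \<Phi> x \<bullet> x \<partial>\<beta>)"
proof -
  interpret S: martingale_coupling \<beta> \<alpha> "\<lambda>z. g (snd z, fst z)" "\<lambda>z. K (snd z, fst z)" M by (rule swap_coupling)
  have "(\<lambda>z. \<Phi> (snd z) \<bullet> K z) \<in> borel_measurable borel"
    by (intro borel_measurable_inner K measurable_compose[OF snd_borel \<Phi>(1)])
  then show ?thesis using integral_law_swap S.law_constraint_fst[OF \<Phi>] by simp
qed

lemma sq_law: "square_integrable law fst" "square_integrable law snd" "square_integrable law K"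
proof -
  show "square_integrable law fst" "square_integrable law K" using law_facts(3)[OF sq_\<alpha>] law_facts(4) by auto
  have sm: "snd \<in> borel_measurable law"
    by (rule borel_measurable_sets_borel[OF sets_law]) (intro borel_measurable_continuous_onI continuous_intros)
  have "square_integrable (distr law borel snd) (\<lambda>x. x)"
    unfolding distr_law_snd square_integrable_def using P2_D(4)[OF \<beta>] sets_\<beta>
    by (auto intro: borel_measurable_sets_borel)
  then show "square_integrable law snd" using square_integrable_distr[OF sm, of "\<lambda>x. x"] by simp
qed

text \<open>If the cost barely exceeds both second moments, then K is close to both coordinates, and
  hence the coordinates are close to each other.\<close>

lemma integral_dist_le: "(\<integral>z. (norm (snd z - fst z))\<^sup>2 \<partial>law) \<le> 2 * (cost - m2 \<alpha>) + 2 * (cost - m2 \<beta>)"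
proof -
  note i1 = square_integrableD(2)[OF square_integrable_diff[OF sq_law(3,1)]]
  note i2 = square_integrableD(2)[OF square_integrable_diff[OF sq_law(3,2)]]
  have "(\<integral>z. (norm (snd z - fst z))\<^sup>2 \<partial>law) \<le> (\<integral>z. 2 * (norm (K z - fst z))\<^sup>2 + 2 * (norm (K z - snd z))\<^sup>2 \<partial>law)"
  proof (rule integral_mono)
    fix z
    have "0 \<le> (norm ((K z - fst z) + (K z - snd z)))\<^sup>2" by simp
    then show "(norm (snd z - fst z))\<^sup>2 \<le> 2 * (norm (K z - fst z))\<^sup>2 + 2 * (norm (K z - snd z))\<^sup>2"
      by (simp add: power2_norm_eq_inner inner_diff_left inner_diff_right inner_add_left inner_add_right inner_commute)
  qed (use i1 i2 square_integrableD(2)[OF square_integrable_diff[OF sq_law(2,1)]] in auto)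
  also have "\<dots> = 2 * (\<integral>z. (norm (K z - fst z))\<^sup>2 \<partial>law) + 2 * (\<integral>z. (norm (K z - snd z))\<^sup>2 \<partial>law)"
    using i1 i2 by simp
  finally show ?thesis by (simp add: integral_fst_dist integral_snd_dist)
qed

end

context martingale_coupling
begin

lemma distr_ext_snd:
  assumes N: "prob_space N" and X: "X \<in> borel_measurable N" and law_X: "distr N borel X = \<alpha>"
  shows "distr (ext N X) borel snd = \<beta>"
proof -
  have "\<beta> = distr (distr (ext N X) borel (\<lambda>w. (X (fst w), snd w))) borel snd"
    unfolding distr_ext_T[OF assms] by (rule distr_law_snd[symmetric])
  also have "\<dots> = distr (ext N X) borel snd"
    using measurable_ext[OF assms T_meas[OF assms]] snd_borel by (subst distr_distr) (auto simp: comp_def)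
  finally show ?thesis by simp
qed

lemma ext_constraint:
  assumes N: "prob_space N" and X: "X \<in> borel_measurable N" and law_X: "distr N borel X = \<alpha>"
    and \<Phi>: "\<Phi> \<in> borel_measurable borel" "bounded (range \<Phi>)"
  shows "(\<integral>w. \<Phi> (snd w) \<bullet> K (X (fst w), snd w) \<partial>ext N X) = (\<integral>y. \<Phi> y \<bullet> y \<partial>\<beta>)"
proof -
  have m: "(\<lambda>z. \<Phi> (snd z) \<bullet> K z) \<in> borel_measurable borel"
    by (intro borel_measurable_inner K measurable_compose[OF snd_borel \<Phi>(1)])
  show ?thesis
    using integral_ext_T[OF assms(1-3) m] law_constraint_snd[OF \<Phi>] by simp
qed

lemma integral_ext_D:
  assumes N: "prob_space N" and X: "X \<in> borel_measurable N" and law_X: "distr N borel X = \<alpha>"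
  shows "(\<integral>w. (norm (K (X (fst w), snd w) - X (fst w)))\<^sup>2 \<partial>ext N X) = cost - m2 \<alpha>"
proof -
  have m: "(\<lambda>z. (norm (K z - fst z))\<^sup>2) \<in> borel_measurable borel"
    using borel_measurable_diff[OF K fst_borel] by measurable
  show ?thesis using integral_ext_T[OF assms m] integral_fst_dist by simp
qed

lemma integral_ext_dist_le:
  assumes N: "prob_space N" and X: "X \<in> borel_measurable N" and law_X: "distr N borel X = \<alpha>"
  shows "square_integrable (ext N X) (\<lambda>w. snd w - X (fst w))"
    and "(\<integral>w. (norm (snd w - X (fst w)))\<^sup>2 \<partial>ext N X) \<le> 2 * (cost - m2 \<alpha>) + 2 * (cost - m2 \<beta>)"
proof -
  have m0: "(\<lambda>z. snd z - fst z) \<in> borel_measurable (borel :: ('a \<times> 'a) measure)"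
    by (rule borel_measurable_diff[OF snd_borel fst_borel])
  then have m: "(\<lambda>z. (norm (snd z - fst z))\<^sup>2) \<in> borel_measurable (borel :: ('a \<times> 'a) measure)"
    by measurable
  have "square_integrable law (\<lambda>z. snd z - fst z)" by (intro square_integrable_diff sq_law)
  then have "square_integrable (distr (ext N X) borel (\<lambda>w. (X (fst w), snd w))) (\<lambda>z. snd z - fst z)"
    unfolding distr_ext_T[OF assms] .
  then show "square_integrable (ext N X) (\<lambda>w. snd w - X (fst w))"
    unfolding square_integrable_distr[OF measurable_ext[OF assms T_meas[OF assms]] m0] by simp
  show "(\<integral>w. (norm (snd w - X (fst w)))\<^sup>2 \<partial>ext N X) \<le> 2 * (cost - m2 \<alpha>) + 2 * (cost - m2 \<beta>)"
    using integral_ext_T[OF assms m] integral_dist_le by simp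
qed

end

text \<open>If \<open>X'\<close>, \<open>Y'\<close> are coupled to \<open>X\<close>, \<open>Y\<close> through martingale couplings with third variables
  \<open>K1\<close>, \<open>K2\<close>, conditionally independently given \<open>(X, Y)\<close>, then \<open>k + (K1 - X) + (K2 - Y)\<close> is
  admissible for \<open>(X', Y')\<close>, and its three terms are orthogonal.\<close>
lemma GammaQ_transfer:
  fixes \<alpha> \<beta> \<alpha>' \<beta>' :: "'a::euclidean_space measure"
  assumes P: "P \<in> GammaQ \<alpha> \<beta>" and E: "energy P \<le> ennreal E" "0 \<le> E"
    and c1: "martingale_coupling \<alpha> \<alpha>' g1 K1 M1" and c2: "martingale_coupling \<beta> \<beta>' g2 K2 M2"
    and d1: "martingale_coupling.cost \<alpha> \<alpha>' g1 K1 - m2 \<alpha> \<le> e1" "martingale_coupling.cost \<alpha> \<alpha>' g1 K1 - m2 \<alpha>' \<le> e1"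
    and d2: "martingale_coupling.cost \<beta> \<beta>' g2 K2 - m2 \<beta> \<le> e2" "martingale_coupling.cost \<beta> \<beta>' g2 K2 - m2 \<beta>' \<le> e2"
  obtains N :: "((('a \<times> 'a) \<times> 'a) \<times> 'a) measure" and X Y K P' where
    "P' \<in> GammaQ \<alpha>' \<beta>'" "energy P' \<le> ennreal (E + e1 + e2)"
    "prob_space N" "X \<in> borel_measurable N" "Y \<in> borel_measurable N"
    "distr N borel X = gam P" "distr N borel Y = gam P'"
    "square_integrable N K" "square_integrable N (\<lambda>w. vdens P (X w))"
    "(\<integral>w. (norm (K w - vdens P (X w)))\<^sup>2 \<partial>N) \<le> e1 + e2"
    "integrable N (\<lambda>w. (norm (Y w - X w))\<^sup>2)" "(\<integral>w. (norm (Y w - X w))\<^sup>2 \<partial>N) \<le> 4 * (e1 + e2)"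
    "\<And>f. f \<in> borel_measurable borel \<Longrightarrow> bounded (range f) \<Longrightarrow>
      (\<integral>z. f z \<bullet> snd P' z \<partial>fst P') = (\<integral>w. fst (f (Y w)) + snd (f (Y w)) \<bullet> K w \<partial>N)"
proof -
  interpret C1: martingale_coupling \<alpha> \<alpha>' g1 K1 M1 by (rule c1)
  interpret C2: martingale_coupling \<beta> \<beta>' g2 K2 M2 by (rule c2)
  interpret P: nonneg_vmeas P by (rule GammaQ_nonneg_vmeas[OF P])
  have ac: "AE z in fst P. fst (snd P z) = 0 \<longrightarrow> snd (snd P z) = 0"
    and m1: "distr (gam P) borel fst = \<alpha>" and m2: "distr (gam P) borel snd = \<beta>"
    and q1: "\<And>\<Phi>. \<Phi> \<in> borel_measurable borel \<Longrightarrow> bounded (range \<Phi>) \<Longrightarrow> (\<integral>z. \<Phi> (fst z) \<bullet> vdens P z \<partial>gam P) = (\<integral>x. \<Phi> x \<bullet> x \<partial>\<alpha>)"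
    and q2: "\<And>\<Phi>. \<Phi> \<in> borel_measurable borel \<Longrightarrow> bounded (range \<Phi>) \<Longrightarrow> (\<integral>z. \<Phi> (snd z) \<bullet> vdens P z \<partial>gam P) = (\<integral>x. \<Phi> x \<bullet> x \<partial>\<beta>)"
    using P unfolding GammaQ_iff[OF C1.prob(1) C1.sets_\<alpha> C2.prob(1) C2.sets_\<alpha>] by blast+
  define N0 where "N0 = gam P"
  define V where "V = vdens P"
  have sN0: "sets N0 = sets borel" by (simp add: N0_def sets_gam[OF P.VM])
  have fm: "fst \<in> borel_measurable N0" "snd \<in> borel_measurable N0"
    by (rule borel_measurable_sets_borel[OF sN0 C1.fst_borel] borel_measurable_sets_borel[OF sN0 C1.snd_borel])+
  have pN0: "prob_space N0"
    by (rule prob_space_distrD[OF fm(1)]) (use m1 C1.prob in \<open>simp add: N0_def\<close>)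
  have sqV: "square_integrable N0 V"
    unfolding square_integrable_def N0_def V_def
    using P.dual_le_energy(1)[OF ac E, of "\<lambda>_. 0"] P.borelG[OF vdens_borel[OF P.VM]] by simp
  have V2: "(\<integral>z. (norm (V z))\<^sup>2 \<partial>N0) \<le> E"
    using P.dual_le_energy(2)[OF ac E, of "\<lambda>_. 0"] by (simp add: N0_def V_def)
  have L0: "distr N0 borel fst = \<alpha>" "distr N0 borel snd = \<beta>" using m1 m2 by (simp_all add: N0_def)
  \<comment> \<open>\<open>N0\<close> carries (X, Y); \<open>N1\<close> adds X' drawn given X, and
    \<open>N2\<close> below adds Y' drawn given Y. The increments \<open>D1\<close> and
    \<open>D2\<close> belong to these two extensions.\<close>
  define N1 where "N1 = C1.ext N0 fst"
  note A1 = pN0 fm(1) L0(1)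
  have pN1: "prob_space N1" unfolding N1_def by (rule C1.prob_ext[OF A1])
  have fst1: "fst \<in> measurable N1 N0" unfolding N1_def by (rule C1.measurable_ext[OF A1]) simp
  have d10: "distr N1 N0 fst = N0" unfolding N1_def by (rule C1.distr_ext_fst[OF A1])
  have s1: "(\<lambda>w. snd (fst w)) \<in> borel_measurable N1" by (rule measurable_compose[OF fst1 fm(2)])
  have L1: "distr N1 borel (\<lambda>w. snd (fst w)) = \<beta>"
    using distr_distr[OF fm(2) fst1] L0(2) by (simp add: d10 comp_def)
  define N2 where "N2 = C2.ext N1 (\<lambda>w. snd (fst w))"
  note A2 = pN1 s1 L1
  have pN2: "prob_space N2" unfolding N2_def by (rule C2.prob_ext[OF A2])
  interpret N1: prob_space N1 by (rule pN1)
  interpret N2: prob_space N2 by (rule pN2)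
  have fst2: "fst \<in> measurable N2 N1" unfolding N2_def by (rule C2.measurable_ext[OF A2]) simp
  have d21: "distr N2 N1 fst = N1" unfolding N2_def by (rule C2.distr_ext_fst[OF A2])
  have snd1: "snd \<in> borel_measurable N1"
    unfolding N1_def by (rule C1.measurable_ext[OF A1]) (simp add: measurable_cong_sets[OF refl C1.sets_\<beta>, symmetric])
  have snd2: "snd \<in> borel_measurable N2"
    unfolding N2_def by (rule C2.measurable_ext[OF A2]) (simp add: measurable_cong_sets[OF refl C2.sets_\<beta>, symmetric])
  define D1 where "D1 w = K1 (fst (fst w), snd w) - fst (fst w)" for w :: "('a \<times> 'a) \<times> 'a"
  define D2 where "D2 w = K2 (snd (fst (fst w)), snd w) - snd (fst (fst w))" for w :: "(('a \<times> 'a) \<times> 'a) \<times> 'a"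
  define F1 where "F1 w = V (fst w) + D1 w" for w
  define K where "K w = F1 (fst w) + D2 w" for w
  define Y where "Y w = (snd (fst w), snd w)" for w :: "(('a \<times> 'a) \<times> 'a) \<times> 'a"
  define X where "X w = fst (fst w)" for w :: "(('a \<times> 'a) \<times> 'a) \<times> 'a"
  have sqV1: "square_integrable N1 (\<lambda>w. V (fst w))" unfolding N1_def by (rule C1.sq_ext_fst[OF A1 sqV])
  have sqD1: "square_integrable N1 D1" unfolding N1_def D1_def[abs_def] by (rule C1.sq_ext_D[OF A1])
  have sqF1: "square_integrable N1 F1" unfolding F1_def[abs_def] by (rule square_integrable_add[OF sqV1 sqD1])
  have up: "square_integrable N1 F \<Longrightarrow> square_integrable N2 (\<lambda>w. F (fst w))" for F :: "_ \<Rightarrow> 'a"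
    unfolding N2_def by (rule C2.sq_ext_fst[OF A2])
  have sqD2: "square_integrable N2 D2" unfolding N2_def D2_def[abs_def] by (rule C2.sq_ext_D[OF A2])
  have sqK: "square_integrable N2 K" unfolding K_def[abs_def] by (rule square_integrable_add[OF up[OF sqF1] sqD2])
  have o1: "(\<integral>w. F (fst w) \<bullet> D1 w \<partial>N1) = 0" if "square_integrable N0 F" for F
    unfolding N1_def D1_def by (rule C1.ext_orth[OF A1 that])
  have o2: "(\<integral>w. F (fst w) \<bullet> D2 w \<partial>N2) = 0" if "square_integrable N1 F" for F
    unfolding N2_def D2_def by (rule C2.ext_orth[OF A2 that])
  have i21: "(\<integral>w. f (fst w) \<partial>N2) = (\<integral>w. f w \<partial>N1)" if "f \<in> borel_measurable N1" for f :: "_ \<Rightarrow> real"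
    unfolding N2_def by (rule C2.integral_ext_fst[OF A2 that])
  have i10: "(\<integral>w. f (fst w) \<partial>N1) = (\<integral>w. f w \<partial>N0)" if "f \<in> borel_measurable N0" for f :: "_ \<Rightarrow> real"
    unfolding N1_def by (rule C1.integral_ext_fst[OF A1 that])
  have sqm: "(\<lambda>w. (norm (F w))\<^sup>2) \<in> borel_measurable L" if "square_integrable L F" for F :: "'w \<Rightarrow> 'a" and L
    using square_integrableD(1)[OF that] by measurable
  have nD1: "(\<integral>w. (norm (D1 w))\<^sup>2 \<partial>N1) \<le> e1"
    using C1.integral_ext_D[OF A1] d1(1) by (simp add: N1_def D1_def)
  have nD2: "(\<integral>w. (norm (D2 w))\<^sup>2 \<partial>N2) \<le> e2"
    using C2.integral_ext_D[OF A2] d2(1) by (simp add: N2_def D2_def)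
  have nF1: "(\<integral>w. (norm (F1 w))\<^sup>2 \<partial>N1) \<le> E + e1"
  proof -
    have "(\<integral>w. (norm (F1 w))\<^sup>2 \<partial>N1) = (\<integral>w. (norm (V (fst w)))\<^sup>2 \<partial>N1) + (\<integral>w. (norm (D1 w))\<^sup>2 \<partial>N1)"
      unfolding F1_def by (rule integral_norm_sq_add[OF sqV1 sqD1 o1[OF sqV]])
    then show ?thesis using i10[OF sqm[OF sqV]] V2 nD1 by simp
  qed
  have nK: "(\<integral>w. (norm (K w))\<^sup>2 \<partial>N2) \<le> E + e1 + e2"
  proof -
    have "(\<integral>w. (norm (K w))\<^sup>2 \<partial>N2) = (\<integral>w. (norm (F1 (fst w)))\<^sup>2 \<partial>N2) + (\<integral>w. (norm (D2 w))\<^sup>2 \<partial>N2)"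
      unfolding K_def by (rule integral_norm_sq_add[OF up[OF sqF1] sqD2 o2[OF sqF1]])
    then show ?thesis using i21[OF sqm[OF sqF1]] nF1 nD2 by simp
  qed
  have nKV: "(\<integral>w. (norm (K w - V (X w)))\<^sup>2 \<partial>N2) \<le> e1 + e2"
  proof -
    have "K w - V (X w) = D1 (fst w) + D2 w" for w by (simp add: K_def F1_def X_def)
    then have "(\<integral>w. (norm (K w - V (X w)))\<^sup>2 \<partial>N2) = (\<integral>w. (norm (D1 (fst w) + D2 w))\<^sup>2 \<partial>N2)"
      by simp
    also have "\<dots> = (\<integral>w. (norm (D1 (fst w)))\<^sup>2 \<partial>N2) + (\<integral>w. (norm (D2 w))\<^sup>2 \<partial>N2)"
      by (rule integral_norm_sq_add[OF up[OF sqD1] sqD2 o2[OF sqD1]])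
    finally show ?thesis using i21[OF sqm[OF sqD1]] nD1 nD2 by simp
  qed
  have Ym: "Y \<in> borel_measurable N2"
    unfolding Y_def[abs_def] by (rule C1.measurable_Pair_borel[OF measurable_compose[OF fst2 snd1] snd2])
  have "X \<in> measurable N2 N0" unfolding X_def[abs_def] by (rule measurable_compose[OF fst2 fst1])
  then have Xm: "X \<in> borel_measurable N2" by (simp add: measurable_cong_sets[OF refl sN0])
  have X_law: "distr N2 borel X = gam P"
  proof -
    have "distr N2 N0 X = N0"
      using distr_distr[OF fst1 fst2] by (simp add: d10 d21 comp_def X_def[abs_def])
    then show ?thesis using distr_cong[of N2 N2 borel N0 X X] sN0 by (simp add: N0_def)
  qed
  have sqX: "square_integrable N2 (\<lambda>w. V (X w))" unfolding X_def by (rule up[OF sqV1])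
  have l\<alpha>': "distr N2 borel (\<lambda>w. fst (Y w)) = \<alpha>'"
    using distr_distr[OF snd1 fst2] C1.distr_ext_snd[OF A1, folded N1_def] by (simp add: d21 comp_def Y_def)
  have l\<beta>': "distr N2 borel (\<lambda>w. snd (Y w)) = \<beta>'"
    using C2.distr_ext_snd[OF A2] by (simp add: Y_def N2_def)
  have q\<alpha>: "(\<integral>w. \<Phi> (fst (Y w)) \<bullet> K w \<partial>N2) = (\<integral>x. \<Phi> x \<bullet> x \<partial>\<alpha>')"
    if \<Phi>: "\<Phi> \<in> borel_measurable borel" "bounded (range \<Phi>)" for \<Phi>
  proof -
    obtain C where C: "\<And>y. norm (\<Phi> y) \<le> C" using \<Phi>(2) by (auto simp: bounded_iff)
    \<comment> \<open>\<Psi>(X) is the conditional expectation of \<Phi>(X'). The constraint of P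
      says that V and X have the same product with \<Psi>(X), so of V + K1 - X only K1 contributes.
      The increment \<open>D2\<close> drops out, having mean zero given \<open>N1\<close>.\<close>
    define \<Psi> where "\<Psi> x = (\<integral>y. g1 (x, y) *\<^sub>R \<Phi> y \<partial>\<alpha>')" for x
    have \<Psi>m: "\<Psi> \<in> borel_measurable borel" and \<Psi>b: "bounded (range \<Psi>)"
      unfolding \<Psi>_def[abs_def] using C1.conditional_bounded[OF \<Phi>(1) C]
      by (auto intro!: boundedI[of _ "M1 * C"])
    have sq\<Phi>: "square_integrable N1 (\<lambda>w. \<Phi> (snd w))"
      by (rule N1.square_integrable_bounded[where C=C]) (use C measurable_compose[OF snd1 \<Phi>(1)] in auto)
    have sqid: "square_integrable N0 fst" by (rule C1.sq_X[OF A1])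
    have sqid1: "square_integrable N1 (\<lambda>w. fst (fst w))" unfolding N1_def by (rule C1.sq_ext_fst[OF A1 sqid])
    have sqK1: "square_integrable N1 (\<lambda>w. K1 (fst (fst w), snd w))" unfolding N1_def by (rule C1.sq_ext_K[OF A1])
    have c: "(\<integral>w. \<Phi> (snd w) \<bullet> W (fst w) \<partial>N1) = (\<integral>z. \<Psi> (fst z) \<bullet> W z \<partial>N0)" if "square_integrable N0 W" for W
      unfolding N1_def \<Psi>_def by (rule C1.ext_conditional[OF A1 \<Phi>(1) C that])
    have "(\<integral>w. \<Phi> (fst (Y w)) \<bullet> K w \<partial>N2) = (\<integral>w. \<Phi> (snd (fst w)) \<bullet> F1 (fst w) + \<Phi> (snd (fst w)) \<bullet> D2 w \<partial>N2)"
      by (simp add: Y_def K_def inner_add_right)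
    also have "\<dots> = (\<integral>w. \<Phi> (snd (fst w)) \<bullet> F1 (fst w) \<partial>N2)"
      using square_integrable_inner[OF up[OF sq\<Phi>] up[OF sqF1]] square_integrable_inner[OF up[OF sq\<Phi>] sqD2] o2[OF sq\<Phi>] by simp
    also have "\<dots> = (\<integral>w. \<Phi> (snd w) \<bullet> F1 w \<partial>N1)"
      by (rule i21[of "\<lambda>w. \<Phi> (snd w) \<bullet> F1 w"]) (intro borel_measurable_inner square_integrableD(1)[OF sq\<Phi>] square_integrableD(1)[OF sqF1])
    also have "\<dots> = (\<integral>w. \<Phi> (snd w) \<bullet> V (fst w) + \<Phi> (snd w) \<bullet> K1 (fst (fst w), snd w) - \<Phi> (snd w) \<bullet> fst (fst w) \<partial>N1)"
      by (simp add: F1_def D1_def inner_add_right inner_diff_right add_diff_eq)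
    also have "\<dots> = (\<integral>w. \<Phi> (snd w) \<bullet> V (fst w) \<partial>N1) + (\<integral>w. \<Phi> (snd w) \<bullet> K1 (fst (fst w), snd w) \<partial>N1) - (\<integral>w. \<Phi> (snd w) \<bullet> fst (fst w) \<partial>N1)"
      using square_integrable_inner[OF sq\<Phi> sqV1] square_integrable_inner[OF sq\<Phi> sqK1] square_integrable_inner[OF sq\<Phi> sqid1] by simp
    also have "(\<integral>w. \<Phi> (snd w) \<bullet> V (fst w) \<partial>N1) = (\<integral>x. \<Psi> x \<bullet> x \<partial>\<alpha>)"
      using c[OF sqV] q1[OF \<Psi>m \<Psi>b] by (simp add: N0_def V_def)
    also have "(\<integral>w. \<Phi> (snd w) \<bullet> fst (fst w) \<partial>N1) = (\<integral>x. \<Psi> x \<bullet> x \<partial>\<alpha>)"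
      using c[OF sqid] integral_distr[OF fm(1), of "\<lambda>x. \<Psi> x \<bullet> x"] \<Psi>m by (simp add: L0(1))
    also have "(\<integral>w. \<Phi> (snd w) \<bullet> K1 (fst (fst w), snd w) \<partial>N1) = (\<integral>x. \<Phi> x \<bullet> x \<partial>\<alpha>')"
      unfolding N1_def by (rule C1.ext_constraint[OF A1 \<Phi>])
    finally show ?thesis by simp
  qed
  have q\<beta>: "(\<integral>w. \<Phi> (snd (Y w)) \<bullet> K w \<partial>N2) = (\<integral>x. \<Phi> x \<bullet> x \<partial>\<beta>')"
    if \<Phi>: "\<Phi> \<in> borel_measurable borel" "bounded (range \<Phi>)" for \<Phi>
  proof -
    obtain C where C: "\<And>y. norm (\<Phi> y) \<le> C" using \<Phi>(2) by (auto simp: bounded_iff)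
    \<comment> \<open>For Y' the first increment has to vanish as well: \<Phi>(Y') is first replaced
      by \<Psi>(Y), which lives on \<open>N0\<close> and is therefore orthogonal to
      \<open>D1\<close>.\<close>
    define \<Psi> where "\<Psi> x = (\<integral>y. g2 (x, y) *\<^sub>R \<Phi> y \<partial>\<beta>')" for x
    have \<Psi>m: "\<Psi> \<in> borel_measurable borel" and \<Psi>b: "bounded (range \<Psi>)" and \<Psi>C: "\<And>x. norm (\<Psi> x) \<le> M2 * C"
      unfolding \<Psi>_def[abs_def] using C2.conditional_bounded[OF \<Phi>(1) C]
      by (auto intro!: boundedI[of _ "M2 * C"])
    interpret N0: prob_space N0 by (rule pN0)
    have sq\<Psi>: "square_integrable N0 (\<lambda>z. \<Psi> (snd z))"
      by (rule N0.square_integrable_bounded[where C="M2 * C"]) (use \<Psi>C measurable_compose[OF fm(2) \<Psi>m] in auto)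
    have sq\<Psi>1: "square_integrable N1 (\<lambda>w. \<Psi> (snd (fst w)))" unfolding N1_def by (rule C1.sq_ext_fst[OF A1 sq\<Psi>])
    have sq\<Phi>: "square_integrable N2 (\<lambda>w. \<Phi> (snd w))"
      by (rule N2.square_integrable_bounded[where C=C]) (use C measurable_compose[OF snd2 \<Phi>(1)] in auto)
    have sqid: "square_integrable N1 (\<lambda>w. snd (fst w))" by (rule C2.sq_X[OF A2])
    have sqK2: "square_integrable N2 (\<lambda>w. K2 (snd (fst (fst w)), snd w))" unfolding N2_def by (rule C2.sq_ext_K[OF A2])
    have c: "(\<integral>w. \<Phi> (snd w) \<bullet> W (fst w) \<partial>N2) = (\<integral>w. \<Psi> (snd (fst w)) \<bullet> W w \<partial>N1)" if "square_integrable N1 W" for W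
      unfolding N2_def \<Psi>_def by (rule C2.ext_conditional[OF A2 \<Phi>(1) C that])
    have "(\<integral>w. \<Phi> (snd (Y w)) \<bullet> K w \<partial>N2) = (\<integral>w. \<Phi> (snd w) \<bullet> F1 (fst w) + \<Phi> (snd w) \<bullet> K2 (snd (fst (fst w)), snd w) - \<Phi> (snd w) \<bullet> snd (fst (fst w)) \<partial>N2)"
      by (simp add: Y_def K_def D2_def inner_add_right inner_diff_right add_diff_eq)
    also have "\<dots> = (\<integral>w. \<Phi> (snd w) \<bullet> F1 (fst w) \<partial>N2) + (\<integral>w. \<Phi> (snd w) \<bullet> K2 (snd (fst (fst w)), snd w) \<partial>N2) - (\<integral>w. \<Phi> (snd w) \<bullet> snd (fst (fst w)) \<partial>N2)"
      using square_integrable_inner[OF sq\<Phi> up[OF sqF1]] square_integrable_inner[OF sq\<Phi> sqK2] square_integrable_inner[OF sq\<Phi> up[OF sqid]] by simp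
    also have "(\<integral>w. \<Phi> (snd w) \<bullet> F1 (fst w) \<partial>N2) = (\<integral>x. \<Psi> x \<bullet> x \<partial>\<beta>)"
    proof -
      have "(\<integral>w. \<Phi> (snd w) \<bullet> F1 (fst w) \<partial>N2) = (\<integral>w. \<Psi> (snd (fst w)) \<bullet> V (fst w) + \<Psi> (snd (fst w)) \<bullet> D1 w \<partial>N1)"
        using c[OF sqF1] by (simp add: F1_def inner_add_right)
      also have "\<dots> = (\<integral>w. \<Psi> (snd (fst w)) \<bullet> V (fst w) \<partial>N1)"
        using square_integrable_inner[OF sq\<Psi>1 sqV1] square_integrable_inner[OF sq\<Psi>1 sqD1] o1[OF sq\<Psi>] by simp
      also have "\<dots> = (\<integral>z. \<Psi> (snd z) \<bullet> V z \<partial>N0)"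
        by (rule i10[of "\<lambda>z. \<Psi> (snd z) \<bullet> V z"]) (intro borel_measurable_inner square_integrableD(1)[OF sq\<Psi>] square_integrableD(1)[OF sqV])
      also have "\<dots> = (\<integral>x. \<Psi> x \<bullet> x \<partial>\<beta>)" using q2[OF \<Psi>m \<Psi>b] by (simp add: N0_def V_def)
      finally show ?thesis .
    qed
    also have "(\<integral>w. \<Phi> (snd w) \<bullet> snd (fst (fst w)) \<partial>N2) = (\<integral>x. \<Psi> x \<bullet> x \<partial>\<beta>)"
      using c[OF sqid] integral_distr[OF s1, of "\<lambda>x. \<Psi> x \<bullet> x"] \<Psi>m by (simp add: L1)
    also have "(\<integral>w. \<Phi> (snd w) \<bullet> K2 (snd (fst (fst w)), snd w) \<partial>N2) = (\<integral>x. \<Phi> x \<bullet> x \<partial>\<beta>')"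
      unfolding N2_def by (rule C2.ext_constraint[OF A2 \<Phi>])
    finally show ?thesis by simp
  qed
  obtain P' where P': "P' \<in> GammaQ \<alpha>' \<beta>'" "gam P' = distr N2 borel Y"
    "energy P' \<le> ennreal (\<integral>w. (norm (K w))\<^sup>2 \<partial>N2)"
    "\<And>f. f \<in> borel_measurable borel \<Longrightarrow> bounded (range f) \<Longrightarrow>
      (\<integral>z. f z \<bullet> snd P' z \<partial>fst P') = (\<integral>w. fst (f (Y w)) + snd (f (Y w)) \<bullet> K w \<partial>N2)"
    using vmeas_of_random_variables[OF pN2 Ym sqK C1.prob(2) C1.sets_\<beta> C2.prob(2) C2.sets_\<beta> l\<alpha>' l\<beta>' q\<alpha> q\<beta>] by blast
  have sqd1: "square_integrable N2 (\<lambda>w. snd (fst w) - fst (X w))"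
    unfolding X_def using up[OF C1.integral_ext_dist_le(1)[OF A1, folded N1_def]] .
  have sqd2: "square_integrable N2 (\<lambda>w. snd w - snd (X w))"
    unfolding X_def using C2.integral_ext_dist_le(1)[OF A2, folded N2_def] .
  have nY: "(norm (Y w - X w))\<^sup>2 = (norm (snd (fst w) - fst (X w)))\<^sup>2 + (norm (snd w - snd (X w)))\<^sup>2" for w
    by (simp add: norm_prod_def Y_def)
  have iY: "integrable N2 (\<lambda>w. (norm (Y w - X w))\<^sup>2)"
    unfolding nY using square_integrableD(2)[OF sqd1] square_integrableD(2)[OF sqd2] by simp
  have "(\<integral>w. (norm (Y w - X w))\<^sup>2 \<partial>N2) = (\<integral>w. (norm (snd (fst w) - fst (X w)))\<^sup>2 \<partial>N2) + (\<integral>w. (norm (snd w - snd (X w)))\<^sup>2 \<partial>N2)"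
    unfolding nY using square_integrableD(2)[OF sqd1] square_integrableD(2)[OF sqd2] by simp
  also have "(\<integral>w. (norm (snd (fst w) - fst (X w)))\<^sup>2 \<partial>N2) = (\<integral>w. (norm (snd w - fst (fst w)))\<^sup>2 \<partial>N1)"
    unfolding X_def by (rule i21[OF sqm[OF C1.integral_ext_dist_le(1)[OF A1, folded N1_def]]])
  \<comment> \<open>The excess of the cost over each of the two second moments is at most e1, and
    each enters \<open>integral_ext_dist_le\<close> with factor 2.\<close>
  also have "\<dots> \<le> 4 * e1"
    by (rule order_trans[OF C1.integral_ext_dist_le(2)[OF A1, folded N1_def]]) (use d1 in \<open>simp add: algebra_simps\<close>)
  also have "(\<integral>w. (norm (snd w - snd (X w)))\<^sup>2 \<partial>N2) \<le> 4 * e2"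
    unfolding X_def by (rule order_trans[OF C2.integral_ext_dist_le(2)[OF A2, folded N2_def]]) (use d2 in \<open>simp add: algebra_simps\<close>)
  finally have dY: "(\<integral>w. (norm (Y w - X w))\<^sup>2 \<partial>N2) \<le> 4 * (e1 + e2)" by simp
  show thesis
  proof (rule that[OF P'(1) _ pN2 Xm Ym X_law P'(2)[symmetric] sqK _ _ iY dY P'(4)])
    show "energy P' \<le> ennreal (E + e1 + e2)" using P'(3) nK by (meson ennreal_leI order_trans)
    show "square_integrable N2 (\<lambda>w. vdens P (X w))" using sqX by (simp add: V_def)
    show "(\<integral>w. (norm (K w - vdens P (X w)))\<^sup>2 \<partial>N2) \<le> e1 + e2" using nKV by (simp add: V_def)
  qed auto
qed

lemma (in martingale_coupling) law_orth_fst: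
  "square_integrable \<alpha> F \<Longrightarrow> (\<integral>z. F (fst z) \<bullet> (K z - fst z) \<partial>law) = 0"
  by (rule law_facts(6))

lemma (in martingale_coupling) law_orth_snd:
  assumes F: "square_integrable \<beta> F"
  shows "(\<integral>z. F (snd z) \<bullet> (K z - snd z) \<partial>law) = 0"
proof -
  interpret S: martingale_coupling \<beta> \<alpha> "\<lambda>z. g (snd z, fst z)" "\<lambda>z. K (snd z, fst z)" M by (rule swap_coupling)
  have Fm: "F \<in> borel_measurable borel"
    using square_integrableD(1)[OF F] measurable_cong_sets[OF sets_\<beta> refl] by simp
  have "(\<lambda>z. F (snd z) \<bullet> (K z - snd z)) \<in> borel_measurable borel"
    by (intro borel_measurable_inner borel_measurable_diff K snd_borel measurable_compose[OF snd_borel Fm])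
  then show ?thesis using integral_law_swap S.law_orth_fst[OF F] by simp
qed

subsection \<open>Near-optimal couplings\<close>

text \<open>The cells are the level sets of s, and the values of s only label them. Each cell is
  represented by its barycentre \<open>a\<close> and not by its label, which preserves the overall
  barycentre.\<close>

locale cell_partition =
  fixes \<alpha> :: "'a::euclidean_space measure" and s :: "'a \<Rightarrow> 'a"
  assumes \<alpha>: "\<alpha> \<in> P2" and s: "s \<in> borel_measurable borel" and fin: "finite (range s)"
begin

definition p :: "'a \<Rightarrow> real" where "p v = measure \<alpha> (s -` {v})"
definition a :: "'a \<Rightarrow> 'a" where "a v = (1 / p v) *\<^sub>R (\<integral>x. indicator (s -` {v}) x *\<^sub>R x \<partial>\<alpha>)"
text \<open>Null cells are discarded because the discrete duality requires positive weights.\<close>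

definition I :: "'a set" where "I = {v \<in> range s. p v > 0}"

lemma prob: "prob_space \<alpha>" and sets_\<alpha>: "sets \<alpha> = sets borel" and space_\<alpha>: "space \<alpha> = UNIV"
  using P2_D[OF \<alpha>] by auto

lemma simple: "simple_function borel s"
proof -
  have "s -` {v} \<inter> space borel \<in> sets borel" for v
    by (rule measurable_sets[OF s]) simp
  then show ?thesis using fin by (simp add: simple_function_def)
qed

lemma comp_borel:
  fixes h :: "'a \<Rightarrow> 'c::euclidean_space"
  shows "(\<lambda>x. h (s x)) \<in> borel_measurable borel"
  by (rule borel_measurable_simple_function[OF simple_function_compose1[OF simple]])

lemma finI: "finite I" using fin by (simp add: I_def)

lemma cell: "s -` {v} \<in> sets \<alpha>"
  using measurable_sets[OF s, of "{v}"] by (simp add: sets_\<alpha>)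

lemma AE_I: "AE x in \<alpha>. s x \<in> I"
proof -
  interpret prob_space \<alpha> by (rule prob)
  have "(\<Union>v\<in>range s - I. s -` {v}) \<in> null_sets \<alpha>"
  proof (rule null_sets_UN')
    show "countable (range s - I)" using fin by (simp add: countable_finite)
    fix v assume "v \<in> range s - I"
    then have "measure \<alpha> (s -` {v}) = 0"
      using measure_nonneg[of \<alpha> "s -` {v}"] by (auto simp: I_def p_def not_less)
    then show "s -` {v} \<in> null_sets \<alpha>" using cell by (intro null_setsI) (auto simp: emeasure_eq_measure)
  qed
  then show ?thesis by (rule AE_I') auto
qed

lemma integral_sum_cells:
  fixes h :: "'a \<Rightarrow> 'a \<Rightarrow> 'c::euclidean_space"
  assumes h: "\<And>v. integrable \<alpha> (\<lambda>x. indicator (s -` {v}) x *\<^sub>R h v x)" and m: "(\<lambda>x. h (s x) x) \<in> borel_measurable borel"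
  shows "(\<integral>x. h (s x) x \<partial>\<alpha>) = (\<Sum>v\<in>I. \<integral>x. indicator (s -` {v}) x *\<^sub>R h v x \<partial>\<alpha>)"
proof -
  have "(\<integral>x. h (s x) x \<partial>\<alpha>) = (\<integral>x. (\<Sum>v\<in>I. indicator (s -` {v}) x *\<^sub>R h v x) \<partial>\<alpha>)"
  proof (rule integral_cong_AE)
    show "AE x in \<alpha>. h (s x) x = (\<Sum>v\<in>I. indicator (s -` {v}) x *\<^sub>R h v x)"
      using AE_I
    proof eventually_elim
      case (elim x)
      have "(\<Sum>v\<in>I. indicator (s -` {v}) x *\<^sub>R h v x) = (\<Sum>v\<in>I. if v = s x then h v x else 0)"
        by (intro sum.cong) (auto simp: indicator_def)
      then show ?case using elim finI by simp
    qed
    show "(\<lambda>x. \<Sum>v\<in>I. indicator (s -` {v}) x *\<^sub>R h v x) \<in> borel_measurable \<alpha>"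
      using h by (intro borel_measurable_sum) auto
  qed (rule borel_measurable_sets_borel[OF sets_\<alpha> m])
  also have "\<dots> = (\<Sum>v\<in>I. \<integral>x. indicator (s -` {v}) x *\<^sub>R h v x \<partial>\<alpha>)"
    using h by (intro Bochner_Integration.integral_sum)
  finally show ?thesis .
qed

lemma integrable_cells_id: "integrable \<alpha> (\<lambda>x. indicator (s -` {v}) x *\<^sub>R x)"
  by (intro integrable_mult_indicator cell P2_integrable_id \<alpha>)

lemma integral_cells_id: "p v > 0 \<Longrightarrow> (\<integral>x. indicator (s -` {v}) x *\<^sub>R x \<partial>\<alpha>) = p v *\<^sub>R a v"
  by (simp add: a_def)

lemma bounded_comp: "bounded (range (\<lambda>x. h (s x)))"
proof -
  have "range (\<lambda>x. h (s x)) = h ` range s" by auto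
  then show ?thesis using fin by (simp add: finite_imp_bounded)
qed

lemma sq_comp: "square_integrable \<alpha> (\<lambda>x. (h (s x) :: 'c::euclidean_space))"
proof -
  interpret prob_space \<alpha> by (rule prob)
  obtain C where "\<And>x. norm (h (s x)) \<le> C" using bounded_comp[of h] by (auto simp: bounded_iff)
  then show ?thesis
    using borel_measurable_sets_borel[OF sets_\<alpha> comp_borel[of h]] by (intro square_integrable_bounded)
qed

lemma integrable_comp: "integrable \<alpha> (\<lambda>x. (h (s x) :: 'c::euclidean_space))"
proof -
  interpret prob_space \<alpha> by (rule prob)
  show ?thesis by (rule square_integrable_integrable[OF sq_comp])
qed

lemma integral_comp:
  fixes h :: "'a \<Rightarrow> 'c::euclidean_space"
  shows "(\<integral>x. h (s x) \<partial>\<alpha>) = (\<Sum>v\<in>I. p v *\<^sub>R h v)"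
proof -
  interpret prob_space \<alpha> by (rule prob)
  have i: "integrable \<alpha> (\<lambda>x. indicator (s -` {v}) x *\<^sub>R h v)" for v
    by (intro integrable_mult_indicator cell integrable_const)
  show ?thesis
    unfolding integral_sum_cells[of "\<lambda>v x. h v", OF i comp_borel]
  proof (rule sum.cong[OF refl])
    fix v
    have "integrable \<alpha> (indicat_real (s -` {v}))"
      using cell by (intro integrable_real_indicator) (auto simp: emeasure_eq_measure)
    then have "(\<integral>x. indicator (s -` {v}) x *\<^sub>R h v \<partial>\<alpha>) = (\<integral>x. indicator (s -` {v}) x \<partial>\<alpha>) *\<^sub>R h v"
      by (intro integral_scaleR_left)
    then show "(\<integral>x. indicator (s -` {v}) x *\<^sub>R h v \<partial>\<alpha>) = p v *\<^sub>R h v"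
      using cell by (simp add: p_def space_\<alpha>)
  qed
qed

lemma integral_comp_scaleR_id:
  fixes h :: "'a \<Rightarrow> real"
  shows "integrable \<alpha> (\<lambda>x. h (s x) *\<^sub>R x)"
    and "(\<integral>x. h (s x) *\<^sub>R x \<partial>\<alpha>) = (\<Sum>v\<in>I. (p v * h v) *\<^sub>R a v)"
proof -
  have i: "integrable \<alpha> (\<lambda>x. indicator (s -` {v}) x *\<^sub>R (h v *\<^sub>R x))" for v
    using integrable_scaleR_right[OF integrable_cells_id[of v], of "h v"] by (simp add: mult.commute)
  have m: "(\<lambda>x. h (s x) *\<^sub>R x) \<in> borel_measurable borel" using comp_borel[of h] by measurable
  show "(\<integral>x. h (s x) *\<^sub>R x \<partial>\<alpha>) = (\<Sum>v\<in>I. (p v * h v) *\<^sub>R a v)"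
    unfolding integral_sum_cells[of "\<lambda>v x. h v *\<^sub>R x", OF i m]
  proof (rule sum.cong[OF refl])
    fix v assume v: "v \<in> I"
    have "(\<integral>x. indicator (s -` {v}) x *\<^sub>R (h v *\<^sub>R x) \<partial>\<alpha>) = (\<integral>x. h v *\<^sub>R (indicator (s -` {v}) x *\<^sub>R x) \<partial>\<alpha>)"
      by (simp add: mult.commute)
    also have "\<dots> = h v *\<^sub>R (\<integral>x. indicator (s -` {v}) x *\<^sub>R x \<partial>\<alpha>)"
      by (rule integral_scaleR_right)
    also have "\<dots> = h v *\<^sub>R (p v *\<^sub>R a v)"
      using v by (simp add: integral_cells_id I_def)
    finally show "(\<integral>x. indicator (s -` {v}) x *\<^sub>R (h v *\<^sub>R x) \<partial>\<alpha>) = (p v * h v) *\<^sub>R a v"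
      by (simp add: mult.commute)
  qed
  obtain C where C: "\<And>x. norm (h (s x)) \<le> C" using bounded_comp[of h] by (auto simp: bounded_iff)
  show "integrable \<alpha> (\<lambda>x. h (s x) *\<^sub>R x)"
  proof (rule Bochner_Integration.integrable_bound)
    show "integrable \<alpha> (\<lambda>x. C *\<^sub>R x)" using P2_integrable_id[OF \<alpha>] by auto
    show "AE x in \<alpha>. norm (h (s x) *\<^sub>R x) \<le> norm (C *\<^sub>R x)"
    proof (rule AE_I2)
      fix x
      have "\<bar>h (s x)\<bar> * norm x \<le> \<bar>C\<bar> * norm x" using C[of x] by (intro mult_right_mono) auto
      then show "norm (h (s x) *\<^sub>R x) \<le> norm (C *\<^sub>R x)" by simp
    qed
  qed (rule borel_measurable_sets_borel[OF sets_\<alpha> m])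
qed

lemma sq_id: "square_integrable \<alpha> (\<lambda>x. x)"
  using P2_D(4)[OF \<alpha>] by (simp add: square_integrable_def borel_measurable_sets_borel[OF sets_\<alpha>])

lemma integral_comp_inner_id:
  fixes h :: "'a \<Rightarrow> 'a"
  shows "integrable \<alpha> (\<lambda>x. h (s x) \<bullet> x)" and "(\<integral>x. h (s x) \<bullet> x \<partial>\<alpha>) = (\<Sum>v\<in>I. p v * (h v \<bullet> a v))"
proof -
  show "integrable \<alpha> (\<lambda>x. h (s x) \<bullet> x)" by (rule square_integrable_inner[OF sq_comp sq_id])
  have i: "integrable \<alpha> (\<lambda>x. indicator (s -` {v}) x *\<^sub>R (h v \<bullet> x))" for v
    using integrable_inner_right[of "h v", OF integrable_cells_id[of v]] by (simp add: inner_scaleR_right)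
  have m: "(\<lambda>x. h (s x) \<bullet> x) \<in> borel_measurable borel" using comp_borel[of h] by measurable
  show "(\<integral>x. h (s x) \<bullet> x \<partial>\<alpha>) = (\<Sum>v\<in>I. p v * (h v \<bullet> a v))"
    unfolding integral_sum_cells[of "\<lambda>v x. h v \<bullet> x", OF i m]
  proof (rule sum.cong[OF refl])
    fix v assume v: "v \<in> I"
    have "(\<integral>x. indicator (s -` {v}) x *\<^sub>R (h v \<bullet> x) \<partial>\<alpha>) = (\<integral>x. h v \<bullet> (indicator (s -` {v}) x *\<^sub>R x) \<partial>\<alpha>)"
      by simp
    also have "\<dots> = h v \<bullet> (p v *\<^sub>R a v)"
      using v integrable_cells_id by (subst integral_inner_right) (auto simp: integral_cells_id I_def)
    finally show "(\<integral>x. indicator (s -` {v}) x *\<^sub>R (h v \<bullet> x) \<partial>\<alpha>) = p v * (h v \<bullet> a v)"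
      by simp
  qed
qed

lemma sum_p: "(\<Sum>v\<in>I. p v) = 1"
proof -
  interpret prob_space \<alpha> by (rule prob)
  show ?thesis using integral_comp[of "\<lambda>_. 1::real"] by (simp add: prob_space)
qed

lemma sum_pa: "(\<Sum>v\<in>I. p v *\<^sub>R a v) = (\<integral>x. x \<partial>\<alpha>)"
  using integral_comp_scaleR_id(2)[of "\<lambda>_. 1"] by simp

lemma I_nonempty: "I \<noteq> {}"
  using sum_p by auto

lemma p_pos: "v \<in> I \<Longrightarrow> p v > 0"
  by (simp add: I_def)

lemma p_zero: "v \<in> range s \<Longrightarrow> v \<notin> I \<Longrightarrow> p v = 0"
  using measure_nonneg[of \<alpha> "s -` {v}"] by (auto simp: I_def p_def not_less)

text \<open>x - a(s x) is orthogonal to every function of the cell. Hence the left side is the mean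
  square of x - a(s x), and cell barycentres are the best approximation constant on cells.\<close>

lemma cell_variance:
  "(\<integral>x. (x - a (s x)) \<bullet> x \<partial>\<alpha>) \<le> (\<integral>x. (norm (x - s x))\<^sup>2 \<partial>\<alpha>)"
proof -
  interpret prob_space \<alpha> by (rule prob)
  have o: "(\<integral>x. h (s x) \<bullet> (x - a (s x)) \<partial>\<alpha>) = 0" for h :: "'a \<Rightarrow> 'a"
    using integral_comp_inner_id[of h] integral_comp[of "\<lambda>v. h v \<bullet> a v"] integrable_comp[of "\<lambda>v. h v \<bullet> a v"]
    by (simp add: inner_diff_right)
  have sq: "square_integrable \<alpha> (\<lambda>x. x - a (s x))" by (intro square_integrable_diff sq_id sq_comp)
  have "(\<integral>x. (norm (x - s x))\<^sup>2 \<partial>\<alpha>) = (\<integral>x. (norm ((a (s x) - s x) + (x - a (s x))))\<^sup>2 \<partial>\<alpha>)" by simp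
  also have "\<dots> = (\<integral>x. (norm (a (s x) - s x))\<^sup>2 \<partial>\<alpha>) + (\<integral>x. (norm (x - a (s x)))\<^sup>2 \<partial>\<alpha>)"
    by (rule integral_norm_sq_add[OF sq_comp[of "\<lambda>v. a v - v"] sq o[of "\<lambda>v. a v - v"]])
  also have "(\<integral>x. (norm (x - a (s x)))\<^sup>2 \<partial>\<alpha>) = (\<integral>x. (x - a (s x)) \<bullet> x - a (s x) \<bullet> (x - a (s x)) \<partial>\<alpha>)"
    by (simp add: power2_norm_eq_inner inner_diff_left inner_diff_right inner_commute algebra_simps)
  also have "\<dots> = (\<integral>x. (x - a (s x)) \<bullet> x \<partial>\<alpha>)"
    using square_integrable_inner[OF sq sq_id] square_integrable_inner[OF sq_comp[of a] sq] o[of a] by simp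
  finally show ?thesis by (simp add: integral_nonneg_AE)
qed

text \<open>Lifts discrete weights to densities. The deviations x - a(s x) may be added freely,
  since they average to zero on each cell; \<open>near_optimal_coupling\<close> uses this to correct
  cell barycentres to points.\<close>

lemma fiber_identities:
  fixes w :: "'a \<Rightarrow> real" and h :: "'a \<Rightarrow> 'a"
  assumes w: "(\<Sum>v\<in>I. w v) = r"
  shows "(\<integral>x. w (s x) / p (s x) \<partial>\<alpha>) = r"
    and "(\<integral>x. (w (s x) / p (s x)) *\<^sub>R (h (s x) + (x - a (s x))) \<partial>\<alpha>) = (\<Sum>v\<in>I. w v *\<^sub>R h v)"
proof -
  show "(\<integral>x. w (s x) / p (s x) \<partial>\<alpha>) = r"
    using integral_comp[of "\<lambda>v. w v / p v"] w p_pos by (simp add: less_imp_neq[symmetric] cong: sum.cong)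
  have "(\<integral>x. (w (s x) / p (s x)) *\<^sub>R (h (s x) + (x - a (s x))) \<partial>\<alpha>)
    = (\<integral>x. (w (s x) / p (s x)) *\<^sub>R (h (s x) - a (s x)) + (w (s x) / p (s x)) *\<^sub>R x \<partial>\<alpha>)"
    by (rule Bochner_Integration.integral_cong[OF refl]) (simp add: scaleR_add_right scaleR_diff_right)
  also have "\<dots> = (\<Sum>v\<in>I. p v *\<^sub>R ((w v / p v) *\<^sub>R (h v - a v))) + (\<Sum>v\<in>I. (p v * (w v / p v)) *\<^sub>R a v)"
    using integrable_comp[of "\<lambda>v. (w v / p v) *\<^sub>R (h v - a v)"] integral_comp_scaleR_id(1)[of "\<lambda>v. w v / p v"]
    by (simp add: integral_comp[of "\<lambda>v. (w v / p v) *\<^sub>R (h v - a v)"] integral_comp_scaleR_id(2)[of "\<lambda>v. w v / p v"])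
  also have "\<dots> = (\<Sum>v\<in>I. w v *\<^sub>R h v)"
    unfolding sum.distrib[symmetric]
  proof (rule sum.cong[OF refl])
    fix v assume "v \<in> I"
    then have "p v \<noteq> 0" using p_pos by force
    then show "p v *\<^sub>R ((w v / p v) *\<^sub>R (h v - a v)) + (p v * (w v / p v)) *\<^sub>R a v = w v *\<^sub>R h v"
      by (simp add: scaleR_diff_right)
  qed
  finally show "(\<integral>x. (w (s x) / p (s x)) *\<^sub>R (h (s x) + (x - a (s x))) \<partial>\<alpha>) = (\<Sum>v\<in>I. w v *\<^sub>R h v)" .
qed

end

lemma simple_mean_square_approx:
  fixes \<alpha> :: "'a::euclidean_space measure"
  assumes \<alpha>: "\<alpha> \<in> P2" and e: "e > 0"
  obtains s where "cell_partition \<alpha> s" "(\<integral>x. (norm (x - s x))\<^sup>2 \<partial>\<alpha>) < e"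
proof -
  interpret prob_space \<alpha> using P2_D[OF \<alpha>] by simp
  note sb = P2_D(2)[OF \<alpha>]
  obtain F where F: "\<And>i. simple_function borel (F i)" "\<And>x. (\<lambda>i. F i x) \<longlonglongrightarrow> (x::'a)"
      "\<And>i x. dist (F i x) 0 \<le> 2 * dist x 0"
    using borel_measurable_implies_sequence_metric[of "\<lambda>x::'a. x" borel 0] by auto
  have Fm: "F i \<in> borel_measurable borel" for i by (rule borel_measurable_simple_function[OF F(1)])
  have "(\<lambda>i. \<integral>x. (norm (x - F i x))\<^sup>2 \<partial>\<alpha>) \<longlonglongrightarrow> (\<integral>x. 0 \<partial>\<alpha>)"
  proof (rule integral_dominated_convergence[where w="\<lambda>x. 9 * (norm x)\<^sup>2"])
    show "integrable \<alpha> (\<lambda>x. 9 * (norm x)\<^sup>2)" using P2_D(4)[OF \<alpha>] by simp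
    show "AE x in \<alpha>. (\<lambda>i. (norm (x - F i x))\<^sup>2) \<longlonglongrightarrow> 0"
    proof (rule AE_I2)
      fix x
      have "(\<lambda>i. (norm (x - F i x))\<^sup>2) \<longlonglongrightarrow> (norm (x - x))\<^sup>2"
        by (intro tendsto_intros F(2))
      then show "(\<lambda>i. (norm (x - F i x))\<^sup>2) \<longlonglongrightarrow> 0" by simp
    qed
    show "AE x in \<alpha>. norm ((norm (x - F i x))\<^sup>2) \<le> 9 * (norm x)\<^sup>2" for i
    proof (rule AE_I2)
      fix x
      have "norm (x - F i x) \<le> 3 * norm x" using norm_triangle_ineq4[of x "F i x"] F(3)[of i x] by simp
      then have "(norm (x - F i x))\<^sup>2 \<le> (3 * norm x)\<^sup>2" by (intro power_mono) auto
      then show "norm ((norm (x - F i x))\<^sup>2) \<le> 9 * (norm x)\<^sup>2" by (simp add: power_mult_distrib)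
    qed
    show "(\<lambda>x. (norm (x - F i x))\<^sup>2) \<in> borel_measurable \<alpha>" for i
      using Fm[of i] by (intro borel_measurable_sets_borel[OF sb]) measurable
  qed simp
  then have "(\<lambda>i. \<integral>x. (norm (x - F i x))\<^sup>2 \<partial>\<alpha>) \<longlonglongrightarrow> 0" by simp
  then have "\<forall>\<^sub>F i in sequentially. (\<integral>x. (norm (x - F i x))\<^sup>2 \<partial>\<alpha>) < e"
    using e by (rule order_tendstoD(2))
  then obtain i where i: "(\<integral>x. (norm (x - F i x))\<^sup>2 \<partial>\<alpha>) < e" by (auto simp: eventually_sequentially)
  moreover have "cell_partition \<alpha> (F i)"
    by unfold_locales (use \<alpha> Fm simple_functionD(1)[OF F(1)[of i]] in auto)
  ultimately show thesis by (rule that[rotated])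
qed

text \<open>Discretise both measures on finitely many cells, solve the entropic problem for the cell
  barycentres, and lift the solution.\<close>
lemma near_optimal_coupling:
  fixes \<alpha> \<beta> :: "'a::euclidean_space measure"
  assumes \<alpha>: "\<alpha> \<in> P2b b" and \<beta>: "\<beta> \<in> P2b b" and \<delta>: "\<delta> > 0"
  obtains g K M where "martingale_coupling \<alpha> \<beta> g K M"
    "martingale_coupling.cost \<alpha> \<beta> g K \<le> (m2 \<alpha> + m2 \<beta>) / 2 + Z2 \<alpha> \<beta> + \<delta>"
proof -
  \<comment> \<open>The error \<delta> has three equal shares: the variances within the cells of
    \<alpha> and of \<beta>, and the entropic gap.\<close>
  have d3: "\<delta> / 3 > 0" using \<delta> by simp
  obtain s where s: "cell_partition \<alpha> s" "(\<integral>x. (norm (x - s x))\<^sup>2 \<partial>\<alpha>) < \<delta> / 3"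
    using simple_mean_square_approx[OF P2b_P2[OF \<alpha>] d3] by blast
  obtain t where t: "cell_partition \<beta> t" "(\<integral>x. (norm (x - t x))\<^sup>2 \<partial>\<beta>) < \<delta> / 3"
    using simple_mean_square_approx[OF P2b_P2[OF \<beta>] d3] by blast
  interpret A: cell_partition \<alpha> s by (rule s(1))
  interpret B: cell_partition \<beta> t by (rule t(1))
  \<comment> \<open>Solves \<tau> |I| |J| = \<delta>/3, the left side being the gap in
    \<open>entropic_duality\<close>.\<close>
  define \<tau> where "\<tau> = \<delta> / (3 * (real (card A.I) * real (card B.I)))"
  have cpos: "real (card A.I) * real (card B.I) > 0"
    using A.finI B.finI A.I_nonempty B.I_nonempty by (simp add: card_gt_0_iff)
  have \<tau>: "\<tau> > 0" "\<tau> * (real (card A.I) * real (card B.I)) = \<delta> / 3"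
  proof -
    show "\<tau> > 0" unfolding \<tau>_def using cpos \<delta> by (intro divide_pos_pos mult_pos_pos[of 3]) auto
    show "\<tau> * (real (card A.I) * real (card B.I)) = \<delta> / 3"
      using less_imp_neq[OF cpos] by (simp add: \<tau>_def)
  qed
  have bary: "(\<Sum>v\<in>A.I. A.p v *\<^sub>R A.a v) = (\<Sum>v\<in>B.I. B.p v *\<^sub>R B.a v)"
    using A.sum_pa B.sum_pa \<alpha> \<beta> by (simp add: P2b_def)
  show thesis
  proof (rule entropic_duality[OF A.finI B.finI A.I_nonempty B.I_nonempty A.p_pos A.sum_p B.p_pos B.sum_p bary \<tau>(1)], goal_cases)
    case (1 i)
    then show ?case .
  next
    case (2 j)
    then show ?case .
  next
    case (3 \<phi> \<Phi> \<psi> \<Psi> \<gamma>)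
    note feas = 3(1) and \<gamma>0 = 3(2) and r1 = 3(3) and r2 = 3(4) and k1 = 3(5) and k2 = 3(6) and gap = 3(7)
    show thesis
    proof (rule dual_feasible_potential[where I=A.I and J=B.I and \<phi>=\<phi> and \<psi>=\<psi> and \<Phi>=\<Phi> and \<Psi>=\<Psi>], goal_cases)
      case 1
      then show ?case by (rule B.finI)
    next
      case 2
      then show ?case by (rule B.I_nonempty)
    next
      case (3 i j)
      then show ?case by (rule feas)
    next
      case (4 u)
      note u = 4
  \<comment> \<open>Spreads the weight of a pair of cells in proportion to the product measure. The
    density takes finitely many values, which supplies its bound.\<close>
  define g where "g z = \<gamma> (s (fst z)) (t (snd z)) / (A.p (s (fst z)) * B.p (t (snd z)))" for z
  \<comment> \<open>\<open>P\<close> and \<open>Q\<close> lift \<Phi> and \<Psi> and add the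
    deviation from the cell barycentre. Integrating over y, the deviation of y averages out while
    that of x survives and turns the barycentre of the cell into x; symmetrically for y.\<close>
  define P where "P x = \<Phi> (s x) + (x - A.a (s x))" for x
  define Q where "Q y = \<Psi> (t y) + (y - B.a (t y))" for y
  define K where "K z = P (fst z) + Q (snd z)" for z
  have fs: "(fst :: 'a \<times> 'a \<Rightarrow> 'a) \<in> borel_measurable borel" "(snd :: 'a \<times> 'a \<Rightarrow> 'a) \<in> borel_measurable borel"
    by (intro borel_measurable_continuous_onI continuous_intros)+
  have st: "simple_function borel (\<lambda>z :: 'a \<times> 'a. (s (fst z), t (snd z)))"
  proof -
    have "finite (range (\<lambda>z :: 'a \<times> 'a. (s (fst z), t (snd z))))"
      by (rule finite_subset[of _ "range s \<times> range t"]) (use A.fin B.fin in auto)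
    moreover have "(\<lambda>z :: 'a \<times> 'a. (s (fst z), t (snd z))) -` {v} \<inter> space borel \<in> sets borel" for v
    proof -
      have "(\<lambda>z :: 'a \<times> 'a. (s (fst z), t (snd z))) -` {v} = ((\<lambda>z. s (fst z)) -` {fst v} \<inter> space borel) \<inter> ((\<lambda>z. t (snd z)) -` {snd v} \<inter> space borel)"
        by (auto simp: prod_eq_iff)
      then show ?thesis
        using measurable_sets[OF measurable_compose[OF fs(1) A.s], of "{fst v}"] measurable_sets[OF measurable_compose[OF fs(2) B.s], of "{snd v}"]
        by auto
    qed
    ultimately show ?thesis by (simp add: simple_function_def)
  qed
  have gm: "g \<in> borel_measurable borel"
    unfolding g_def[abs_def]
    using borel_measurable_simple_function[OF simple_function_compose1[OF st, of "\<lambda>(i, j). \<gamma> i j / (A.p i * B.p j)"]] by simp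
  have gfin: "finite (range g)"
  proof (rule finite_subset)
    show "range g \<subseteq> (\<lambda>(i, j). \<gamma> i j / (A.p i * B.p j)) ` (range s \<times> range t)" by (auto simp: g_def)
  qed (use A.fin B.fin in auto)
  have gM: "g z \<le> Max (range g)" for z using gfin by (intro Max_ge) auto
  have g0: "0 \<le> g z" for z
  proof (cases "s (fst z) \<in> A.I \<and> t (snd z) \<in> B.I")
    case True
    then show ?thesis using \<gamma>0 A.p_pos B.p_pos by (simp add: g_def less_imp_le)
  next
    case False
    \<comment> \<open>A null cell puts a factor 0 into the denominator, and division by 0 gives
      0.\<close>
    then show ?thesis using A.p_zero[of "s (fst z)"] B.p_zero[of "t (snd z)"] by (auto simp: g_def)
  qed
  have Pm: "P \<in> borel_measurable borel" unfolding P_def[abs_def]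
    using A.comp_borel[of \<Phi>] A.comp_borel[of A.a] by measurable
  have Qm: "Q \<in> borel_measurable borel" unfolding Q_def[abs_def]
    using B.comp_borel[of \<Psi>] B.comp_borel[of B.a] by measurable
  have Km: "K \<in> borel_measurable borel" unfolding K_def[abs_def]
    by (intro borel_measurable_add measurable_compose[OF fs(1) Pm] measurable_compose[OF fs(2) Qm])
  have sqP: "square_integrable \<alpha> P" unfolding P_def[abs_def]
    by (intro square_integrable_add square_integrable_diff A.sq_id A.sq_comp)
  have sqQ: "square_integrable \<beta> Q" unfolding Q_def[abs_def]
    by (intro square_integrable_add square_integrable_diff B.sq_id B.sq_comp)
  have coupling: "martingale_coupling \<alpha> \<beta> g K (Max (range g))"
  proof
    show "\<alpha> \<in> P2" "\<beta> \<in> P2" using \<alpha> \<beta> by (auto simp: P2b_P2)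
    show "AE x in \<alpha>. (\<integral>y. g (x, y) \<partial>\<beta>) = 1" using A.AE_I
    proof eventually_elim
      case (elim x)
      have 1: "(\<Sum>j\<in>B.I. \<gamma> (s x) j / A.p (s x)) = 1"
        using r1[OF elim] A.p_pos[OF elim] by (simp add: sum_divide_distrib[symmetric])
      show ?case using B.fiber_identities(1)[OF 1] by (simp add: g_def)
    qed
    show "AE x in \<alpha>. (\<integral>y. g (x, y) *\<^sub>R K (x, y) \<partial>\<beta>) = x" using A.AE_I
    proof eventually_elim
      case (elim x)
      have 1: "(\<Sum>j\<in>B.I. \<gamma> (s x) j / A.p (s x)) = 1"
        using r1[OF elim] A.p_pos[OF elim] by (simp add: sum_divide_distrib[symmetric])
      have "(\<integral>y. g (x, y) *\<^sub>R K (x, y) \<partial>\<beta>) = (\<Sum>j\<in>B.I. (\<gamma> (s x) j / A.p (s x)) *\<^sub>R ((\<Phi> (s x) + \<Psi> j) + (x - A.a (s x))))"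
        using B.fiber_identities(2)[OF 1, of "\<lambda>j. (\<Phi> (s x) + \<Psi> j) + (x - A.a (s x))"]
        by (simp add: g_def K_def P_def Q_def algebra_simps)
      also have "\<dots> = (1 / A.p (s x)) *\<^sub>R (\<Sum>j\<in>B.I. \<gamma> (s x) j *\<^sub>R (\<Phi> (s x) + \<Psi> j)) + (\<Sum>j\<in>B.I. \<gamma> (s x) j / A.p (s x)) *\<^sub>R (x - A.a (s x))"
        by (simp add: scaleR_sum_right scaleR_sum_left sum.distrib[symmetric] scaleR_add_right)
      also have "\<dots> = x" using k1[OF elim] A.p_pos[OF elim] by (simp add: 1)
      finally show ?case .
    qed
    show "AE y in \<beta>. (\<integral>x. g (x, y) \<partial>\<alpha>) = 1" using B.AE_I
    proof eventually_elim
      case (elim y)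
      have 1: "(\<Sum>i\<in>A.I. \<gamma> i (t y) / B.p (t y)) = 1"
        using r2[OF elim] B.p_pos[OF elim] by (simp add: sum_divide_distrib[symmetric])
      show ?case using A.fiber_identities(1)[OF 1] by (simp add: g_def mult.commute)
    qed
    show "AE y in \<beta>. (\<integral>x. g (x, y) *\<^sub>R K (x, y) \<partial>\<alpha>) = y" using B.AE_I
    proof eventually_elim
      case (elim y)
      have 1: "(\<Sum>i\<in>A.I. \<gamma> i (t y) / B.p (t y)) = 1"
        using r2[OF elim] B.p_pos[OF elim] by (simp add: sum_divide_distrib[symmetric])
      have "(\<integral>x. g (x, y) *\<^sub>R K (x, y) \<partial>\<alpha>) = (\<Sum>i\<in>A.I. (\<gamma> i (t y) / B.p (t y)) *\<^sub>R ((\<Phi> i + \<Psi> (t y)) + (y - B.a (t y))))"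
        using A.fiber_identities(2)[OF 1, of "\<lambda>i. (\<Phi> i + \<Psi> (t y)) + (y - B.a (t y))"]
        by (simp add: g_def K_def P_def Q_def algebra_simps)
      also have "\<dots> = (1 / B.p (t y)) *\<^sub>R (\<Sum>i\<in>A.I. \<gamma> i (t y) *\<^sub>R (\<Phi> i + \<Psi> (t y))) + (\<Sum>i\<in>A.I. \<gamma> i (t y) / B.p (t y)) *\<^sub>R (y - B.a (t y))"
        by (simp add: scaleR_sum_right scaleR_sum_left sum.distrib[symmetric] scaleR_add_right)
      also have "\<dots> = y" using k2[OF elim] B.p_pos[OF elim] by (simp add: 1)
      finally show ?case .
    qed
    show "integrable (\<alpha> \<Otimes>\<^sub>M \<beta>) (\<lambda>z. g z * (norm (K z))\<^sup>2)"
    proof -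
      interpret a: prob_space \<alpha> by (rule A.prob)
      interpret b: prob_space \<beta> by (rule B.prob)
      interpret ab: pair_prob_space \<alpha> \<beta> ..
      have sp: "sets (\<alpha> \<Otimes>\<^sub>M \<beta>) = sets borel"
        using sets_pair_measure_cong[OF A.sets_\<alpha> B.sets_\<alpha>] unfolding borel_prod .
      have iP: "square_integrable (\<alpha> \<Otimes>\<^sub>M \<beta>) (\<lambda>z. P (fst z))"
      proof -
        have "square_integrable (distr (\<alpha> \<Otimes>\<^sub>M \<beta>) \<alpha> fst) P" unfolding b.distr_pair_fst by (rule sqP)
        then show ?thesis
          unfolding square_integrable_distr[OF measurable_fst square_integrableD(1)[OF sqP]] .
      qed
      have "distr (\<beta> \<Otimes>\<^sub>M \<alpha>) \<beta> fst = \<beta>" by (rule a.distr_pair_fst)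
      then have dsnd: "distr (\<alpha> \<Otimes>\<^sub>M \<beta>) \<beta> snd = \<beta>"
        by (subst ab.distr_pair_swap) (simp add: distr_distr comp_def case_prod_beta' measurable_pair_swap')
      have iQ: "square_integrable (\<alpha> \<Otimes>\<^sub>M \<beta>) (\<lambda>z. Q (snd z))"
      proof -
        have "square_integrable (distr (\<alpha> \<Otimes>\<^sub>M \<beta>) \<beta> snd) Q" unfolding dsnd by (rule sqQ)
        then show ?thesis
          unfolding square_integrable_distr[OF measurable_snd square_integrableD(1)[OF sqQ]] .
      qed
      have iK: "integrable (\<alpha> \<Otimes>\<^sub>M \<beta>) (\<lambda>z. (norm (K z))\<^sup>2)"
        unfolding K_def by (rule square_integrableD(2)[OF square_integrable_add[OF iP iQ]])
      show ?thesis
      proof (rule Bochner_Integration.integrable_bound)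
        show "integrable (\<alpha> \<Otimes>\<^sub>M \<beta>) (\<lambda>z. Max (range g) * (norm (K z))\<^sup>2)" using iK by simp
        show "AE z in \<alpha> \<Otimes>\<^sub>M \<beta>. norm (g z * (norm (K z))\<^sup>2) \<le> norm (Max (range g) * (norm (K z))\<^sup>2)"
          using g0 gM order_trans[OF g0 gM] by (intro AE_I2) (simp add: abs_mult mult_right_mono)
      qed (use gm Km in \<open>intro borel_measurable_sets_borel[OF sp], measurable\<close>)
    qed
  qed (use gm Km g0 gM in auto)
  interpret C: martingale_coupling \<alpha> \<beta> g K "Max (range g)" by (rule coupling)
  have lf: "square_integrable C.law (\<lambda>z. P (fst z))" by (rule C.law_facts(3)[OF sqP])
  have sndm: "snd \<in> borel_measurable C.law" by (rule borel_measurable_sets_borel[OF C.sets_law fs(2)])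
  have ls: "square_integrable C.law (\<lambda>z. Q (snd z))"
  proof -
    have "square_integrable (distr C.law borel snd) Q" using sqQ by (simp add: C.distr_law_snd)
    then show ?thesis using square_integrable_distr[OF sndm Qm] by simp
  qed
  have e1: "(\<integral>z. P (fst z) \<bullet> K z \<partial>C.law) = (\<integral>x. P x \<bullet> x \<partial>\<alpha>)"
  proof -
    have fstm: "fst \<in> borel_measurable C.law" by (rule borel_measurable_sets_borel[OF C.sets_law fs(1)])
    have "(\<integral>z. P (fst z) \<bullet> K z \<partial>C.law) = (\<integral>z. P (fst z) \<bullet> (K z - fst z) + P (fst z) \<bullet> fst z \<partial>C.law)"
      by (simp add: inner_diff_right)
    also have "\<dots> = (\<integral>z. P (fst z) \<bullet> fst z \<partial>C.law)"
      using square_integrable_inner[OF lf square_integrable_diff[OF C.sq_law(3,1)]] square_integrable_inner[OF lf C.sq_law(1)]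
        C.law_orth_fst[OF sqP] by simp
    also have "\<dots> = (\<integral>x. P x \<bullet> x \<partial>\<alpha>)"
      using integral_distr[OF fstm, of "\<lambda>x. P x \<bullet> x"] Pm by (simp add: C.distr_law_fst)
    finally show ?thesis .
  qed
  have e2: "(\<integral>z. Q (snd z) \<bullet> K z \<partial>C.law) = (\<integral>y. Q y \<bullet> y \<partial>\<beta>)"
  proof -
    have "(\<integral>z. Q (snd z) \<bullet> K z \<partial>C.law) = (\<integral>z. Q (snd z) \<bullet> (K z - snd z) + Q (snd z) \<bullet> snd z \<partial>C.law)"
      by (simp add: inner_diff_right)
    also have "\<dots> = (\<integral>z. Q (snd z) \<bullet> snd z \<partial>C.law)"
      using square_integrable_inner[OF ls square_integrable_diff[OF C.sq_law(3,2)]] square_integrable_inner[OF ls C.sq_law(2)]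
        C.law_orth_snd[OF sqQ] by simp
    also have "\<dots> = (\<integral>y. Q y \<bullet> y \<partial>\<beta>)"
      using integral_distr[OF sndm, of "\<lambda>x. Q x \<bullet> x"] Qm by (simp add: C.distr_law_snd)
    finally show ?thesis .
  qed
  \<comment> \<open>|K|^2 = P.K + Q.K, and each of P and Q depends on one variable, so K may be
    replaced by that variable. What remains is the discrete energy, in the form bounded by
    \<open>gap\<close>, plus the two cell variances.\<close>
  have "C.cost = (\<integral>z. P (fst z) \<bullet> K z + Q (snd z) \<bullet> K z \<partial>C.law)"
    unfolding C.cost_def power2_norm_eq_inner by (simp add: K_def inner_add_left)
  also have "\<dots> = (\<integral>x. P x \<bullet> x \<partial>\<alpha>) + (\<integral>y. Q y \<bullet> y \<partial>\<beta>)"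
    using square_integrable_inner[OF lf C.sq_law(3)] square_integrable_inner[OF ls C.sq_law(3)] e1 e2 by simp
  also have "(\<integral>x. P x \<bullet> x \<partial>\<alpha>) = (\<Sum>i\<in>A.I. A.p i * (\<Phi> i \<bullet> A.a i)) + (\<integral>x. (x - A.a (s x)) \<bullet> x \<partial>\<alpha>)"
    using A.integral_comp_inner_id[of \<Phi>] square_integrable_inner[OF square_integrable_diff[OF A.sq_id A.sq_comp[of A.a]] A.sq_id]
    by (simp add: P_def inner_add_left)
  also have "(\<integral>y. Q y \<bullet> y \<partial>\<beta>) = (\<Sum>j\<in>B.I. B.p j * (\<Psi> j \<bullet> B.a j)) + (\<integral>y. (y - B.a (t y)) \<bullet> y \<partial>\<beta>)"
    using B.integral_comp_inner_id[of \<Psi>] square_integrable_inner[OF square_integrable_diff[OF B.sq_id B.sq_comp[of B.a]] B.sq_id]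
    by (simp add: Q_def inner_add_left)
  finally have c1: "C.cost \<le> (\<Sum>i\<in>A.I. A.p i * (\<phi> i + 2 * (\<Phi> i \<bullet> A.a i))) + (\<Sum>j\<in>B.I. B.p j * (\<psi> j + 2 * (\<Psi> j \<bullet> B.a j))) + \<delta>"
    using gap \<tau>(2) A.cell_variance B.cell_variance s(2) t(2) by simp
  \<comment> \<open>The dual integrand is affine on each cell, so replacing cell barycentres by the
    integral over \<alpha> is exact, and the pointwise bound by u can be integrated.\<close>
  have "(\<Sum>i\<in>A.I. A.p i * (\<phi> i + 2 * (\<Phi> i \<bullet> A.a i))) = (\<integral>x. \<phi> (s x) + 2 * (\<Phi> (s x) \<bullet> x) \<partial>\<alpha>)"
    using A.integral_comp[of \<phi>] A.integrable_comp[of \<phi>] A.integral_comp_inner_id[of \<Phi>]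
    by (simp add: sum.distrib sum_distrib_left distrib_left mult.left_commute)
  also have "\<dots> \<le> (\<integral>x. (norm x)\<^sup>2 / 2 + u x \<partial>\<alpha>)"
  proof (rule integral_mono_AE)
    show "AE x in \<alpha>. \<phi> (s x) + 2 * (\<Phi> (s x) \<bullet> x) \<le> (norm x)\<^sup>2 / 2 + u x"
      using A.AE_I by eventually_elim (rule u(2))
  qed (use A.integrable_comp[of \<phi>] A.integral_comp_inner_id[of \<Phi>] P2_D(4)[OF A.\<alpha>] C11_1_integrable[OF u(1) A.\<alpha>] in auto)
  also have "\<dots> = m2 \<alpha> / 2 + (\<integral>x. u x \<partial>\<alpha>)"
    using P2_D(4)[OF A.\<alpha>] C11_1_integrable[OF u(1) A.\<alpha>] by (simp add: m2_def)
  finally have b1: "(\<Sum>i\<in>A.I. A.p i * (\<phi> i + 2 * (\<Phi> i \<bullet> A.a i))) \<le> m2 \<alpha> / 2 + (\<integral>x. u x \<partial>\<alpha>)" .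
  have "(\<Sum>j\<in>B.I. B.p j * (\<psi> j + 2 * (\<Psi> j \<bullet> B.a j))) = (\<integral>x. \<psi> (t x) + 2 * (\<Psi> (t x) \<bullet> x) \<partial>\<beta>)"
    using B.integral_comp[of \<psi>] B.integrable_comp[of \<psi>] B.integral_comp_inner_id[of \<Psi>]
    by (simp add: sum.distrib sum_distrib_left distrib_left mult.left_commute)
  also have "\<dots> \<le> (\<integral>x. (norm x)\<^sup>2 / 2 - u x \<partial>\<beta>)"
  proof (rule integral_mono_AE)
    show "AE x in \<beta>. \<psi> (t x) + 2 * (\<Psi> (t x) \<bullet> x) \<le> (norm x)\<^sup>2 / 2 - u x"
      using B.AE_I by eventually_elim (rule u(3))
  qed (use B.integrable_comp[of \<psi>] B.integral_comp_inner_id[of \<Psi>] P2_D(4)[OF B.\<alpha>] C11_1_integrable[OF u(1) B.\<alpha>] in auto)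
  also have "\<dots> = m2 \<beta> / 2 - (\<integral>x. u x \<partial>\<beta>)"
    using P2_D(4)[OF B.\<alpha>] C11_1_integrable[OF u(1) B.\<alpha>] by (simp add: m2_def)
  finally have b2: "(\<Sum>j\<in>B.I. B.p j * (\<psi> j + 2 * (\<Psi> j \<bullet> B.a j))) \<le> m2 \<beta> / 2 - (\<integral>x. u x \<partial>\<beta>)" .
  have "C.cost \<le> (m2 \<alpha> + m2 \<beta>) / 2 + Z2 \<alpha> \<beta> + \<delta>"
    using c1 b1 b2 Z2_upper[OF \<alpha> \<beta> u(1)] by (simp add: field_simps)
  then show thesis by (rule that[OF coupling])
    qed
  qed
qed

subsection \<open>Convex order and the cost\<close>

lemma ext_integral_integrable:
  assumes "integrable M f"
  shows "ext_integral M f = ereal (\<integral>x. f x \<partial>M)"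
proof -
  have fin: "(\<integral>\<^sup>+x. ennreal (f x) \<partial>M) < \<top>" "(\<integral>\<^sup>+x. ennreal (- f x) \<partial>M) < \<top>"
    using assms by (auto simp: real_integrable_def less_top)
  have "enn2ereal x = ereal (enn2real x)" if "x < \<top>" for x
    using that by (cases x) auto
  then show ?thesis using fin real_lebesgue_integral_def[OF assms]
    by (simp add: ext_integral_def)
qed

lemma ext_integral_PInf:
  assumes "(\<integral>\<^sup>+x. ennreal (f x) \<partial>M) = \<top>" "(\<integral>\<^sup>+x. ennreal (- f x) \<partial>M) < \<top>"
  shows "ext_integral M f = \<infinity>"
proof -
  obtain r where "(\<integral>\<^sup>+x. ennreal (- f x) \<partial>M) = ennreal r" "0 \<le> r"
    using assms(2) by (cases "(\<integral>\<^sup>+x. ennreal (- f x) \<partial>M)") auto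
  then show ?thesis using assms(1) by (simp add: ext_integral_def)
qed

text \<open>An integrable minorant makes the negative part finite, so the extended integral is never
  an indeterminate difference: either it is infinite or f is integrable.\<close>

lemma ext_integral_minorant:
  assumes l: "integrable M l" and f: "f \<in> borel_measurable M" and le: "\<And>x. l x \<le> f x"
  shows "(\<integral>\<^sup>+x. ennreal (f x - l x) \<partial>M) = \<top> \<Longrightarrow> ext_integral M f = \<infinity>"
    and "(\<integral>\<^sup>+x. ennreal (f x - l x) \<partial>M) < \<top> \<Longrightarrow> integrable M f"
proof -
  have lm: "l \<in> borel_measurable M" using l by simp
  have lfin: "(\<integral>\<^sup>+x. ennreal (norm (l x)) \<partial>M) < \<top>" using l by (simp add: integrable_iff_bounded)
  have "(\<integral>\<^sup>+x. ennreal (- f x) \<partial>M) \<le> (\<integral>\<^sup>+x. ennreal (norm (l x)) \<partial>M)"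
    by (intro nn_integral_mono ennreal_leI) (use le in \<open>smt (verit) real_norm_def\<close>)
  then have neg: "(\<integral>\<^sup>+x. ennreal (- f x) \<partial>M) < \<top>" using lfin by (rule le_less_trans)
  {
    assume inf: "(\<integral>\<^sup>+x. ennreal (f x - l x) \<partial>M) = \<top>"
    have "(\<integral>\<^sup>+x. ennreal (f x - l x) \<partial>M) \<le> (\<integral>\<^sup>+x. ennreal (f x) + ennreal (norm (l x)) \<partial>M)"
    proof (rule nn_integral_mono)
      fix x
      have "ennreal (f x - l x) \<le> ennreal (max 0 (f x) + norm (l x))" by (intro ennreal_leI) auto
      also have "\<dots> = ennreal (f x) + ennreal (norm (l x))" by (subst ennreal_plus) (auto simp: max_def ennreal_neg)
      finally show "ennreal (f x - l x) \<le> ennreal (f x) + ennreal (norm (l x))" .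
    qed
    also have "\<dots> = (\<integral>\<^sup>+x. ennreal (f x) \<partial>M) + (\<integral>\<^sup>+x. ennreal (norm (l x)) \<partial>M)"
      using f lm by (intro nn_integral_add) auto
    finally have "(\<integral>\<^sup>+x. ennreal (f x) \<partial>M) = \<top>" using inf lfin by (auto simp: top_unique less_top)
    then show "ext_integral M f = \<infinity>" using neg by (rule ext_integral_PInf)
  next
    assume fin: "(\<integral>\<^sup>+x. ennreal (f x - l x) \<partial>M) < \<top>"
    have "integrable M (\<lambda>x. f x - l x)"
      by (rule integrableI_bounded) (use f lm fin le in auto)
    then have "integrable M (\<lambda>x. (f x - l x) + l x)" using l by (rule Bochner_Integration.integrable_add)
    then show "integrable M f" by simp
  }
qed

text \<open>The point at depth \<eta> below the graph lies strictly outside the closed convex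
  epigraph. Comparing the separating hyperplane at x0 with the graph shows t > 0, so it is not
  vertical and is the graph of an affine function.\<close>

lemma convex_affine_minorant:
  fixes \<phi> :: "'a::euclidean_space \<Rightarrow> real"
  assumes \<phi>: "convex_on UNIV \<phi>" and \<eta>: "\<eta> > 0"
  shows "\<exists>q r. (\<forall>x. q \<bullet> x + r \<le> \<phi> x) \<and> \<phi> x0 - \<eta> < q \<bullet> x0 + r"
proof -
  let ?E = "epigraph UNIV \<phi>"
  have cont: "continuous_on UNIV \<phi>" by (rule convex_on_continuous[OF open_UNIV \<phi>])
  have "closed {z. \<phi> (fst z) \<le> snd z}"
    by (intro closed_Collect_le continuous_intros continuous_on_compose2[OF cont]) auto
  then have cl: "closed ?E" by (simp add: epigraph_def)
  have cv: "convex ?E" using \<phi> by (simp add: convex_epigraph)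
  have "(x0, \<phi> x0 - \<eta>) \<notin> ?E" using \<eta> by (simp add: epigraph_def)
  from separating_hyperplane_closed_point[OF cv cl this]
  obtain v b where v: "v \<bullet> (x0, \<phi> x0 - \<eta>) < b" "\<And>z. z \<in> ?E \<Longrightarrow> b < v \<bullet> z" by blast
  obtain q t where qt: "v = (q, t)" by (cases v)
  have 1: "b < q \<bullet> x + t * \<phi> x" for x using v(2)[of "(x, \<phi> x)"] by (simp add: qt epigraph_def)
  have 2: "q \<bullet> x0 + t * (\<phi> x0 - \<eta>) < b" using v(1) by (simp add: qt)
  have "0 < t * \<eta>" using 1[of x0] 2 by (simp add: algebra_simps)
  then have t: "t > 0" using \<eta> by (simp add: zero_less_mult_iff)
  show ?thesis
  proof (intro exI conjI allI)
    show "(- (1 / t) *\<^sub>R q) \<bullet> x + b / t \<le> \<phi> x" for x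
      using 1[of x] t by (simp add: field_simps)
    show "\<phi> x0 - \<eta> < (- (1 / t) *\<^sub>R q) \<bullet> x0 + b / t"
      using 2 t by (simp add: field_simps)
  qed
qed

text \<open>For each tolerance 1/(m + 1) the sets where a minorant is that close to \<phi> are open
  and cover the space, so by Lindelof countably many minorants suffice.\<close>

lemma convex_countable_affine_minorants:
  fixes \<phi> :: "'a::euclidean_space \<Rightarrow> real"
  assumes \<phi>: "convex_on UNIV \<phi>"
  obtains q :: "nat \<Rightarrow> 'a" and r :: "nat \<Rightarrow> real" where
    "\<And>n x. q n \<bullet> x + r n \<le> \<phi> x" "\<And>x e. e > 0 \<Longrightarrow> \<exists>n. \<phi> x - e < q n \<bullet> x + r n"
proof -
  have cont: "continuous_on UNIV \<phi>" by (rule convex_on_continuous[OF open_UNIV \<phi>])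
  define A where "A = {(q, r). \<forall>x. q \<bullet> x + r \<le> \<phi> x}"
  define U where "U m l = {x. \<phi> x - 1 / real (Suc m) < fst l \<bullet> x + snd l}" for m :: nat and l :: "'a \<times> real"
  have op: "open (U m l)" for m l
    unfolding U_def by (intro open_Collect_less continuous_intros cont)
  have cover: "\<Union> (U m ` A) = UNIV" for m
  proof -
    have "x \<in> \<Union> (U m ` A)" for x
      using convex_affine_minorant[OF \<phi>, of "1 / real (Suc m)" x] by (fastforce simp: A_def U_def)
    then show ?thesis by auto
  qed
  have "\<exists>L. countable L \<and> L \<subseteq> A \<and> \<Union> (U m ` L) = UNIV" for m
  proof -
    have "\<exists>F \<subseteq> U m ` A. countable F \<and> \<Union>F = \<Union> (U m ` A)"
      by (rule Lindelof[of "U m ` A"]) (use op in blast, blast)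
    then obtain F where F: "F \<subseteq> U m ` A" "countable F" "\<Union>F = \<Union> (U m ` A)" by blast
    then have "\<exists>L. countable L \<and> L \<subseteq> A \<and> F = U m ` L"
      using countable_subset_image[of F "U m" A] by blast
    then obtain L where "countable L" "L \<subseteq> A" "F = U m ` L" by blast
    then show ?thesis using F cover by auto
  qed
  then obtain L where L: "\<And>m. countable (L m)" "\<And>m. L m \<subseteq> A" "\<And>m. \<Union> (U m ` L m) = UNIV" by metis
  define S where "S = (\<Union>m. L m)"
  have S: "countable S" "S \<subseteq> A" using L by (auto simp: S_def)
  have "(0::'a) \<in> \<Union> (U 0 ` L 0)" using L(3)[of 0] by simp
  then have "S \<noteq> {}" by (auto simp: S_def)
  then have f: "range (from_nat_into S) = S" using S(1) by (rule range_from_nat_into)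
  define f where "f = from_nat_into S"
  note f = f[folded f_def]
  show thesis
  proof (rule that[of "\<lambda>n. fst (f n)" "\<lambda>n. snd (f n)"])
    fix n x
    have "f n \<in> A" using f S by auto
    then show "fst (f n) \<bullet> x + snd (f n) \<le> \<phi> x" by (auto simp: A_def split: prod.splits)
  next
    fix x and e :: real assume "e > 0"
    then obtain m where m: "1 / real (Suc m) < e" by (rule nat_approx_posE)
    obtain l where l: "l \<in> L m" "x \<in> U m l" using L(3)[of m] by blast
    then have "l \<in> range f" using f by (auto simp: S_def)
    then obtain n where "l = f n" by blast
    then show "\<exists>n. \<phi> x - e < fst (f n) \<bullet> x + snd (f n)"
      using l(2) m by (intro exI[of _ n]) (simp add: U_def)
  qed
qed

text \<open>Finite maxima of affine minorants increase to the convex function. They grow linearly,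
  hence are integrable for every measure in \<open>P2\<close>, and their subgradients are
  bounded.\<close>

fun max_affine :: "(nat \<Rightarrow> 'a::euclidean_space) \<Rightarrow> (nat \<Rightarrow> real) \<Rightarrow> nat \<Rightarrow> 'a \<Rightarrow> real" where
  "max_affine q r 0 x = q 0 \<bullet> x + r 0"
| "max_affine q r (Suc n) x = max (max_affine q r n x) (q (Suc n) \<bullet> x + r (Suc n))"

lemma max_affine_borel: "max_affine q r n \<in> borel_measurable borel"
proof (induction n)
  case 0
  show ?case by (simp add: max_affine.simps[abs_def])
next
  case (Suc n)
  then show ?case by (simp add: max_affine.simps[abs_def])
qed

lemma max_affine_ge: "i \<le> n \<Longrightarrow> q i \<bullet> x + r i \<le> max_affine q r n x"
proof (induction n)
  case (Suc n)
  then show ?case by (cases "i = Suc n") (auto simp: le_max_iff_disj)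
qed simp

lemma max_affine_le: "(\<And>i. q i \<bullet> x + r i \<le> B) \<Longrightarrow> max_affine q r n x \<le> B"
  by (induction n) auto

lemma max_affine_integrable:
  assumes "\<rho> \<in> P2"
  shows "integrable \<rho> (max_affine q r n)"
proof -
  interpret prob_space \<rho> using P2_D[OF assms] by simp
  have a: "integrable \<rho> (\<lambda>x. q i \<bullet> x + r i)" for i
    using P2_integrable_id[OF assms] by auto
  show ?thesis
  proof (induction n)
    case 0
    show ?case using a[of 0] by (simp add: max_affine.simps[abs_def])
  next
    case (Suc n)
    have "integrable \<rho> (\<lambda>x. max (max_affine q r n x) (q (Suc n) \<bullet> x + r (Suc n)))"
      using Suc a by (intro integrable_max)
    then show ?case by (simp add: max_affine.simps[abs_def])
  qed
qed

text \<open>The bounded measurable selection is an admissible test function in the marginal constraint.\<close>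
lemma max_affine_subgradient:
  "\<exists>s. s \<in> borel_measurable borel \<and> bounded (range s) \<and>
    (\<forall>x y. max_affine q r n x + s x \<bullet> (y - x) \<le> max_affine q r n y)"
proof (induction n)
  case 0
  show ?case by (intro exI[of _ "\<lambda>_. q 0"]) (auto simp: inner_diff_right)
next
  case (Suc n)
  then obtain s where s: "s \<in> borel_measurable borel" "bounded (range s)"
    "\<And>x y. max_affine q r n x + s x \<bullet> (y - x) \<le> max_affine q r n y" by blast
  note [measurable] = s(1) max_affine_borel[of q r n]
  let ?l = "\<lambda>x. q (Suc n) \<bullet> x + r (Suc n)"
  let ?s = "\<lambda>x. if ?l x \<le> max_affine q r n x then s x else q (Suc n)"
  show ?case
  proof (intro exI[of _ ?s] conjI allI)
    show "?s \<in> borel_measurable borel" by measurable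
    have "range ?s \<subseteq> insert (q (Suc n)) (range s)" by auto
    then show "bounded (range ?s)" using s(2) by (meson bounded_insert bounded_subset)
    show "max_affine q r (Suc n) x + ?s x \<bullet> (y - x) \<le> max_affine q r (Suc n) y" for x y
      using s(3)[of x y] by (auto simp: inner_diff_right le_max_iff_disj max_def)
  qed
qed

text \<open>\<open>con\<close> states E[K|X] = X, so this is conditional Jensen. It is proved for
  finite maxima of affine functions, where a bounded subgradient at X is a legitimate test field in
  \<open>con\<close>, and extended to all convex functions by monotone convergence.\<close>

lemma convex_dominates_conditional:
  fixes X K :: "'w \<Rightarrow> 'a::euclidean_space"
  assumes N: "prob_space N" and X: "X \<in> borel_measurable N" and K: "square_integrable N K"
    and law: "distr N borel X = \<alpha>" and \<alpha>: "\<alpha> \<in> P2"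
    and con: "\<And>\<Phi>. \<Phi> \<in> borel_measurable borel \<Longrightarrow> bounded (range \<Phi>) \<Longrightarrow> (\<integral>w. \<Phi> (X w) \<bullet> K w \<partial>N) = (\<integral>x. \<Phi> x \<bullet> x \<partial>\<alpha>)"
  shows "distr N borel K \<in> P2" "m2 (distr N borel K) = (\<integral>w. (norm (K w))\<^sup>2 \<partial>N)"
    "convex_dominates (distr N borel K) \<alpha>"
proof -
  interpret N: prob_space N by fact
  have Km: "K \<in> borel_measurable N" using K by (rule square_integrableD)
  let ?\<rho> = "distr N borel K"
  show \<rho>: "?\<rho> \<in> P2"
    using N.prob_space_distr[OF Km] square_integrableD(2)[OF K] Km
    by (simp add: P2_def integrable_distr_eq)
  show "m2 ?\<rho> = (\<integral>w. (norm (K w))\<^sup>2 \<partial>N)" unfolding m2_def by (rule integral_distr[OF Km]) simp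
  have sqX: "square_integrable N X"
  proof -
    have "integrable (distr N borel X) (\<lambda>x. (norm x)\<^sup>2)" using P2_D(4)[OF \<alpha>] by (simp add: law)
    then show ?thesis using X by (simp add: square_integrable_def integrable_distr_eq)
  qed
  show "convex_dominates ?\<rho> \<alpha>"
    unfolding convex_dominates_def
  proof (intro allI impI)
    fix \<phi> :: "'a \<Rightarrow> real" assume \<phi>: "convex_on UNIV \<phi>"
    have \<phi>m: "\<phi> \<in> borel_measurable borel"
      by (rule borel_measurable_continuous_onI[OF convex_on_continuous[OF open_UNIV \<phi>]])
    obtain q r where qr: "\<And>n x. q n \<bullet> x + r n \<le> \<phi> x" "\<And>x e. e > 0 \<Longrightarrow> \<exists>n::nat. \<phi> x - e < q n \<bullet> x + r n"
      by (rule convex_countable_affine_minorants[OF \<phi>]) (rule that)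
    let ?m = "max_affine q r"
    have mle: "?m n x \<le> \<phi> x" for n x by (rule max_affine_le[OF qr(1)])
    have minc: "?m n x \<le> ?m n' x" if "n \<le> n'" for n n' x
      using that by (induction n' rule: dec_induct) (auto simp: le_max_iff_disj)
    have step: "(\<integral>x. ?m n x \<partial>\<alpha>) \<le> (\<integral>x. ?m n x \<partial>?\<rho>)" for n
    proof -
      obtain s where s: "s \<in> borel_measurable borel" "bounded (range s)"
        "\<And>x y. ?m n x + s x \<bullet> (y - x) \<le> ?m n y" using max_affine_subgradient[of q r n] by blast
      obtain C where C: "\<And>x. norm (s x) \<le> C" using s(2) by (auto simp: bounded_iff)
      have sqs: "square_integrable N (\<lambda>w. s (X w))"
        by (rule N.square_integrable_bounded[where C=C]) (use C measurable_compose[OF X s(1)] in auto)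
      have iX: "integrable N (\<lambda>w. ?m n (X w))" "(\<integral>w. ?m n (X w) \<partial>N) = (\<integral>x. ?m n x \<partial>\<alpha>)"
        using max_affine_integrable[OF \<alpha>, of q r n] integrable_distr_eq[OF X max_affine_borel, of q r n]
          integral_distr[OF X max_affine_borel, of q r n] by (simp_all add: law)
      have iK: "integrable N (\<lambda>w. ?m n (K w))" "(\<integral>w. ?m n (K w) \<partial>N) = (\<integral>x. ?m n x \<partial>?\<rho>)"
        using max_affine_integrable[OF \<rho>, of q r n] integrable_distr_eq[OF Km max_affine_borel, of q r n]
          integral_distr[OF Km max_affine_borel, of q r n] by simp_all
      have sX: "(\<integral>w. s (X w) \<bullet> X w \<partial>N) = (\<integral>x. s x \<bullet> x \<partial>\<alpha>)"
        using integral_distr[OF X, of "\<lambda>x. s x \<bullet> x"] s(1) by (simp add: law)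
      have "(\<integral>x. ?m n x \<partial>\<alpha>) = (\<integral>w. ?m n (X w) + (s (X w) \<bullet> K w - s (X w) \<bullet> X w) \<partial>N)"
        using iX square_integrable_inner[OF sqs K] square_integrable_inner[OF sqs sqX] con[OF s(1,2)] sX by simp
      also have "\<dots> \<le> (\<integral>w. ?m n (K w) \<partial>N)"
        using iX(1) iK(1) square_integrable_inner[OF sqs K] square_integrable_inner[OF sqs sqX] s(3)
        by (intro integral_mono) (auto simp: inner_diff_right)
      finally show ?thesis using iK(2) by simp
    qed
    \<comment> \<open>The zeroth maximum is affine, and a constant field in \<open>con\<close> shows
      that the law of K and \<alpha> have the same mean.\<close>
    have base: "(\<integral>x. ?m 0 x \<partial>?\<rho>) = (\<integral>x. ?m 0 x \<partial>\<alpha>)"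
    proof -
      have "(\<integral>w. q 0 \<bullet> K w \<partial>N) = (\<integral>x. q 0 \<bullet> x \<partial>\<alpha>)" by (rule con) auto
      then have "(\<integral>x. q 0 \<bullet> x \<partial>?\<rho>) = (\<integral>x. q 0 \<bullet> x \<partial>\<alpha>)" using integral_distr[OF Km, of "\<lambda>x. q 0 \<bullet> x"] by simp
      moreover have "(\<integral>x. ?m 0 x \<partial>L) = (\<integral>x. q 0 \<bullet> x \<partial>L) + r 0" if "L \<in> P2" for L
      proof -
        interpret L: prob_space L using P2_D[OF that] by simp
        show ?thesis using P2_integrable_id[OF that] by (simp add: L.prob_space)
      qed
      ultimately show ?thesis using \<rho> \<alpha> by simp
    qed
    have mm: "?m n \<in> borel_measurable L" "\<phi> \<in> borel_measurable L" if "L \<in> P2" for L n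
      using borel_measurable_sets_borel[OF P2_D(2)[OF that]] max_affine_borel \<phi>m by auto
    \<comment> \<open>Subtracting the affine minorant makes the integrands nonnegative, so monotone
      convergence applies even if the integral of \<phi> is infinite.\<close>
    have nn: "(\<integral>\<^sup>+x. ennreal (\<phi> x - ?m 0 x) \<partial>\<alpha>) \<le> (\<integral>\<^sup>+x. ennreal (\<phi> x - ?m 0 x) \<partial>?\<rho>)"
    proof -
      have "ennreal (\<phi> x - ?m 0 x) = (SUP n. ennreal (?m n x - ?m 0 x))" for x
      proof (rule antisym)
        show "ennreal (\<phi> x - ?m 0 x) \<le> (SUP n. ennreal (?m n x - ?m 0 x))"
        proof (rule ennreal_le_epsilon)
          fix e :: real assume e: "e > 0"
          obtain n where n: "\<phi> x - e < q n \<bullet> x + r n" using qr(2)[OF e] by blast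
          have "\<phi> x - ?m 0 x \<le> (?m n x - ?m 0 x) + e"
            using n max_affine_ge[of n n q x r] by linarith
          then have "ennreal (\<phi> x - ?m 0 x) \<le> ennreal ((?m n x - ?m 0 x) + e)" by (rule ennreal_leI)
          also have "\<dots> = ennreal (?m n x - ?m 0 x) + ennreal e"
            using minc[of 0 n x] e by (intro ennreal_plus) auto
          also have "\<dots> \<le> (SUP n. ennreal (?m n x - ?m 0 x)) + ennreal e"
            by (intro add_mono SUP_upper) auto
          finally show "ennreal (\<phi> x - ?m 0 x) \<le> (SUP n. ennreal (?m n x - ?m 0 x)) + ennreal e" .
        qed
        show "(SUP n. ennreal (?m n x - ?m 0 x)) \<le> ennreal (\<phi> x - ?m 0 x)"
          by (intro SUP_least ennreal_leI diff_right_mono mle)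
      qed
      then have "(\<integral>\<^sup>+x. ennreal (\<phi> x - ?m 0 x) \<partial>\<alpha>) = (\<integral>\<^sup>+x. (SUP n. ennreal (?m n x - ?m 0 x)) \<partial>\<alpha>)" by simp
      also have "\<dots> = (SUP n. \<integral>\<^sup>+x. ennreal (?m n x - ?m 0 x) \<partial>\<alpha>)"
      proof (rule nn_integral_monotone_convergence_SUP)
        show "incseq (\<lambda>n x. ennreal (?m n x - ?m 0 x))"
          by (intro incseq_SucI le_funI ennreal_leI diff_right_mono minc) simp
        show "(\<lambda>x. ennreal (?m n x - ?m 0 x)) \<in> borel_measurable \<alpha>" for n
          using mm(1)[OF \<alpha>, of n] mm(1)[OF \<alpha>, of 0] by measurable
      qed
      also have "\<dots> \<le> (\<integral>\<^sup>+x. ennreal (\<phi> x - ?m 0 x) \<partial>?\<rho>)"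
      proof (rule SUP_least)
        fix n
        have i: "integrable L (\<lambda>x. ?m n x - ?m 0 x)" if "L \<in> P2" for L
          by (intro Bochner_Integration.integrable_diff max_affine_integrable that)
        have pos: "0 \<le> ?m n x - ?m 0 x" for x using minc[of 0 n x] by simp
        have "(\<integral>x. ?m n x - ?m 0 x \<partial>\<alpha>) \<le> (\<integral>x. ?m n x - ?m 0 x \<partial>?\<rho>)"
          using step[of n] base max_affine_integrable[OF \<alpha>] max_affine_integrable[OF \<rho>]
          by (simp del: max_affine.simps)
        then have "(\<integral>\<^sup>+x. ennreal (?m n x - ?m 0 x) \<partial>\<alpha>) \<le> (\<integral>\<^sup>+x. ennreal (?m n x - ?m 0 x) \<partial>?\<rho>)"
          using nn_integral_eq_integral[OF i[OF \<alpha>]] nn_integral_eq_integral[OF i[OF \<rho>]] pos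
          by (simp del: max_affine.simps add: ennreal_leI)
        also have "\<dots> \<le> (\<integral>\<^sup>+x. ennreal (\<phi> x - ?m 0 x) \<partial>?\<rho>)"
          by (intro nn_integral_mono ennreal_leI diff_right_mono mle)
        finally show "(\<integral>\<^sup>+x. ennreal (?m n x - ?m 0 x) \<partial>\<alpha>) \<le> (\<integral>\<^sup>+x. ennreal (\<phi> x - ?m 0 x) \<partial>?\<rho>)" .
      qed
      finally show ?thesis .
    qed
    show "ext_integral \<alpha> \<phi> \<le> ext_integral ?\<rho> \<phi>"
    proof (cases "(\<integral>\<^sup>+x. ennreal (\<phi> x - ?m 0 x) \<partial>?\<rho>) = \<top>")
      case True
      then have "ext_integral ?\<rho> \<phi> = \<infinity>"
        by (rule ext_integral_minorant(1)[OF max_affine_integrable[OF \<rho>] mm(2)[OF \<rho>] mle])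
      then show ?thesis by simp
    next
      case False
      then have f\<rho>: "(\<integral>\<^sup>+x. ennreal (\<phi> x - ?m 0 x) \<partial>?\<rho>) < \<top>" by (simp add: less_top)
      then have f\<alpha>: "(\<integral>\<^sup>+x. ennreal (\<phi> x - ?m 0 x) \<partial>\<alpha>) < \<top>" using nn by (rule le_less_trans[rotated])
      have i\<rho>: "integrable ?\<rho> \<phi>"
        by (rule ext_integral_minorant(2)[OF max_affine_integrable[OF \<rho>] mm(2)[OF \<rho>] mle f\<rho>])
      have i\<alpha>: "integrable \<alpha> \<phi>"
        by (rule ext_integral_minorant(2)[OF max_affine_integrable[OF \<alpha>] mm(2)[OF \<alpha>] mle f\<alpha>])
      have d: "integrable L (\<lambda>x. \<phi> x - ?m 0 x)" if "integrable L \<phi>" "L \<in> P2" for L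
        by (intro Bochner_Integration.integrable_diff max_affine_integrable that)
      have "ennreal (\<integral>x. \<phi> x - ?m 0 x \<partial>\<alpha>) \<le> ennreal (\<integral>x. \<phi> x - ?m 0 x \<partial>?\<rho>)"
        using nn nn_integral_eq_integral[OF d[OF i\<alpha> \<alpha>]] nn_integral_eq_integral[OF d[OF i\<rho> \<rho>]] mle
        by (simp del: max_affine.simps)
      moreover have "0 \<le> (\<integral>x. \<phi> x - ?m 0 x \<partial>?\<rho>)"
        using mle by (intro integral_nonneg_AE AE_I2) (simp del: max_affine.simps)
      ultimately have "(\<integral>x. \<phi> x - ?m 0 x \<partial>\<alpha>) \<le> (\<integral>x. \<phi> x - ?m 0 x \<partial>?\<rho>)" by (simp add: ennreal_le_iff del: max_affine.simps)
      then have "(\<integral>x. \<phi> x \<partial>\<alpha>) \<le> (\<integral>x. \<phi> x \<partial>?\<rho>)"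
        using i\<rho> i\<alpha> base max_affine_integrable[OF \<alpha>] max_affine_integrable[OF \<rho>]
        by (simp del: max_affine.simps)
      then show ?thesis by (simp add: ext_integral_integrable[OF i\<alpha>] ext_integral_integrable[OF i\<rho>])
    qed
  qed
qed

lemma Ccost_le:
  assumes "\<rho> \<in> P2" "convex_dominates \<rho> \<alpha>" "convex_dominates \<rho> \<beta>"
  shows "Ccost \<alpha> \<beta> \<le> m2 \<rho>"
  unfolding Ccost_def
proof (rule cInf_lower)
  show "bdd_below {m2 \<rho> |\<rho>. \<rho> \<in> P2 \<and> convex_dominates \<rho> \<alpha> \<and> convex_dominates \<rho> \<beta>}"
    by (rule bdd_belowI[of _ 0]) (auto simp: m2_def intro: integral_nonneg_AE)
qed (use assms in blast)

text \<open>The law of dq/d\<gamma> under \<gamma> is a competitor for \<open>Ccost\<close>: the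
  constraints say that its conditional mean given either coordinate is that coordinate.\<close>

lemma Ccost_le_energy:
  fixes \<alpha> \<beta> :: "'a::euclidean_space measure"
  assumes P: "P \<in> GammaQ \<alpha> \<beta>" and \<alpha>: "\<alpha> \<in> P2" and \<beta>: "\<beta> \<in> P2"
    and i: "integrable (gam P) (\<lambda>z. (norm (vdens P z))\<^sup>2)"
  shows "Ccost \<alpha> \<beta> \<le> (\<integral>z. (norm (vdens P z))\<^sup>2 \<partial>gam P)"
proof -
  interpret P: nonneg_vmeas P by (rule GammaQ_nonneg_vmeas[OF P])
  have m1: "distr (gam P) borel fst = \<alpha>" and m2: "distr (gam P) borel snd = \<beta>"
    and q1: "\<And>\<Phi>. \<Phi> \<in> borel_measurable borel \<Longrightarrow> bounded (range \<Phi>) \<Longrightarrow> (\<integral>z. \<Phi> (fst z) \<bullet> vdens P z \<partial>gam P) = (\<integral>x. \<Phi> x \<bullet> x \<partial>\<alpha>)"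
    and q2: "\<And>\<Phi>. \<Phi> \<in> borel_measurable borel \<Longrightarrow> bounded (range \<Phi>) \<Longrightarrow> (\<integral>z. \<Phi> (snd z) \<bullet> vdens P z \<partial>gam P) = (\<integral>x. \<Phi> x \<bullet> x \<partial>\<beta>)"
    using P unfolding GammaQ_iff[OF P2_D(1,2)[OF \<alpha>] P2_D(1,2)[OF \<beta>]] by blast+
  have fm: "fst \<in> borel_measurable (gam P)" "snd \<in> borel_measurable (gam P)"
    by (intro P.borelG borel_measurable_continuous_onI continuous_intros)+
  have pr: "prob_space (gam P)"
    by (rule prob_space_distrD[OF fm(1)]) (use m1 P2_D(1)[OF \<alpha>] in simp)
  have sq: "square_integrable (gam P) (vdens P)"
    using i P.borelG[OF vdens_borel[OF P.VM]] by (simp add: square_integrable_def)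
  note d1 = convex_dominates_conditional[OF pr fm(1) sq m1 \<alpha> q1]
  note d2 = convex_dominates_conditional[OF pr fm(2) sq m2 \<beta> q2]
  have "Ccost \<alpha> \<beta> \<le> m2 (distr (gam P) borel (vdens P))" by (rule Ccost_le[OF d1(1,3) d2(3)])
  also have "\<dots> = (\<integral>z. (norm (vdens P z))\<^sup>2 \<partial>gam P)" by (rule d1(2))
  finally show ?thesis .
qed

text \<open>By the lower Taylor bound |z|^2/2 + u lies above its tangents; two tangent inequalities
  at the intermediate point, averaged, give convexity.\<close>

lemma C11_1_convex:
  fixes u :: "'a::euclidean_space \<Rightarrow> real"
  assumes "C11_1 u"
  shows "convex_on UNIV (\<lambda>z. (norm z)\<^sup>2 / 2 + u z)"
proof -
  obtain G where G: "\<And>x y. \<bar>u y - u x - G x \<bullet> (y - x)\<bar> \<le> (norm (y - x))\<^sup>2 / 2"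
    using C11_1_taylor[OF assms] by blast
  let ?f = "\<lambda>z. (norm z)\<^sup>2 / 2 + u z"
  have tan: "?f x + (G x + x) \<bullet> (y - x) \<le> ?f y" for x y
    using abs_le_D2[OF G[of y x]]
    by (simp add: power2_norm_eq_inner inner_diff_left inner_diff_right inner_add_left inner_add_right inner_commute)
  show ?thesis
  proof (rule convex_onI)
    fix t :: real and x y :: 'a assume t: "0 < t" "t < 1"
    let ?z = "(1 - t) *\<^sub>R x + t *\<^sub>R y"
    have "(1 - t) * (?f ?z + (G ?z + ?z) \<bullet> (x - ?z)) \<le> (1 - t) * ?f x"
      using tan[of ?z x] t by (intro mult_left_mono) auto
    moreover have "t * (?f ?z + (G ?z + ?z) \<bullet> (y - ?z)) \<le> t * ?f y"
      using tan[of ?z y] t by (intro mult_left_mono) auto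
    moreover have "(1 - t) * ((G ?z + ?z) \<bullet> (x - ?z)) + t * ((G ?z + ?z) \<bullet> (y - ?z)) = 0"
    proof -
      have "(1 - t) * ((G ?z + ?z) \<bullet> (x - ?z)) + t * ((G ?z + ?z) \<bullet> (y - ?z))
         = (G ?z + ?z) \<bullet> ((1 - t) *\<^sub>R (x - ?z) + t *\<^sub>R (y - ?z))" by (simp add: inner_add_right)
      also have "(1 - t) *\<^sub>R (x - ?z) + t *\<^sub>R (y - ?z) = 0" by (simp add: algebra_simps)
      finally show ?thesis by simp
    qed
    moreover have "(1 - t) * (?f ?z + (G ?z + ?z) \<bullet> (x - ?z)) + t * (?f ?z + (G ?z + ?z) \<bullet> (y - ?z))
        = ?f ?z + ((1 - t) * ((G ?z + ?z) \<bullet> (x - ?z)) + t * ((G ?z + ?z) \<bullet> (y - ?z)))"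
      by (simp only: distrib_left left_diff_distrib)
    ultimately show "?f ?z \<le> (1 - t) * ?f x + t * ?f y" by linarith
  qed simp
qed

text \<open>For a competitor \<rho>, test its convex order over \<alpha> with |z|^2/2 + u and over
  \<beta> with |z|^2/2 - u; in the sum the integrals of u under \<rho> cancel.\<close>

lemma Z2_le_Ccost:
  fixes \<alpha> \<beta> :: "'a::euclidean_space measure"
  assumes \<alpha>: "\<alpha> \<in> P2b b" and \<beta>: "\<beta> \<in> P2b b"
  shows "(m2 \<alpha> + m2 \<beta>) / 2 + Z2 \<alpha> \<beta> \<le> Ccost \<alpha> \<beta>"
  unfolding Ccost_def
proof (rule cInf_greatest)
  note \<alpha>2 = P2b_P2[OF \<alpha>] and \<beta>2 = P2b_P2[OF \<beta>]
  \<comment> \<open>Any coupling will do: the law of its K dominates both measures, so the set under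
    the infimum is not empty.\<close>
  obtain g K M where "martingale_coupling \<alpha> \<beta> g K M" 
    by (rule near_optimal_coupling[OF \<alpha> \<beta> zero_less_one]) (rule that)
  then interpret C: martingale_coupling \<alpha> \<beta> g K M .
  have fm: "fst \<in> borel_measurable C.law" "snd \<in> borel_measurable C.law"
    by (rule borel_measurable_sets_borel[OF C.sets_law C.fst_borel] borel_measurable_sets_borel[OF C.sets_law C.snd_borel])+
  note d1 = convex_dominates_conditional[OF C.prob_law fm(1) C.sq_law(3) C.distr_law_fst \<alpha>2 C.law_constraint_fst]
  note d2 = convex_dominates_conditional[OF C.prob_law fm(2) C.sq_law(3) C.distr_law_snd \<beta>2 C.law_constraint_snd]
  show "{m2 \<rho> |\<rho>. \<rho> \<in> P2 \<and> convex_dominates \<rho> \<alpha> \<and> convex_dominates \<rho> \<beta>} \<noteq> {}"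
    using d1 d2 by blast
  fix x assume "x \<in> {m2 \<rho> |\<rho>. \<rho> \<in> P2 \<and> convex_dominates \<rho> \<alpha> \<and> convex_dominates \<rho> \<beta>}"
  then obtain \<rho> where \<rho>: "\<rho> \<in> P2" "convex_dominates \<rho> \<alpha>" "convex_dominates \<rho> \<beta>" and x: "x = m2 \<rho>" by blast
  have half: "m2 L / 2 + (\<integral>z. u z \<partial>L) \<le> m2 \<rho> / 2 + (\<integral>z. u z \<partial>\<rho>)"
    if u: "C11_1 u" and L: "L \<in> P2" "convex_dominates \<rho> L" for u and L :: "'a measure"
  proof -
    have i: "integrable L' (\<lambda>z. (norm z)\<^sup>2 / 2 + u z)" "(\<integral>z. (norm z)\<^sup>2 / 2 + u z \<partial>L') = m2 L' / 2 + (\<integral>z. u z \<partial>L')"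
      if "L' \<in> P2" for L'
      using P2_D(4)[OF that] C11_1_integrable[OF u that] by (simp_all add: m2_def)
    have "ext_integral L (\<lambda>z. (norm z)\<^sup>2 / 2 + u z) \<le> ext_integral \<rho> (\<lambda>z. (norm z)\<^sup>2 / 2 + u z)"
      using L(2) C11_1_convex[OF u] by (simp add: convex_dominates_def)
    then show ?thesis by (simp add: ext_integral_integrable[OF i(1)] L \<rho> i(2))
  qed
  have "Z2 \<alpha> \<beta> \<le> m2 \<rho> - (m2 \<alpha> + m2 \<beta>) / 2"
  proof (rule Z2_least)
    fix u :: "'a \<Rightarrow> real" assume u: "C11_1 u"
    show "(\<integral>z. u z \<partial>\<alpha>) - (\<integral>z. u z \<partial>\<beta>) \<le> m2 \<rho> - (m2 \<alpha> + m2 \<beta>) / 2"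
      using half[OF u \<alpha>2 \<rho>(2)] half[OF C11_1_uminus[OF u] \<beta>2 \<rho>(3)] by (simp add: field_simps)
  qed
  then show "(m2 \<alpha> + m2 \<beta>) / 2 + Z2 \<alpha> \<beta> \<le> x" by (simp add: x)
qed

text \<open>Over either second moment the excess of the cost is half the difference of the moments
  plus Z2 plus \<delta>; that half difference is at most another Z2.\<close>

lemma close_coupling:
  fixes \<alpha> \<beta> :: "'a::euclidean_space measure"
  assumes \<alpha>: "\<alpha> \<in> P2b b" and \<beta>: "\<beta> \<in> P2b b" and \<delta>: "\<delta> > 0"
  shows "\<exists>g K M. martingale_coupling \<alpha> \<beta> g K M
     \<and> martingale_coupling.cost \<alpha> \<beta> g K - m2 \<alpha> \<le> 2 * Z2 \<alpha> \<beta> + \<delta>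
     \<and> martingale_coupling.cost \<alpha> \<beta> g K - m2 \<beta> \<le> 2 * Z2 \<alpha> \<beta> + \<delta>"
proof (rule near_optimal_coupling[OF \<alpha> \<beta> \<delta>])
  fix g K M assume c: "martingale_coupling \<alpha> \<beta> g K M"
    and le: "martingale_coupling.cost \<alpha> \<beta> g K \<le> (m2 \<alpha> + m2 \<beta>) / 2 + Z2 \<alpha> \<beta> + \<delta>"
  have "m2 \<beta> - m2 \<alpha> \<le> 2 * Z2 \<alpha> \<beta>" "m2 \<alpha> - m2 \<beta> \<le> 2 * Z2 \<alpha> \<beta>"
    using m2_diff_le_Z2[OF \<beta> \<alpha>] m2_diff_le_Z2[OF \<alpha> \<beta>] Z2_commute[of \<alpha> \<beta>] by auto
  then show ?thesis using c le by (intro exI[of _ g] exI[of _ K] exI[of _ M]) (auto simp: field_simps)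
qed

text \<open>Convergence in \<open>Z2\<close> gives couplings of \<mu> and \<open>\<mu>s n\<close>
  whose mean square distance tends to zero, by \<open>integral_dist_le\<close>. As only near-optimal
  couplings are available, a slack 1/(n + 1) is added.\<close>

lemma integral_limit_Z2:
  fixes \<mu> :: "'a::euclidean_space measure" and h :: "'a \<Rightarrow> real"
  assumes \<mu>: "\<mu> \<in> P2b b" and \<mu>s: "\<And>n. \<mu>s n \<in> P2b b" and Z: "(\<lambda>n. Z2 (\<mu>s n) \<mu>) \<longlonglongrightarrow> 0"
    and h: "continuous_on UNIV h" "\<And>z. norm (h z) \<le> C * (1 + (norm z)\<^sup>2)"
  shows "(\<lambda>n. \<integral>x. h x \<partial>\<mu>s n) \<longlonglongrightarrow> (\<integral>x. h x \<partial>\<mu>)"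
proof -
  have "\<forall>n. \<exists>g K M. martingale_coupling \<mu> (\<mu>s n) g K M
     \<and> martingale_coupling.cost \<mu> (\<mu>s n) g K - m2 \<mu> \<le> 2 * Z2 \<mu> (\<mu>s n) + 1 / real (Suc n)
     \<and> martingale_coupling.cost \<mu> (\<mu>s n) g K - m2 (\<mu>s n) \<le> 2 * Z2 \<mu> (\<mu>s n) + 1 / real (Suc n)"
    using close_coupling[OF \<mu> \<mu>s] by simp
  then obtain g K M where c: "\<And>n. martingale_coupling \<mu> (\<mu>s n) (g n) (K n) (M n)"
    and d: "\<And>n. martingale_coupling.cost \<mu> (\<mu>s n) (g n) (K n) - m2 \<mu> \<le> 2 * Z2 \<mu> (\<mu>s n) + 1 / real (Suc n)"
      "\<And>n. martingale_coupling.cost \<mu> (\<mu>s n) (g n) (K n) - m2 (\<mu>s n) \<le> 2 * Z2 \<mu> (\<mu>s n) + 1 / real (Suc n)"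
    by metis
  define N where "N n = martingale_coupling.law \<mu> (\<mu>s n) (g n)" for n
  note cc = martingale_coupling.prob_law[OF c] martingale_coupling.sets_law[OF c]
    martingale_coupling.distr_law_fst[OF c] martingale_coupling.distr_law_snd[OF c]
    martingale_coupling.sq_law[OF c] martingale_coupling.integral_dist_le[OF c]
  have fm: "fst \<in> borel_measurable (N n)" "snd \<in> borel_measurable (N n)" for n
    unfolding N_def using martingale_coupling.fst_borel[OF c] martingale_coupling.snd_borel[OF c]
    by (auto intro!: borel_measurable_sets_borel[OF cc(2)])
  have hm: "h \<in> borel_measurable borel" using h(1) by (rule borel_measurable_continuous_onI)
  have i: "integrable (N n) (\<lambda>w. (norm (snd w - fst w))\<^sup>2)" for n
    unfolding N_def by (rule square_integrableD(2)[OF square_integrable_diff[OF cc(6,5)]])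
  have "(\<lambda>n. \<integral>w. (norm (snd w - fst w))\<^sup>2 \<partial>(N n)) \<longlonglongrightarrow> 0"
  proof (rule real_tendsto_sandwich[of "\<lambda>_. 0" _ _ "\<lambda>n. 4 * (2 * Z2 (\<mu>s n) \<mu> + 1 / real (Suc n))"])
    show "\<forall>\<^sub>F n in sequentially. (\<integral>w. (norm (snd w - fst w))\<^sup>2 \<partial>(N n)) \<le> 4 * (2 * Z2 (\<mu>s n) \<mu> + 1 / real (Suc n))"
    proof (rule always_eventually, rule allI)
      fix n
      show "(\<integral>w. (norm (snd w - fst w))\<^sup>2 \<partial>(N n)) \<le> 4 * (2 * Z2 (\<mu>s n) \<mu> + 1 / real (Suc n))"
        using cc(8)[of n] d[of n] by (simp add: N_def Z2_commute[of \<mu>])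
    qed
    have "(\<lambda>n. 4 * (2 * Z2 (\<mu>s n) \<mu> + 1 / real (Suc n))) \<longlonglongrightarrow> 4 * (2 * 0 + 0)"
      by (intro tendsto_intros Z LIMSEQ_Suc[OF lim_1_over_n])
    then show "(\<lambda>n. 4 * (2 * Z2 (\<mu>s n) \<mu> + 1 / real (Suc n))) \<longlonglongrightarrow> 0" by simp
  qed (auto simp: integral_nonneg_AE)
  note msp = mean_square_perturbation[of N "\<lambda>_. fst" "\<lambda>_. snd" \<mu>, OF _ fm _ P2b_P2[OF \<mu>] i this h]
  have lim: "(\<lambda>n. \<integral>w. norm (h (snd w) - h (fst w)) \<partial>(N n)) \<longlonglongrightarrow> 0"
    using msp cc(1,3) by (auto simp: N_def)
  have ih: "integrable (\<mu>s n) h" "integrable \<mu> h" for n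
    by (rule P2_integrable[OF P2b_P2[OF \<mu>s] hm h(2)] P2_integrable[OF P2b_P2[OF \<mu>] hm h(2)])+
  have "norm ((\<integral>x. h x \<partial>\<mu>s n) - (\<integral>x. h x \<partial>\<mu>)) \<le> (\<integral>w. norm (h (snd w) - h (fst w)) \<partial>(N n))" for n
  proof -
    have e: "(\<integral>x. h x \<partial>\<mu>s n) = (\<integral>w. h (snd w) \<partial>(N n))" "(\<integral>x. h x \<partial>\<mu>) = (\<integral>w. h (fst w) \<partial>(N n))"
      using integral_distr[OF fm(2)[of n] hm] integral_distr[OF fm(1)[of n] hm] cc(3,4)[of n] by (simp_all add: N_def)
    have ii: "integrable (N n) (\<lambda>w. h (snd w))" "integrable (N n) (\<lambda>w. h (fst w))"
      using integrable_distr_eq[OF fm(2)[of n] hm] integrable_distr_eq[OF fm(1)[of n] hm] cc(3,4)[of n] ih by (simp_all add: N_def)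
    have "(\<integral>x. h x \<partial>\<mu>s n) - (\<integral>x. h x \<partial>\<mu>) = (\<integral>w. h (snd w) - h (fst w) \<partial>(N n))"
      unfolding e using ii by simp
    then show ?thesis using integral_norm_bound[of "N n" "\<lambda>w. h (snd w) - h (fst w)"] by simp
  qed
  then have "(\<lambda>n. (\<integral>x. h x \<partial>\<mu>s n) - (\<integral>x. h x \<partial>\<mu>)) \<longlonglongrightarrow> 0"
    by (intro Lim_null_comparison[OF _ lim] always_eventually allI)
  then show ?thesis by (simp add: LIM_zero_iff)
qed

lemma GammaQ_near_optimal:
  fixes \<alpha> \<beta> :: "'a::euclidean_space measure"
  assumes \<alpha>: "\<alpha> \<in> P2b b" and \<beta>: "\<beta> \<in> P2b b" and \<delta>: "\<delta> > 0"
  obtains P where "P \<in> GammaQ \<alpha> \<beta>" "energy P \<le> ennreal ((m2 \<alpha> + m2 \<beta>) / 2 + Z2 \<alpha> \<beta> + \<delta>)"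
proof (rule near_optimal_coupling[OF \<alpha> \<beta> \<delta>])
  fix g K M assume c: "martingale_coupling \<alpha> \<beta> g K M"
    and le: "martingale_coupling.cost \<alpha> \<beta> g K \<le> (m2 \<alpha> + m2 \<beta>) / 2 + Z2 \<alpha> \<beta> + \<delta>"
  interpret martingale_coupling \<alpha> \<beta> g K M by (rule c)
  have T: "(\<lambda>z. z) \<in> borel_measurable law" by (rule borel_measurable_sets_borel[OF sets_law]) simp
  have "\<exists>P. P \<in> GammaQ \<alpha> \<beta> \<and> energy P \<le> ennreal (\<integral>w. (norm (K w))\<^sup>2 \<partial>law)"
    by (rule vmeas_of_random_variables[OF prob_law T sq_law(3) prob(1) sets_\<alpha> prob(2) sets_\<beta>
        distr_law_fst distr_law_snd law_constraint_fst law_constraint_snd]) auto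
  then obtain P where P: "P \<in> GammaQ \<alpha> \<beta>" "energy P \<le> ennreal (\<integral>w. (norm (K w))\<^sup>2 \<partial>law)" by blast
  have "(\<integral>w. (norm (K w))\<^sup>2 \<partial>law) \<le> (m2 \<alpha> + m2 \<beta>) / 2 + Z2 \<alpha> \<beta> + \<delta>"
    using le by (simp add: cost_def)
  then have "energy P \<le> ennreal ((m2 \<alpha> + m2 \<beta>) / 2 + Z2 \<alpha> \<beta> + \<delta>)"
    using P(2) ennreal_leI order_trans by blast
  with P(1) show thesis by (rule that)
qed

lemma gam_P2:
  assumes P: "P \<in> GammaQ \<alpha> \<beta>" and \<alpha>: "\<alpha> \<in> P2" and \<beta>: "\<beta> \<in> P2"
  shows "gam P \<in> P2"
proof -
  interpret P: nonneg_vmeas P by (rule GammaQ_nonneg_vmeas[OF P])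
  have m1: "distr (gam P) borel fst = \<alpha>" and m2: "distr (gam P) borel snd = \<beta>"
    using P unfolding GammaQ_iff[OF P2_D(1,2)[OF \<alpha>] P2_D(1,2)[OF \<beta>]] by blast+
  have fm: "fst \<in> borel_measurable (gam P)" "snd \<in> borel_measurable (gam P)"
    by (intro P.borelG borel_measurable_continuous_onI continuous_intros)+
  have pr: "prob_space (gam P)"
    by (rule prob_space_distrD[OF fm(1)]) (use m1 P2_D(1)[OF \<alpha>] in simp)
  have "integrable (distr (gam P) borel fst) (\<lambda>x. (norm x)\<^sup>2)" "integrable (distr (gam P) borel snd) (\<lambda>x. (norm x)\<^sup>2)"
    using P2_D(4)[OF \<alpha>] P2_D(4)[OF \<beta>] by (simp_all add: m1 m2)
  then have "integrable (gam P) (\<lambda>z. (norm (fst z))\<^sup>2 + (norm (snd z))\<^sup>2)"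
    using fm by (intro Bochner_Integration.integrable_add) (simp_all add: integrable_distr_eq)
  then have "integrable (gam P) (\<lambda>z. (norm z)\<^sup>2)" by (simp add: norm_prod_def)
  then show ?thesis using pr sets_gam[OF P.VM] by (simp add: P2_def)
qed

text \<open>If the energy is infinite, the integrable minorant c - k C shows that the extended
  integral is infinite too. If it is finite, the integral splits, and \<open>rn\<close> may be
  exchanged for \<open>vdens\<close> a.e.\<close>

lemma ext_integral_penalised:
  assumes P: "P \<in> GammaQ \<alpha> \<beta>" and \<alpha>: "\<alpha> \<in> P2" and \<beta>: "\<beta> \<in> P2"
    and c: "integrable (gam P) c" and k: "k > 0"
  shows "energy P = \<top> \<Longrightarrow> ext_integral (gam P) (\<lambda>z. c z + k * ((norm (rn P z))\<^sup>2 - C)) = \<infinity>"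
    and "energy P < \<top> \<Longrightarrow> ext_integral (gam P) (\<lambda>z. c z + k * ((norm (rn P z))\<^sup>2 - C))
        = ereal ((\<integral>z. c z \<partial>gam P) + k * ((\<integral>z. (norm (vdens P z))\<^sup>2 \<partial>gam P) - C))"
    and "energy P < \<top> \<Longrightarrow> integrable (gam P) (\<lambda>z. (norm (vdens P z))\<^sup>2)"
    and "energy P < \<top> \<Longrightarrow> energy P = ennreal (\<integral>z. (norm (vdens P z))\<^sup>2 \<partial>gam P)"
proof -
  interpret P: nonneg_vmeas P by (rule GammaQ_nonneg_vmeas[OF P])
  have ac: "AE z in fst P. fst (snd P z) = 0 \<longrightarrow> snd (snd P z) = 0"
    using P unfolding GammaQ_iff[OF P2_D(1,2)[OF \<alpha>] P2_D(1,2)[OF \<beta>]] by blast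
  interpret G: prob_space "gam P" using P2_D(1)[OF gam_P2[OF P \<alpha> \<beta>]] .
  note rnm = P.borelG[OF P.rn_vdens(1)[OF ac]] and vm = P.borelG[OF vdens_borel[OF P.VM]]
  have fm: "(\<lambda>z. c z + k * ((norm (rn P z))\<^sup>2 - C)) \<in> borel_measurable (gam P)"
    using rnm c by measurable
  {
    assume inf: "energy P = \<top>"
    show "ext_integral (gam P) (\<lambda>z. c z + k * ((norm (rn P z))\<^sup>2 - C)) = \<infinity>"
    proof (rule ext_integral_minorant(1))
      show "integrable (gam P) (\<lambda>z. c z - k * C)" using c by simp
      show "c z - k * C \<le> c z + k * ((norm (rn P z))\<^sup>2 - C)" for z
        using k by (simp add: algebra_simps)
      have "(\<integral>\<^sup>+z. ennreal (c z + k * ((norm (rn P z))\<^sup>2 - C) - (c z - k * C)) \<partial>gam P)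
          = (\<integral>\<^sup>+z. ennreal k * ennreal ((norm (rn P z))\<^sup>2) \<partial>gam P)"
        using k by (intro nn_integral_cong) (simp add: ennreal_mult[symmetric] algebra_simps)
      also have "\<dots> = ennreal k * energy P"
        unfolding energy_def using rnm by (intro nn_integral_cmult) measurable
      also have "\<dots> = \<top>" using inf k by (simp add: ennreal_mult_top)
      finally show "(\<integral>\<^sup>+z. ennreal (c z + k * ((norm (rn P z))\<^sup>2 - C) - (c z - k * C)) \<partial>gam P) = \<top>" .
    qed (rule fm)
  next
    assume fin: "energy P < \<top>"
    show i: "integrable (gam P) (\<lambda>z. (norm (vdens P z))\<^sup>2)"
      using fin vm by (intro integrableI_bounded) (auto simp: P.energy_vdens[OF ac])
    show "energy P = ennreal (\<integral>z. (norm (vdens P z))\<^sup>2 \<partial>gam P)"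
      unfolding P.energy_vdens[OF ac] using i by (intro nn_integral_eq_integral) auto
    have AE: "AE z in gam P. c z + k * ((norm (vdens P z))\<^sup>2 - C) = c z + k * ((norm (rn P z))\<^sup>2 - C)"
      using P.rn_vdens(2)[OF ac] by eventually_elim simp
    have i2: "integrable (gam P) (\<lambda>z. c z + k * ((norm (vdens P z))\<^sup>2 - C))" using c i by simp
    have i3: "integrable (gam P) (\<lambda>z. c z + k * ((norm (rn P z))\<^sup>2 - C))"
      by (rule integrable_cong_AE_imp[OF i2 fm AE])
    have "(\<integral>z. c z + k * ((norm (rn P z))\<^sup>2 - C) \<partial>gam P) = (\<integral>z. c z + k * ((norm (vdens P z))\<^sup>2 - C) \<partial>gam P)"
      by (rule sym, rule integral_cong_AE[OF _ fm AE]) (use i2 in simp)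
    also have "\<dots> = (\<integral>z. c z \<partial>gam P) + k * ((\<integral>z. (norm (vdens P z))\<^sup>2 \<partial>gam P) - C)"
      using c i by (simp add: G.prob_space)
    finally show "ext_integral (gam P) (\<lambda>z. c z + k * ((norm (rn P z))\<^sup>2 - C))
        = ereal ((\<integral>z. c z \<partial>gam P) + k * ((\<integral>z. (norm (vdens P z))\<^sup>2 \<partial>gam P) - C))"
      by (simp add: ext_integral_integrable[OF i3])
  }
qed

subsection \<open>Gamma-convergence\<close>

text \<open>The assumptions are inherited by subsequences, so \<open>liminf_inequality\<close> can
  instantiate the locale again. The growth of c is recorded as quadratic, the form that
  \<open>mean_square_perturbation\<close> takes.\<close>

locale marginal_approximation =
  fixes b :: "'a::euclidean_space" and c :: "'a \<times> 'a \<Rightarrow> real" and Cc D1 :: real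
    and \<mu> \<nu> :: "'a measure" and \<mu>s \<nu>s :: "nat \<Rightarrow> 'a measure" and \<epsilon> :: "nat \<Rightarrow> real"
  assumes c_cont: "continuous_on UNIV c" and c_lower: "\<And>z. - D1 \<le> c z"
    and c_growth: "\<And>z. norm (c z) \<le> Cc * (1 + (norm z)\<^sup>2)"
    and \<mu>: "\<mu> \<in> P2b b" and \<nu>: "\<nu> \<in> P2b b"
    and \<mu>s: "\<And>n. \<mu>s n \<in> P2b b" and \<nu>s: "\<And>n. \<nu>s n \<in> P2b b"
    and Z\<mu>: "(\<lambda>n. Z2 (\<mu>s n) \<mu>) \<longlonglongrightarrow> 0" and Z\<nu>: "(\<lambda>n. Z2 (\<nu>s n) \<nu>) \<longlonglongrightarrow> 0"
    and \<epsilon>_pos: "\<And>n. \<epsilon> n > 0" and \<epsilon>_lim: "\<epsilon> \<longlonglongrightarrow> 0"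
begin

definition F :: "nat \<Rightarrow> 'a vmeas \<Rightarrow> ereal" where
  "F n P = ext_integral (gam P) (\<lambda>z. c z + (1 / (2 * \<epsilon> n)) * ((norm (rn P z))\<^sup>2 - Ccost (\<mu>s n) (\<nu>s n)))
                   + chi (GammaQ (\<mu>s n) (\<nu>s n)) P"

definition F_lim :: "'a vmeas \<Rightarrow> ereal" where
  "F_lim P = ext_integral (gam P) c + chi (GammaQbar \<mu> \<nu>) P"

lemmas P2s = P2b_P2[OF \<mu>] P2b_P2[OF \<nu>] P2b_P2[OF \<mu>s] P2b_P2[OF \<nu>s]

lemma c_borel: "c \<in> borel_measurable borel"
  using c_cont by (rule borel_measurable_continuous_onI)

lemma c_integrable: "P \<in> GammaQ \<alpha> \<beta> \<Longrightarrow> \<alpha> \<in> P2 \<Longrightarrow> \<beta> \<in> P2 \<Longrightarrow> integrable (gam P) c"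
  by (rule P2_integrable[OF gam_P2 c_borel c_growth])

definition err :: "nat \<Rightarrow> real" where
  "err n = 2 * Z2 \<mu> (\<mu>s n) + 2 * Z2 \<nu> (\<nu>s n) + 2 * (\<epsilon> n / real (Suc n))"

lemma Z2_limits: "(\<lambda>n. Z2 \<mu> (\<mu>s n)) \<longlonglongrightarrow> 0" "(\<lambda>n. Z2 \<nu> (\<nu>s n)) \<longlonglongrightarrow> 0"
  using Z\<mu> Z\<nu> by (simp_all add: Z2_commute[of \<mu>] Z2_commute[of \<nu>])

lemma eps_over: "(\<lambda>n. \<epsilon> n / real (Suc n)) \<longlonglongrightarrow> 0"
proof -
  have "(\<lambda>n. \<epsilon> n * (1 / real (Suc n))) \<longlonglongrightarrow> 0 * 0"
    by (intro tendsto_mult \<epsilon>_lim LIMSEQ_Suc[OF lim_1_over_n])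
  then show ?thesis by simp
qed

lemma err_lim: "err \<longlonglongrightarrow> 0"
proof -
  have "err \<longlonglongrightarrow> 2 * 0 + 2 * 0 + 2 * 0"
    unfolding err_def[abs_def] by (intro tendsto_intros Z2_limits eps_over)
  then show ?thesis by simp
qed

text \<open>The space N with X, Y, K is exported together with P', because weak convergence of the
  recovery sequence is proved on N.\<close>

lemma perturbed_admissible:
  assumes P: "P \<in> GammaQ \<mu> \<nu>" and E: "energy P \<le> ennreal E" "0 \<le> E"
  shows "\<exists>(N :: ((('a \<times> 'a) \<times> 'a) \<times> 'a) measure) X Y K P'.
    P' \<in> GammaQ (\<mu>s n) (\<nu>s n) \<and> energy P' \<le> ennreal (E + err n) \<and>
    prob_space N \<and> X \<in> borel_measurable N \<and> Y \<in> borel_measurable N \<and>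
    distr N borel X = gam P \<and> distr N borel Y = gam P' \<and>
    square_integrable N K \<and> square_integrable N (\<lambda>w. vdens P (X w)) \<and>
    (\<integral>w. (norm (K w - vdens P (X w)))\<^sup>2 \<partial>N) \<le> err n \<and>
    integrable N (\<lambda>w. (norm (Y w - X w))\<^sup>2) \<and> (\<integral>w. (norm (Y w - X w))\<^sup>2 \<partial>N) \<le> 4 * err n \<and>
    (\<forall>f. f \<in> borel_measurable borel \<longrightarrow> bounded (range f) \<longrightarrow>
      (\<integral>z. f z \<bullet> snd P' z \<partial>fst P') = (\<integral>w. fst (f (Y w)) + snd (f (Y w)) \<bullet> K w \<partial>N))"
proof -
  have \<delta>: "\<epsilon> n / real (Suc n) > 0" using \<epsilon>_pos[of n] by simp
  obtain g1 K1 M1 where c1: "martingale_coupling \<mu> (\<mu>s n) g1 K1 M1"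
     "martingale_coupling.cost \<mu> (\<mu>s n) g1 K1 - m2 \<mu> \<le> 2 * Z2 \<mu> (\<mu>s n) + \<epsilon> n / real (Suc n)"
     "martingale_coupling.cost \<mu> (\<mu>s n) g1 K1 - m2 (\<mu>s n) \<le> 2 * Z2 \<mu> (\<mu>s n) + \<epsilon> n / real (Suc n)"
    using close_coupling[OF \<mu> \<mu>s \<delta>] by metis
  obtain g2 K2 M2 where c2: "martingale_coupling \<nu> (\<nu>s n) g2 K2 M2"
     "martingale_coupling.cost \<nu> (\<nu>s n) g2 K2 - m2 \<nu> \<le> 2 * Z2 \<nu> (\<nu>s n) + \<epsilon> n / real (Suc n)"
     "martingale_coupling.cost \<nu> (\<nu>s n) g2 K2 - m2 (\<nu>s n) \<le> 2 * Z2 \<nu> (\<nu>s n) + \<epsilon> n / real (Suc n)"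
    using close_coupling[OF \<nu> \<nu>s \<delta>] by metis
  define e1 where "e1 = 2 * Z2 \<mu> (\<mu>s n) + \<epsilon> n / real (Suc n)"
  define e2 where "e2 = 2 * Z2 \<nu> (\<nu>s n) + \<epsilon> n / real (Suc n)"
  have err: "err n = e1 + e2" by (simp add: err_def e1_def e2_def)
  show ?thesis
  proof (rule GammaQ_transfer[OF P E c1(1) c2(1) c1(2,3)[folded e1_def] c2(2,3)[folded e2_def]], goal_cases)
    case (1 N X Y K P')
    then show ?case unfolding err add.assoc[symmetric]
      by (intro exI[of _ N] exI[of _ X] exI[of _ Y] exI[of _ K] exI[of _ P'] conjI allI impI)
  qed
qed

text \<open>Any admissible pair of (\<mu>, \<nu>) is transferred to the perturbed marginals, where
  the energy of an admissible pair bounds \<open>Ccost\<close> from above.\<close>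

lemma Ccost_upper:
  assumes P: "P \<in> GammaQ \<mu> \<nu>" and E: "energy P \<le> ennreal E" "0 \<le> E"
  shows "Ccost (\<mu>s n) (\<nu>s n) \<le> E + err n"
proof -
  obtain P' where P': "P' \<in> GammaQ (\<mu>s n) (\<nu>s n)" "energy P' \<le> ennreal (E + err n)"
    using perturbed_admissible[OF P E, of n] by metis
  have en: "0 \<le> err n"
    using Z2_nonneg[OF \<mu> \<mu>s] Z2_nonneg[OF \<nu> \<nu>s] \<epsilon>_pos[of n] by (simp add: err_def)
  interpret P': nonneg_vmeas P' by (rule GammaQ_nonneg_vmeas[OF P'(1)])
  have ac: "AE z in fst P'. fst (snd P' z) = 0 \<longrightarrow> snd (snd P' z) = 0"
    using P'(1) unfolding GammaQ_iff[OF P2_D(1,2)[OF P2s(3)] P2_D(1,2)[OF P2s(4)]] by blast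
  note d = P'.dual_le_energy(1,2)[OF ac P'(2), of "\<lambda>_. 0"]
  have "Ccost (\<mu>s n) (\<nu>s n) \<le> (\<integral>z. (norm (vdens P' z))\<^sup>2 \<partial>gam P')"
    using d(1) E(2) en by (intro Ccost_le_energy[OF P'(1) P2s(3,4)]) auto
  also have "\<dots> \<le> E + err n" using d(2) E(2) en by auto
  finally show ?thesis .
qed

text \<open>The energy is at least \<open>Ccost\<close>, so the penalty is nonnegative and the
  transport cost is at most B. Conversely c \<ge> -D1 leaves at most B + D1 for the penalty, and
  multiplying by 2 \<epsilon> n bounds the energy excess.\<close>

lemma F_finite:
  assumes "F n P \<le> ereal B"
  shows "P \<in> GammaQ (\<mu>s n) (\<nu>s n)" and "energy P < \<top>"
    and "(\<integral>z. c z \<partial>gam P) \<le> B" and "energy P \<le> ennreal (Ccost (\<mu>s n) (\<nu>s n) + 2 * \<epsilon> n * (B + D1))"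
    and "0 \<le> Ccost (\<mu>s n) (\<nu>s n) + 2 * \<epsilon> n * (B + D1)" and "0 \<le> B + D1"
proof -
  show P: "P \<in> GammaQ (\<mu>s n) (\<nu>s n)"
  proof (rule ccontr)
    assume "P \<notin> GammaQ (\<mu>s n) (\<nu>s n)"
    then have "F n P = \<infinity>" by (simp add: F_def chi_def)
    then show False using assms by simp
  qed
  have k: "1 / (2 * \<epsilon> n) > 0" using \<epsilon>_pos[of n] by simp
  note ci = c_integrable[OF P P2s(3,4)]
  note v = ext_integral_penalised[OF P P2s(3,4) ci k]
  have Fe: "F n P = ext_integral (gam P) (\<lambda>z. c z + (1 / (2 * \<epsilon> n)) * ((norm (rn P z))\<^sup>2 - Ccost (\<mu>s n) (\<nu>s n)))"
    using P by (simp add: F_def chi_def)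
  show fin: "energy P < \<top>"
  proof (rule ccontr)
    assume "\<not> energy P < \<top>"
    then have "energy P = \<top>" by (simp add: less_top[symmetric])
    then show False using v(1) assms Fe by simp
  qed
  define En where "En = (\<integral>z. (norm (vdens P z))\<^sup>2 \<partial>gam P)"
  define I where "I = (\<integral>z. c z \<partial>gam P)"
  define Cn where "Cn = Ccost (\<mu>s n) (\<nu>s n)"
  have 1: "I + (1 / (2 * \<epsilon> n)) * (En - Cn) \<le> B"
    using assms v(2)[OF fin] by (simp add: Fe En_def I_def Cn_def)
  have 2: "Cn \<le> En" unfolding Cn_def En_def by (rule Ccost_le_energy[OF P P2s(3,4) v(3)[OF fin]])
  interpret G: prob_space "gam P" using P2_D(1)[OF gam_P2[OF P P2s(3,4)]] .
  have 3: "- D1 \<le> I"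
    using integral_mono[of "gam P" "\<lambda>_. - D1" c] ci c_lower by (simp add: I_def G.prob_space)
  have 4: "0 \<le> (1 / (2 * \<epsilon> n)) * (En - Cn)" using k 2 by (intro mult_nonneg_nonneg) auto
  show "I \<le> B" using 1 4 by linarith
  show "0 \<le> B + D1" using 1 3 4 by linarith
  have "(1 / (2 * \<epsilon> n)) * (En - Cn) \<le> B + D1" using 1 3 by linarith
  then have 5: "En \<le> Cn + 2 * \<epsilon> n * (B + D1)" using \<epsilon>_pos[of n] by (simp add: field_simps)
  have "0 \<le> En" by (simp add: En_def integral_nonneg_AE)
  then show "0 \<le> Ccost (\<mu>s n) (\<nu>s n) + 2 * \<epsilon> n * (B + D1)" using 5 by (simp add: Cn_def)
  show "energy P \<le> ennreal (Ccost (\<mu>s n) (\<nu>s n) + 2 * \<epsilon> n * (B + D1))"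
    using v(4)[OF fin] 5 by (simp add: En_def Cn_def ennreal_leI)
qed

text \<open>Let P' be a competitor of energy at most E. Its transfer bounds \<open>Ccost\<close> and
  hence the energies of the sequence by L n with limit E, and closedness makes P admissible with
  energy at most E. As P' is arbitrary, P is a minimiser.\<close>

lemma liminf_bound:
  assumes Ps: "\<And>n. Ps n \<in> VM" and P: "P \<in> VM" and conv: "vm_weak_conv Ps P"
    and B: "\<And>n. F n (Ps n) \<le> ereal B"
  shows "F_lim P \<le> ereal B"
proof -
  note ff = F_finite[OF B]
  have cl: "P \<in> GammaQ \<mu> \<nu> \<and> energy P \<le> ennreal E"
    if P': "P' \<in> GammaQ \<mu> \<nu>" and E: "energy P' \<le> ennreal E" "0 \<le> E" for P' E
  proof -
    define L where "L n = E + err n + 2 * \<epsilon> n * (B + D1)" for n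
    have cu: "Ccost (\<mu>s n) (\<nu>s n) + 2 * \<epsilon> n * (B + D1) \<le> L n" for n
      using Ccost_upper[OF P' E, of n] by (simp add: L_def)
    have Ln: "energy (Ps n) \<le> ennreal (L n)" for n
      using ff(4)[of n] ennreal_leI[OF cu[of n]] by (rule order_trans)
    have L0: "0 \<le> L n" for n using ff(5)[of n] cu[of n] by (rule order_trans)
    have "L \<longlonglongrightarrow> E + 0 + 2 * 0 * (B + D1)"
      unfolding L_def[abs_def] by (intro tendsto_intros err_lim \<epsilon>_lim)
    then have L: "L \<longlonglongrightarrow> E" by simp
    have gr: "norm (\<phi> x) \<le> C * (1 + (norm x)\<^sup>2)" if "\<And>x. norm (\<phi> x) \<le> C" for \<phi> :: "'a \<Rightarrow> real" and C x
    proof -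
      have "0 \<le> C" using order_trans[OF norm_ge_zero that] .
      then show ?thesis using that[of x] by (simp add: distrib_left add_increasing2)
    qed
    have gr2: "norm (\<Phi> x \<bullet> x) \<le> C * (1 + (norm x)\<^sup>2)" if "\<And>x. norm (\<Phi> x) \<le> C" for \<Phi> :: "'a \<Rightarrow> 'a" and C x
    proof -
      have C0: "0 \<le> C" using order_trans[OF norm_ge_zero that] .
      have "\<bar>\<Phi> x \<bullet> x\<bar> \<le> norm (\<Phi> x) * norm x" by (rule Cauchy_Schwarz_ineq2)
      also have "\<dots> \<le> C * (1 + (norm x)\<^sup>2)" using that C0 norm_le_quadratic by (intro mult_mono) auto
      finally show ?thesis by simp
    qed
    have l1: "(\<lambda>n. \<integral>x. \<phi> x \<partial>\<alpha>s n) \<longlonglongrightarrow> (\<integral>x. \<phi> x \<partial>\<alpha>)"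
      if "\<alpha> \<in> P2b b" "\<And>n. \<alpha>s n \<in> P2b b" "(\<lambda>n. Z2 (\<alpha>s n) \<alpha>) \<longlonglongrightarrow> 0" "continuous_on UNIV \<phi>" "bounded (range \<phi>)"
      for \<phi> :: "'a \<Rightarrow> real" and \<alpha> and \<alpha>s :: "nat \<Rightarrow> 'a measure"
    proof -
      note \<phi>b = that(5)
      obtain C where C: "\<And>x. norm (\<phi> x) \<le> C" using \<phi>b by (auto simp: bounded_iff)
      have "norm (\<phi> x) \<le> C * (1 + (norm x)\<^sup>2)" for x by (rule gr, rule C)
      then show ?thesis by (rule integral_limit_Z2[OF that(1-4)])
    qed
    have l2: "(\<lambda>n. \<integral>x. \<Phi> x \<bullet> x \<partial>\<alpha>s n) \<longlonglongrightarrow> (\<integral>x. \<Phi> x \<bullet> x \<partial>\<alpha>)"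
      if "\<alpha> \<in> P2b b" "\<And>n. \<alpha>s n \<in> P2b b" "(\<lambda>n. Z2 (\<alpha>s n) \<alpha>) \<longlonglongrightarrow> 0" "continuous_on UNIV \<Phi>" "bounded (range \<Phi>)"
      for \<Phi> :: "'a \<Rightarrow> 'a" and \<alpha> and \<alpha>s :: "nat \<Rightarrow> 'a measure"
    proof -
      note \<Phi>b = that(5)
      obtain C where C: "\<And>x. norm (\<Phi> x) \<le> C" using \<Phi>b by (auto simp: bounded_iff)
      have "continuous_on UNIV (\<lambda>x. \<Phi> x \<bullet> x)" using that(4) by (intro continuous_intros)
      moreover have "norm (\<Phi> x \<bullet> x) \<le> C * (1 + (norm x)\<^sup>2)" for x by (rule gr2, rule C)
      ultimately show ?thesis by (rule integral_limit_Z2[OF that(1-3)])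
    qed
    show ?thesis
      by (intro conjI GammaQ_closed[of Ps \<mu>s \<nu>s P \<mu> \<nu> L E, OF ff(1) P conv P2s(3,4,1,2)
            l1[OF \<mu> \<mu>s Z\<mu>] l2[OF \<mu> \<mu>s Z\<mu>] l1[OF \<nu> \<nu>s Z\<nu>] l2[OF \<nu> \<nu>s Z\<nu>] Ln L0 L])
  qed
  \<comment> \<open>\<open>cl\<close> speaks only relative to a competitor of finite energy; one
    such pair is needed to conclude that P is admissible at all.\<close>
  obtain P0 where P0: "P0 \<in> GammaQ \<mu> \<nu>" "energy P0 \<le> ennreal ((m2 \<mu> + m2 \<nu>) / 2 + Z2 \<mu> \<nu> + 1)"
    by (rule GammaQ_near_optimal[OF \<mu> \<nu> zero_less_one])
  have PQ: "P \<in> GammaQ \<mu> \<nu>"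
  proof -
    have "0 \<le> (m2 \<mu> + m2 \<nu>) / 2 + Z2 \<mu> \<nu> + 1"
      using Z2_nonneg[OF \<mu> \<nu>] by (simp add: m2_def integral_nonneg_AE)
    then show ?thesis using cl[OF P0] by simp
  qed
  have Pbar: "P \<in> GammaQbar \<mu> \<nu>"
    unfolding GammaQbar_def
  proof (intro CollectI conjI PQ ballI)
    fix P' assume P': "P' \<in> GammaQ \<mu> \<nu>"
    show "energy P \<le> energy P'"
    proof (cases "energy P'")
      case (real r)
      then show ?thesis using cl[OF P', of r] by simp
    qed simp
  qed
  note ci = c_integrable[OF PQ P2s(1,2)]
  interpret P: nonneg_vmeas P by (rule GammaQ_nonneg_vmeas[OF PQ])
  \<comment> \<open>c need not be bounded above and is not a test function for weak convergence; its
    truncations at N are, and N is sent to infinity afterwards.\<close>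
  have cN: "(\<integral>z. min (c z) (real N) \<partial>gam P) \<le> B" for N :: nat
  proof (rule LIMSEQ_le_const2)
    have cont: "continuous_on UNIV (\<lambda>z. min (c z) (real N))" by (intro continuous_intros c_cont)
    then have mN: "(\<lambda>z. min (c z) (real N)) \<in> borel_measurable borel" by (rule borel_measurable_continuous_onI)
    have bd: "bounded (range (\<lambda>z. min (c z) (real N)))"
    proof (rule boundedI[of _ "\<bar>D1\<bar> + real N"], elim rangeE)
      fix y z assume "y = min (c z) (real N)"
      then show "norm y \<le> \<bar>D1\<bar> + real N" using c_lower[of z] by (auto simp: min_def abs_le_iff)
    qed
    have eq: "(\<integral>z. min (c z) (real N) * fst (snd Q z) + (0::'a) \<bullet> snd (snd Q z) \<partial>fst Q) = (\<integral>z. min (c z) (real N) \<partial>gam Q)"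
      if "nonneg_vmeas Q" for Q
      using nonneg_vmeas.integral_gam[OF that mN] by (simp add: mult.commute)
    show "(\<lambda>n. \<integral>z. min (c z) (real N) \<partial>gam (Ps n)) \<longlonglongrightarrow> (\<integral>z. min (c z) (real N) \<partial>gam P)"
      using vm_weak_convD[OF conv cont bd continuous_on_const, of 0]
      unfolding eq[OF P.nonneg_vmeas_axioms] eq[OF GammaQ_nonneg_vmeas[OF ff(1)]] by simp
    have "(\<integral>z. min (c z) (real N) \<partial>gam (Ps n)) \<le> B" for n
    proof -
      note cin = c_integrable[OF ff(1)[of n] P2s(3,4)]
      interpret G: prob_space "gam (Ps n)" using P2_D(1)[OF gam_P2[OF ff(1)[of n] P2s(3,4)]] .
      have "(\<integral>z. min (c z) (real N) \<partial>gam (Ps n)) \<le> (\<integral>z. c z \<partial>gam (Ps n))"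
        using cin by (intro integral_mono integrable_min) auto
      then show ?thesis using ff(3)[of n] by linarith
    qed
    then show "\<exists>N'. \<forall>n\<ge>N'. (\<integral>z. min (c z) (real N) \<partial>gam (Ps n)) \<le> B" by blast
  qed
  have "(\<lambda>N. \<integral>z. min (c z) (real N) \<partial>gam P) \<longlonglongrightarrow> (\<integral>z. c z \<partial>gam P)"
  proof (rule integral_dominated_convergence[where w="\<lambda>z. norm (c z)"])
    show "AE z in gam P. (\<lambda>N. min (c z) (real N)) \<longlonglongrightarrow> c z"
    proof (rule AE_I2)
      fix z
      obtain N where "c z \<le> real N" using real_arch_simple by blast
      then show "(\<lambda>N. min (c z) (real N)) \<longlonglongrightarrow> c z"
        by (intro tendsto_eventually eventually_sequentiallyI[of N]) auto
    qed
  qed (use ci in auto)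
  then have "(\<integral>z. c z \<partial>gam P) \<le> B" using cN by (intro LIMSEQ_le_const2) auto
  then show ?thesis using Pbar by (simp add: F_lim_def chi_def ext_integral_integrable[OF ci])
qed

text \<open>The minimal energy is at most (m2 \<mu> + m2 \<nu>)/2 + Z2 \<mu> \<nu>, and the
  perturbed \<open>Ccost\<close> is at least the same expression in the perturbed marginals.
  Exchanging one marginal costs one Z2 for half the moment difference and one for the triangle
  inequality, hence the factors 2.\<close>

lemma minimal_energy:
  assumes P: "P \<in> GammaQbar \<mu> \<nu>"
  obtains E where "0 \<le> E" "energy P = ennreal E" "\<And>n. E \<le> Ccost (\<mu>s n) (\<nu>s n) + 2 * Z2 \<mu> (\<mu>s n) + 2 * Z2 \<nu> (\<nu>s n)"
proof -
  have mn: "\<And>P'. P' \<in> GammaQ \<mu> \<nu> \<Longrightarrow> energy P \<le> energy P'"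
    using P by (auto simp: GammaQbar_def)
  have le: "energy P \<le> ennreal ((m2 \<mu> + m2 \<nu>) / 2 + Z2 \<mu> \<nu> + \<delta>)" if \<delta>: "\<delta> > 0" for \<delta>
    by (rule GammaQ_near_optimal[OF \<mu> \<nu> \<delta>]) (use mn order_trans in blast)
  have nn: "0 \<le> (m2 \<mu> + m2 \<nu>) / 2 + Z2 \<mu> \<nu>"
    using Z2_nonneg[OF \<mu> \<nu>] by (simp add: m2_def integral_nonneg_AE)
  obtain E where E: "0 \<le> E" "energy P = ennreal E"
    using le[of 1] by (cases "energy P") (auto simp: top_unique)
  have E1: "E \<le> (m2 \<mu> + m2 \<nu>) / 2 + Z2 \<mu> \<nu>"
  proof (rule field_le_epsilon)
    fix \<delta> :: real assume "\<delta> > 0"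
    then have "ennreal E \<le> ennreal ((m2 \<mu> + m2 \<nu>) / 2 + Z2 \<mu> \<nu> + \<delta>)"
      unfolding E(2)[symmetric] by (rule le)
    then show "E \<le> (m2 \<mu> + m2 \<nu>) / 2 + Z2 \<mu> \<nu> + \<delta>"
      by (subst (asm) ennreal_le_iff) (use nn \<open>\<delta> > 0\<close> in linarith)
  qed
  have arith: "e \<le> C + 2 * r + 2 * t"
    if "e \<le> (m + k) / 2 + z" "(ms + ks) / 2 + zs \<le> C" "m - ms \<le> 2 * r" "k - ks \<le> 2 * t"
      "z \<le> r + z1" "z1 \<le> zs + z2" "z2 = t" for e C r t m k z ms ks zs z1 z2 :: real
  proof -
    have "(m + k) / 2 \<le> (ms + ks) / 2 + r + t" using that(3,4) by (simp add: field_simps)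
    moreover have "z \<le> r + (zs + t)" using that(5-7) by simp
    ultimately show ?thesis using that(1,2) by linarith
  qed
  have "E \<le> Ccost (\<mu>s n) (\<nu>s n) + 2 * Z2 \<mu> (\<mu>s n) + 2 * Z2 \<nu> (\<nu>s n)" for n
    by (rule arith[OF E1 Z2_le_Ccost[OF \<mu>s \<nu>s] m2_diff_le_Z2[OF \<mu> \<mu>s] m2_diff_le_Z2[OF \<nu> \<nu>s]
          Z2_triangle[OF \<mu> \<nu> \<mu>s] Z2_triangle[OF \<mu>s \<nu> \<nu>s] Z2_commute])
  with E show thesis by (rule that)
qed

text \<open>Write V for \<open>vdens P\<close> at X. The vector part f(Y).K - f(X).V is split as
  f(Y).(K - V) + (f(Y) - f(X)).V: the first term is small in mean square, while in the second V is
  merely square integrable and f(Y) - f(X) is bounded and small in mean.\<close>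

lemma weak_conv_of_perturbation:
  fixes N :: "nat \<Rightarrow> 'w measure"
  assumes P: "P \<in> GammaQ \<mu> \<nu>"
    and N: "\<And>n. prob_space (N n)" and X: "\<And>n. X n \<in> borel_measurable (N n)" and Y: "\<And>n. Y n \<in> borel_measurable (N n)"
    and lawX: "\<And>n. distr (N n) borel (X n) = gam P"
    and K: "\<And>n. square_integrable (N n) (K n)" and V: "\<And>n. square_integrable (N n) (\<lambda>w. vdens P (X n w))"
    and KV: "(\<lambda>n. \<integral>w. (norm (K n w - vdens P (X n w)))\<^sup>2 \<partial>(N n)) \<longlonglongrightarrow> 0"
    and XY: "\<And>n. integrable (N n) (\<lambda>w. (norm (Y n w - X n w))\<^sup>2)"
      "(\<lambda>n. \<integral>w. (norm (Y n w - X n w))\<^sup>2 \<partial>(N n)) \<longlonglongrightarrow> 0"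
    and rep: "\<And>n f. f \<in> borel_measurable borel \<Longrightarrow> bounded (range f) \<Longrightarrow>
      (\<integral>z. f z \<bullet> snd (Ps n) z \<partial>fst (Ps n)) = (\<integral>w. fst (f (Y n w)) + snd (f (Y n w)) \<bullet> K n w \<partial>(N n))"
  shows "vm_weak_conv Ps P"
  unfolding vm_weak_conv_def
proof (intro allI impI)
  fix f :: "'a \<times> 'a \<Rightarrow> real \<times> 'a" assume f: "continuous_on UNIV f" "bounded (range f)"
  interpret P: nonneg_vmeas P by (rule GammaQ_nonneg_vmeas[OF P])
  have ac: "AE z in fst P. fst (snd P z) = 0 \<longrightarrow> snd (snd P z) = 0"
    using P unfolding GammaQ_iff[OF P2_D(1,2)[OF P2s(1)] P2_D(1,2)[OF P2s(2)]] by blast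
  have fm: "f \<in> borel_measurable borel" using f(1) by (rule borel_measurable_continuous_onI)
  have fm1: "(\<lambda>z. fst (f z)) \<in> borel_measurable borel" and fm2: "(\<lambda>z. snd (f z)) \<in> borel_measurable borel"
    by (rule measurable_compose[OF fm], intro borel_measurable_continuous_onI continuous_intros)+
  obtain B0 where B0: "\<And>z. norm (f z) \<le> B0" using f(2) by (auto simp: bounded_iff)
  \<comment> \<open>The added 1 makes B positive, so that B^2 + E can be divided by when s is
    chosen.\<close>
  define B where "B = B0 + 1"
  have B: "norm (f z) \<le> B" for z using B0[of z] by (simp add: B_def)
  have Bp: "B > 0" using order_trans[OF norm_ge_zero B0] by (simp add: B_def add_nonneg_pos)
  have comp_le: "norm (fst v) \<le> norm v" "norm (snd v) \<le> norm v" for v :: "real \<times> 'a"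
    using norm_fst_le[of "fst v" "snd v"] norm_snd_le[of "snd v" "fst v"] by simp_all
  have B1: "norm (fst (f z)) \<le> B" "norm (snd (f z)) \<le> B" for z
    by (rule order_trans[OF comp_le(1) B] order_trans[OF comp_le(2) B])+
  have fgr: "norm (f z) \<le> B * (1 + (norm z)\<^sup>2)" for z
    using B[of z] Bp by (simp add: distrib_left add_increasing2)
  note msp = mean_square_perturbation[OF N X Y lawX gam_P2[OF P P2s(1,2)] XY f(1) fgr]
  define a where "a n = (\<integral>w. norm (f (Y n w) - f (X n w)) \<partial>(N n))" for n
  define d where "d n = (\<integral>w. (norm (K n w - vdens P (X n w)))\<^sup>2 \<partial>(N n))" for n
  have vm: "vdens P \<in> borel_measurable borel" by (rule vdens_borel[OF P.VM])
  define E where "E = (\<integral>z. (norm (vdens P z))\<^sup>2 \<partial>gam P)"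
  have EV: "(\<integral>w. (norm (vdens P (X n w)))\<^sup>2 \<partial>(N n)) = E" for n
    unfolding E_def lawX[of n, symmetric] using vm by (intro integral_distr[OF X, symmetric]) measurable
  have limit: "(\<integral>z. f z \<bullet> snd P z \<partial>fst P) = (\<integral>w. fst (f (X n w)) + snd (f (X n w)) \<bullet> vdens P (X n w) \<partial>(N n))" for n
  proof -
    have m: "(\<lambda>z. fst (f z) + snd (f z) \<bullet> vdens P z) \<in> borel_measurable borel"
      by (intro borel_measurable_add borel_measurable_inner fm1 fm2 vm)
    have "(\<integral>z. f z \<bullet> snd P z \<partial>fst P) = (\<integral>z. fst (snd P z) *\<^sub>R (fst (f z) + snd (f z) \<bullet> vdens P z) \<partial>fst P)"
    proof (rule integral_cong_AE)
      show "AE z in fst P. f z \<bullet> snd P z = fst (snd P z) *\<^sub>R (fst (f z) + snd (f z) \<bullet> vdens P z)"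
        using P.AE_vdens[OF ac]
      proof eventually_elim
        case (elim z)
        have "f z \<bullet> snd P z = fst (f z) * fst (snd P z) + snd (f z) \<bullet> snd (snd P z)"
          by (simp add: inner_prod_def)
        also have "snd (f z) \<bullet> snd (snd P z) = fst (snd P z) * (snd (f z) \<bullet> vdens P z)"
          unfolding elim[symmetric] by (rule inner_scaleR_right)
        finally show ?case by (simp add: algebra_simps)
      qed
      show "(\<lambda>z. f z \<bullet> snd P z) \<in> borel_measurable (fst P)"
        by (rule P.borelM) (intro borel_measurable_inner fm VM_D(4)[OF P.VM])
      show "(\<lambda>z. fst (snd P z) *\<^sub>R (fst (f z) + snd (f z) \<bullet> vdens P z)) \<in> borel_measurable (fst P)"
        by (rule P.borelM) (intro borel_measurable_scaleR m VM_D(5)[OF P.VM])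
    qed
    also have "\<dots> = (\<integral>z. fst (f z) + snd (f z) \<bullet> vdens P z \<partial>gam P)"
      by (rule P.integral_gam[OF m, symmetric])
    also have "\<dots> = (\<integral>w. fst (f (X n w)) + snd (f (X n w)) \<bullet> vdens P (X n w) \<partial>(N n))"
      unfolding lawX[of n, symmetric] by (rule integral_distr[OF X m])
    finally show ?thesis .
  qed
  define D where "D n = \<bar>(\<integral>z. f z \<bullet> snd (Ps n) z \<partial>fst (Ps n)) - (\<integral>z. f z \<bullet> snd P z \<partial>fst P)\<bar>" for n
  \<comment> \<open>The free weight s makes those terms small that do not tend to zero with
    n.\<close>
  have young: "\<bar>x \<bullet> y\<bar> \<le> s / 2 * (norm x)\<^sup>2 + 1 / (2 * s) * (norm y)\<^sup>2" if s: "s > 0" for x y :: 'a and s :: real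
  proof -
    have "0 \<le> (s * norm x - norm y)\<^sup>2" by simp
    then have "2 * s * (norm x * norm y) \<le> s\<^sup>2 * (norm x)\<^sup>2 + (norm y)\<^sup>2"
      by (simp add: power2_eq_square algebra_simps)
    then have "norm x * norm y \<le> s / 2 * (norm x)\<^sup>2 + 1 / (2 * s) * (norm y)\<^sup>2"
      using s by (simp add: field_simps power2_eq_square)
    then show ?thesis using Cauchy_Schwarz_ineq2[of x y] by linarith
  qed
  have Dle: "D n \<le> s / 2 * (B\<^sup>2 + E) + (1 + B / s) * a n + 1 / (2 * s) * d n" if s: "s > 0" for n s
  proof -
    interpret Nn: prob_space "N n" by (rule N)
    let ?x = "\<lambda>w. snd (f (Y n w))" and ?x' = "\<lambda>w. snd (f (X n w))" and ?v = "\<lambda>w. vdens P (X n w)"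
    have sqx: "square_integrable (N n) ?x" "square_integrable (N n) ?x'"
      by (rule Nn.square_integrable_bounded[where C=B, OF measurable_compose[OF Y fm2] B1(2)]
          Nn.square_integrable_bounded[where C=B, OF measurable_compose[OF X fm2] B1(2)])+
    have i1: "integrable (N n) (\<lambda>w. fst (f (Y n w)))" "integrable (N n) (\<lambda>w. fst (f (X n w)))"
      by (rule Nn.integrable_const_bound[where B=B, OF AE_I2[OF B1(1)] measurable_compose[OF Y fm1]]
          Nn.integrable_const_bound[where B=B, OF AE_I2[OF B1(1)] measurable_compose[OF X fm1]])+
    note i2 = square_integrable_inner[OF sqx(1) K[of n]] square_integrable_inner[OF sqx(2) V[of n]]
    have idk: "integrable (N n) (\<lambda>w. (norm (K n w - ?v w))\<^sup>2)"
      by (rule square_integrableD(2)[OF square_integrable_diff[OF K V]])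
    have iv: "integrable (N n) (\<lambda>w. (norm (?v w))\<^sup>2)" by (rule square_integrableD(2)[OF V])
    have "(\<integral>z. f z \<bullet> snd (Ps n) z \<partial>fst (Ps n)) - (\<integral>z. f z \<bullet> snd P z \<partial>fst P)
        = (\<integral>w. (fst (f (Y n w)) + ?x w \<bullet> K n w) - (fst (f (X n w)) + ?x' w \<bullet> ?v w) \<partial>(N n))"
      unfolding rep[OF fm f(2), of n] limit[of n] using i1 i2 by simp
    then have "D n \<le> (\<integral>w. norm ((fst (f (Y n w)) + ?x w \<bullet> K n w) - (fst (f (X n w)) + ?x' w \<bullet> ?v w)) \<partial>(N n))"
      unfolding D_def using integral_norm_bound[of "N n" "\<lambda>w. (fst (f (Y n w)) + ?x w \<bullet> K n w) - (fst (f (X n w)) + ?x' w \<bullet> ?v w)"]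
      by simp
    also have "\<dots> \<le> (\<integral>w. (s / 2 * B\<^sup>2 + (1 + B / s) * norm (f (Y n w) - f (X n w))) + (1 / (2 * s) * (norm (K n w - ?v w))\<^sup>2 + s / 2 * (norm (?v w))\<^sup>2) \<partial>(N n))"
    proof (rule integral_mono)
      show "integrable (N n) (\<lambda>w. norm ((fst (f (Y n w)) + ?x w \<bullet> K n w) - (fst (f (X n w)) + ?x' w \<bullet> ?v w)))"
        using i1 i2 by (intro integrable_norm Bochner_Integration.integrable_diff Bochner_Integration.integrable_add)
      show "integrable (N n) (\<lambda>w. (s / 2 * B\<^sup>2 + (1 + B / s) * norm (f (Y n w) - f (X n w))) + (1 / (2 * s) * (norm (K n w - ?v w))\<^sup>2 + s / 2 * (norm (?v w))\<^sup>2))"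
        by (intro Bochner_Integration.integrable_add integrable_mult_right Nn.integrable_const msp(1) idk iv)
      fix w
      let ?\<delta> = "norm (f (Y n w) - f (X n w))"
      have f1: "\<bar>fst (f (Y n w)) - fst (f (X n w))\<bar> \<le> ?\<delta>" and f2: "norm (?x w - ?x' w) \<le> ?\<delta>"
        using comp_le[of "f (Y n w) - f (X n w)"] by simp_all
      have t1: "\<bar>?x w \<bullet> (K n w - ?v w)\<bar> \<le> s / 2 * B\<^sup>2 + 1 / (2 * s) * (norm (K n w - ?v w))\<^sup>2"
      proof -
        have "s / 2 * (norm (?x w))\<^sup>2 \<le> s / 2 * B\<^sup>2" using s B1(2) by (intro mult_left_mono power_mono) auto
        then show ?thesis using young[OF s, of "?x w" "K n w - ?v w"] by linarith
      qed
      have t2: "\<bar>(?x w - ?x' w) \<bullet> ?v w\<bar> \<le> B / s * ?\<delta> + s / 2 * (norm (?v w))\<^sup>2"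
      proof -
        \<comment> \<open>Boundedness reduces the square |x - x'|^2 to 2 B |x - x'|, whose integral
          is controlled by \<open>msp\<close>.\<close>
        have "norm (?x w - ?x' w) \<le> 2 * B"
          using norm_triangle_ineq4[of "?x w" "?x' w"] B1(2)[of "Y n w"] B1(2)[of "X n w"] by linarith
        then have "norm (?x w - ?x' w) * norm (?x w - ?x' w) \<le> (2 * B) * ?\<delta>"
          using f2 Bp by (intro mult_mono) auto
        then have "1 / (2 * s) * (norm (?x w - ?x' w))\<^sup>2 \<le> 1 / (2 * s) * ((2 * B) * ?\<delta>)"
          using s by (intro mult_left_mono) (auto simp: power2_eq_square)
        also have "\<dots> = B / s * ?\<delta>" using s by simp
        finally show ?thesis using young[OF s, of "?v w" "?x w - ?x' w"] by (simp add: inner_commute)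
      qed
      have "(fst (f (Y n w)) + ?x w \<bullet> K n w) - (fst (f (X n w)) + ?x' w \<bullet> ?v w)
         = (fst (f (Y n w)) - fst (f (X n w))) + ?x w \<bullet> (K n w - ?v w) + (?x w - ?x' w) \<bullet> ?v w"
        by (simp add: inner_diff_left inner_diff_right)
      then have "norm ((fst (f (Y n w)) + ?x w \<bullet> K n w) - (fst (f (X n w)) + ?x' w \<bullet> ?v w))
         \<le> \<bar>fst (f (Y n w)) - fst (f (X n w))\<bar> + \<bar>?x w \<bullet> (K n w - ?v w)\<bar> + \<bar>(?x w - ?x' w) \<bullet> ?v w\<bar>"
        unfolding real_norm_def by linarith
      also have "\<dots> \<le> ?\<delta> + (s / 2 * B\<^sup>2 + 1 / (2 * s) * (norm (K n w - ?v w))\<^sup>2) + (B / s * ?\<delta> + s / 2 * (norm (?v w))\<^sup>2)"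
        by (intro add_mono f1 t1 t2)
      also have "\<dots> = (s / 2 * B\<^sup>2 + (1 + B / s) * ?\<delta>) + (1 / (2 * s) * (norm (K n w - ?v w))\<^sup>2 + s / 2 * (norm (?v w))\<^sup>2)"
        by (simp add: distrib_right)
      finally show "norm ((fst (f (Y n w)) + ?x w \<bullet> K n w) - (fst (f (X n w)) + ?x' w \<bullet> ?v w))
         \<le> (s / 2 * B\<^sup>2 + (1 + B / s) * ?\<delta>) + (1 / (2 * s) * (norm (K n w - ?v w))\<^sup>2 + s / 2 * (norm (?v w))\<^sup>2)" .
    qed
    also have "\<dots> = s / 2 * B\<^sup>2 + (1 + B / s) * a n + (1 / (2 * s) * d n + s / 2 * E)"
      using msp(1)[of n] idk iv
      by (simp add: Nn.prob_space a_def d_def EV[of n, symmetric])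
    finally show ?thesis by (simp add: distrib_left)
  qed
  have "D \<longlonglongrightarrow> 0"
  proof (rule order_tendstoI)
    fix r :: real assume "r < 0"
    moreover have "0 \<le> D n" for n by (simp add: D_def)
    ultimately show "\<forall>\<^sub>F n in sequentially. r < D n" by (intro always_eventually allI) (rule less_le_trans)
  next
    fix e :: real assume e: "0 < e"
    have BE: "B\<^sup>2 + E > 0" using Bp by (simp add: E_def integral_nonneg_AE add_pos_nonneg)
    \<comment> \<open>Chosen so that the part of \<open>Dle\<close> that does not depend on n equals
      e/2.\<close>
    define s where "s = e / (B\<^sup>2 + E)"
    have s: "s > 0" using e BE by (simp add: s_def)
    have sBE: "s / 2 * (B\<^sup>2 + E) = e / 2"
      unfolding s_def times_divide_eq_left using BE by (subst nonzero_mult_div_cancel_right) auto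
    have "(\<lambda>n. (1 + B / s) * a n + 1 / (2 * s) * d n) \<longlonglongrightarrow> (1 + B / s) * 0 + 1 / (2 * s) * 0"
      unfolding a_def d_def by (intro tendsto_intros msp(2) KV)
    then have "\<forall>\<^sub>F n in sequentially. (1 + B / s) * a n + 1 / (2 * s) * d n < e / 2"
      by (rule order_tendstoD(2)) (use e in simp)
    then show "\<forall>\<^sub>F n in sequentially. D n < e"
    proof eventually_elim
      case (elim n)
      then show ?case using Dle[OF s, of n] sBE by linarith
    qed
  qed
  then have "(\<lambda>n. (\<integral>z. f z \<bullet> snd (Ps n) z \<partial>fst (Ps n)) - (\<integral>z. f z \<bullet> snd P z \<partial>fst P)) \<longlonglongrightarrow> 0"
    unfolding D_def by (simp add: tendsto_rabs_zero_iff)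
  then show "(\<lambda>n. \<integral>z. f z \<bullet> snd (Ps n) z \<partial>fst (Ps n)) \<longlonglongrightarrow> (\<integral>z. f z \<bullet> snd P z \<partial>fst P)"
    by (simp add: LIM_zero_iff)
qed

lemma recovery_sequence:
  assumes rate: "(\<lambda>n. (Z2 \<mu> (\<mu>s n) + Z2 \<nu> (\<nu>s n)) / \<epsilon> n) \<longlonglongrightarrow> 0" and P: "P \<in> GammaQbar \<mu> \<nu>"
  shows "\<exists>Ps. (\<forall>n. Ps n \<in> VM) \<and> vm_weak_conv Ps P \<and> limsup (\<lambda>n. F n (Ps n)) \<le> F_lim P"
proof -
  have PQ: "P \<in> GammaQ \<mu> \<nu>" using P by (simp add: GammaQbar_def)
  obtain E where E: "0 \<le> E" "energy P = ennreal E"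
    "\<And>n. E \<le> Ccost (\<mu>s n) (\<nu>s n) + 2 * Z2 \<mu> (\<mu>s n) + 2 * Z2 \<nu> (\<nu>s n)"
    using minimal_energy[OF P] by blast
  have El: "energy P \<le> ennreal E" using E(2) by simp
  obtain N :: "nat \<Rightarrow> ((('a \<times> 'a) \<times> 'a) \<times> 'a) measure" and X Y K Ps where R:
    "\<And>n. Ps n \<in> GammaQ (\<mu>s n) (\<nu>s n)" "\<And>n. energy (Ps n) \<le> ennreal (E + err n)"
    "\<And>n. prob_space (N n)" "\<And>n. X n \<in> borel_measurable (N n)" "\<And>n. Y n \<in> borel_measurable (N n)"
    "\<And>n. distr (N n) borel (X n) = gam P" "\<And>n. distr (N n) borel (Y n) = gam (Ps n)"
    "\<And>n. square_integrable (N n) (K n)" "\<And>n. square_integrable (N n) (\<lambda>w. vdens P (X n w))"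
    "\<And>n. (\<integral>w. (norm (K n w - vdens P (X n w)))\<^sup>2 \<partial>(N n)) \<le> err n"
    "\<And>n. integrable (N n) (\<lambda>w. (norm (Y n w - X n w))\<^sup>2)" "\<And>n. (\<integral>w. (norm (Y n w - X n w))\<^sup>2 \<partial>(N n)) \<le> 4 * err n"
    "\<And>n f. f \<in> borel_measurable borel \<Longrightarrow> bounded (range f) \<Longrightarrow>
      (\<integral>z. f z \<bullet> snd (Ps n) z \<partial>fst (Ps n)) = (\<integral>w. fst (f (Y n w)) + snd (f (Y n w)) \<bullet> K n w \<partial>(N n))"
  proof -
    define Rn where "Rn n N X Y K P' \<longleftrightarrow>
      P' \<in> GammaQ (\<mu>s n) (\<nu>s n) \<and> energy P' \<le> ennreal (E + err n) \<and>
      prob_space N \<and> X \<in> borel_measurable N \<and> Y \<in> borel_measurable N \<and>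
      distr N borel X = gam P \<and> distr N borel Y = gam P' \<and>
      square_integrable N K \<and> square_integrable N (\<lambda>w. vdens P (X w)) \<and>
      (\<integral>w. (norm (K w - vdens P (X w)))\<^sup>2 \<partial>N) \<le> err n \<and>
      integrable N (\<lambda>w. (norm (Y w - X w))\<^sup>2) \<and> (\<integral>w. (norm (Y w - X w))\<^sup>2 \<partial>N) \<le> 4 * err n \<and>
      (\<forall>f. f \<in> borel_measurable borel \<longrightarrow> bounded (range f) \<longrightarrow>
        (\<integral>z. f z \<bullet> snd P' z \<partial>fst P') = (\<integral>w. fst (f (Y w)) + snd (f (Y w)) \<bullet> K w \<partial>N))"
      for n and N :: "((('a \<times> 'a) \<times> 'a) \<times> 'a) measure" and X Y K P'
    have "\<exists>N X Y K P'. Rn n N X Y K P'" for n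
      unfolding Rn_def by (rule perturbed_admissible[OF PQ El E(1)])
    then obtain N X Y K Ps where Rn: "\<And>n. Rn n (N n) (X n) (Y n) (K n) (Ps n)" by metis
    show thesis
      by (rule that[of Ps N X Y K]) (use Rn in \<open>unfold Rn_def, blast\<close>)+
  qed
  have KV: "(\<lambda>n. \<integral>w. (norm (K n w - vdens P (X n w)))\<^sup>2 \<partial>(N n)) \<longlonglongrightarrow> 0"
    by (rule real_tendsto_sandwich[OF _ _ tendsto_const err_lim]) (auto simp: R(10) integral_nonneg_AE)
  have "(\<lambda>n. 4 * err n) \<longlonglongrightarrow> 4 * 0" by (intro tendsto_intros err_lim)
  then have e4: "(\<lambda>n. 4 * err n) \<longlonglongrightarrow> 0" by simp
  have XY: "(\<lambda>n. \<integral>w. (norm (Y n w - X n w))\<^sup>2 \<partial>(N n)) \<longlonglongrightarrow> 0"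
    by (rule real_tendsto_sandwich[OF _ _ tendsto_const e4]) (auto simp: R(12) integral_nonneg_AE)
  have conv: "vm_weak_conv Ps P"
    by (rule weak_conv_of_perturbation[OF PQ R(3,4,5,6,8,9) KV R(11) XY R(13)])
  note msp = mean_square_perturbation[OF R(3,4,5,6) gam_P2[OF PQ P2s(1,2)] R(11) XY c_cont c_growth]
  note ci = c_integrable[OF PQ P2s(1,2)]
  note cin = c_integrable[OF R(1) P2s(3,4)]
  have "norm ((\<integral>z. c z \<partial>gam (Ps n)) - (\<integral>z. c z \<partial>gam P)) \<le> (\<integral>w. norm (c (Y n w) - c (X n w)) \<partial>(N n))" for n
  proof -
    have e: "(\<integral>z. c z \<partial>gam (Ps n)) = (\<integral>w. c (Y n w) \<partial>(N n))" "(\<integral>z. c z \<partial>gam P) = (\<integral>w. c (X n w) \<partial>(N n))"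
      using integral_distr[OF R(5)[of n] c_borel] integral_distr[OF R(4)[of n] c_borel] by (simp_all add: R(6,7))
    have ii: "integrable (N n) (\<lambda>w. c (Y n w))" "integrable (N n) (\<lambda>w. c (X n w))"
      using integrable_distr_eq[OF R(5)[of n] c_borel] integrable_distr_eq[OF R(4)[of n] c_borel] ci cin[of n] by (simp_all add: R(6,7))
    have "(\<integral>z. c z \<partial>gam (Ps n)) - (\<integral>z. c z \<partial>gam P) = (\<integral>w. c (Y n w) - c (X n w) \<partial>(N n))"
      unfolding e using ii by simp
    then show ?thesis using integral_norm_bound[of "N n" "\<lambda>w. c (Y n w) - c (X n w)"] by simp
  qed
  then have "(\<lambda>n. (\<integral>z. c z \<partial>gam (Ps n)) - (\<integral>z. c z \<partial>gam P)) \<longlonglongrightarrow> 0"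
    by (intro Lim_null_comparison[OF _ msp(2)] always_eventually allI)
  then have clim: "(\<lambda>n. \<integral>z. c z \<partial>gam (Ps n)) \<longlonglongrightarrow> (\<integral>z. c z \<partial>gam P)" by (simp add: LIM_zero_iff)
  \<comment> \<open>The energy of \<open>Ps n\<close> exceeds \<open>Ccost\<close> by at most 4 (Z2
    + Z2) + 2 \<epsilon> n / (n + 1), where \<open>err\<close> and \<open>minimal_energy\<close>
    contribute 2 Z2 per marginal each. Division by 2 \<epsilon> n leaves twice the assumed rate and
    1/(n + 1).\<close>
  define U where "U n = (\<integral>z. c z \<partial>gam (Ps n)) + (2 * ((Z2 \<mu> (\<mu>s n) + Z2 \<nu> (\<nu>s n)) / \<epsilon> n) + 1 / real (Suc n))" for n
  have FU: "F n (Ps n) \<le> ereal (U n)" for n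
  proof -
    have en: "0 \<le> err n"
      using Z2_nonneg[OF \<mu> \<mu>s] Z2_nonneg[OF \<nu> \<nu>s] \<epsilon>_pos[of n] by (simp add: err_def)
    have k: "1 / (2 * \<epsilon> n) > 0" using \<epsilon>_pos[of n] by simp
    note v = ext_integral_penalised[OF R(1) P2s(3,4) cin k]
    have fin: "energy (Ps n) < \<top>" using R(2)[of n] by (rule le_less_trans) simp
    define En where "En = (\<integral>z. (norm (vdens (Ps n) z))\<^sup>2 \<partial>gam (Ps n))"
    have "ennreal En \<le> ennreal (E + err n)" using R(2)[of n] v(4)[OF fin] by (simp only: En_def)
    then have "En \<le> E + err n" by (subst (asm) ennreal_le_iff) (use E(1) en in auto)
    then have "En - Ccost (\<mu>s n) (\<nu>s n) \<le> 4 * (Z2 \<mu> (\<mu>s n) + Z2 \<nu> (\<nu>s n)) + 2 * (\<epsilon> n / real (Suc n))"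
      using E(3)[of n] by (simp add: err_def)
    then have "(1 / (2 * \<epsilon> n)) * (En - Ccost (\<mu>s n) (\<nu>s n))
       \<le> (1 / (2 * \<epsilon> n)) * (4 * (Z2 \<mu> (\<mu>s n) + Z2 \<nu> (\<nu>s n)) + 2 * (\<epsilon> n / real (Suc n)))"
      using k by (intro mult_left_mono) auto
    also have "\<dots> = 2 * ((Z2 \<mu> (\<mu>s n) + Z2 \<nu> (\<nu>s n)) / \<epsilon> n) + 1 / real (Suc n)"
      using \<epsilon>_pos[of n] by (simp add: divide_simps) (simp add: algebra_simps)
    finally have "(1 / (2 * \<epsilon> n)) * (En - Ccost (\<mu>s n) (\<nu>s n)) \<le> 2 * ((Z2 \<mu> (\<mu>s n) + Z2 \<nu> (\<nu>s n)) / \<epsilon> n) + 1 / real (Suc n)" .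
    then show ?thesis using R(1)[of n] v(2)[OF fin, of "Ccost (\<mu>s n) (\<nu>s n)"]
      by (simp add: F_def chi_def U_def En_def)
  qed
  have "U \<longlonglongrightarrow> (\<integral>z. c z \<partial>gam P) + (2 * 0 + 0)"
    unfolding U_def[abs_def] by (intro tendsto_intros clim rate LIMSEQ_Suc[OF lim_1_over_n])
  then have "(\<lambda>n. ereal (U n)) \<longlonglongrightarrow> ereal (\<integral>z. c z \<partial>gam P)" by simp
  then have lU: "limsup (\<lambda>n. ereal (U n)) = ereal (\<integral>z. c z \<partial>gam P)" by (intro lim_imp_Limsup) auto
  have "limsup (\<lambda>n. F n (Ps n)) \<le> limsup (\<lambda>n. ereal (U n))"
    using FU by (intro Limsup_mono always_eventually) auto
  also have "\<dots> = F_lim P" unfolding lU using P by (simp add: F_lim_def chi_def ext_integral_integrable[OF ci])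
  finally have "limsup (\<lambda>n. F n (Ps n)) \<le> F_lim P" .
  moreover have "Ps n \<in> VM" for n using nonneg_vmeas.VM[OF GammaQ_nonneg_vmeas[OF R(1)]] .
  ultimately show ?thesis using conv by blast
qed

end

lemma (in marginal_approximation) subsequence:
  assumes r: "strict_mono (r :: nat \<Rightarrow> nat)"
  shows "marginal_approximation b c Cc D1 \<mu> \<nu> (\<lambda>n. \<mu>s (r n)) (\<lambda>n. \<nu>s (r n)) (\<lambda>n. \<epsilon> (r n))"
proof
  show "(\<lambda>n. Z2 (\<mu>s (r n)) \<mu>) \<longlonglongrightarrow> 0" "(\<lambda>n. Z2 (\<nu>s (r n)) \<nu>) \<longlonglongrightarrow> 0" "(\<lambda>n. \<epsilon> (r n)) \<longlonglongrightarrow> 0"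
    using LIMSEQ_subseq_LIMSEQ[OF Z\<mu> r] LIMSEQ_subseq_LIMSEQ[OF Z\<nu> r] LIMSEQ_subseq_LIMSEQ[OF \<epsilon>_lim r]
    by (simp_all add: comp_def)
qed (use c_cont c_lower c_growth \<mu> \<nu> \<mu>s \<nu>s \<epsilon>_pos in auto)

text \<open>\<open>liminf_bound\<close> needs one bound valid for all n. If the inequality failed, a
  real B would fit strictly between the two sides, and along a subsequence all values would stay
  below B.\<close>

lemma (in marginal_approximation) liminf_inequality:
  assumes Ps: "\<And>n. Ps n \<in> VM" and P: "P \<in> VM" and conv: "vm_weak_conv Ps P"
  shows "F_lim P \<le> liminf (\<lambda>n. F n (Ps n))"
proof (rule ccontr)
  assume "\<not> F_lim P \<le> liminf (\<lambda>n. F n (Ps n))"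
  then obtain B where B: "liminf (\<lambda>n. F n (Ps n)) < ereal B" "ereal B < F_lim P"
    using ereal_dense2 by (meson not_le)
  obtain r :: "nat \<Rightarrow> nat" where r: "strict_mono r" "((\<lambda>n. F n (Ps n)) \<circ> r) \<longlonglongrightarrow> liminf (\<lambda>n. F n (Ps n))"
    using liminf_subseq_lim by blast
  have "\<forall>\<^sub>F n in sequentially. ((\<lambda>n. F n (Ps n)) \<circ> r) n < ereal B"
    by (rule order_tendstoD(2)[OF r(2) B(1)])
  then obtain n0 where n0: "\<And>n. n \<ge> n0 \<Longrightarrow> F (r n) (Ps (r n)) < ereal B"
    by (auto simp: eventually_sequentially)
  \<comment> \<open>The shift discards the finitely many terms of the subsequence that may lie above
    B.\<close>
  define r' where "r' n = r (n + n0)" for n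
  have r': "strict_mono r'" using r(1) by (auto simp: r'_def strict_mono_def)
  interpret S: marginal_approximation b c Cc D1 \<mu> \<nu> "\<lambda>n. \<mu>s (r' n)" "\<lambda>n. \<nu>s (r' n)" "\<lambda>n. \<epsilon> (r' n)"
    by (rule subsequence[OF r'])
  have "vm_weak_conv (\<lambda>n. Ps (r' n)) P"
    using conv LIMSEQ_subseq_LIMSEQ[OF _ r'] unfolding vm_weak_conv_def comp_def by blast
  moreover have "S.F n (Ps (r' n)) \<le> ereal B" for n
  proof -
    have "S.F n (Ps (r' n)) = F (r' n) (Ps (r' n))" by (simp only: S.F_def F_def)
    then show ?thesis using n0[of "n + n0"] by (simp add: r'_def less_imp_le)
  qed
  ultimately have "S.F_lim P \<le> ereal B" by (intro S.liminf_bound[of "\<lambda>n. Ps (r' n)"] Ps P)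
  then show False using B(2) by (simp add: S.F_lim_def F_lim_def)
qed

text \<open>The case p = 0 is separate because \<open>0 powr 0\<close> is 0.\<close>

lemma powr_le_quadratic:
  fixes r p :: real
  assumes "0 \<le> r" "0 \<le> p" "p < 2"
  shows "(if p = 0 then 1 else r powr p) \<le> 1 + r\<^sup>2"
proof (cases "r \<le> 1")
  case True
  have "r powr p \<le> 1" using assms True by (intro powr_le1) auto
  then show ?thesis by (simp add: add_increasing2)
next
  case False
  have "r powr p \<le> r powr 2" using assms False by (intro powr_mono) auto
  also have "\<dots> = r\<^sup>2" using False by simp
  finally show ?thesis by (auto simp: add_increasing)
qed

theorem theorem6p1:
  fixes b :: "'a::euclidean_space"
    and c :: "'a \<times> 'a \<Rightarrow> real"
    and p D1 D2 :: real
    and \<mu> \<nu> :: "'a measure"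
    and \<mu>s \<nu>s :: "nat \<Rightarrow> 'a measure"
    and \<epsilon> :: "nat \<Rightarrow> real"
  assumes c_cont: "continuous_on UNIV c"
    and p: "0 \<le> p" "p < 2" and D: "D1 > 0" "D2 > 0"
    and c_lower: "\<And>x y. - D1 \<le> c (x, y)"
    and c_upper: "\<And>x y. c (x, y) \<le> D2 * (1 + (if p = 0 then 1 else norm x powr p)
                                           + (if p = 0 then 1 else norm y powr p))"
    and \<mu>: "\<mu> \<in> P2b b" and \<nu>: "\<nu> \<in> P2b b"
    and \<mu>s: "\<And>n. \<mu>s n \<in> P2b b" and \<nu>s: "\<And>n. \<nu>s n \<in> P2b b"
    and Z\<mu>: "(\<lambda>n. Z2 (\<mu>s n) \<mu>) \<longlonglongrightarrow> 0" and Z\<nu>: "(\<lambda>n. Z2 (\<nu>s n) \<nu>) \<longlonglongrightarrow> 0"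
    and \<epsilon>_pos: "\<And>n. \<epsilon> n > 0" and \<epsilon>_lim: "\<epsilon> \<longlonglongrightarrow> 0"
    and rate: "(\<lambda>n. (Z2 \<mu> (\<mu>s n) + Z2 \<nu> (\<nu>s n)) / \<epsilon> n) \<longlonglongrightarrow> 0"
  shows "Gamma_converges VM vm_weak_conv
           (\<lambda>n P. ext_integral (gam P)
                     (\<lambda>z. c z + (1 / (2 * \<epsilon> n)) * ((norm (rn P z))\<^sup>2 - Ccost (\<mu>s n) (\<nu>s n)))
                   + chi (GammaQ (\<mu>s n) (\<nu>s n)) P)
           (\<lambda>P. ext_integral (gam P) c + chi (GammaQbar \<mu> \<nu>) P)"
proof -
  \<comment> \<open>D2 is multiplied by 3 + |x|^2 + |y|^2, which is at most 3 (1 + |z|^2); D1 is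
    added to cover the lower bound.\<close>
  have growth: "norm (c z) \<le> (D1 + 3 * D2) * (1 + (norm z)\<^sup>2)" for z
  proof -
    obtain x y where z: "z = (x, y)" by (cases z)
    have n: "(norm z)\<^sup>2 = (norm x)\<^sup>2 + (norm y)\<^sup>2" by (simp add: z norm_prod_def)
    have "c z \<le> D2 * (1 + (1 + (norm x)\<^sup>2) + (1 + (norm y)\<^sup>2))"
      unfolding z using D p by (intro order_trans[OF c_upper] mult_left_mono add_mono powr_le_quadratic) auto
    also have "\<dots> \<le> (3 * D2) * (1 + (norm z)\<^sup>2)" using D by (simp add: n algebra_simps)
    also have "\<dots> \<le> (D1 + 3 * D2) * (1 + (norm z)\<^sup>2)" using D by (intro mult_right_mono) auto
    finally have 1: "c z \<le> (D1 + 3 * D2) * (1 + (norm z)\<^sup>2)" .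
    have "D1 * 1 \<le> (D1 + 3 * D2) * (1 + (norm z)\<^sup>2)" using D by (intro mult_mono) auto
    then have 2: "- c z \<le> (D1 + 3 * D2) * (1 + (norm z)\<^sup>2)" using c_lower[of x y] by (simp add: z)
    show ?thesis using 1 2 by (simp add: abs_le_iff)
  qed
  interpret marginal_approximation b c "D1 + 3 * D2" D1 \<mu> \<nu> \<mu>s \<nu>s \<epsilon>
    by unfold_locales (use c_cont c_lower growth \<mu> \<nu> \<mu>s \<nu>s Z\<mu> Z\<nu> \<epsilon>_pos \<epsilon>_lim in auto)
  have "Gamma_converges VM vm_weak_conv F F_lim"
    unfolding Gamma_converges_def
  proof (intro conjI ballI allI impI)
    fix P :: "'a vmeas" and xs assume "P \<in> VM" "\<forall>n. xs n \<in> VM" "vm_weak_conv xs P"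
    then show "F_lim P \<le> liminf (\<lambda>n. F n (xs n))" by (intro liminf_inequality) auto
  next
    fix P :: "'a vmeas" assume P: "P \<in> VM"
    show "\<exists>xs. (\<forall>n. xs n \<in> VM) \<and> vm_weak_conv xs P \<and> limsup (\<lambda>n. F n (xs n)) \<le> F_lim P"
    proof (cases "P \<in> GammaQbar \<mu> \<nu>")
      case True
      then show ?thesis by (rule recovery_sequence[OF rate])
    next
      case False
      \<comment> \<open>Adding \<infinity> gives \<infinity> whatever the first summand is, so the
        constant sequence recovers P.\<close>
      then have "F_lim P = \<infinity>" by (simp add: F_lim_def chi_def)
      then show ?thesis using P by (intro exI[of _ "\<lambda>_. P"]) (simp add: vm_weak_conv_def)
    qed
  qed
  then show ?thesis unfolding F_def[abs_def] F_lim_def[abs_def] .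
qed

end
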